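(* The equivalence $K\colon\mathrm{ShMulti}_{lr}\to\mathrm{SkMon}_{ln}$ between left representable short multicategories and left normal skew monoidal categories (defined in the context) restricts to an equivalence $K_{rep}\colon\mathrm{ShMulti}_{rep}\to\mathrm{Mon}$ between representable short multicategories and monoidal categories, which fits in a commutative triangle of equivalences $T_{rep}=K_{rep}\circ U_{rep}$, where $U_{rep}\colon\mathrm{Multi}_{rep}\to\mathrm{ShMulti}_{rep}$ is the forgetful functor and $T_{rep}\colon\mathrm{Multi}_{rep}\to\mathrm{Mon}$ is the standard equivalence between representable multicategories and monoidal categories.
   Context: **Short multicategories.** A short multicategory $\mathbb C$ consists of a category $\mathcal C$; for $0\le n\le 4$ a functor $\mathbb C_n(-;-)\colon(\mathcal C^n)^{op}\times\mathcal C\to\mathrm{Set}$ (elements of $\mathbb C_n(a_1,\dots,a_n;b)$ are called $n$-ary maps), with $\mathbb C_1(-;-)=\mathcal C(-,-)$; one writes $q\circ f$ and $f\circ_i p$ for the functorial action of a unary map $q$ on the codomain and of a unary map $p$ on the $i$-th input. Furthermore there are substitution functions $\circ_i\colon\mathbb C_n(\bar b;c)\times\mathbb C_m(\bar a;b_i)\to\mathbb C_{n+m-1}(\bar b_{<i},\bar a,\bar b_{>i};c)$ for $1\le i\le n$ and $(n,m)\in\{(2,2),(3,2),(2,3),(2,0),(3,0)\}$, natural in all $a_k$, all $b_k$ with $k\ne i$, and $c$, and dinatural in $b_i$. For $f$ binary, $g$ $n$-ary and $h$ $p$-ary, one requires: (A) $f\circ_i(g\circ_j h)=(f\circ_i g)\circ_{j+i-1}h$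 for $1\le i\le 2$, $1\le j\le n$, when $(n,p)\in\{(2,2),(2,0)\}$; (B) $(f\circ_1 g)\circ_{n+1}h=(f\circ_2 h)\circ_1 g$ when $(n,p)\in\{(2,2),(2,0),(0,2),(0,0)\}$. A morphism $F\colon\mathbb C\to\mathbb D$ is a functor $F\colon\mathcal C\to\mathcal D$ with natural families $F_n\colon\mathbb C_n(\bar a;b)\to\mathbb D_n(F\bar a;Fb)$, $0\le n\le4$, $F_1$ being the functor action, commuting with all substitutions $\circ_i$. **Left representability and representability (short).** A short multicategory is left representable if there are binary maps $\theta_{a,b}\colon a,b\to ab$ (for all $a,b$) and a nullary map $u\in\mathbb C_0(\,;i)$ such that $-\circ_1\theta_{a,b}\colon\mathbb C_n(ab,\bar x;d)\to\mathbb C_{n+1}(a,b,\bar x;d)$ is bijective for $n=1,2,3$ and $-\circ_1u\colon\mathbb C_{n+1}(i,\bar x;d)\to\mathbb C_n(\bar x;d)$ is bijective for $n=0,1,2$. It is representable if there are such $\theta_{a,b}$ and $u$ for which all maps $-\circ_j u\colon\mathbb C_n(\bar x,i,\bar y;z)\to\mathbb C_{n-1}(\bar x,\bar y;z)$ and $-\circ_j\theta_{a,b}\colon\mathbb C_n(\bar x,ab,\bar y;z)\to\mathbb C_{n+1}(\bar x,a,b,\bar y;z)$ are bijective, for $1\le n\le3$, $|\bar x|+|\bar y|=n-1$, $j=|\bar x|+1$. $\mathrm{ShMulti}_{lr}$, $\mathrm{ShMulti}_{rep}$ are the corresponding full subcategories of the category of short multicategories. **Multicategories.** $\mathrm{Multi}_{rep}$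 is the category of representable multicategories (non-symmetric) and multifunctors; representable means that for each list $\bar a$ of length $n\ge0$ there is a multimap $\theta_{\bar a}\colon\bar a\to m\bar a$ such that substitution with $\theta_{\bar a}$ gives bijections $\mathbb C_{k+1}(\bar x,m\bar a,\bar y;b)\to\mathbb C_{k+n}(\bar x,\bar a,\bar y;b)$ for all $\bar x,\bar y,b$ with $|\bar x|+|\bar y|=k$. $U_{rep}$ keeps the category of unary maps, the $n$-ary maps for $n\le4$, and the substitutions of $m$-ary maps into $n$-ary maps for $(n,m)\in\{(2,2),(3,2),(2,3),(2,0),(3,0)\}$, and forgets the rest. **Skew monoidal categories.** A (left) skew monoidal category is a category $\mathcal C$ with a functor $(a,b)\mapsto ab$, $\mathcal C\times\mathcal C\to\mathcal C$, an object $i$, and natural families $\alpha_{a,b,c}\colon(ab)c\to a(bc)$, $\lambda_a\colon ia\to a$, $\rho_a\colon a\to ai$ (not necessarily invertible) satisfying $\alpha_{a,b,cd}\alpha_{ab,c,d}=(a\,\alpha_{b,c,d})\alpha_{a,bc,d}(\alpha_{a,b,c}\,d)$, $\lambda_{ab}\alpha_{i,a,b}=\lambda_a b$, $\alpha_{a,b,i}\rho_{ab}=a\rho_b$, $(a\lambda_b)\alpha_{a,i,b}(\rho_a b)=1_{ab}$, $\lambda_i\rho_i=1_i$. It is left normal if $\lambda$ is invertible, and it is a monoidal category if $\alpha,\lambda,\rho$ are all invertible. A lax monoidal functor is a functor $F$ with a map $f_0\colon i\to Fi$ and a natural family $f_2\colon FaFb\to F(ab)$ such that $F\alpha\circ f_2\circ(f_2\cdot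 Fc)=f_2\circ(Fa\cdot f_2)\circ\alpha$, $F\lambda\circ f_2\circ(f_0\cdot Fa)=\lambda$, $f_2\circ(Fa\cdot f_0)\circ\rho=F\rho$. $\mathrm{SkMon}_{ln}$ (resp. $\mathrm{Mon}$) is the category of left normal skew monoidal (resp. monoidal) categories and lax monoidal functors. **The functors $K$ and $T_{rep}$.** For each left representable short multicategory fix a choice of binary maps $\theta_{a,b}\colon a,b\to ab$ (for all $a,b$) and of a nullary map $u\in\mathbb C_0(\,;i)$ such that $-\circ_1\theta_{a,b}\colon\mathbb C_n(ab,\bar x;d)\to\mathbb C_{n+1}(a,b,\bar x;d)$ is bijective for $n=1,2,3$ and $-\circ_1u\colon\mathbb C_{n+1}(i,\bar x;d)\to\mathbb C_n(\bar x;d)$ is bijective for $n=0,1,2$. $K\mathbb C$ has underlying category $\mathcal C$, tensor $ab$, unit $i$; for $f\colon a\to b$, $g\colon c\to d$, $fg\colon ac\to bd$ is the unique map with $(fg)\circ\theta_{a,c}=(\theta_{b,d}\circ_1f)\circ_2g$; $\alpha$ is the unique map with $(\alpha\circ\theta_{ab,c})\circ_1\theta_{a,b}=\theta_{a,bc}\circ_2\theta_{b,c}$; $\lambda_a$ is the unique map with $(\lambda_a\circ\theta_{i,a})\circ_1u=1_a$; $\rho_a=\theta_{a,i}\circ_2u$. On a morphism $F$, $KF=(F,f_0,f_2)$ where $f_2$ is the unique map with $f_2\circ\theta_{Fa,Fb}=F_2(\theta_{a,b})$ and $f_0$ the unique map with $f_0\circ u=F_0(u)$. $T_{rep}$ is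 given by the same formulas in a representable multicategory (with the same choices of binary and nullary classifiers); it is known to be an equivalence. *)

theory Defs
  imports "HOL-Library.FuncSet"
begin

section \<open>Categories, functors, equivalences\<close>

text \<open>
  Hom-sets are families indexed by source and target and are not required to be disjoint, so
  composition carries its three objects: \<open>Cmp C a b c g f\<close> is \<open>g \<circ> f\<close> for \<open>f : a \<rightarrow> b\<close>, \<open>g : b \<rightarrow> c\<close>.
  In particular maps of every arity can live in one and the same type, so that all the categories
  of structures below are taken over the same pair of types \<open>('o, 'a)\<close>.
\<close>

record ('o, 'a) cat =
  Ob :: "'o set"
  Hom :: "'o \<Rightarrow> 'o \<Rightarrow> 'a set"
  Id :: "'o \<Rightarrow> 'a"
  Cmp :: "'o \<Rightarrow> 'o \<Rightarrow> 'o \<Rightarrow> 'a \<Rightarrow> 'a \<Rightarrow> 'a"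

locale category =
  fixes C :: "('o, 'a) cat"
  assumes Id_in: "a \<in> Ob C \<Longrightarrow> Id C a \<in> Hom C a a"
    and Cmp_in: "\<lbrakk>a \<in> Ob C; b \<in> Ob C; c \<in> Ob C; f \<in> Hom C a b; g \<in> Hom C b c\<rbrakk>
      \<Longrightarrow> Cmp C a b c g f \<in> Hom C a c"
    and Cmp_Id: "\<lbrakk>a \<in> Ob C; b \<in> Ob C; f \<in> Hom C a b\<rbrakk> \<Longrightarrow> Cmp C a a b f (Id C a) = f"
    and Id_Cmp: "\<lbrakk>a \<in> Ob C; b \<in> Ob C; f \<in> Hom C a b\<rbrakk> \<Longrightarrow> Cmp C a b b (Id C b) f = f"
    and Cmp_assoc: "\<lbrakk>a \<in> Ob C; b \<in> Ob C; c \<in> Ob C; d \<in> Ob C;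
        f \<in> Hom C a b; g \<in> Hom C b c; h \<in> Hom C c d\<rbrakk>
      \<Longrightarrow> Cmp C a b d (Cmp C b c d h g) f = Cmp C a c d h (Cmp C a b c g f)"

text \<open>\<open>h \<circ> (g \<circ> f)\<close> for \<open>f : a \<rightarrow> b\<close>, \<open>g : b \<rightarrow> c\<close>, \<open>h : c \<rightarrow> d\<close>.\<close>

abbreviation Cmp3 :: "('o, 'a) cat \<Rightarrow> 'o \<Rightarrow> 'o \<Rightarrow> 'o \<Rightarrow> 'o \<Rightarrow> 'a \<Rightarrow> 'a \<Rightarrow> 'a \<Rightarrow> 'a" where
  "Cmp3 C a b c d h g f \<equiv> Cmp C a c d h (Cmp C a b c g f)"

definition iso_in :: "('o, 'a) cat \<Rightarrow> 'o \<Rightarrow> 'o \<Rightarrow> 'a \<Rightarrow> bool" where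
  "iso_in C a b f \<longleftrightarrow> f \<in> Hom C a b \<and>
     (\<exists>g\<in>Hom C b a. Cmp C a b a g f = Id C a \<and> Cmp C b a b f g = Id C b)"

definition full_subcat :: "('o, 'a) cat \<Rightarrow> ('o \<Rightarrow> bool) \<Rightarrow> ('o, 'a) cat" where
  "full_subcat C P = C\<lparr>Ob := {a \<in> Ob C. P a}\<rparr>"

definition prod_cat :: "('o, 'a) cat \<Rightarrow> ('p, 'b) cat \<Rightarrow> ('o \<times> 'p, 'a \<times> 'b) cat" where
  "prod_cat C D = \<lparr>
     Ob = Ob C \<times> Ob D,
     Hom = (\<lambda>(a, a') (b, b'). Hom C a b \<times> Hom D a' b'),
     Id = (\<lambda>(a, a'). (Id C a, Id D a')),
     Cmp = (\<lambda>(a, a') (b, b') (c, c') (g, g') (f, f'). (Cmp C a b c g f, Cmp D a' b' c' g' f'))\<rparr>"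

text \<open>
  Functors (and all other morphisms of structures below) are normalised to be \<open>undefined\<close> outside
  the carriers of their source, so that equality of the representing records is equality of
  functors.
\<close>

record ('o, 'a, 'p, 'b) func =
  FOb :: "'o \<Rightarrow> 'p"
  FHom :: "'o \<Rightarrow> 'o \<Rightarrow> 'a \<Rightarrow> 'b"

definition mk_func :: "('o, 'a) cat \<Rightarrow> ('o \<Rightarrow> 'p) \<Rightarrow> ('o \<Rightarrow> 'o \<Rightarrow> 'a \<Rightarrow> 'b) \<Rightarrow> ('o, 'a, 'p, 'b) func" where
  "mk_func C F0 F1 = \<lparr>
     FOb = restrict F0 (Ob C),
     FHom = (\<lambda>a b f. if a \<in> Ob C \<and> b \<in> Ob C \<and> f \<in> Hom C a b then F1 a b f else undefined)\<rparr>"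

locale is_functor =
  fixes C :: "('o, 'a) cat" and D :: "('p, 'b) cat" and F :: "('o, 'a, 'p, 'b) func"
  assumes FOb_in: "a \<in> Ob C \<Longrightarrow> FOb F a \<in> Ob D"
    and FHom_in: "\<lbrakk>a \<in> Ob C; b \<in> Ob C; f \<in> Hom C a b\<rbrakk>
      \<Longrightarrow> FHom F a b f \<in> Hom D (FOb F a) (FOb F b)"
    and FHom_Id: "a \<in> Ob C \<Longrightarrow> FHom F a a (Id C a) = Id D (FOb F a)"
    and FHom_Cmp: "\<lbrakk>a \<in> Ob C; b \<in> Ob C; c \<in> Ob C; f \<in> Hom C a b; g \<in> Hom C b c\<rbrakk>
      \<Longrightarrow> FHom F a c (Cmp C a b c g f)
          = Cmp D (FOb F a) (FOb F b) (FOb F c) (FHom F b c g) (FHom F a b f)"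
    and F_normal: "F = mk_func C (FOb F) (FHom F)"

definition id_func :: "('o, 'a) cat \<Rightarrow> ('o, 'a, 'o, 'a) func" where
  "id_func C = mk_func C (\<lambda>a. a) (\<lambda>a b f. f)"

definition comp_func :: "('o, 'a) cat \<Rightarrow> ('p, 'b, 'q, 'c) func \<Rightarrow> ('o, 'a, 'p, 'b) func
    \<Rightarrow> ('o, 'a, 'q, 'c) func" where
  "comp_func C G F = mk_func C (\<lambda>a. FOb G (FOb F a))
     (\<lambda>a b f. FHom G (FOb F a) (FOb F b) (FHom F a b f))"

definition restrict_func :: "('o, 'a) cat \<Rightarrow> ('o, 'a, 'p, 'b) func \<Rightarrow> ('o, 'a, 'p, 'b) func" where
  "restrict_func C F = mk_func C (FOb F) (FHom F)"

definition naturally_isomorphic :: "('o, 'a) cat \<Rightarrow> ('p, 'b) cat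
    \<Rightarrow> ('o, 'a, 'p, 'b) func \<Rightarrow> ('o, 'a, 'p, 'b) func \<Rightarrow> bool" where
  "naturally_isomorphic C D F G \<longleftrightarrow>
     (\<exists>\<tau>. (\<forall>a\<in>Ob C. iso_in D (FOb F a) (FOb G a) (\<tau> a)) \<and>
       (\<forall>a\<in>Ob C. \<forall>b\<in>Ob C. \<forall>f\<in>Hom C a b.
          Cmp D (FOb F a) (FOb F b) (FOb G b) (\<tau> b) (FHom F a b f)
          = Cmp D (FOb F a) (FOb G a) (FOb G b) (FHom G a b f) (\<tau> a)))"

definition is_equivalence :: "('o, 'a) cat \<Rightarrow> ('p, 'b) cat \<Rightarrow> ('o, 'a, 'p, 'b) func \<Rightarrow> bool" where
  "is_equivalence C D F \<longleftrightarrow> category C \<and> category D \<and> is_functor C D F \<and>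
     (\<exists>G. is_functor D C G \<and>
        naturally_isomorphic C C (comp_func C G F) (id_func C) \<and>
        naturally_isomorphic D D (comp_func D F G) (id_func D))"

section \<open>Short multicategories\<close>

text \<open>Input positions are counted from 1: \<open>plug bs i as\<close> replaces \<open>b\<^sub>i\<close> by the list \<open>as\<close>.\<close>

definition plug :: "'o list \<Rightarrow> nat \<Rightarrow> 'o list \<Rightarrow> 'o list" where
  "plug bs i as = take (i - 1) bs @ as @ drop i bs"

text \<open>
  \<open>SAct C as as' b b' ps q f\<close> is the action of the functor \<open>C\<^sub>n(-;-)\<close> at
  \<open>p\<^sub>k : a'\<^sub>k \<rightarrow> a\<^sub>k\<close> and \<open>q : b \<rightarrow> b'\<close> on \<open>f : as \<rightarrow> b\<close>, and \<open>SSub C bs c i as f g\<close> is the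
  substitution \<open>f \<circ>\<^sub>i g\<close> of \<open>g : as \<rightarrow> b\<^sub>i\<close> into \<open>f : bs \<rightarrow> c\<close>.
\<close>

record ('o, 'a) shmulti =
  SUnary :: "('o, 'a) cat"
  SHom :: "'o list \<Rightarrow> 'o \<Rightarrow> 'a set"
  SAct :: "'o list \<Rightarrow> 'o list \<Rightarrow> 'o \<Rightarrow> 'o \<Rightarrow> 'a list \<Rightarrow> 'a \<Rightarrow> 'a \<Rightarrow> 'a"
  SSub :: "'o list \<Rightarrow> 'o \<Rightarrow> nat \<Rightarrow> 'o list \<Rightarrow> 'a \<Rightarrow> 'a \<Rightarrow> 'a"

abbreviation SOb :: "('o, 'a) shmulti \<Rightarrow> 'o set" where
  "SOb C \<equiv> Ob (SUnary C)"

definition sub_arities :: "(nat \<times> nat) set" where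
  "sub_arities = {(2, 2), (3, 2), (2, 3), (2, 0), (3, 0)}"

definition hom_list :: "('o, 'a) cat \<Rightarrow> 'o list \<Rightarrow> 'o list \<Rightarrow> 'a list \<Rightarrow> bool" where
  "hom_list C as bs ps \<longleftrightarrow> length as = length ps \<and> length bs = length ps \<and>
     (\<forall>k<length ps. ps ! k \<in> Hom C (as ! k) (bs ! k))"

definition Cmp_list :: "('o, 'a) cat \<Rightarrow> 'o list \<Rightarrow> 'o list \<Rightarrow> 'o list \<Rightarrow> 'a list \<Rightarrow> 'a list \<Rightarrow> 'a list" where
  "Cmp_list C as bs cs qs ps =
     map (\<lambda>k. Cmp C (as ! k) (bs ! k) (cs ! k) (qs ! k) (ps ! k)) [0..<length ps]"

definition FHom_list :: "('o, 'a, 'p, 'b) func \<Rightarrow> 'o list \<Rightarrow> 'o list \<Rightarrow> 'a list \<Rightarrow> 'b list" where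
  "FHom_list F as bs ps = map (\<lambda>k. FHom F (as ! k) (bs ! k) (ps ! k)) [0..<length ps]"

text \<open>The actions \<open>q \<circ> f\<close> (for \<open>f : as \<rightarrow> b\<close>, \<open>q : b \<rightarrow> c\<close>) and
  \<open>f \<circ>\<^sub>i p\<close> (for \<open>f : bs \<rightarrow> c\<close>, \<open>p : a \<rightarrow> b\<^sub>i\<close>) in a single variable.\<close>

definition post :: "('o, 'a) shmulti \<Rightarrow> 'o list \<Rightarrow> 'o \<Rightarrow> 'o \<Rightarrow> 'a \<Rightarrow> 'a \<Rightarrow> 'a" where
  "post C as b c q f = SAct C as as b c (map (Id (SUnary C)) as) q f"

definition pre :: "('o, 'a) shmulti \<Rightarrow> 'o list \<Rightarrow> 'o \<Rightarrow> nat \<Rightarrow> 'o \<Rightarrow> 'a \<Rightarrow> 'a \<Rightarrow> 'a" where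
  "pre C bs c i a f p = SAct C bs (bs[i - 1 := a]) c c
     ((map (Id (SUnary C)) bs)[i - 1 := p]) (Id (SUnary C) c) f"

text \<open>
  \<open>\<circ>\<^sub>i\<close> is written both for the substitutions and for the actions of unary maps; \<open>scomp\<close> is this
  common operation.
\<close>

definition scomp :: "('o, 'a) shmulti \<Rightarrow> 'o list \<Rightarrow> 'o \<Rightarrow> nat \<Rightarrow> 'o list \<Rightarrow> 'a \<Rightarrow> 'a \<Rightarrow> 'a" where
  "scomp C bs c i as f g =
     (if length bs = 1 then post C as (bs ! 0) c f g
      else if length as = 1 then pre C bs c i (as ! 0) f g
      else SSub C bs c i as f g)"

locale short_multicategory =
  fixes C :: "('o, 'a) shmulti"
  assumes unary_category: "category (SUnary C)"
    \<comment> \<open>functors \<open>C\<^sub>n(-;-)\<close> for \<open>n \<le> 4\<close>\<close>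
    and SAct_in: "\<lbrakk>length as \<le> 4; set as \<subseteq> SOb C; set as' \<subseteq> SOb C; b \<in> SOb C; b' \<in> SOb C;
        hom_list (SUnary C) as' as ps; q \<in> Hom (SUnary C) b b'; f \<in> SHom C as b\<rbrakk>
      \<Longrightarrow> SAct C as as' b b' ps q f \<in> SHom C as' b'"
    and SAct_Id: "\<lbrakk>length as \<le> 4; set as \<subseteq> SOb C; b \<in> SOb C; f \<in> SHom C as b\<rbrakk>
      \<Longrightarrow> SAct C as as b b (map (Id (SUnary C)) as) (Id (SUnary C) b) f = f"
    and SAct_Cmp: "\<lbrakk>length as \<le> 4; set as \<subseteq> SOb C; set as' \<subseteq> SOb C; set as'' \<subseteq> SOb C;
        b \<in> SOb C; b' \<in> SOb C; b'' \<in> SOb C;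
        hom_list (SUnary C) as' as ps; hom_list (SUnary C) as'' as' ps';
        q \<in> Hom (SUnary C) b b'; q' \<in> Hom (SUnary C) b' b''; f \<in> SHom C as b\<rbrakk>
      \<Longrightarrow> SAct C as as'' b b'' (Cmp_list (SUnary C) as'' as' as ps ps') (Cmp (SUnary C) b b' b'' q' q) f
          = SAct C as' as'' b' b'' ps' q' (SAct C as as' b b' ps q f)"
    \<comment> \<open>\<open>C\<^sub>1(-;-) = C(-,-)\<close>\<close>
    and SHom_unary: "\<lbrakk>a \<in> SOb C; b \<in> SOb C\<rbrakk> \<Longrightarrow> SHom C [a] b = Hom (SUnary C) a b"
    and SAct_unary: "\<lbrakk>a \<in> SOb C; a' \<in> SOb C; b \<in> SOb C; b' \<in> SOb C;
        p \<in> Hom (SUnary C) a' a; q \<in> Hom (SUnary C) b b'; f \<in> Hom (SUnary C) a b\<rbrakk>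
      \<Longrightarrow> SAct C [a] [a'] b b' [p] q f = Cmp3 (SUnary C) a' a b b' q f p"
    \<comment> \<open>substitutions\<close>
    and SSub_in: "\<lbrakk>(length bs, length as) \<in> sub_arities; i \<in> {1..length bs};
        set bs \<subseteq> SOb C; set as \<subseteq> SOb C; c \<in> SOb C;
        f \<in> SHom C bs c; g \<in> SHom C as (bs ! (i - 1))\<rbrakk>
      \<Longrightarrow> SSub C bs c i as f g \<in> SHom C (plug bs i as) c"
    and SSub_nat_target: "\<lbrakk>(length bs, length as) \<in> sub_arities; i \<in> {1..length bs};
        set bs \<subseteq> SOb C; set as \<subseteq> SOb C; c \<in> SOb C; c' \<in> SOb C;
        f \<in> SHom C bs c; g \<in> SHom C as (bs ! (i - 1)); q \<in> Hom (SUnary C) c c'\<rbrakk>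
      \<Longrightarrow> SSub C bs c' i as (post C bs c c' q f) g
          = post C (plug bs i as) c c' q (SSub C bs c i as f g)"
    and SSub_nat_inner: "\<lbrakk>(length bs, length as) \<in> sub_arities; i \<in> {1..length bs};
        k \<in> {1..length as}; set bs \<subseteq> SOb C; set as \<subseteq> SOb C; a' \<in> SOb C; c \<in> SOb C;
        f \<in> SHom C bs c; g \<in> SHom C as (bs ! (i - 1)); p \<in> Hom (SUnary C) a' (as ! (k - 1))\<rbrakk>
      \<Longrightarrow> SSub C bs c i (as[k - 1 := a']) f (pre C as (bs ! (i - 1)) k a' g p)
          = pre C (plug bs i as) c (i + k - 1) a' (SSub C bs c i as f g) p"
    and SSub_nat_before: "\<lbrakk>(length bs, length as) \<in> sub_arities; i \<in> {1..length bs};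
        k \<in> {1..<i}; set bs \<subseteq> SOb C; set as \<subseteq> SOb C; b' \<in> SOb C; c \<in> SOb C;
        f \<in> SHom C bs c; g \<in> SHom C as (bs ! (i - 1)); p \<in> Hom (SUnary C) b' (bs ! (k - 1))\<rbrakk>
      \<Longrightarrow> SSub C (bs[k - 1 := b']) c i as (pre C bs c k b' f p) g
          = pre C (plug bs i as) c k b' (SSub C bs c i as f g) p"
    and SSub_nat_after: "\<lbrakk>(length bs, length as) \<in> sub_arities; i \<in> {1..length bs};
        k \<in> {i<..length bs}; set bs \<subseteq> SOb C; set as \<subseteq> SOb C; b' \<in> SOb C; c \<in> SOb C;
        f \<in> SHom C bs c; g \<in> SHom C as (bs ! (i - 1)); p \<in> Hom (SUnary C) b' (bs ! (k - 1))\<rbrakk>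
      \<Longrightarrow> SSub C (bs[k - 1 := b']) c i as (pre C bs c k b' f p) g
          = pre C (plug bs i as) c (k + length as - 1) b' (SSub C bs c i as f g) p"
    and SSub_dinat: "\<lbrakk>(length bs, length as) \<in> sub_arities; i \<in> {1..length bs};
        set bs \<subseteq> SOb C; set as \<subseteq> SOb C; b' \<in> SOb C; c \<in> SOb C;
        f \<in> SHom C bs c; g \<in> SHom C as b'; p \<in> Hom (SUnary C) b' (bs ! (i - 1))\<rbrakk>
      \<Longrightarrow> SSub C (bs[i - 1 := b']) c i as (pre C bs c i b' f p) g
          = SSub C bs c i as f (post C as b' (bs ! (i - 1)) p g)"
    \<comment> \<open>associativity\<close>
    and assoc_nested: "\<lbrakk>length bs = 2; (length as, length xs) \<in> {(2, 2), (2, 0)};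
        i \<in> {1..2}; j \<in> {1..length as};
        set bs \<subseteq> SOb C; set as \<subseteq> SOb C; set xs \<subseteq> SOb C; d \<in> SOb C;
        f \<in> SHom C bs d; g \<in> SHom C as (bs ! (i - 1)); h \<in> SHom C xs (as ! (j - 1))\<rbrakk>
      \<Longrightarrow> scomp C bs d i (plug as j xs) f (scomp C as (bs ! (i - 1)) j xs g h)
          = scomp C (plug bs i as) d (j + i - 1) xs (scomp C bs d i as f g) h"
    and assoc_parallel: "\<lbrakk>length bs = 2; (length as, length xs) \<in> {(2, 2), (2, 0), (0, 2), (0, 0)};
        set bs \<subseteq> SOb C; set as \<subseteq> SOb C; set xs \<subseteq> SOb C; d \<in> SOb C;
        f \<in> SHom C bs d; g \<in> SHom C as (bs ! 0); h \<in> SHom C xs (bs ! 1)\<rbrakk>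
      \<Longrightarrow> scomp C (plug bs 1 as) d (length as + 1) xs (scomp C bs d 1 as f g) h
          = scomp C (plug bs 2 xs) d 1 as (scomp C bs d 2 xs f h) g"

text \<open>\<open>SMap F as b\<close> is the component \<open>C\<^sub>n(as;b) \<rightarrow> D\<^sub>n(F as;F b)\<close>, where \<open>n = length as\<close>.\<close>

record ('o, 'a) shmor =
  SFun :: "('o, 'a, 'o, 'a) func"
  SMap :: "'o list \<Rightarrow> 'o \<Rightarrow> 'a \<Rightarrow> 'a"

definition restrict_SMap :: "('o, 'a) shmulti \<Rightarrow> ('o list \<Rightarrow> 'o \<Rightarrow> 'a \<Rightarrow> 'a)
    \<Rightarrow> 'o list \<Rightarrow> 'o \<Rightarrow> 'a \<Rightarrow> 'a" where
  "restrict_SMap C \<phi> as b f =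
     (if length as \<le> 4 \<and> set as \<subseteq> SOb C \<and> b \<in> SOb C \<and> f \<in> SHom C as b
      then \<phi> as b f else undefined)"

locale short_multi_morphism =
  fixes C D :: "('o, 'a) shmulti" and F :: "('o, 'a) shmor"
  assumes unary_functor: "is_functor (SUnary C) (SUnary D) (SFun F)"
    and SMap_in: "\<lbrakk>length as \<le> 4; set as \<subseteq> SOb C; b \<in> SOb C; f \<in> SHom C as b\<rbrakk>
      \<Longrightarrow> SMap F as b f \<in> SHom D (map (FOb (SFun F)) as) (FOb (SFun F) b)"
    and SMap_natural: "\<lbrakk>length as \<le> 4; set as \<subseteq> SOb C; set as' \<subseteq> SOb C; b \<in> SOb C; b' \<in> SOb C;
        hom_list (SUnary C) as' as ps; q \<in> Hom (SUnary C) b b'; f \<in> SHom C as b\<rbrakk>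
      \<Longrightarrow> SMap F as' b' (SAct C as as' b b' ps q f)
          = SAct D (map (FOb (SFun F)) as) (map (FOb (SFun F)) as') (FOb (SFun F) b) (FOb (SFun F) b')
              (FHom_list (SFun F) as' as ps) (FHom (SFun F) b b' q) (SMap F as b f)"
    and SMap_unary: "\<lbrakk>a \<in> SOb C; b \<in> SOb C; f \<in> Hom (SUnary C) a b\<rbrakk>
      \<Longrightarrow> SMap F [a] b f = FHom (SFun F) a b f"
    and SMap_SSub: "\<lbrakk>(length bs, length as) \<in> sub_arities; i \<in> {1..length bs};
        set bs \<subseteq> SOb C; set as \<subseteq> SOb C; c \<in> SOb C;
        f \<in> SHom C bs c; g \<in> SHom C as (bs ! (i - 1))\<rbrakk>
      \<Longrightarrow> SMap F (plug bs i as) c (SSub C bs c i as f g)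
          = SSub D (map (FOb (SFun F)) bs) (FOb (SFun F) c) i (map (FOb (SFun F)) as)
              (SMap F bs c f) (SMap F as (bs ! (i - 1)) g)"
    and SMap_normal: "SMap F = restrict_SMap C (SMap F)"

definition id_shmor :: "('o, 'a) shmulti \<Rightarrow> ('o, 'a) shmor" where
  "id_shmor C = \<lparr>SFun = id_func (SUnary C), SMap = restrict_SMap C (\<lambda>as b f. f)\<rparr>"

definition comp_shmor :: "('o, 'a) shmulti \<Rightarrow> ('o, 'a) shmor \<Rightarrow> ('o, 'a) shmor \<Rightarrow> ('o, 'a) shmor" where
  "comp_shmor C G F = \<lparr>
     SFun = comp_func (SUnary C) (SFun G) (SFun F),
     SMap = restrict_SMap C (\<lambda>as b f.
       SMap G (map (FOb (SFun F)) as) (FOb (SFun F) b) (SMap F as b f))\<rparr>"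

definition ShMulti :: "(('o, 'a) shmulti, ('o, 'a) shmor) cat" where
  "ShMulti = \<lparr>
     Ob = {C. short_multicategory C},
     Hom = (\<lambda>C D. {F. short_multi_morphism C D F}),
     Id = id_shmor,
     Cmp = (\<lambda>C D E G F. comp_shmor C G F)\<rparr>"

text \<open>A family \<open>\<theta>\<^sub>a\<^sub>,\<^sub>b : a, b \<rightarrow> ab\<close> together with \<open>u : () \<rightarrow> i\<close>.\<close>

record ('o, 'a) classifiers =
  Ten :: "'o \<Rightarrow> 'o \<Rightarrow> 'o"
  Th :: "'o \<Rightarrow> 'o \<Rightarrow> 'a"
  Unt :: "'o"
  Nul :: "'a"

locale left_classifiers =
  fixes C :: "('o, 'a) shmulti" and \<chi> :: "('o, 'a) classifiers"
  assumes Ten_in: "\<lbrakk>a \<in> SOb C; b \<in> SOb C\<rbrakk> \<Longrightarrow> Ten \<chi> a b \<in> SOb C"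
    and Th_in: "\<lbrakk>a \<in> SOb C; b \<in> SOb C\<rbrakk> \<Longrightarrow> Th \<chi> a b \<in> SHom C [a, b] (Ten \<chi> a b)"
    and Unt_in: "Unt \<chi> \<in> SOb C"
    and Nul_in: "Nul \<chi> \<in> SHom C [] (Unt \<chi>)"
    and Th_left_universal: "\<lbrakk>a \<in> SOb C; b \<in> SOb C; length xs \<le> 2; set xs \<subseteq> SOb C; d \<in> SOb C\<rbrakk>
      \<Longrightarrow> bij_betw (\<lambda>f. scomp C (Ten \<chi> a b # xs) d 1 [a, b] f (Th \<chi> a b))
            (SHom C (Ten \<chi> a b # xs) d) (SHom C (a # b # xs) d)"
    and Nul_left_universal: "\<lbrakk>length xs \<le> 2; set xs \<subseteq> SOb C; d \<in> SOb C\<rbrakk>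
      \<Longrightarrow> bij_betw (\<lambda>f. scomp C (Unt \<chi> # xs) d 1 [] f (Nul \<chi>))
            (SHom C (Unt \<chi> # xs) d) (SHom C xs d)"

locale full_classifiers =
  fixes C :: "('o, 'a) shmulti" and \<chi> :: "('o, 'a) classifiers"
  assumes Ten_in: "\<lbrakk>a \<in> SOb C; b \<in> SOb C\<rbrakk> \<Longrightarrow> Ten \<chi> a b \<in> SOb C"
    and Th_in: "\<lbrakk>a \<in> SOb C; b \<in> SOb C\<rbrakk> \<Longrightarrow> Th \<chi> a b \<in> SHom C [a, b] (Ten \<chi> a b)"
    and Unt_in: "Unt \<chi> \<in> SOb C"
    and Nul_in: "Nul \<chi> \<in> SHom C [] (Unt \<chi>)"
    and Th_universal: "\<lbrakk>a \<in> SOb C; b \<in> SOb C; length xs + length ys \<le> 2;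
        set xs \<subseteq> SOb C; set ys \<subseteq> SOb C; d \<in> SOb C\<rbrakk>
      \<Longrightarrow> bij_betw (\<lambda>f. scomp C (xs @ [Ten \<chi> a b] @ ys) d (length xs + 1) [a, b] f (Th \<chi> a b))
            (SHom C (xs @ [Ten \<chi> a b] @ ys) d) (SHom C (xs @ [a, b] @ ys) d)"
    and Nul_universal: "\<lbrakk>length xs + length ys \<le> 2;
        set xs \<subseteq> SOb C; set ys \<subseteq> SOb C; d \<in> SOb C\<rbrakk>
      \<Longrightarrow> bij_betw (\<lambda>f. scomp C (xs @ [Unt \<chi>] @ ys) d (length xs + 1) [] f (Nul \<chi>))
            (SHom C (xs @ [Unt \<chi>] @ ys) d) (SHom C (xs @ ys) d)"

definition left_representable :: "('o, 'a) shmulti \<Rightarrow> bool" where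
  "left_representable C \<longleftrightarrow> (\<exists>\<chi>. left_classifiers C \<chi>)"

definition representable :: "('o, 'a) shmulti \<Rightarrow> bool" where
  "representable C \<longleftrightarrow> (\<exists>\<chi>. full_classifiers C \<chi>)"

definition ShMulti_lr :: "(('o, 'a) shmulti, ('o, 'a) shmor) cat" where
  "ShMulti_lr = full_subcat ShMulti left_representable"

definition ShMulti_rep :: "(('o, 'a) shmulti, ('o, 'a) shmor) cat" where
  "ShMulti_rep = full_subcat ShMulti representable"

section \<open>Multicategories\<close>

record ('o, 'a) multi =
  MOb :: "'o set"
  MHom :: "'o list \<Rightarrow> 'o \<Rightarrow> 'a set"
  MId :: "'o \<Rightarrow> 'a"
  MSub :: "'o list \<Rightarrow> 'o \<Rightarrow> nat \<Rightarrow> 'o list \<Rightarrow> 'a \<Rightarrow> 'a \<Rightarrow> 'a"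

locale multicategory =
  fixes M :: "('o, 'a) multi"
  assumes MId_in: "a \<in> MOb M \<Longrightarrow> MId M a \<in> MHom M [a] a"
    and MSub_in: "\<lbrakk>i \<in> {1..length bs}; set bs \<subseteq> MOb M; set as \<subseteq> MOb M; c \<in> MOb M;
        f \<in> MHom M bs c; g \<in> MHom M as (bs ! (i - 1))\<rbrakk>
      \<Longrightarrow> MSub M bs c i as f g \<in> MHom M (plug bs i as) c"
    and MSub_MId: "\<lbrakk>i \<in> {1..length bs}; set bs \<subseteq> MOb M; c \<in> MOb M; f \<in> MHom M bs c\<rbrakk>
      \<Longrightarrow> MSub M bs c i [bs ! (i - 1)] f (MId M (bs ! (i - 1))) = f"
    and MId_MSub: "\<lbrakk>set as \<subseteq> MOb M; b \<in> MOb M; f \<in> MHom M as b\<rbrakk>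
      \<Longrightarrow> MSub M [b] b 1 as (MId M b) f = f"
    and MSub_nested: "\<lbrakk>i \<in> {1..length bs}; j \<in> {1..length as};
        set bs \<subseteq> MOb M; set as \<subseteq> MOb M; set xs \<subseteq> MOb M; d \<in> MOb M;
        f \<in> MHom M bs d; g \<in> MHom M as (bs ! (i - 1)); h \<in> MHom M xs (as ! (j - 1))\<rbrakk>
      \<Longrightarrow> MSub M bs d i (plug as j xs) f (MSub M as (bs ! (i - 1)) j xs g h)
          = MSub M (plug bs i as) d (j + i - 1) xs (MSub M bs d i as f g) h"
    and MSub_parallel: "\<lbrakk>i \<in> {1..<j}; j \<in> {1..length bs};
        set bs \<subseteq> MOb M; set as \<subseteq> MOb M; set xs \<subseteq> MOb M; d \<in> MOb M;
        f \<in> MHom M bs d; g \<in> MHom M as (bs ! (i - 1)); h \<in> MHom M xs (bs ! (j - 1))\<rbrakk>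
      \<Longrightarrow> MSub M (plug bs i as) d (j + length as - 1) xs (MSub M bs d i as f g) h
          = MSub M (plug bs j xs) d i as (MSub M bs d j xs f h) g"

definition multi_representable :: "('o, 'a) multi \<Rightarrow> bool" where
  "multi_representable M \<longleftrightarrow>
     (\<forall>as. set as \<subseteq> MOb M \<longrightarrow>
       (\<exists>m\<in>MOb M. \<exists>\<theta>\<in>MHom M as m.
          \<forall>xs ys b. set xs \<subseteq> MOb M \<and> set ys \<subseteq> MOb M \<and> b \<in> MOb M \<longrightarrow>
            bij_betw (\<lambda>f. MSub M (xs @ [m] @ ys) b (length xs + 1) as f \<theta>)
              (MHom M (xs @ [m] @ ys) b) (MHom M (xs @ as @ ys) b)))"

record ('o, 'a) multifun =
  MFOb :: "'o \<Rightarrow> 'o"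
  MFMap :: "'o list \<Rightarrow> 'o \<Rightarrow> 'a \<Rightarrow> 'a"

definition mk_multifun :: "('o, 'a) multi \<Rightarrow> ('o \<Rightarrow> 'o) \<Rightarrow> ('o list \<Rightarrow> 'o \<Rightarrow> 'a \<Rightarrow> 'a)
    \<Rightarrow> ('o, 'a) multifun" where
  "mk_multifun M F0 F1 = \<lparr>
     MFOb = restrict F0 (MOb M),
     MFMap = (\<lambda>as b f. if set as \<subseteq> MOb M \<and> b \<in> MOb M \<and> f \<in> MHom M as b
       then F1 as b f else undefined)\<rparr>"

locale multifunctor =
  fixes M N :: "('o, 'a) multi" and F :: "('o, 'a) multifun"
  assumes MFOb_in: "a \<in> MOb M \<Longrightarrow> MFOb F a \<in> MOb N"
    and MFMap_in: "\<lbrakk>set as \<subseteq> MOb M; b \<in> MOb M; f \<in> MHom M as b\<rbrakk>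
      \<Longrightarrow> MFMap F as b f \<in> MHom N (map (MFOb F) as) (MFOb F b)"
    and MFMap_MId: "a \<in> MOb M \<Longrightarrow> MFMap F [a] a (MId M a) = MId N (MFOb F a)"
    and MFMap_MSub: "\<lbrakk>i \<in> {1..length bs}; set bs \<subseteq> MOb M; set as \<subseteq> MOb M; c \<in> MOb M;
        f \<in> MHom M bs c; g \<in> MHom M as (bs ! (i - 1))\<rbrakk>
      \<Longrightarrow> MFMap F (plug bs i as) c (MSub M bs c i as f g)
          = MSub N (map (MFOb F) bs) (MFOb F c) i (map (MFOb F) as)
              (MFMap F bs c f) (MFMap F as (bs ! (i - 1)) g)"
    and MF_normal: "F = mk_multifun M (MFOb F) (MFMap F)"

definition Multi :: "(('o, 'a) multi, ('o, 'a) multifun) cat" where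
  "Multi = \<lparr>
     Ob = {M. multicategory M},
     Hom = (\<lambda>M N. {F. multifunctor M N F}),
     Id = (\<lambda>M. mk_multifun M (\<lambda>a. a) (\<lambda>as b f. f)),
     Cmp = (\<lambda>M N P G F. mk_multifun M (\<lambda>a. MFOb G (MFOb F a))
       (\<lambda>as b f. MFMap G (map (MFOb F) as) (MFOb F b) (MFMap F as b f)))\<rparr>"

definition Multi_rep :: "(('o, 'a) multi, ('o, 'a) multifun) cat" where
  "Multi_rep = full_subcat Multi multi_representable"

subsection \<open>The forgetful functor to short multicategories\<close>

definition unary_cat :: "('o, 'a) multi \<Rightarrow> ('o, 'a) cat" where
  "unary_cat M = \<lparr>
     Ob = MOb M,
     Hom = (\<lambda>a b. MHom M [a] b),
     Id = MId M,
     Cmp = (\<lambda>a b c g f. MSub M [b] c 1 [a] g f)\<rparr>"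

definition unary_functor_of :: "('o, 'a) multi \<Rightarrow> ('o, 'a) multifun \<Rightarrow> ('o, 'a, 'o, 'a) func" where
  "unary_functor_of M F = mk_func (unary_cat M) (MFOb F) (\<lambda>a b f. MFMap F [a] b f)"

text \<open>\<open>pre_upto M as as' b ps f k\<close> is \<open>f \<circ>\<^sub>1 p\<^sub>1 \<circ>\<^sub>2 \<dots> \<circ>\<^sub>k p\<^sub>k\<close>, a map with inputs
  \<open>a'\<^sub>1, \<dots>, a'\<^sub>k, a\<^sub>k\<^sub>+\<^sub>1, \<dots>, a\<^sub>n\<close>.\<close>

primrec pre_upto :: "('o, 'a) multi \<Rightarrow> 'o list \<Rightarrow> 'o list \<Rightarrow> 'o \<Rightarrow> 'a list \<Rightarrow> 'a \<Rightarrow> nat \<Rightarrow> 'a" where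
  "pre_upto M as as' b ps f 0 = f"
| "pre_upto M as as' b ps f (Suc k) =
     MSub M (take k as' @ drop k as) b (Suc k) [as' ! k] (pre_upto M as as' b ps f k) (ps ! k)"

definition U_obj :: "('o, 'a) multi \<Rightarrow> ('o, 'a) shmulti" where
  "U_obj M = \<lparr>
     SUnary = unary_cat M,
     SHom = (\<lambda>as b. if length as \<le> 4 then MHom M as b else {}),
     SAct = (\<lambda>as as' b b' ps q f.
       if length as \<le> 4 then MSub M [b] b' 1 as' q (pre_upto M as as' b ps f (length as))
       else undefined),
     SSub = (\<lambda>bs c i as f g.
       if (length bs, length as) \<in> sub_arities then MSub M bs c i as f g else undefined)\<rparr>"

definition U_mor :: "('o, 'a) multi \<Rightarrow> ('o, 'a) multifun \<Rightarrow> ('o, 'a) shmor" where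
  "U_mor M F = \<lparr>
     SFun = unary_functor_of M F,
     SMap = restrict_SMap (U_obj M) (MFMap F)\<rparr>"

definition U_rep :: "(('o, 'a) multi, ('o, 'a) multifun, ('o, 'a) shmulti, ('o, 'a) shmor) func" where
  "U_rep = mk_func Multi_rep U_obj (\<lambda>M N F. U_mor M F)"

section \<open>Skew monoidal categories\<close>

record ('o, 'a) skmon =
  KCat :: "('o, 'a) cat"
  KTen :: "('o \<times> 'o, 'a \<times> 'a, 'o, 'a) func"
  KUnit :: "'o"
  KAssoc :: "'o \<Rightarrow> 'o \<Rightarrow> 'o \<Rightarrow> 'a"
  KLam :: "'o \<Rightarrow> 'a"
  KRho :: "'o \<Rightarrow> 'a"

abbreviation KOb :: "('o, 'a) skmon \<Rightarrow> 'o set" where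
  "KOb S \<equiv> Ob (KCat S)"

abbreviation ten_ob :: "('o, 'a) skmon \<Rightarrow> 'o \<Rightarrow> 'o \<Rightarrow> 'o" (infixl "\<odot>\<index>" 70) where
  "a \<odot>\<^bsub>S\<^esub> b \<equiv> FOb (KTen S) (a, b)"

text \<open>\<open>ten_ar S a b c d f g\<close> is \<open>fg : ac \<rightarrow> bd\<close> for \<open>f : a \<rightarrow> b\<close>, \<open>g : c \<rightarrow> d\<close>.\<close>

abbreviation ten_ar :: "('o, 'a) skmon \<Rightarrow> 'o \<Rightarrow> 'o \<Rightarrow> 'o \<Rightarrow> 'o \<Rightarrow> 'a \<Rightarrow> 'a \<Rightarrow> 'a" where
  "ten_ar S a b c d f g \<equiv> FHom (KTen S) (a, c) (b, d) (f, g)"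

locale skew_monoidal =
  fixes S :: "('o, 'a) skmon" (structure)
  assumes KCat_category: "category (KCat S)"
    and KTen_functor: "is_functor (prod_cat (KCat S) (KCat S)) (KCat S) (KTen S)"
    and KUnit_in: "KUnit S \<in> KOb S"
    and KAssoc_in: "\<lbrakk>a \<in> KOb S; b \<in> KOb S; c \<in> KOb S\<rbrakk>
      \<Longrightarrow> KAssoc S a b c \<in> Hom (KCat S) ((a \<odot> b) \<odot> c) (a \<odot> (b \<odot> c))"
    and KLam_in: "a \<in> KOb S \<Longrightarrow> KLam S a \<in> Hom (KCat S) (KUnit S \<odot> a) a"
    and KRho_in: "a \<in> KOb S \<Longrightarrow> KRho S a \<in> Hom (KCat S) a (a \<odot> KUnit S)"
    and KAssoc_natural: "\<lbrakk>a \<in> KOb S; b \<in> KOb S; c \<in> KOb S; a' \<in> KOb S; b' \<in> KOb S; c' \<in> KOb S;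
        f \<in> Hom (KCat S) a a'; g \<in> Hom (KCat S) b b'; h \<in> Hom (KCat S) c c'\<rbrakk>
      \<Longrightarrow> Cmp (KCat S) ((a \<odot> b) \<odot> c) ((a' \<odot> b') \<odot> c') (a' \<odot> (b' \<odot> c')) (KAssoc S a' b' c')
            (ten_ar S (a \<odot> b) (a' \<odot> b') c c' (ten_ar S a a' b b' f g) h)
          = Cmp (KCat S) ((a \<odot> b) \<odot> c) (a \<odot> (b \<odot> c)) (a' \<odot> (b' \<odot> c'))
            (ten_ar S a a' (b \<odot> c) (b' \<odot> c') f (ten_ar S b b' c c' g h)) (KAssoc S a b c)"
    and KLam_natural: "\<lbrakk>a \<in> KOb S; a' \<in> KOb S; f \<in> Hom (KCat S) a a'\<rbrakk>
      \<Longrightarrow> Cmp (KCat S) (KUnit S \<odot> a) (KUnit S \<odot> a') a' (KLam S a')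
            (ten_ar S (KUnit S) (KUnit S) a a' (Id (KCat S) (KUnit S)) f)
          = Cmp (KCat S) (KUnit S \<odot> a) a a' f (KLam S a)"
    and KRho_natural: "\<lbrakk>a \<in> KOb S; a' \<in> KOb S; f \<in> Hom (KCat S) a a'\<rbrakk>
      \<Longrightarrow> Cmp (KCat S) a a' (a' \<odot> KUnit S) (KRho S a') f
          = Cmp (KCat S) a (a \<odot> KUnit S) (a' \<odot> KUnit S)
            (ten_ar S a a' (KUnit S) (KUnit S) f (Id (KCat S) (KUnit S))) (KRho S a)"
    and pentagon: "\<lbrakk>a \<in> KOb S; b \<in> KOb S; c \<in> KOb S; d \<in> KOb S\<rbrakk>
      \<Longrightarrow> Cmp (KCat S) (((a \<odot> b) \<odot> c) \<odot> d) ((a \<odot> b) \<odot> (c \<odot> d)) (a \<odot> (b \<odot> (c \<odot> d)))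
            (KAssoc S a b (c \<odot> d)) (KAssoc S (a \<odot> b) c d)
          = Cmp3 (KCat S) (((a \<odot> b) \<odot> c) \<odot> d) ((a \<odot> (b \<odot> c)) \<odot> d) (a \<odot> ((b \<odot> c) \<odot> d))
              (a \<odot> (b \<odot> (c \<odot> d)))
            (ten_ar S a a ((b \<odot> c) \<odot> d) (b \<odot> (c \<odot> d)) (Id (KCat S) a) (KAssoc S b c d))
            (KAssoc S a (b \<odot> c) d)
            (ten_ar S ((a \<odot> b) \<odot> c) (a \<odot> (b \<odot> c)) d d (KAssoc S a b c) (Id (KCat S) d))"
    and left_unit: "\<lbrakk>a \<in> KOb S; b \<in> KOb S\<rbrakk>
      \<Longrightarrow> Cmp (KCat S) ((KUnit S \<odot> a) \<odot> b) (KUnit S \<odot> (a \<odot> b)) (a \<odot> b)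
            (KLam S (a \<odot> b)) (KAssoc S (KUnit S) a b)
          = ten_ar S (KUnit S \<odot> a) a b b (KLam S a) (Id (KCat S) b)"
    and right_unit: "\<lbrakk>a \<in> KOb S; b \<in> KOb S\<rbrakk>
      \<Longrightarrow> Cmp (KCat S) (a \<odot> b) ((a \<odot> b) \<odot> KUnit S) (a \<odot> (b \<odot> KUnit S))
            (KAssoc S a b (KUnit S)) (KRho S (a \<odot> b))
          = ten_ar S a a b (b \<odot> KUnit S) (Id (KCat S) a) (KRho S b)"
    and middle_unit: "\<lbrakk>a \<in> KOb S; b \<in> KOb S\<rbrakk>
      \<Longrightarrow> Cmp3 (KCat S) (a \<odot> b) ((a \<odot> KUnit S) \<odot> b) (a \<odot> (KUnit S \<odot> b)) (a \<odot> b)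
            (ten_ar S a a (KUnit S \<odot> b) b (Id (KCat S) a) (KLam S b))
            (KAssoc S a (KUnit S) b)
            (ten_ar S a (a \<odot> KUnit S) b b (KRho S a) (Id (KCat S) b))
          = Id (KCat S) (a \<odot> b)"
    and unit_unit: "Cmp (KCat S) (KUnit S) (KUnit S \<odot> KUnit S) (KUnit S)
        (KLam S (KUnit S)) (KRho S (KUnit S)) = Id (KCat S) (KUnit S)"

definition left_normal :: "('o, 'a) skmon \<Rightarrow> bool" where
  "left_normal S \<longleftrightarrow> (\<forall>a\<in>KOb S. iso_in (KCat S) (KUnit S \<odot>\<^bsub>S\<^esub> a) a (KLam S a))"

definition monoidal :: "('o, 'a) skmon \<Rightarrow> bool" where
  "monoidal S \<longleftrightarrow>
     (\<forall>a\<in>KOb S. \<forall>b\<in>KOb S. \<forall>c\<in>KOb S.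
        iso_in (KCat S) ((a \<odot>\<^bsub>S\<^esub> b) \<odot>\<^bsub>S\<^esub> c) (a \<odot>\<^bsub>S\<^esub> (b \<odot>\<^bsub>S\<^esub> c)) (KAssoc S a b c)) \<and>
     (\<forall>a\<in>KOb S. iso_in (KCat S) (KUnit S \<odot>\<^bsub>S\<^esub> a) a (KLam S a)) \<and>
     (\<forall>a\<in>KOb S. iso_in (KCat S) a (a \<odot>\<^bsub>S\<^esub> KUnit S) (KRho S a))"

record ('o, 'a) laxfun =
  LFun :: "('o, 'a, 'o, 'a) func"
  Lax0 :: "'a"
  Lax2 :: "'o \<Rightarrow> 'o \<Rightarrow> 'a"

definition restrict_Lax2 :: "('o, 'a) skmon \<Rightarrow> ('o \<Rightarrow> 'o \<Rightarrow> 'a) \<Rightarrow> 'o \<Rightarrow> 'o \<Rightarrow> 'a" where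
  "restrict_Lax2 S \<phi> a b = (if a \<in> KOb S \<and> b \<in> KOb S then \<phi> a b else undefined)"

locale lax_monoidal =
  fixes S R :: "('o, 'a) skmon" and F :: "('o, 'a) laxfun"
  assumes LFun_functor: "is_functor (KCat S) (KCat R) (LFun F)"
    and Lax0_in: "Lax0 F \<in> Hom (KCat R) (KUnit R) (FOb (LFun F) (KUnit S))"
    and Lax2_in: "\<lbrakk>a \<in> KOb S; b \<in> KOb S\<rbrakk>
      \<Longrightarrow> Lax2 F a b \<in> Hom (KCat R) (FOb (LFun F) a \<odot>\<^bsub>R\<^esub> FOb (LFun F) b) (FOb (LFun F) (a \<odot>\<^bsub>S\<^esub> b))"
    and Lax2_natural: "\<lbrakk>a \<in> KOb S; b \<in> KOb S; a' \<in> KOb S; b' \<in> KOb S;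
        f \<in> Hom (KCat S) a a'; g \<in> Hom (KCat S) b b'\<rbrakk>
      \<Longrightarrow> Cmp (KCat R) (FOb (LFun F) a \<odot>\<^bsub>R\<^esub> FOb (LFun F) b) (FOb (LFun F) a' \<odot>\<^bsub>R\<^esub> FOb (LFun F) b')
              (FOb (LFun F) (a' \<odot>\<^bsub>S\<^esub> b'))
            (Lax2 F a' b')
            (ten_ar R (FOb (LFun F) a) (FOb (LFun F) a') (FOb (LFun F) b) (FOb (LFun F) b')
              (FHom (LFun F) a a' f) (FHom (LFun F) b b' g))
          = Cmp (KCat R) (FOb (LFun F) a \<odot>\<^bsub>R\<^esub> FOb (LFun F) b) (FOb (LFun F) (a \<odot>\<^bsub>S\<^esub> b))
              (FOb (LFun F) (a' \<odot>\<^bsub>S\<^esub> b'))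
            (FHom (LFun F) (a \<odot>\<^bsub>S\<^esub> b) (a' \<odot>\<^bsub>S\<^esub> b') (ten_ar S a a' b b' f g))
            (Lax2 F a b)"
    and Lax_assoc: "\<lbrakk>a \<in> KOb S; b \<in> KOb S; c \<in> KOb S;
        a' = FOb (LFun F) a; b' = FOb (LFun F) b; c' = FOb (LFun F) c\<rbrakk>
      \<Longrightarrow> Cmp3 (KCat R) ((a' \<odot>\<^bsub>R\<^esub> b') \<odot>\<^bsub>R\<^esub> c') (FOb (LFun F) (a \<odot>\<^bsub>S\<^esub> b) \<odot>\<^bsub>R\<^esub> c')
              (FOb (LFun F) ((a \<odot>\<^bsub>S\<^esub> b) \<odot>\<^bsub>S\<^esub> c)) (FOb (LFun F) (a \<odot>\<^bsub>S\<^esub> (b \<odot>\<^bsub>S\<^esub> c)))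
            (FHom (LFun F) ((a \<odot>\<^bsub>S\<^esub> b) \<odot>\<^bsub>S\<^esub> c) (a \<odot>\<^bsub>S\<^esub> (b \<odot>\<^bsub>S\<^esub> c)) (KAssoc S a b c))
            (Lax2 F (a \<odot>\<^bsub>S\<^esub> b) c)
            (ten_ar R (a' \<odot>\<^bsub>R\<^esub> b') (FOb (LFun F) (a \<odot>\<^bsub>S\<^esub> b)) c' c' (Lax2 F a b) (Id (KCat R) c'))
          = Cmp3 (KCat R) ((a' \<odot>\<^bsub>R\<^esub> b') \<odot>\<^bsub>R\<^esub> c') (a' \<odot>\<^bsub>R\<^esub> (b' \<odot>\<^bsub>R\<^esub> c'))
              (a' \<odot>\<^bsub>R\<^esub> FOb (LFun F) (b \<odot>\<^bsub>S\<^esub> c)) (FOb (LFun F) (a \<odot>\<^bsub>S\<^esub> (b \<odot>\<^bsub>S\<^esub> c)))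
            (Lax2 F a (b \<odot>\<^bsub>S\<^esub> c))
            (ten_ar R a' a' (b' \<odot>\<^bsub>R\<^esub> c') (FOb (LFun F) (b \<odot>\<^bsub>S\<^esub> c)) (Id (KCat R) a') (Lax2 F b c))
            (KAssoc R a' b' c')"
    and Lax_left_unit: "\<lbrakk>a \<in> KOb S; a' = FOb (LFun F) a\<rbrakk>
      \<Longrightarrow> Cmp3 (KCat R) (KUnit R \<odot>\<^bsub>R\<^esub> a') (FOb (LFun F) (KUnit S) \<odot>\<^bsub>R\<^esub> a')
              (FOb (LFun F) (KUnit S \<odot>\<^bsub>S\<^esub> a)) a'
            (FHom (LFun F) (KUnit S \<odot>\<^bsub>S\<^esub> a) a (KLam S a))
            (Lax2 F (KUnit S) a)
            (ten_ar R (KUnit R) (FOb (LFun F) (KUnit S)) a' a' (Lax0 F) (Id (KCat R) a'))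
          = KLam R a'"
    and Lax_right_unit: "\<lbrakk>a \<in> KOb S; a' = FOb (LFun F) a\<rbrakk>
      \<Longrightarrow> Cmp3 (KCat R) a' (a' \<odot>\<^bsub>R\<^esub> KUnit R) (a' \<odot>\<^bsub>R\<^esub> FOb (LFun F) (KUnit S))
              (FOb (LFun F) (a \<odot>\<^bsub>S\<^esub> KUnit S))
            (Lax2 F a (KUnit S))
            (ten_ar R a' a' (KUnit R) (FOb (LFun F) (KUnit S)) (Id (KCat R) a') (Lax0 F))
            (KRho R a')
          = FHom (LFun F) a (a \<odot>\<^bsub>S\<^esub> KUnit S) (KRho S a)"
    and Lax2_normal: "Lax2 F = restrict_Lax2 S (Lax2 F)"

definition id_lax :: "('o, 'a) skmon \<Rightarrow> ('o, 'a) laxfun" where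
  "id_lax S = \<lparr>
     LFun = id_func (KCat S),
     Lax0 = Id (KCat S) (KUnit S),
     Lax2 = restrict_Lax2 S (\<lambda>a b. Id (KCat S) (a \<odot>\<^bsub>S\<^esub> b))\<rparr>"

definition comp_lax :: "('o, 'a) skmon \<Rightarrow> ('o, 'a) skmon \<Rightarrow> ('o, 'a) skmon
    \<Rightarrow> ('o, 'a) laxfun \<Rightarrow> ('o, 'a) laxfun \<Rightarrow> ('o, 'a) laxfun" where
  "comp_lax S R Q G F =
     (let F0 = FOb (LFun F); G0 = FOb (LFun G) in \<lparr>
       LFun = comp_func (KCat S) (LFun G) (LFun F),
       Lax0 = Cmp (KCat Q) (KUnit Q) (G0 (KUnit R)) (G0 (F0 (KUnit S)))
         (FHom (LFun G) (KUnit R) (F0 (KUnit S)) (Lax0 F)) (Lax0 G),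
       Lax2 = restrict_Lax2 S (\<lambda>a b.
         Cmp (KCat Q) (G0 (F0 a) \<odot>\<^bsub>Q\<^esub> G0 (F0 b)) (G0 (F0 a \<odot>\<^bsub>R\<^esub> F0 b)) (G0 (F0 (a \<odot>\<^bsub>S\<^esub> b)))
           (FHom (LFun G) (F0 a \<odot>\<^bsub>R\<^esub> F0 b) (F0 (a \<odot>\<^bsub>S\<^esub> b)) (Lax2 F a b))
           (Lax2 G (F0 a) (F0 b)))\<rparr>)"

definition SkMon :: "(('o, 'a) skmon, ('o, 'a) laxfun) cat" where
  "SkMon = \<lparr>
     Ob = {S. skew_monoidal S},
     Hom = (\<lambda>S R. {F. lax_monoidal S R F}),
     Id = id_lax,
     Cmp = comp_lax\<rparr>"

definition SkMon_ln :: "(('o, 'a) skmon, ('o, 'a) laxfun) cat" where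
  "SkMon_ln = full_subcat SkMon left_normal"

definition Mon :: "(('o, 'a) skmon, ('o, 'a) laxfun) cat" where
  "Mon = full_subcat SkMon monoidal"

section \<open>The functors to skew monoidal categories\<close>

text \<open>
  The formulas below are used both for short multicategories and for multicategories; what they
  need is a category of unary maps, the sets of multimaps, and \<open>\<circ>\<^sub>i\<close>.
\<close>

record ('o, 'a) comp_data =
  DCat :: "('o, 'a) cat"
  DHom :: "'o list \<Rightarrow> 'o \<Rightarrow> 'a set"
  DComp :: "'o list \<Rightarrow> 'o \<Rightarrow> nat \<Rightarrow> 'o list \<Rightarrow> 'a \<Rightarrow> 'a \<Rightarrow> 'a"

definition short_data :: "('o, 'a) shmulti \<Rightarrow> ('o, 'a) comp_data" where
  "short_data C = \<lparr>DCat = SUnary C, DHom = SHom C, DComp = scomp C\<rparr>"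

definition multi_data :: "('o, 'a) multi \<Rightarrow> ('o, 'a) comp_data" where
  "multi_data M = \<lparr>DCat = unary_cat M, DHom = MHom M, DComp = MSub M\<rparr>"

definition tensor_ar :: "('o, 'a) comp_data \<Rightarrow> ('o, 'a) classifiers
    \<Rightarrow> 'o \<Rightarrow> 'o \<Rightarrow> 'o \<Rightarrow> 'o \<Rightarrow> 'a \<Rightarrow> 'a \<Rightarrow> 'a" where
  "tensor_ar X \<chi> a b c d f g =
     (THE h. h \<in> Hom (DCat X) (Ten \<chi> a c) (Ten \<chi> b d) \<and>
        DComp X [Ten \<chi> a c] (Ten \<chi> b d) 1 [a, c] h (Th \<chi> a c)
        = DComp X [a, d] (Ten \<chi> b d) 2 [c]
            (DComp X [b, d] (Ten \<chi> b d) 1 [a] (Th \<chi> b d) f) g)"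

definition associator :: "('o, 'a) comp_data \<Rightarrow> ('o, 'a) classifiers \<Rightarrow> 'o \<Rightarrow> 'o \<Rightarrow> 'o \<Rightarrow> 'a" where
  "associator X \<chi> a b c =
     (let ab = Ten \<chi> a b; bc = Ten \<chi> b c; l = Ten \<chi> ab c; r = Ten \<chi> a bc in
      THE h. h \<in> Hom (DCat X) l r \<and>
        DComp X [ab, c] r 1 [a, b] (DComp X [l] r 1 [ab, c] h (Th \<chi> ab c)) (Th \<chi> a b)
        = DComp X [a, bc] r 2 [b, c] (Th \<chi> a bc) (Th \<chi> b c))"

definition left_unitor :: "('o, 'a) comp_data \<Rightarrow> ('o, 'a) classifiers \<Rightarrow> 'o \<Rightarrow> 'a" where
  "left_unitor X \<chi> a =
     (let i = Unt \<chi>; ia = Ten \<chi> i a in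
      THE h. h \<in> Hom (DCat X) ia a \<and>
        DComp X [i, a] a 1 [] (DComp X [ia] a 1 [i, a] h (Th \<chi> i a)) (Nul \<chi>) = Id (DCat X) a)"

definition right_unitor :: "('o, 'a) comp_data \<Rightarrow> ('o, 'a) classifiers \<Rightarrow> 'o \<Rightarrow> 'a" where
  "right_unitor X \<chi> a = DComp X [a, Unt \<chi>] (Ten \<chi> a (Unt \<chi>)) 2 [] (Th \<chi> a (Unt \<chi>)) (Nul \<chi>)"

definition skew_of :: "('o, 'a) comp_data \<Rightarrow> ('o, 'a) classifiers \<Rightarrow> ('o, 'a) skmon" where
  "skew_of X \<chi> = \<lparr>
     KCat = DCat X,
     KTen = mk_func (prod_cat (DCat X) (DCat X)) (\<lambda>(a, c). Ten \<chi> a c)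
       (\<lambda>(a, c) (b, d) (f, g). tensor_ar X \<chi> a b c d f g),
     KUnit = Unt \<chi>,
     KAssoc = (\<lambda>a b c. if a \<in> Ob (DCat X) \<and> b \<in> Ob (DCat X) \<and> c \<in> Ob (DCat X)
       then associator X \<chi> a b c else undefined),
     KLam = restrict (left_unitor X \<chi>) (Ob (DCat X)),
     KRho = restrict (right_unitor X \<chi>) (Ob (DCat X))\<rparr>"

text \<open>
  \<open>F\<close> is the functor of unary maps and \<open>\<phi> as b\<close> the action on maps \<open>as \<rightarrow> b\<close> of a morphism
  from \<open>X\<close> (with classifiers \<open>\<chi>\<close>) to \<open>Y\<close> (with classifiers \<open>\<psi>\<close>).
\<close>

definition lax_of :: "('o, 'a) comp_data \<Rightarrow> ('o, 'a) classifiers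
    \<Rightarrow> ('o, 'a) comp_data \<Rightarrow> ('o, 'a) classifiers
    \<Rightarrow> ('o, 'a, 'o, 'a) func \<Rightarrow> ('o list \<Rightarrow> 'o \<Rightarrow> 'a \<Rightarrow> 'a) \<Rightarrow> ('o, 'a) laxfun" where
  "lax_of X \<chi> Y \<psi> F \<phi> = \<lparr>
     LFun = F,
     Lax0 = (THE h. h \<in> Hom (DCat Y) (Unt \<psi>) (FOb F (Unt \<chi>)) \<and>
       DComp Y [Unt \<psi>] (FOb F (Unt \<chi>)) 1 [] h (Nul \<psi>) = \<phi> [] (Unt \<chi>) (Nul \<chi>)),
     Lax2 = (\<lambda>a b. if a \<in> Ob (DCat X) \<and> b \<in> Ob (DCat X)
       then (THE h. h \<in> Hom (DCat Y) (Ten \<psi> (FOb F a) (FOb F b)) (FOb F (Ten \<chi> a b)) \<and>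
         DComp Y [Ten \<psi> (FOb F a) (FOb F b)] (FOb F (Ten \<chi> a b)) 1 [FOb F a, FOb F b]
           h (Th \<psi> (FOb F a) (FOb F b)) = \<phi> [a, b] (Ten \<chi> a b) (Th \<chi> a b))
       else undefined)\<rparr>"

text \<open>\<open>ch\<close> is the fixed choice of left classifiers.\<close>

definition K_functor :: "(('o, 'a) shmulti \<Rightarrow> ('o, 'a) classifiers)
    \<Rightarrow> (('o, 'a) shmulti, ('o, 'a) shmor, ('o, 'a) skmon, ('o, 'a) laxfun) func" where
  "K_functor ch = mk_func ShMulti_lr
     (\<lambda>C. skew_of (short_data C) (ch C))
     (\<lambda>C D F. lax_of (short_data C) (ch C) (short_data D) (ch D) (SFun F) (SMap F))"

definition K_rep :: "(('o, 'a) shmulti \<Rightarrow> ('o, 'a) classifiers)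
    \<Rightarrow> (('o, 'a) shmulti, ('o, 'a) shmor, ('o, 'a) skmon, ('o, 'a) laxfun) func" where
  "K_rep ch = restrict_func ShMulti_rep (K_functor ch)"

text \<open>\<open>T_rep\<close> uses in a multicategory the classifiers chosen for its underlying short multicategory.\<close>

definition T_rep :: "(('o, 'a) shmulti \<Rightarrow> ('o, 'a) classifiers)
    \<Rightarrow> (('o, 'a) multi, ('o, 'a) multifun, ('o, 'a) skmon, ('o, 'a) laxfun) func" where
  "T_rep ch = mk_func Multi_rep
     (\<lambda>M. skew_of (multi_data M) (ch (U_obj M)))
     (\<lambda>M N F. lax_of (multi_data M) (ch (U_obj M)) (multi_data N) (ch (U_obj N))
        (unary_functor_of M F) (MFMap F))"

end

theory Submission
  imports Defs
begin

text \<open>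
  All the functors in question are shown to be fully faithful and essentially surjective
  (\<open>equivalence_if_fully_faithful_essentially_surjective\<close>), and all of this rests on one
  observation: in the presence of left universal maps \<open>\<theta>\<^sub>a\<^sub>,\<^sub>b\<close> and \<open>u\<close>, every multimap is built
  from unary maps, \<open>\<theta>\<close> and \<open>u\<close>. A nullary map is \<open>q \<circ> u\<close> and a map with at least two inputs is
  \<open>g \<circ>\<^sub>1 \<theta>\<close>, where \<open>q\<close> and \<open>g\<close> are unique and \<open>g\<close> has one input less (\<open>map_induct\<close>). This uses only the
  arities that a short multicategory has. Short multicategories and multicategories are therefore
  treated together, as structures with a partially defined substitution
  (\<open>partial_multicategory\<close>).

  \<^item> \<^bold>\<open>The functor is well defined.\<close> An axiom of a skew monoidal category, or of a lax monoidal
    functor, can be tested after substituting \<open>\<theta>\<close> and \<open>u\<close>. Both of its sides then become words in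
    \<open>\<theta>\<close>, \<open>u\<close> and unary maps, equal by associativity of substitution (\<open>skew_monoidal_S\<close>,
    \<open>lax_monoidal_L\<close>). Left normality holds because \<open>\<theta> \<circ>\<^sub>1 u\<close> inverts \<open>\<lambda>\<close> (\<open>inverse_lam\<close>).

  \<^item> \<^bold>\<open>Faithful.\<close> A morphism is determined by its values on unary maps, \<open>\<theta>\<close> and \<open>u\<close>, which are the
    functor, \<open>f\<^sub>2\<close> and \<open>f\<^sub>0\<close> (\<open>morphism_determined\<close>).

  \<^item> \<^bold>\<open>Full.\<close> A lax monoidal functor prescribes these values, and they extend recursively to all
    maps. The axioms of a lax functor are what is needed for the extension to preserve the
    substitution of generators into \<open>\<theta>\<close>; two inductions give all substitutions
    (\<open>preserved_generator\<close>, \<open>preserved_all\<close>, \<open>lax_lifts\<close>).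

  \<^item> \<^bold>\<open>Essentially surjective.\<close> A left normal skew monoidal category \<open>S\<close> comes from a whole
    multicategory, \<open>Mu\<close>, whose maps \<open>as \<rightarrow> b\<close> are the arrows \<open>(a\<^sub>1 a\<^sub>2 \<dots>) a\<^sub>n \<rightarrow> b\<close>. Such an arrow
    is the same as a family of arrows \<open>((x a\<^sub>1) \<dots>) a\<^sub>n \<rightarrow> x b\<close> that is natural in \<open>x\<close> and
    compatible with \<open>\<alpha>\<close> (\<open>enc_dec\<close>, \<open>dec_enc\<close>). Families are substituted by composing them, so
    that associativity is immediate (\<open>multicategory_Mu\<close>), and the structure induced by the
    canonical classifiers is the given one (\<open>same_skew_Mu\<close>).

  For the restriction to the representable case, note that universal maps with the same source
  differ by isomorphisms. Hence in a representable short multicategory the chosen left classifiers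
  are universal in every input (\<open>universal_transfer\<close>), and this yields inverses of \<open>\<alpha>\<close> and \<open>\<rho>\<close>
  (\<open>representable_monoidal\<close>). If conversely \<open>S\<close> is monoidal, the families of the canonical
  classifiers in \<open>Mu\<close> are pointwise invertible, so that \<open>Mu\<close> is representable
  (\<open>multi_representable_Mu\<close>).

  \<open>T_rep\<close> factors as \<open>K_rep \<circ> U_rep\<close> because its formulas contain only substitutions that the
  truncation keeps (\<open>skew_of_U\<close>, \<open>lax_of_U\<close>). It is an equivalence by the same argument as
  for \<open>K_rep\<close>, carried out with all arities, and \<open>U_rep\<close> is one by two out of three.
\<close>

section \<open>Arrows with source and target\<close>

text \<open>An arrow bundled with its two ends. Composition of such arrows has no object
  arguments, so that the laws of a category become ordinary rewrite rules.\<close>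

datatype ('o, 'a) arr = Arr (dm: 'o) (cd: 'o) (raw: 'a)

definition arrs :: "('o, 'a) cat \<Rightarrow> ('o, 'a) arr set" where
  "arrs C = {f. dm f \<in> Ob C \<and> cd f \<in> Ob C \<and> raw f \<in> Hom C (dm f) (cd f)}"

definition acomp :: "('o, 'a) cat \<Rightarrow> ('o, 'a) arr \<Rightarrow> ('o, 'a) arr \<Rightarrow> ('o, 'a) arr" where
  "acomp C g f = Arr (dm f) (cd g) (Cmp C (dm f) (cd f) (cd g) (raw g) (raw f))"

definition ide :: "('o, 'a) cat \<Rightarrow> 'o \<Rightarrow> ('o, 'a) arr" where
  "ide C a = Arr a a (Id C a)"

lemma dm_acomp [simp]: "dm (acomp C g f) = dm f"
  and cd_acomp [simp]: "cd (acomp C g f) = cd g"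
  and dm_ide [simp]: "dm (ide C a) = a"
  and cd_ide [simp]: "cd (ide C a) = a"
  by (simp_all add: acomp_def ide_def)

lemma Arr_in_arrs [simp]: "Arr a b f \<in> arrs C \<longleftrightarrow> a \<in> Ob C \<and> b \<in> Ob C \<and> f \<in> Hom C a b"
  by (simp add: arrs_def)

lemma arrsD: "f \<in> arrs C \<Longrightarrow> dm f \<in> Ob C" "f \<in> arrs C \<Longrightarrow> cd f \<in> Ob C"
  "f \<in> arrs C \<Longrightarrow> raw f \<in> Hom C (dm f) (cd f)"
  by (simp_all add: arrs_def)

lemma Arr_Cmp: "Arr a c (Cmp C a b c g f) = acomp C (Arr b c g) (Arr a b f)"
  by (simp add: acomp_def)

lemma Arr_Id: "Arr a a (Id C a) = ide C a"
  by (simp add: ide_def)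

context category
begin

lemma ide_arrs [simp]: "a \<in> Ob C \<Longrightarrow> ide C a \<in> arrs C"
  by (simp add: ide_def Id_in)

lemma acomp_arrs [simp]: "\<lbrakk>f \<in> arrs C; g \<in> arrs C; dm g = cd f\<rbrakk> \<Longrightarrow> acomp C g f \<in> arrs C"
  by (auto simp: acomp_def arrs_def intro: Cmp_in)

lemma acomp_ide [simp]: "\<lbrakk>f \<in> arrs C; dm f = a\<rbrakk> \<Longrightarrow> acomp C f (ide C a) = f"
  by (cases f) (auto simp: acomp_def arrs_def ide_def Cmp_Id)

lemma ide_acomp [simp]: "\<lbrakk>f \<in> arrs C; cd f = a\<rbrakk> \<Longrightarrow> acomp C (ide C a) f = f"
  by (cases f) (auto simp: acomp_def arrs_def ide_def Id_Cmp)

lemma acomp_assoc: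
  "\<lbrakk>f \<in> arrs C; g \<in> arrs C; h \<in> arrs C; dm g = cd f; dm h = cd g\<rbrakk>
    \<Longrightarrow> acomp C (acomp C h g) f = acomp C h (acomp C g f)"
  by (cases f; cases g; cases h) (auto simp: acomp_def arrs_def Cmp_assoc)

text \<open>Composites are kept bracketed to the right; this applies an equation between composites
  of two arrows at the head of a longer one.\<close>

lemma acomp_extend:
  "\<lbrakk>acomp C g f = k; f \<in> arrs C; g \<in> arrs C; h \<in> arrs C; dm g = cd f; dm f = cd h\<rbrakk>
    \<Longrightarrow> acomp C g (acomp C f h) = acomp C k h"
  by (auto simp: acomp_assoc)

end

definition inverse_arrs :: "('o, 'a) cat \<Rightarrow> ('o, 'a) arr \<Rightarrow> ('o, 'a) arr \<Rightarrow> bool" where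
  "inverse_arrs C f g \<longleftrightarrow> f \<in> arrs C \<and> g \<in> arrs C \<and> dm g = cd f \<and> cd g = dm f \<and>
     acomp C g f = ide C (dm f) \<and> acomp C f g = ide C (cd f)"

lemma iso_in_arrs:
  assumes "a \<in> Ob C" "b \<in> Ob C"
  shows "iso_in C a b f \<longleftrightarrow> (\<exists>g. inverse_arrs C (Arr a b f) g)" (is "?l \<longleftrightarrow> ?r")
proof
  assume ?l
  then obtain g where "f \<in> Hom C a b" "g \<in> Hom C b a" "Cmp C a b a g f = Id C a"
      "Cmp C b a b f g = Id C b"
    by (auto simp: iso_in_def)
  then have "inverse_arrs C (Arr a b f) (Arr b a g)"
    using assms by (simp add: inverse_arrs_def acomp_def ide_def)
  then show ?r by blast
next
  assume ?r
  then obtain g where "inverse_arrs C (Arr a b f) g" by blast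
  then show ?l
    by (cases g) (auto simp: inverse_arrs_def iso_in_def acomp_def ide_def)
qed

context category
begin

lemma inverse_acomp:
  assumes "inverse_arrs C f f'" "inverse_arrs C g g'" "dm g = cd f"
  shows "inverse_arrs C (acomp C g f) (acomp C f' g')"
proof -
  have "acomp C f' (acomp C g' (acomp C g f)) = ide C (dm f)"
    using assms by (simp add: inverse_arrs_def acomp_extend[of g' g "ide C (dm g)" f])
  moreover have "acomp C g (acomp C f (acomp C f' g')) = ide C (cd g)"
    using assms by (simp add: inverse_arrs_def acomp_extend[of f f' "ide C (cd f)" g'])
  ultimately show ?thesis
    using assms by (simp add: inverse_arrs_def acomp_assoc)
qed

lemma iso_in_trans:
  assumes "a \<in> Ob C" "b \<in> Ob C" "c \<in> Ob C" "iso_in C a b f" "iso_in C b c g"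
  shows "iso_in C a c (Cmp C a b c g f)"
proof -
  obtain f' g' where "inverse_arrs C (Arr a b f) f'" "inverse_arrs C (Arr b c g) g'"
    using iso_in_arrs[OF assms(1,2)] iso_in_arrs[OF assms(2,3)] assms(4,5) by blast
  then have "inverse_arrs C (Arr a c (Cmp C a b c g f)) (acomp C f' g')"
    unfolding Arr_Cmp by (rule inverse_acomp) simp
  then show ?thesis
    using iso_in_arrs[OF assms(1,3)] by blast
qed

end

lemma category_full_subcat: "category C \<Longrightarrow> category (full_subcat C P)"
  by (auto simp: category_def full_subcat_def)

lemma full_subcat_simps [simp]:
  "Hom (full_subcat C P) = Hom C" "Id (full_subcat C P) = Id C" "Cmp (full_subcat C P) = Cmp C"
  "Ob (full_subcat C P) = {a \<in> Ob C. P a}"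
  "iso_in (full_subcat C P) a b f \<longleftrightarrow> iso_in C a b f"
  by (auto simp: full_subcat_def iso_in_def)

section \<open>Functors on arrows\<close>

definition fmap :: "('o, 'a, 'p, 'b) func \<Rightarrow> ('o, 'a) arr \<Rightarrow> ('p, 'b) arr" where
  "fmap F f = Arr (FOb F (dm f)) (FOb F (cd f)) (FHom F (dm f) (cd f) (raw f))"

lemma dm_fmap [simp]: "dm (fmap F f) = FOb F (dm f)"
  and cd_fmap [simp]: "cd (fmap F f) = FOb F (cd f)"
  by (simp_all add: fmap_def)

context is_functor
begin

lemma fmap_arrs [simp]: "f \<in> arrs C \<Longrightarrow> fmap F f \<in> arrs D"
  by (cases f) (simp add: fmap_def FOb_in FHom_in)

lemma fmap_ide [simp]: "a \<in> Ob C \<Longrightarrow> fmap F (ide C a) = ide D (FOb F a)"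
  by (simp add: fmap_def ide_def FHom_Id)

lemma fmap_acomp: "\<lbrakk>f \<in> arrs C; g \<in> arrs C; dm g = cd f\<rbrakk>
    \<Longrightarrow> fmap F (acomp C g f) = acomp D (fmap F g) (fmap F f)"
  by (cases f; cases g) (simp add: fmap_def acomp_def FHom_Cmp)

end

lemma FOb_mk_func [simp]: "a \<in> Ob C \<Longrightarrow> FOb (mk_func C F0 F1) a = F0 a"
  and FHom_mk_func [simp]: "\<lbrakk>a \<in> Ob C; b \<in> Ob C; f \<in> Hom C a b\<rbrakk>
    \<Longrightarrow> FHom (mk_func C F0 F1) a b f = F1 a b f"
  by (simp_all add: mk_func_def)

lemma mk_func_cong:
  assumes "\<And>a. a \<in> Ob C \<Longrightarrow> F0 a = G0 a"
    and "\<And>a b f. \<lbrakk>a \<in> Ob C; b \<in> Ob C; f \<in> Hom C a b\<rbrakk> \<Longrightarrow> F1 a b f = G1 a b f"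
  shows "mk_func C F0 F1 = mk_func C G0 G1"
  using assms by (auto simp: mk_func_def fun_eq_iff)

lemma mk_func_normal:
  "mk_func C F0 F1 = mk_func C (FOb (mk_func C F0 F1)) (FHom (mk_func C F0 F1))"
  by (rule mk_func_cong) auto

lemma mk_func_is_functor:
  assumes "\<And>a. a \<in> Ob C \<Longrightarrow> F0 a \<in> Ob D"
    and "\<And>a b f. \<lbrakk>a \<in> Ob C; b \<in> Ob C; f \<in> Hom C a b\<rbrakk> \<Longrightarrow> F1 a b f \<in> Hom D (F0 a) (F0 b)"
    and "\<And>a. a \<in> Ob C \<Longrightarrow> F1 a a (Id C a) = Id D (F0 a)"
    and "\<And>a b c f g. \<lbrakk>a \<in> Ob C; b \<in> Ob C; c \<in> Ob C; f \<in> Hom C a b; g \<in> Hom C b c\<rbrakk>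
      \<Longrightarrow> F1 a c (Cmp C a b c g f) = Cmp D (F0 a) (F0 b) (F0 c) (F1 b c g) (F1 a b f)"
    and "category C"
  shows "is_functor C D (mk_func C F0 F1)"
proof -
  interpret category C by fact
  show ?thesis
    by unfold_locales
      (use assms mk_func_normal[of C F0 F1] in \<open>auto simp: Id_in Cmp_in\<close>)
qed

lemma functor_eqI:
  assumes "is_functor C D F" "is_functor C D' G"
    and "\<And>a. a \<in> Ob C \<Longrightarrow> FOb F a = FOb G a"
    and "\<And>a b f. \<lbrakk>a \<in> Ob C; b \<in> Ob C; f \<in> Hom C a b\<rbrakk> \<Longrightarrow> FHom F a b f = FHom G a b f"
  shows "F = G"
  using is_functor.F_normal[OF assms(1)] is_functor.F_normal[OF assms(2)]
    mk_func_cong[of C "FOb F" "FOb G" "FHom F" "FHom G"] assms(3,4) by metis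

lemma id_func_is_functor: "category C \<Longrightarrow> is_functor C C (id_func C)"
  unfolding id_func_def by (rule mk_func_is_functor) auto

lemma comp_func_is_functor:
  assumes "category C" "is_functor C D F" "is_functor D E G"
  shows "is_functor C E (comp_func C G F)"
proof -
  interpret F: is_functor C D F by fact
  interpret G: is_functor D E G by fact
  show ?thesis
    unfolding comp_func_def
    by (rule mk_func_is_functor)
      (use assms(1) in \<open>auto simp: F.FOb_in G.FOb_in F.FHom_in G.FHom_in F.FHom_Id G.FHom_Id F.FHom_Cmp G.FHom_Cmp\<close>)
qed

lemma FOb_id_func [simp]: "a \<in> Ob C \<Longrightarrow> FOb (id_func C) a = a"
  and FHom_id_func [simp]: "\<lbrakk>a \<in> Ob C; b \<in> Ob C; f \<in> Hom C a b\<rbrakk> \<Longrightarrow> FHom (id_func C) a b f = f"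
  and FOb_comp_func [simp]: "a \<in> Ob C \<Longrightarrow> FOb (comp_func C G F) a = FOb G (FOb F a)"
  and FHom_comp_func [simp]: "\<lbrakk>a \<in> Ob C; b \<in> Ob C; f \<in> Hom C a b\<rbrakk>
    \<Longrightarrow> FHom (comp_func C G F) a b f = FHom G (FOb F a) (FOb F b) (FHom F a b f)"
  by (simp_all add: id_func_def comp_func_def)

lemma fmap_id_func [simp]: "f \<in> arrs C \<Longrightarrow> fmap (id_func C) f = f"
  and fmap_comp_func [simp]: "f \<in> arrs C \<Longrightarrow> fmap (comp_func C G F) f = fmap G (fmap F f)"
  by (cases f; simp add: fmap_def)+

section \<open>Equivalences\<close>

definition fully_faithful :: "('o, 'a) cat \<Rightarrow> ('p, 'b) cat \<Rightarrow> ('o, 'a, 'p, 'b) func \<Rightarrow> bool" where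
  "fully_faithful C D F \<longleftrightarrow> (\<forall>a\<in>Ob C. \<forall>b\<in>Ob C.
     bij_betw (FHom F a b) (Hom C a b) (Hom D (FOb F a) (FOb F b)))"

definition essentially_surjective ::
    "('o, 'a) cat \<Rightarrow> ('p, 'b) cat \<Rightarrow> ('o, 'a, 'p, 'b) func \<Rightarrow> bool" where
  "essentially_surjective C D F \<longleftrightarrow> (\<forall>d\<in>Ob D. \<exists>c\<in>Ob C. \<exists>e. iso_in D (FOb F c) d e)"

context
  fixes C :: "('o, 'a) cat" and D :: "('p, 'b) cat" and F :: "('o, 'a, 'p, 'b) func"
  assumes cC: "category C" and cD: "category D" and fF: "is_functor C D F"
    and ff: "fully_faithful C D F"
begin

lemma fmap_faithful:
  assumes "f \<in> arrs C" "g \<in> arrs C" "dm f = dm g" "cd f = cd g" "fmap F f = fmap F g"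
  shows "f = g"
proof -
  have "inj_on (FHom F (dm f) (cd f)) (Hom C (dm f) (cd f))"
    using ff assms(1) by (auto simp: fully_faithful_def bij_betw_def arrs_def)
  then have "raw f = raw g"
    by (rule inj_onD) (use assms in \<open>auto simp: fmap_def arrs_def\<close>)
  then show ?thesis using assms by (simp add: arr.expand)
qed

lemma fmap_full:
  assumes "h \<in> arrs D" "dm h = FOb F a" "cd h = FOb F b" "a \<in> Ob C" "b \<in> Ob C"
  shows "\<exists>f\<in>arrs C. dm f = a \<and> cd f = b \<and> fmap F f = h"
proof -
  have "raw h \<in> FHom F a b ` Hom C a b"
    using ff assms by (auto simp: fully_faithful_def bij_betw_def arrs_def)
  then obtain f where "f \<in> Hom C a b" "raw h = FHom F a b f" by blast
  then show ?thesis
    using assms by (intro bexI[of _ "Arr a b f"]) (auto simp: fmap_def intro: arr.expand)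
qed

text \<open>The preimages of an isomorphism and of its inverse compose to arrows whose images are
  identities, hence to identities by faithfulness.\<close>

lemma fully_faithful_reflects_iso:
  assumes "a \<in> Ob C" "b \<in> Ob C" "iso_in D (FOb F a) (FOb F b) h"
  shows "\<exists>f. iso_in C a b f"
proof -
  interpret C: category C by (rule cC)
  interpret F: is_functor C D F by (rule fF)
  obtain k where k: "inverse_arrs D (Arr (FOb F a) (FOb F b) h) k"
    using assms by (auto simp: iso_in_arrs F.FOb_in)
  obtain f where f: "f \<in> arrs C" "dm f = a" "cd f = b" "fmap F f = Arr (FOb F a) (FOb F b) h"
    using fmap_full[of "Arr (FOb F a) (FOb F b) h" a b] k assms by (auto simp: inverse_arrs_def)
  obtain g where g: "g \<in> arrs C" "dm g = b" "cd g = a" "fmap F g = k"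
    using fmap_full[of k b a] k assms by (auto simp: inverse_arrs_def)
  have "acomp C g f = ide C a"
    by (rule fmap_faithful) (use f g k assms in \<open>auto simp: F.fmap_acomp inverse_arrs_def\<close>)
  moreover have "acomp C f g = ide C b"
    by (rule fmap_faithful) (use f g k assms in \<open>auto simp: F.fmap_acomp inverse_arrs_def\<close>)
  ultimately have "inverse_arrs C (Arr a b (raw f)) g"
    using f g by (cases f) (simp add: inverse_arrs_def)
  then show ?thesis using iso_in_arrs[OF assms(1,2)] by blast
qed

text \<open>The quasi-inverse sends \<open>d\<close> to a chosen \<open>G d\<close> with an isomorphism
  \<open>\<epsilon>\<^sub>d : F (G d) \<rightarrow> d\<close> (with inverse \<open>\<kappa>\<^sub>d\<close>), and \<open>f : d \<rightarrow> d'\<close> to the arrow over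
  \<open>\<kappa>\<^sub>d\<^sub>' f \<epsilon>\<^sub>d\<close>; faithfulness turns every identity to be checked into one between images. The
  isomorphism \<open>G (F c) \<rightarrow> c\<close> lies over \<open>\<epsilon>\<close> at \<open>F c\<close>.\<close>

lemma equivalence_if_fully_faithful_essentially_surjective:
  assumes "essentially_surjective C D F"
  shows "is_equivalence C D F"
proof -
  interpret C: category C by (rule cC)
  interpret D: category D by (rule cD)
  interpret F: is_functor C D F by (rule fF)
  have "\<forall>d\<in>Ob D. \<exists>c e k. c \<in> Ob C \<and> inverse_arrs D e k \<and> dm e = FOb F c \<and> cd e = d"
    using assms unfolding essentially_surjective_def
    by (metis iso_in_arrs F.FOb_in arr.sel(1,2))
  then obtain G0 \<epsilon> \<kappa> where G0: "\<And>d. d \<in> Ob D \<Longrightarrow> G0 d \<in> Ob C"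
    and inv: "\<And>d. d \<in> Ob D \<Longrightarrow> inverse_arrs D (\<epsilon> d) (\<kappa> d)"
    and dme: "\<And>d. d \<in> Ob D \<Longrightarrow> dm (\<epsilon> d) = FOb F (G0 d)"
    and cde: "\<And>d. d \<in> Ob D \<Longrightarrow> cd (\<epsilon> d) = d"
    by metis
  have ek [simp]: "\<epsilon> d \<in> arrs D" "\<kappa> d \<in> arrs D" "dm (\<epsilon> d) = FOb F (G0 d)" "cd (\<epsilon> d) = d"
      "dm (\<kappa> d) = d" "cd (\<kappa> d) = FOb F (G0 d)"
      "acomp D (\<epsilon> d) (\<kappa> d) = ide D d" "acomp D (\<kappa> d) (\<epsilon> d) = ide D (FOb F (G0 d))"
    if "d \<in> Ob D" for d
    using inv[OF that] dme[OF that] cde[OF that] by (auto simp: inverse_arrs_def)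
  have "\<forall>f\<in>arrs D. \<exists>g\<in>arrs C. dm g = G0 (dm f) \<and> cd g = G0 (cd f) \<and>
      fmap F g = acomp D (\<kappa> (cd f)) (acomp D f (\<epsilon> (dm f)))"
    by (intro ballI fmap_full) (auto simp: arrsD G0)
  then obtain G1 where G1: "\<And>f. f \<in> arrs D \<Longrightarrow> G1 f \<in> arrs C"
      "\<And>f. f \<in> arrs D \<Longrightarrow> dm (G1 f) = G0 (dm f)"
      "\<And>f. f \<in> arrs D \<Longrightarrow> cd (G1 f) = G0 (cd f)"
      "\<And>f. f \<in> arrs D \<Longrightarrow> fmap F (G1 f) = acomp D (\<kappa> (cd f)) (acomp D f (\<epsilon> (dm f)))"
    by metis
  have eG1: "acomp D (\<epsilon> (cd f)) (fmap F (G1 f)) = acomp D f (\<epsilon> (dm f))" if "f \<in> arrs D" for f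
    using that by (simp add: G1 arrsD D.acomp_extend[of _ _ "ide D (cd f)"])
  have G1_ide: "G1 (ide D d) = ide C (G0 d)" if "d \<in> Ob D" for d
    by (rule fmap_faithful) (use that in \<open>auto simp: G1 G0\<close>)
  have G1_comp: "G1 (acomp D g f) = acomp C (G1 g) (G1 f)"
    if "f \<in> arrs D" "g \<in> arrs D" "dm g = cd f" for f g
  proof (rule fmap_faithful)
    have "fmap F (acomp C (G1 g) (G1 f))
        = acomp D (acomp D (\<kappa> (cd g)) (acomp D g (\<epsilon> (dm g)))) (fmap F (G1 f))"
      using that by (simp add: F.fmap_acomp G1)
    also have "\<dots> = acomp D (\<kappa> (cd g)) (acomp D g (acomp D (\<epsilon> (cd f)) (fmap F (G1 f))))"
      using that by (simp add: D.acomp_assoc arrsD G1 del: G1(4))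
    also have "\<dots> = acomp D (\<kappa> (cd g)) (acomp D g (acomp D f (\<epsilon> (dm f))))"
      using that by (simp add: eG1)
    finally show "fmap F (G1 (acomp D g f)) = fmap F (acomp C (G1 g) (G1 f))"
      using that by (simp add: G1 D.acomp_assoc arrsD)
  qed (use that in \<open>auto simp: G1\<close>)
  define G where "G = mk_func D G0 (\<lambda>d d' f. raw (G1 (Arr d d' f)))"
  have Arr_G1: "Arr (G0 d) (G0 d') (raw (G1 (Arr d d' f))) = G1 (Arr d d' f)"
    if "d \<in> Ob D" "d' \<in> Ob D" "f \<in> Hom D d d'" for d d' f
    by (rule arr.expand) (use that in \<open>simp add: G1\<close>)
  have raw_G1: "raw (G1 (Arr d d' f)) \<in> Hom C (G0 d) (G0 d')"
    if "d \<in> Ob D" "d' \<in> Ob D" "f \<in> Hom D d d'" for d d' f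
    using G1(1)[of "Arr d d' f"] that by (auto simp: arrs_def G1)
  have fG: "is_functor D C G"
    unfolding G_def
  proof (rule mk_func_is_functor)
    fix a b c f g
    assume A: "a \<in> Ob D" "b \<in> Ob D" "c \<in> Ob D" "f \<in> Hom D a b" "g \<in> Hom D b c"
    show "raw (G1 (Arr a c (Cmp D a b c g f)))
        = Cmp C (G0 a) (G0 b) (G0 c) (raw (G1 (Arr b c g))) (raw (G1 (Arr a b f)))"
      using A by (simp add: Arr_Cmp G1_comp) (simp add: G1 acomp_def)
  next
    fix a assume "a \<in> Ob D"
    then show "raw (G1 (Arr a a (Id D a))) = Id C (G0 a)"
      by (simp add: Arr_Id G1_ide) (simp add: ide_def)
  qed (use raw_G1 G0 cD in auto)
  have "\<forall>c\<in>Ob C. \<exists>t t'. inverse_arrs C t t' \<and> dm t = G0 (FOb F c) \<and> cd t = c \<and> fmap F t = \<epsilon> (FOb F c)"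
  proof
    fix c assume c: "c \<in> Ob C"
    obtain t where t: "t \<in> arrs C" "dm t = G0 (FOb F c)" "cd t = c" "fmap F t = \<epsilon> (FOb F c)"
      using fmap_full[of "\<epsilon> (FOb F c)" "G0 (FOb F c)" c] c by (auto simp: F.FOb_in G0)
    obtain t' where t': "t' \<in> arrs C" "dm t' = c" "cd t' = G0 (FOb F c)" "fmap F t' = \<kappa> (FOb F c)"
      using fmap_full[of "\<kappa> (FOb F c)" c "G0 (FOb F c)"] c by (auto simp: F.FOb_in G0)
    have "acomp C t' t = ide C (G0 (FOb F c))"
      by (rule fmap_faithful) (use t t' c in \<open>auto simp: F.FOb_in G0 F.fmap_acomp\<close>)
    moreover have "acomp C t t' = ide C c"
      by (rule fmap_faithful) (use t t' c in \<open>auto simp: F.FOb_in G0 F.fmap_acomp\<close>)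
    ultimately show "\<exists>t t'. inverse_arrs C t t' \<and> dm t = G0 (FOb F c) \<and> cd t = c \<and> fmap F t = \<epsilon> (FOb F c)"
      using t t' by (intro exI[of _ t] exI[of _ t']) (auto simp: inverse_arrs_def)
  qed
  then obtain \<tau> \<tau>' where \<tau>: "\<And>c. c \<in> Ob C \<Longrightarrow> inverse_arrs C (\<tau> c) (\<tau>' c)"
      "\<And>c. c \<in> Ob C \<Longrightarrow> dm (\<tau> c) = G0 (FOb F c)" "\<And>c. c \<in> Ob C \<Longrightarrow> cd (\<tau> c) = c"
      "\<And>c. c \<in> Ob C \<Longrightarrow> fmap F (\<tau> c) = \<epsilon> (FOb F c)"
    by metis
  have \<tau>in: "\<tau> c \<in> arrs C" if "c \<in> Ob C" for c
    using \<tau>(1)[OF that] by (simp add: inverse_arrs_def)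
  have nat_\<tau>: "acomp C (\<tau> (cd f)) (G1 (fmap F f)) = acomp C f (\<tau> (dm f))" if "f \<in> arrs C" for f
    by (rule fmap_faithful)
      (use that eG1[of "fmap F f"] in \<open>auto simp: \<tau>in \<tau>(2-4) G1(1-3) arrsD F.fmap_acomp F.FOb_in\<close>)
  have "naturally_isomorphic C C (comp_func C G F) (id_func C)"
    unfolding naturally_isomorphic_def
  proof (rule exI[of _ "\<lambda>c. raw (\<tau> c)"], intro conjI ballI)
    fix c assume c: "c \<in> Ob C"
    have "Arr (G0 (FOb F c)) c (raw (\<tau> c)) = \<tau> c"
      by (rule arr.expand) (simp add: \<tau> c)
    then show "iso_in C (FOb (comp_func C G F) c) (FOb (id_func C) c) (raw (\<tau> c))"
      using c \<tau>(1)[OF c] by (auto simp: G_def F.FOb_in G0 iso_in_arrs)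
  next
    fix a b f assume A: "a \<in> Ob C" "b \<in> Ob C" "f \<in> Hom C a b"
    have "raw (acomp C (\<tau> b) (G1 (fmap F (Arr a b f)))) = raw (acomp C (Arr a b f) (\<tau> a))"
      using A nat_\<tau>[of "Arr a b f"] by simp
    then show "Cmp C (FOb (comp_func C G F) a) (FOb (comp_func C G F) b) (FOb (id_func C) b)
          (raw (\<tau> b)) (FHom (comp_func C G F) a b f)
        = Cmp C (FOb (comp_func C G F) a) (FOb (id_func C) a) (FOb (id_func C) b)
          (FHom (id_func C) a b f) (raw (\<tau> a))"
      using A by (simp add: G_def F.FOb_in F.FHom_in acomp_def G1 \<tau> fmap_def)
  qed
  moreover have "naturally_isomorphic D D (comp_func D F G) (id_func D)"
    unfolding naturally_isomorphic_def
  proof (rule exI[of _ "\<lambda>d. raw (\<epsilon> d)"], intro conjI ballI)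
    fix d assume d: "d \<in> Ob D"
    have "Arr (FOb F (G0 d)) d (raw (\<epsilon> d)) = \<epsilon> d"
      by (rule arr.expand) (simp add: d)
    then show "iso_in D (FOb (comp_func D F G) d) (FOb (id_func D) d) (raw (\<epsilon> d))"
      using d inv[OF d] by (auto simp: G_def F.FOb_in G0 iso_in_arrs)
  next
    fix a b f assume A: "a \<in> Ob D" "b \<in> Ob D" "f \<in> Hom D a b"
    have "raw (acomp D (\<epsilon> b) (fmap F (G1 (Arr a b f)))) = raw (acomp D (Arr a b f) (\<epsilon> a))"
      using A eG1[of "Arr a b f"] by simp
    then show "Cmp D (FOb (comp_func D F G) a) (FOb (comp_func D F G) b) (FOb (id_func D) b)
          (raw (\<epsilon> b)) (FHom (comp_func D F G) a b f)
        = Cmp D (FOb (comp_func D F G) a) (FOb (id_func D) a) (FOb (id_func D) b)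
          (FHom (id_func D) a b f) (raw (\<epsilon> a))"
      using A by (simp add: G_def F.FOb_in F.FHom_in acomp_def G1(1-3) fmap_def)
  qed
  ultimately show ?thesis
    using fG cC cD fF by (auto simp: is_equivalence_def)
qed

end


section \<open>Skew monoidal categories on arrows\<close>

abbreviation kcomp :: "('o, 'a) skmon \<Rightarrow> ('o, 'a) arr \<Rightarrow> ('o, 'a) arr \<Rightarrow> ('o, 'a) arr"
    (infixr "\<cdot>\<index>" 55) where
  "g \<cdot>\<^bsub>S\<^esub> f \<equiv> acomp (KCat S) g f"

abbreviation karrs :: "('o, 'a) skmon \<Rightarrow> ('o, 'a) arr set" where
  "karrs S \<equiv> arrs (KCat S)"

abbreviation kide :: "('o, 'a) skmon \<Rightarrow> 'o \<Rightarrow> ('o, 'a) arr" ("\<one>\<index>") where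
  "\<one>\<^bsub>S\<^esub> a \<equiv> ide (KCat S) a"

definition ten :: "('o, 'a) skmon \<Rightarrow> ('o, 'a) arr \<Rightarrow> ('o, 'a) arr \<Rightarrow> ('o, 'a) arr"
    (infixr "\<otimes>\<index>" 60) where
  "f \<otimes>\<^bsub>S\<^esub> g = Arr (dm f \<odot>\<^bsub>S\<^esub> dm g) (cd f \<odot>\<^bsub>S\<^esub> cd g)
     (ten_ar S (dm f) (cd f) (dm g) (cd g) (raw f) (raw g))"

definition asc :: "('o, 'a) skmon \<Rightarrow> 'o \<Rightarrow> 'o \<Rightarrow> 'o \<Rightarrow> ('o, 'a) arr" where
  "asc S a b c = Arr ((a \<odot>\<^bsub>S\<^esub> b) \<odot>\<^bsub>S\<^esub> c) (a \<odot>\<^bsub>S\<^esub> (b \<odot>\<^bsub>S\<^esub> c)) (KAssoc S a b c)"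

definition lam :: "('o, 'a) skmon \<Rightarrow> 'o \<Rightarrow> ('o, 'a) arr" where
  "lam S a = Arr (KUnit S \<odot>\<^bsub>S\<^esub> a) a (KLam S a)"

definition rho :: "('o, 'a) skmon \<Rightarrow> 'o \<Rightarrow> ('o, 'a) arr" where
  "rho S a = Arr a (a \<odot>\<^bsub>S\<^esub> KUnit S) (KRho S a)"

lemma ends [simp]:
  "dm (f \<otimes>\<^bsub>S\<^esub> g) = dm f \<odot>\<^bsub>S\<^esub> dm g" "cd (f \<otimes>\<^bsub>S\<^esub> g) = cd f \<odot>\<^bsub>S\<^esub> cd g"
  "dm (asc S a b c) = (a \<odot>\<^bsub>S\<^esub> b) \<odot>\<^bsub>S\<^esub> c" "cd (asc S a b c) = a \<odot>\<^bsub>S\<^esub> (b \<odot>\<^bsub>S\<^esub> c)"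
  "dm (lam S a) = KUnit S \<odot>\<^bsub>S\<^esub> a" "cd (lam S a) = a"
  "dm (rho S a) = a" "cd (rho S a) = a \<odot>\<^bsub>S\<^esub> KUnit S"
  by (simp_all add: ten_def asc_def lam_def rho_def)

lemma prod_cat_simps [simp]:
  "Ob (prod_cat C D) = Ob C \<times> Ob D" "Hom (prod_cat C D) (a, a') (b, b') = Hom C a b \<times> Hom D a' b'"
  "Id (prod_cat C D) (a, a') = (Id C a, Id D a')"
  "Cmp (prod_cat C D) (a, a') (b, b') (c, c') (g, g') (f, f') = (Cmp C a b c g f, Cmp D a' b' c' g' f')"
  by (auto simp: prod_cat_def)

lemma (in skew_monoidal) ten_natural_facts:
  shows ten_ob_in [simp]: "\<lbrakk>a \<in> KOb S; b \<in> KOb S\<rbrakk> \<Longrightarrow> a \<odot> b \<in> KOb S"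
    and ten_arrs [simp]: "\<lbrakk>f \<in> karrs S; g \<in> karrs S\<rbrakk> \<Longrightarrow> f \<otimes> g \<in> karrs S"
    and ten_ide [simp]: "\<lbrakk>a \<in> KOb S; b \<in> KOb S\<rbrakk> \<Longrightarrow> \<one> a \<otimes> \<one> b = \<one> (a \<odot> b)"
    and ten_acomp: "\<lbrakk>f \<in> karrs S; f' \<in> karrs S; g \<in> karrs S; g' \<in> karrs S; dm g = cd f; dm g' = cd f'\<rbrakk>
      \<Longrightarrow> (g \<cdot> f) \<otimes> (g' \<cdot> f') = (g \<otimes> g') \<cdot> (f \<otimes> f')"
proof -
  interpret T: is_functor "prod_cat (KCat S) (KCat S)" "KCat S" "KTen S" by (rule KTen_functor)
  show t: "a \<odot> b \<in> KOb S" if "a \<in> KOb S" "b \<in> KOb S" for a b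
    using T.FOb_in[of "(a, b)"] that by simp
  show "f \<otimes> g \<in> karrs S" if "f \<in> karrs S" "g \<in> karrs S"
    using T.FHom_in[of "(dm f, dm g)" "(cd f, cd g)" "(raw f, raw g)"] that t
    by (simp add: arrs_def ten_def)
  show "\<one> a \<otimes> \<one> b = \<one> (a \<odot> b)" if "a \<in> KOb S" "b \<in> KOb S"
    using T.FHom_Id[of "(a, b)"] that by (simp add: ten_def ide_def)
  show "(g \<cdot> f) \<otimes> (g' \<cdot> f') = (g \<otimes> g') \<cdot> (f \<otimes> f')"
    if "f \<in> karrs S" "f' \<in> karrs S" "g \<in> karrs S" "g' \<in> karrs S" "dm g = cd f" "dm g' = cd f'"
    using T.FHom_Cmp[of "(dm f, dm f')" "(cd f, cd f')" "(cd g, cd g')" "(raw f, raw f')" "(raw g, raw g')"] that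
    by (simp add: arrs_def acomp_def ten_def)
qed

sublocale skew_monoidal \<subseteq> category "KCat S"
  by (rule KCat_category)

context skew_monoidal
begin

lemma unit_ob [simp]: "KUnit S \<in> KOb S"
  by (rule KUnit_in)

lemma structure_arrs [simp]:
  "\<lbrakk>a \<in> KOb S; b \<in> KOb S; c \<in> KOb S\<rbrakk> \<Longrightarrow> asc S a b c \<in> karrs S"
  "a \<in> KOb S \<Longrightarrow> lam S a \<in> karrs S"
  "a \<in> KOb S \<Longrightarrow> rho S a \<in> karrs S"
  by (simp_all add: asc_def lam_def rho_def KAssoc_in KLam_in KRho_in)

lemma asc_natural:
  "\<lbrakk>f \<in> karrs S; g \<in> karrs S; h \<in> karrs S\<rbrakk>
    \<Longrightarrow> asc S (cd f) (cd g) (cd h) \<cdot> ((f \<otimes> g) \<otimes> h) = (f \<otimes> (g \<otimes> h)) \<cdot> asc S (dm f) (dm g) (dm h)"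
  using KAssoc_natural[of "dm f" "dm g" "dm h" "cd f" "cd g" "cd h" "raw f" "raw g" "raw h"]
  by (simp add: acomp_def ten_def asc_def arrs_def)

lemma lam_natural: "f \<in> karrs S \<Longrightarrow> lam S (cd f) \<cdot> (\<one> (KUnit S) \<otimes> f) = f \<cdot> lam S (dm f)"
  using KLam_natural[of "dm f" "cd f" "raw f"]
  by (cases f) (simp add: acomp_def ten_def lam_def arrs_def ide_def)

lemma rho_natural: "f \<in> karrs S \<Longrightarrow> rho S (cd f) \<cdot> f = (f \<otimes> \<one> (KUnit S)) \<cdot> rho S (dm f)"
  using KRho_natural[of "dm f" "cd f" "raw f"]
  by (cases f) (simp add: acomp_def ten_def rho_def arrs_def ide_def)

lemma arr_pentagon:
  "\<lbrakk>a \<in> KOb S; b \<in> KOb S; c \<in> KOb S; d \<in> KOb S\<rbrakk>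
    \<Longrightarrow> asc S a b (c \<odot> d) \<cdot> asc S (a \<odot> b) c d
      = (\<one> a \<otimes> asc S b c d) \<cdot> asc S a (b \<odot> c) d \<cdot> (asc S a b c \<otimes> \<one> d)"
  using pentagon[of a b c d] by (simp add: acomp_def ten_def asc_def ide_def)

lemma arr_left_unit:
  "\<lbrakk>a \<in> KOb S; b \<in> KOb S\<rbrakk> \<Longrightarrow> lam S (a \<odot> b) \<cdot> asc S (KUnit S) a b = lam S a \<otimes> \<one> b"
  using left_unit[of a b] by (simp add: acomp_def ten_def asc_def lam_def ide_def)

lemma arr_right_unit:
  "\<lbrakk>a \<in> KOb S; b \<in> KOb S\<rbrakk> \<Longrightarrow> asc S a b (KUnit S) \<cdot> rho S (a \<odot> b) = \<one> a \<otimes> rho S b"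
  using right_unit[of a b] by (simp add: acomp_def ten_def asc_def rho_def ide_def)

lemma arr_middle_unit:
  "\<lbrakk>a \<in> KOb S; b \<in> KOb S\<rbrakk>
    \<Longrightarrow> (\<one> a \<otimes> lam S b) \<cdot> asc S a (KUnit S) b \<cdot> (rho S a \<otimes> \<one> b) = \<one> (a \<odot> b)"
  using middle_unit[of a b] by (simp add: acomp_def ten_def asc_def rho_def lam_def ide_def)

lemma arr_unit_unit: "lam S (KUnit S) \<cdot> rho S (KUnit S) = \<one> (KUnit S)"
  using unit_unit by (simp add: acomp_def rho_def lam_def ide_def)

end

lemma skew_monoidalI:
  fixes S (structure)
  assumes "category (KCat S)"
    and "is_functor (prod_cat (KCat S) (KCat S)) (KCat S) (KTen S)"
    and "KUnit S \<in> KOb S"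
    and "\<And>a b c. \<lbrakk>a \<in> KOb S; b \<in> KOb S; c \<in> KOb S\<rbrakk> \<Longrightarrow> asc S a b c \<in> karrs S"
    and "\<And>a. a \<in> KOb S \<Longrightarrow> lam S a \<in> karrs S"
    and "\<And>a. a \<in> KOb S \<Longrightarrow> rho S a \<in> karrs S"
    and asc_natural: "\<And>f g h. \<lbrakk>f \<in> karrs S; g \<in> karrs S; h \<in> karrs S\<rbrakk>
      \<Longrightarrow> asc S (cd f) (cd g) (cd h) \<cdot> ((f \<otimes> g) \<otimes> h) = (f \<otimes> (g \<otimes> h)) \<cdot> asc S (dm f) (dm g) (dm h)"
    and lam_natural: "\<And>f. f \<in> karrs S \<Longrightarrow> lam S (cd f) \<cdot> (\<one> (KUnit S) \<otimes> f) = f \<cdot> lam S (dm f)"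
    and rho_natural: "\<And>f. f \<in> karrs S \<Longrightarrow> rho S (cd f) \<cdot> f = (f \<otimes> \<one> (KUnit S)) \<cdot> rho S (dm f)"
    and pentagon: "\<And>a b c d. \<lbrakk>a \<in> KOb S; b \<in> KOb S; c \<in> KOb S; d \<in> KOb S\<rbrakk>
      \<Longrightarrow> asc S a b (c \<odot> d) \<cdot> asc S (a \<odot> b) c d
        = (\<one> a \<otimes> asc S b c d) \<cdot> asc S a (b \<odot> c) d \<cdot> (asc S a b c \<otimes> \<one> d)"
    and left_unit: "\<And>a b. \<lbrakk>a \<in> KOb S; b \<in> KOb S\<rbrakk>
      \<Longrightarrow> lam S (a \<odot> b) \<cdot> asc S (KUnit S) a b = lam S a \<otimes> \<one> b"
    and right_unit: "\<And>a b. \<lbrakk>a \<in> KOb S; b \<in> KOb S\<rbrakk>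
      \<Longrightarrow> asc S a b (KUnit S) \<cdot> rho S (a \<odot> b) = \<one> a \<otimes> rho S b"
    and middle_unit: "\<And>a b. \<lbrakk>a \<in> KOb S; b \<in> KOb S\<rbrakk>
      \<Longrightarrow> (\<one> a \<otimes> lam S b) \<cdot> asc S a (KUnit S) b \<cdot> (rho S a \<otimes> \<one> b) = \<one> (a \<odot> b)"
    and unit_unit: "lam S (KUnit S) \<cdot> rho S (KUnit S) = \<one> (KUnit S)"
  shows "skew_monoidal S"
proof (rule skew_monoidal.intro)
  fix a b c a' b' c' f g h
  assume "a \<in> KOb S" "b \<in> KOb S" "c \<in> KOb S" "a' \<in> KOb S" "b' \<in> KOb S" "c' \<in> KOb S"
    "f \<in> Hom (KCat S) a a'" "g \<in> Hom (KCat S) b b'" "h \<in> Hom (KCat S) c c'"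
  then show "Cmp (KCat S) ((a \<odot> b) \<odot> c) ((a' \<odot> b') \<odot> c') (a' \<odot> (b' \<odot> c')) (KAssoc S a' b' c')
            (ten_ar S (a \<odot> b) (a' \<odot> b') c c' (ten_ar S a a' b b' f g) h)
          = Cmp (KCat S) ((a \<odot> b) \<odot> c) (a \<odot> (b \<odot> c)) (a' \<odot> (b' \<odot> c'))
            (ten_ar S a a' (b \<odot> c) (b' \<odot> c') f (ten_ar S b b' c c' g h)) (KAssoc S a b c)"
    using asc_natural[of "Arr a a' f" "Arr b b' g" "Arr c c' h"]
    by (simp add: acomp_def ten_def asc_def)
next
  fix a a' f assume "a \<in> KOb S" "a' \<in> KOb S" "f \<in> Hom (KCat S) a a'"
  then show "Cmp (KCat S) (KUnit S \<odot> a) (KUnit S \<odot> a') a' (KLam S a')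
            (ten_ar S (KUnit S) (KUnit S) a a' (Id (KCat S) (KUnit S)) f)
          = Cmp (KCat S) (KUnit S \<odot> a) a a' f (KLam S a)"
    using lam_natural[of "Arr a a' f"] by (simp add: acomp_def ten_def lam_def ide_def)
next
  fix a a' f assume "a \<in> KOb S" "a' \<in> KOb S" "f \<in> Hom (KCat S) a a'"
  then show "Cmp (KCat S) a a' (a' \<odot> KUnit S) (KRho S a') f
          = Cmp (KCat S) a (a \<odot> KUnit S) (a' \<odot> KUnit S)
            (ten_ar S a a' (KUnit S) (KUnit S) f (Id (KCat S) (KUnit S))) (KRho S a)"
    using rho_natural[of "Arr a a' f"] by (simp add: acomp_def ten_def rho_def ide_def)
qed (use assms(1-6) pentagon left_unit right_unit middle_unit unit_unit in
      \<open>simp_all add: acomp_def ten_def asc_def lam_def rho_def ide_def\<close>)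

section \<open>Lax monoidal functors on arrows\<close>

definition lax0 :: "('o, 'a) skmon \<Rightarrow> ('o, 'a) skmon \<Rightarrow> ('o, 'a) laxfun \<Rightarrow> ('o, 'a) arr" where
  "lax0 S R F = Arr (KUnit R) (FOb (LFun F) (KUnit S)) (Lax0 F)"

definition lax2 :: "('o, 'a) skmon \<Rightarrow> ('o, 'a) skmon \<Rightarrow> ('o, 'a) laxfun \<Rightarrow> 'o \<Rightarrow> 'o \<Rightarrow> ('o, 'a) arr" where
  "lax2 S R F a b =
     Arr (FOb (LFun F) a \<odot>\<^bsub>R\<^esub> FOb (LFun F) b) (FOb (LFun F) (a \<odot>\<^bsub>S\<^esub> b)) (Lax2 F a b)"

lemma lax_ends [simp]:
  "dm (lax0 S R F) = KUnit R" "cd (lax0 S R F) = FOb (LFun F) (KUnit S)"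
  "dm (lax2 S R F a b) = FOb (LFun F) a \<odot>\<^bsub>R\<^esub> FOb (LFun F) b"
  "cd (lax2 S R F a b) = FOb (LFun F) (a \<odot>\<^bsub>S\<^esub> b)"
  by (simp_all add: lax0_def lax2_def)

locale lax_functor = S: skew_monoidal S + R: skew_monoidal R + lax_monoidal S R F
  for S R :: "('o, 'a) skmon" and F :: "('o, 'a) laxfun"

sublocale lax_functor \<subseteq> is_functor "KCat S" "KCat R" "LFun F"
  by (rule LFun_functor)

context lax_functor
begin

abbreviation ob where "ob \<equiv> FOb (LFun F)"
abbreviation ar where "ar \<equiv> fmap (LFun F)"

lemma ob_in [simp]: "a \<in> KOb S \<Longrightarrow> ob a \<in> KOb R"
  by (rule FOb_in)

lemma lax0_arrs [simp]: "lax0 S R F \<in> karrs R"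
  by (simp add: lax0_def Lax0_in)

lemma lax2_arrs [simp]: "\<lbrakk>a \<in> KOb S; b \<in> KOb S\<rbrakk> \<Longrightarrow> lax2 S R F a b \<in> karrs R"
  by (simp add: lax2_def Lax2_in)

lemma lax2_natural: "\<lbrakk>f \<in> karrs S; g \<in> karrs S\<rbrakk>
    \<Longrightarrow> lax2 S R F (cd f) (cd g) \<cdot>\<^bsub>R\<^esub> (ar f \<otimes>\<^bsub>R\<^esub> ar g) = ar (f \<otimes>\<^bsub>S\<^esub> g) \<cdot>\<^bsub>R\<^esub> lax2 S R F (dm f) (dm g)"
  using Lax2_natural[of "dm f" "dm g" "cd f" "cd g" "raw f" "raw g"]
  by (simp add: arrs_def acomp_def fmap_def lax2_def ten_def)

lemma lax_assoc: "\<lbrakk>a \<in> KOb S; b \<in> KOb S; c \<in> KOb S\<rbrakk>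
    \<Longrightarrow> ar (asc S a b c) \<cdot>\<^bsub>R\<^esub> lax2 S R F (a \<odot>\<^bsub>S\<^esub> b) c \<cdot>\<^bsub>R\<^esub> (lax2 S R F a b \<otimes>\<^bsub>R\<^esub> \<one>\<^bsub>R\<^esub> (ob c))
      = lax2 S R F a (b \<odot>\<^bsub>S\<^esub> c) \<cdot>\<^bsub>R\<^esub> (\<one>\<^bsub>R\<^esub> (ob a) \<otimes>\<^bsub>R\<^esub> lax2 S R F b c) \<cdot>\<^bsub>R\<^esub> asc R (ob a) (ob b) (ob c)"
  using Lax_assoc[of a b c "ob a" "ob b" "ob c"]
  by (simp add: acomp_def fmap_def lax2_def ten_def asc_def ide_def)

lemma lax_left_unit: "a \<in> KOb S
    \<Longrightarrow> ar (lam S a) \<cdot>\<^bsub>R\<^esub> lax2 S R F (KUnit S) a \<cdot>\<^bsub>R\<^esub> (lax0 S R F \<otimes>\<^bsub>R\<^esub> \<one>\<^bsub>R\<^esub> (ob a)) = lam R (ob a)"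
  using Lax_left_unit[of a "ob a"]
  by (simp add: acomp_def fmap_def lax2_def lax0_def ten_def lam_def ide_def)

lemma lax_right_unit: "a \<in> KOb S
    \<Longrightarrow> lax2 S R F a (KUnit S) \<cdot>\<^bsub>R\<^esub> (\<one>\<^bsub>R\<^esub> (ob a) \<otimes>\<^bsub>R\<^esub> lax0 S R F) \<cdot>\<^bsub>R\<^esub> rho R (ob a) = ar (rho S a)"
  using Lax_right_unit[of a "ob a"]
  by (simp add: acomp_def fmap_def lax2_def lax0_def ten_def rho_def ide_def)

end

lemma lax_monoidalI:
  fixes S R F
  defines "ob \<equiv> FOb (LFun F)" and "ar \<equiv> fmap (LFun F)"
  assumes fn: "is_functor (KCat S) (KCat R) (LFun F)"
    and l0: "lax0 S R F \<in> karrs R"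
    and l2: "\<And>a b. \<lbrakk>a \<in> KOb S; b \<in> KOb S\<rbrakk> \<Longrightarrow> lax2 S R F a b \<in> karrs R"
    and nat: "\<And>f g. \<lbrakk>f \<in> karrs S; g \<in> karrs S\<rbrakk>
    \<Longrightarrow> lax2 S R F (cd f) (cd g) \<cdot>\<^bsub>R\<^esub> (ar f \<otimes>\<^bsub>R\<^esub> ar g) = ar (f \<otimes>\<^bsub>S\<^esub> g) \<cdot>\<^bsub>R\<^esub> lax2 S R F (dm f) (dm g)"
    and assoc: "\<And>a b c. \<lbrakk>a \<in> KOb S; b \<in> KOb S; c \<in> KOb S\<rbrakk>
    \<Longrightarrow> ar (asc S a b c) \<cdot>\<^bsub>R\<^esub> lax2 S R F (a \<odot>\<^bsub>S\<^esub> b) c \<cdot>\<^bsub>R\<^esub> (lax2 S R F a b \<otimes>\<^bsub>R\<^esub> \<one>\<^bsub>R\<^esub> (ob c))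
      = lax2 S R F a (b \<odot>\<^bsub>S\<^esub> c) \<cdot>\<^bsub>R\<^esub> (\<one>\<^bsub>R\<^esub> (ob a) \<otimes>\<^bsub>R\<^esub> lax2 S R F b c) \<cdot>\<^bsub>R\<^esub> asc R (ob a) (ob b) (ob c)"
    and left: "\<And>a. a \<in> KOb S
    \<Longrightarrow> ar (lam S a) \<cdot>\<^bsub>R\<^esub> lax2 S R F (KUnit S) a \<cdot>\<^bsub>R\<^esub> (lax0 S R F \<otimes>\<^bsub>R\<^esub> \<one>\<^bsub>R\<^esub> (ob a)) = lam R (ob a)"
    and right: "\<And>a. a \<in> KOb S
    \<Longrightarrow> lax2 S R F a (KUnit S) \<cdot>\<^bsub>R\<^esub> (\<one>\<^bsub>R\<^esub> (ob a) \<otimes>\<^bsub>R\<^esub> lax0 S R F) \<cdot>\<^bsub>R\<^esub> rho R (ob a) = ar (rho S a)"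
    and normal: "Lax2 F = restrict_Lax2 S (Lax2 F)"
  shows "lax_monoidal S R F"
proof (rule lax_monoidal.intro)
  fix a b a' b' f g
  assume "a \<in> KOb S" "b \<in> KOb S" "a' \<in> KOb S" "b' \<in> KOb S"
    "f \<in> Hom (KCat S) a a'" "g \<in> Hom (KCat S) b b'"
  then show "Cmp (KCat R) (FOb (LFun F) a \<odot>\<^bsub>R\<^esub> FOb (LFun F) b) (FOb (LFun F) a' \<odot>\<^bsub>R\<^esub> FOb (LFun F) b')
              (FOb (LFun F) (a' \<odot>\<^bsub>S\<^esub> b'))
            (Lax2 F a' b')
            (ten_ar R (FOb (LFun F) a) (FOb (LFun F) a') (FOb (LFun F) b) (FOb (LFun F) b')
              (FHom (LFun F) a a' f) (FHom (LFun F) b b' g))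
          = Cmp (KCat R) (FOb (LFun F) a \<odot>\<^bsub>R\<^esub> FOb (LFun F) b) (FOb (LFun F) (a \<odot>\<^bsub>S\<^esub> b))
              (FOb (LFun F) (a' \<odot>\<^bsub>S\<^esub> b'))
            (FHom (LFun F) (a \<odot>\<^bsub>S\<^esub> b) (a' \<odot>\<^bsub>S\<^esub> b') (ten_ar S a a' b b' f g))
            (Lax2 F a b)"
    using nat[of "Arr a a' f" "Arr b b' g"]
    by (simp add: acomp_def fmap_def lax2_def ten_def ar_def)
qed (use fn l0 l2 assoc left right normal in \<open>simp_all add: acomp_def fmap_def lax2_def lax0_def
      ten_def lam_def rho_def asc_def ide_def ar_def ob_def is_functor.FOb_in\<close>)

lemma laxfun_eqI:
  assumes "lax_monoidal S R F" "lax_monoidal S R' G"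
    and "LFun F = LFun G" "Lax0 F = Lax0 G"
    and "\<And>a b. \<lbrakk>a \<in> KOb S; b \<in> KOb S\<rbrakk> \<Longrightarrow> Lax2 F a b = Lax2 G a b"
  shows "F = G"
proof -
  have "Lax2 F = Lax2 G"
    using lax_monoidal.Lax2_normal[OF assms(1)] lax_monoidal.Lax2_normal[OF assms(2)] assms(5)
    by (metis (no_types, opaque_lifting) ext restrict_Lax2_def)
  then show ?thesis using assms by simp
qed

text \<open>Fields of the record \<open>skmon\<close> are arbitrary off the carriers, so structures which are
  the same mathematically can be different records. Such structures are isomorphic by the
  identity, not equal.\<close>

definition same_skew :: "('o, 'a) skmon \<Rightarrow> ('o, 'a) skmon \<Rightarrow> bool" where
  "same_skew S R \<longleftrightarrow> KOb S = KOb R \<and> KUnit S = KUnit R \<and> karrs S = karrs R \<and>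
     (\<forall>a\<in>KOb S. \<one>\<^bsub>S\<^esub> a = \<one>\<^bsub>R\<^esub> a \<and> lam S a = lam R a \<and> rho S a = rho R a) \<and>
     (\<forall>f\<in>karrs S. \<forall>g\<in>karrs S. f \<otimes>\<^bsub>S\<^esub> g = f \<otimes>\<^bsub>R\<^esub> g \<and> (dm g = cd f \<longrightarrow> g \<cdot>\<^bsub>S\<^esub> f = g \<cdot>\<^bsub>R\<^esub> f)) \<and>
     (\<forall>a\<in>KOb S. \<forall>b\<in>KOb S. a \<odot>\<^bsub>S\<^esub> b = a \<odot>\<^bsub>R\<^esub> b \<and> (\<forall>c\<in>KOb S. asc S a b c = asc R a b c))"

lemma id_lax_simps [simp]:
  "LFun (id_lax S) = id_func (KCat S)"
  "Lax0 (id_lax S) = Id (KCat S) (KUnit S)"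
  "\<lbrakk>a \<in> KOb S; b \<in> KOb S\<rbrakk> \<Longrightarrow> Lax2 (id_lax S) a b = Id (KCat S) (a \<odot>\<^bsub>S\<^esub> b)"
  by (simp_all add: id_lax_def restrict_Lax2_def)

text \<open>For two structures that agree on the carriers rather than for one, so that it also gives
  the comparison isomorphisms between such structures.\<close>

lemma id_lax_lax_monoidal:
  assumes "skew_monoidal S" "skew_monoidal R" "same_skew S R"
  shows "lax_monoidal S R (id_lax S)"
proof -
  interpret S: skew_monoidal S by fact
  interpret R: skew_monoidal R by fact
  have KOb: "KOb S = KOb R" and unit: "KUnit S = KUnit R" and arrs: "karrs S = karrs R"
    and ids: "a \<in> KOb R \<Longrightarrow> \<one>\<^bsub>S\<^esub> a = \<one>\<^bsub>R\<^esub> a" "a \<in> KOb R \<Longrightarrow> lam S a = lam R a"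
      "a \<in> KOb R \<Longrightarrow> rho S a = rho R a"
    and ten: "f \<in> karrs R \<Longrightarrow> g \<in> karrs R \<Longrightarrow> f \<otimes>\<^bsub>S\<^esub> g = f \<otimes>\<^bsub>R\<^esub> g"
    and comp: "f \<in> karrs R \<Longrightarrow> g \<in> karrs R \<Longrightarrow> dm g = cd f \<Longrightarrow> g \<cdot>\<^bsub>S\<^esub> f = g \<cdot>\<^bsub>R\<^esub> f"
    and tob: "a \<in> KOb R \<Longrightarrow> b \<in> KOb R \<Longrightarrow> a \<odot>\<^bsub>S\<^esub> b = a \<odot>\<^bsub>R\<^esub> b"
    and asc: "a \<in> KOb R \<Longrightarrow> b \<in> KOb R \<Longrightarrow> c \<in> KOb R \<Longrightarrow> asc S a b c = asc R a b c"
    for a b c f g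
    using assms(3) unfolding same_skew_def by auto
  have l0: "lax0 S R (id_lax S) = \<one>\<^bsub>R\<^esub> (KUnit R)"
    using ids(1)[of "KUnit R"] by (simp add: lax0_def ide_def unit KOb)
  have l2: "lax2 S R (id_lax S) a b = \<one>\<^bsub>R\<^esub> (a \<odot>\<^bsub>R\<^esub> b)" if "a \<in> KOb R" "b \<in> KOb R" for a b
    using ids(1)[of "a \<odot>\<^bsub>R\<^esub> b"] that by (simp add: lax2_def ide_def KOb tob)
  have F: "is_functor (KCat S) (KCat R) (id_func (KCat S))"
    unfolding id_func_def
  proof (rule mk_func_is_functor)
    fix a b f assume "a \<in> KOb S" "b \<in> KOb S" "f \<in> Hom (KCat S) a b"
    then have "Arr a b f \<in> karrs R" unfolding arrs[symmetric] by simp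
    then show "f \<in> Hom (KCat R) a b" by simp
  next
    fix a assume "a \<in> KOb S"
    then show "Id (KCat S) a = Id (KCat R) a" using ids(1)[of a] by (simp add: ide_def KOb)
  next
    fix a b c f g assume *: "a \<in> KOb S" "b \<in> KOb S" "c \<in> KOb S" "f \<in> Hom (KCat S) a b" "g \<in> Hom (KCat S) b c"
    then have "Arr a b f \<in> karrs S" "Arr b c g \<in> karrs S" by simp_all
    then show "Cmp (KCat S) a b c g f = Cmp (KCat R) a b c g f"
      using comp[of "Arr a b f" "Arr b c g"] unfolding arrs by (simp add: acomp_def)
  qed (simp_all add: KOb S.KCat_category)
  show ?thesis
  proof (rule lax_monoidalI, unfold id_lax_simps)
    fix f g assume "f \<in> karrs S" "g \<in> karrs S"
    then have *: "f \<in> karrs R" "g \<in> karrs R" by (simp_all add: arrs)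
    then have "FOb (id_func (KCat S)) (dm f) = dm f" "FOb (id_func (KCat S)) (dm g) = dm g"
      by (simp_all add: arrsD KOb)
    then show "lax2 S R (id_lax S) (cd f) (cd g) \<cdot>\<^bsub>R\<^esub> (fmap (id_func (KCat S)) f \<otimes>\<^bsub>R\<^esub> fmap (id_func (KCat S)) g)
      = fmap (id_func (KCat S)) (f \<otimes>\<^bsub>S\<^esub> g) \<cdot>\<^bsub>R\<^esub> lax2 S R (id_lax S) (dm f) (dm g)"
      using * by (simp add: arrs l2 arrsD ten)
  next
    show "Lax2 (id_lax S) = restrict_Lax2 S (Lax2 (id_lax S))"
      by (simp add: id_lax_def restrict_Lax2_def fun_eq_iff)
  qed (use F in \<open>simp_all add: l0 l2 arrs unit KOb ids asc tob\<close>)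
qed

lemma same_skew_refl: "same_skew S S"
  by (simp add: same_skew_def)

lemma same_skew_sym:
  assumes "same_skew S R"
  shows "same_skew R S"
  using assms by (auto simp: same_skew_def)

section \<open>The category of skew monoidal categories\<close>

lemma comp_lax_simps:
  "LFun (comp_lax S R Q G F) = comp_func (KCat S) (LFun G) (LFun F)"
  "\<lbrakk>lax_functor S R F; lax_functor R Q G\<rbrakk>
    \<Longrightarrow> lax0 S Q (comp_lax S R Q G F) = fmap (LFun G) (lax0 S R F) \<cdot>\<^bsub>Q\<^esub> lax0 R Q G"
  "\<lbrakk>lax_functor S R F; lax_functor R Q G; a \<in> KOb S; b \<in> KOb S\<rbrakk>
    \<Longrightarrow> lax2 S Q (comp_lax S R Q G F) a b
      = fmap (LFun G) (lax2 S R F a b) \<cdot>\<^bsub>Q\<^esub> lax2 R Q G (FOb (LFun F) a) (FOb (LFun F) b)"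
proof -
  show "LFun (comp_lax S R Q G F) = comp_func (KCat S) (LFun G) (LFun F)"
    by (simp add: comp_lax_def Let_def)
  assume "lax_functor S R F" "lax_functor R Q G"
  then interpret F: lax_functor S R F + G: lax_functor R Q G by auto
  show "lax0 S Q (comp_lax S R Q G F) = fmap (LFun G) (lax0 S R F) \<cdot>\<^bsub>Q\<^esub> lax0 R Q G"
    by (simp add: comp_lax_def Let_def lax0_def acomp_def fmap_def)
  show "a \<in> KOb S \<Longrightarrow> b \<in> KOb S \<Longrightarrow> lax2 S Q (comp_lax S R Q G F) a b
      = fmap (LFun G) (lax2 S R F a b) \<cdot>\<^bsub>Q\<^esub> lax2 R Q G (FOb (LFun F) a) (FOb (LFun F) b)"
    by (simp add: comp_lax_def Let_def lax2_def acomp_def fmap_def restrict_Lax2_def)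
qed

text \<open>Each axiom for the composite is the image under \<open>G\<close> of the axiom for \<open>F\<close> pasted to
  the axiom for \<open>G\<close>; in between, naturality of \<open>g\<^sub>2\<close> moves \<open>G f\<^sub>2\<close> and \<open>G f\<^sub>0\<close> past it.\<close>

lemma comp_lax_lax_monoidal:
  assumes "lax_functor S R F" "lax_functor R Q G"
  shows "lax_monoidal S Q (comp_lax S R Q G F)"
proof -
  interpret F: lax_functor S R F by fact
  interpret G: lax_functor R Q G by fact
  let ?H = "comp_lax S R Q G F" and ?GF = "comp_func (KCat S) (LFun G) (LFun F)"
  note H = comp_lax_simps(1) comp_lax_simps(2,3)[OF assms]
  note assoc = G.R.acomp_assoc
  show ?thesis
  proof (rule lax_monoidalI, unfold H(1))
    show "is_functor (KCat S) (KCat Q) ?GF"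
      by (rule comp_func_is_functor[where D = "KCat R"])
        (auto simp: F.S.KCat_category F.LFun_functor G.LFun_functor)
    show "lax0 S Q ?H \<in> karrs Q" by (simp add: H)
    show "lax2 S Q ?H a b \<in> karrs Q" if "a \<in> KOb S" "b \<in> KOb S" for a b
      using that by (simp add: H)
    show "Lax2 ?H = restrict_Lax2 S (Lax2 ?H)"
      by (simp add: comp_lax_def Let_def restrict_Lax2_def fun_eq_iff)
  next
    fix f g assume fg: "f \<in> karrs S" "g \<in> karrs S"
    note [simp] = arrsD[OF fg(1)] arrsD[OF fg(2)]
    have "G.ar (lax2 S R F (cd f) (cd g)) \<cdot>\<^bsub>Q\<^esub> lax2 R Q G (F.ob (cd f)) (F.ob (cd g)) \<cdot>\<^bsub>Q\<^esub>
          (G.ar (F.ar f) \<otimes>\<^bsub>Q\<^esub> G.ar (F.ar g))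
        = G.ar (lax2 S R F (cd f) (cd g)) \<cdot>\<^bsub>Q\<^esub> G.ar (F.ar f \<otimes>\<^bsub>R\<^esub> F.ar g) \<cdot>\<^bsub>Q\<^esub>
          lax2 R Q G (F.ob (dm f)) (F.ob (dm g))"
      using fg G.lax2_natural[of "F.ar f" "F.ar g"] by simp
    also have "\<dots> = G.ar (F.ar (f \<otimes>\<^bsub>S\<^esub> g) \<cdot>\<^bsub>R\<^esub> lax2 S R F (dm f) (dm g)) \<cdot>\<^bsub>Q\<^esub>
          lax2 R Q G (F.ob (dm f)) (F.ob (dm g))"
      using fg by (simp add: assoc[symmetric] G.fmap_acomp[symmetric] F.lax2_natural)
    finally show "lax2 S Q ?H (cd f) (cd g) \<cdot>\<^bsub>Q\<^esub>
        (fmap ?GF f \<otimes>\<^bsub>Q\<^esub> fmap ?GF g)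
      = fmap ?GF (f \<otimes>\<^bsub>S\<^esub> g) \<cdot>\<^bsub>Q\<^esub> lax2 S Q ?H (dm f) (dm g)"
      using fg by (simp add: H assoc G.fmap_acomp)
  next
    fix a b c assume [simp]: "a \<in> KOb S" "b \<in> KOb S" "c \<in> KOb S"
    let ?f = "lax2 S R F" and ?g = "lax2 R Q G"
    let ?k = "?g (F.ob a \<odot>\<^bsub>R\<^esub> F.ob b) (F.ob c) \<cdot>\<^bsub>Q\<^esub> (?g (F.ob a) (F.ob b) \<otimes>\<^bsub>Q\<^esub> \<one>\<^bsub>Q\<^esub> (G.ob (F.ob c)))"
    have t1: "(G.ar (?f a b) \<cdot>\<^bsub>Q\<^esub> ?g (F.ob a) (F.ob b)) \<otimes>\<^bsub>Q\<^esub> \<one>\<^bsub>Q\<^esub> (G.ob (F.ob c))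
        = (G.ar (?f a b) \<otimes>\<^bsub>Q\<^esub> G.ar (\<one>\<^bsub>R\<^esub> (F.ob c))) \<cdot>\<^bsub>Q\<^esub> (?g (F.ob a) (F.ob b) \<otimes>\<^bsub>Q\<^esub> \<one>\<^bsub>Q\<^esub> (G.ob (F.ob c)))"
      using G.R.ten_acomp[of "?g (F.ob a) (F.ob b)" "\<one>\<^bsub>Q\<^esub> (G.ob (F.ob c))" "G.ar (?f a b)" "\<one>\<^bsub>Q\<^esub> (G.ob (F.ob c))"] by simp
    have t2: "\<one>\<^bsub>Q\<^esub> (G.ob (F.ob a)) \<otimes>\<^bsub>Q\<^esub> (G.ar (?f b c) \<cdot>\<^bsub>Q\<^esub> ?g (F.ob b) (F.ob c))
        = (G.ar (\<one>\<^bsub>R\<^esub> (F.ob a)) \<otimes>\<^bsub>Q\<^esub> G.ar (?f b c)) \<cdot>\<^bsub>Q\<^esub> (\<one>\<^bsub>Q\<^esub> (G.ob (F.ob a)) \<otimes>\<^bsub>Q\<^esub> ?g (F.ob b) (F.ob c))"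
      using G.R.ten_acomp[of "\<one>\<^bsub>Q\<^esub> (G.ob (F.ob a))" "?g (F.ob b) (F.ob c)" "\<one>\<^bsub>Q\<^esub> (G.ob (F.ob a))" "G.ar (?f b c)"] by simp
    have n1: "?g (F.ob (a \<odot>\<^bsub>S\<^esub> b)) (F.ob c) \<cdot>\<^bsub>Q\<^esub> (G.ar (?f a b) \<otimes>\<^bsub>Q\<^esub> G.ar (\<one>\<^bsub>R\<^esub> (F.ob c)))
        = G.ar (?f a b \<otimes>\<^bsub>R\<^esub> \<one>\<^bsub>R\<^esub> (F.ob c)) \<cdot>\<^bsub>Q\<^esub> ?g (F.ob a \<odot>\<^bsub>R\<^esub> F.ob b) (F.ob c)"
      using G.lax2_natural[of "?f a b" "\<one>\<^bsub>R\<^esub> (F.ob c)"] by simp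
    have n2: "?g (F.ob a) (F.ob (b \<odot>\<^bsub>S\<^esub> c)) \<cdot>\<^bsub>Q\<^esub> (G.ar (\<one>\<^bsub>R\<^esub> (F.ob a)) \<otimes>\<^bsub>Q\<^esub> G.ar (?f b c))
        = G.ar (\<one>\<^bsub>R\<^esub> (F.ob a) \<otimes>\<^bsub>R\<^esub> ?f b c) \<cdot>\<^bsub>Q\<^esub> ?g (F.ob a) (F.ob b \<odot>\<^bsub>R\<^esub> F.ob c)"
      using G.lax2_natural[of "\<one>\<^bsub>R\<^esub> (F.ob a)" "?f b c"] by simp
    have "G.ar (F.ar (asc S a b c)) \<cdot>\<^bsub>Q\<^esub> (G.ar (?f (a \<odot>\<^bsub>S\<^esub> b) c) \<cdot>\<^bsub>Q\<^esub> ?g (F.ob (a \<odot>\<^bsub>S\<^esub> b)) (F.ob c)) \<cdot>\<^bsub>Q\<^esub>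
          ((G.ar (?f a b) \<cdot>\<^bsub>Q\<^esub> ?g (F.ob a) (F.ob b)) \<otimes>\<^bsub>Q\<^esub> \<one>\<^bsub>Q\<^esub> (G.ob (F.ob c)))
        = G.ar (F.ar (asc S a b c)) \<cdot>\<^bsub>Q\<^esub> G.ar (?f (a \<odot>\<^bsub>S\<^esub> b) c) \<cdot>\<^bsub>Q\<^esub>
          G.ar (?f a b \<otimes>\<^bsub>R\<^esub> \<one>\<^bsub>R\<^esub> (F.ob c)) \<cdot>\<^bsub>Q\<^esub> ?k"
      unfolding t1 using G.R.acomp_extend[OF n1] by (simp add: assoc del: G.fmap_ide)
    also have "\<dots> = G.ar (F.ar (asc S a b c) \<cdot>\<^bsub>R\<^esub> ?f (a \<odot>\<^bsub>S\<^esub> b) c \<cdot>\<^bsub>R\<^esub> (?f a b \<otimes>\<^bsub>R\<^esub> \<one>\<^bsub>R\<^esub> (F.ob c))) \<cdot>\<^bsub>Q\<^esub> ?k"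
      by (simp add: assoc G.fmap_acomp)
    also have "\<dots> = G.ar (?f a (b \<odot>\<^bsub>S\<^esub> c) \<cdot>\<^bsub>R\<^esub> (\<one>\<^bsub>R\<^esub> (F.ob a) \<otimes>\<^bsub>R\<^esub> ?f b c)) \<cdot>\<^bsub>Q\<^esub>
          (G.ar (asc R (F.ob a) (F.ob b) (F.ob c)) \<cdot>\<^bsub>Q\<^esub> ?k)"
      by (simp add: F.lax_assoc assoc G.fmap_acomp)
    also have "G.ar (asc R (F.ob a) (F.ob b) (F.ob c)) \<cdot>\<^bsub>Q\<^esub> ?k
        = ?g (F.ob a) (F.ob b \<odot>\<^bsub>R\<^esub> F.ob c) \<cdot>\<^bsub>Q\<^esub> (\<one>\<^bsub>Q\<^esub> (G.ob (F.ob a)) \<otimes>\<^bsub>Q\<^esub> ?g (F.ob b) (F.ob c)) \<cdot>\<^bsub>Q\<^esub>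
          asc Q (G.ob (F.ob a)) (G.ob (F.ob b)) (G.ob (F.ob c))"
      by (rule G.lax_assoc) auto
    also have "G.ar (?f a (b \<odot>\<^bsub>S\<^esub> c) \<cdot>\<^bsub>R\<^esub> (\<one>\<^bsub>R\<^esub> (F.ob a) \<otimes>\<^bsub>R\<^esub> ?f b c)) \<cdot>\<^bsub>Q\<^esub> \<dots>
        = (G.ar (?f a (b \<odot>\<^bsub>S\<^esub> c)) \<cdot>\<^bsub>Q\<^esub> ?g (F.ob a) (F.ob (b \<odot>\<^bsub>S\<^esub> c))) \<cdot>\<^bsub>Q\<^esub>
          (\<one>\<^bsub>Q\<^esub> (G.ob (F.ob a)) \<otimes>\<^bsub>Q\<^esub> (G.ar (?f b c) \<cdot>\<^bsub>Q\<^esub> ?g (F.ob b) (F.ob c))) \<cdot>\<^bsub>Q\<^esub>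
          asc Q (G.ob (F.ob a)) (G.ob (F.ob b)) (G.ob (F.ob c))"
      unfolding t2 using G.R.acomp_extend[OF n2] by (simp add: assoc G.fmap_acomp del: G.fmap_ide)
    finally show "fmap ?GF (asc S a b c) \<cdot>\<^bsub>Q\<^esub> lax2 S Q ?H (a \<odot>\<^bsub>S\<^esub> b) c \<cdot>\<^bsub>Q\<^esub>
        (lax2 S Q ?H a b \<otimes>\<^bsub>Q\<^esub> \<one>\<^bsub>Q\<^esub> (FOb ?GF c))
      = lax2 S Q ?H a (b \<odot>\<^bsub>S\<^esub> c) \<cdot>\<^bsub>Q\<^esub> (\<one>\<^bsub>Q\<^esub> (FOb ?GF a) \<otimes>\<^bsub>Q\<^esub> lax2 S Q ?H b c) \<cdot>\<^bsub>Q\<^esub>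
        asc Q (FOb ?GF a) (FOb ?GF b)
          (FOb ?GF c)"
      by (simp add: H)
  next
    fix a assume [simp]: "a \<in> KOb S"
    let ?f = "lax2 S R F" and ?g = "lax2 R Q G" and ?fu = "lax0 S R F" and ?gu = "lax0 R Q G"
    have t1: "(G.ar ?fu \<cdot>\<^bsub>Q\<^esub> ?gu) \<otimes>\<^bsub>Q\<^esub> \<one>\<^bsub>Q\<^esub> (G.ob (F.ob a))
        = (G.ar ?fu \<otimes>\<^bsub>Q\<^esub> G.ar (\<one>\<^bsub>R\<^esub> (F.ob a))) \<cdot>\<^bsub>Q\<^esub> (?gu \<otimes>\<^bsub>Q\<^esub> \<one>\<^bsub>Q\<^esub> (G.ob (F.ob a)))"
      using G.R.ten_acomp[of ?gu "\<one>\<^bsub>Q\<^esub> (G.ob (F.ob a))" "G.ar ?fu" "\<one>\<^bsub>Q\<^esub> (G.ob (F.ob a))"] by simp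
    have n1: "?g (F.ob (KUnit S)) (F.ob a) \<cdot>\<^bsub>Q\<^esub> (G.ar ?fu \<otimes>\<^bsub>Q\<^esub> G.ar (\<one>\<^bsub>R\<^esub> (F.ob a)))
        = G.ar (?fu \<otimes>\<^bsub>R\<^esub> \<one>\<^bsub>R\<^esub> (F.ob a)) \<cdot>\<^bsub>Q\<^esub> ?g (KUnit R) (F.ob a)"
      using G.lax2_natural[of ?fu "\<one>\<^bsub>R\<^esub> (F.ob a)"] by simp
    have "G.ar (F.ar (lam S a)) \<cdot>\<^bsub>Q\<^esub> (G.ar (?f (KUnit S) a) \<cdot>\<^bsub>Q\<^esub> ?g (F.ob (KUnit S)) (F.ob a)) \<cdot>\<^bsub>Q\<^esub>
          ((G.ar ?fu \<cdot>\<^bsub>Q\<^esub> ?gu) \<otimes>\<^bsub>Q\<^esub> \<one>\<^bsub>Q\<^esub> (G.ob (F.ob a)))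
        = G.ar (F.ar (lam S a) \<cdot>\<^bsub>R\<^esub> ?f (KUnit S) a \<cdot>\<^bsub>R\<^esub> (?fu \<otimes>\<^bsub>R\<^esub> \<one>\<^bsub>R\<^esub> (F.ob a))) \<cdot>\<^bsub>Q\<^esub>
          ?g (KUnit R) (F.ob a) \<cdot>\<^bsub>Q\<^esub> (?gu \<otimes>\<^bsub>Q\<^esub> \<one>\<^bsub>Q\<^esub> (G.ob (F.ob a)))"
      unfolding t1 using G.R.acomp_extend[OF n1] by (simp add: assoc G.fmap_acomp del: G.fmap_ide)
    also have "\<dots> = lam Q (G.ob (F.ob a))"
      by (simp add: F.lax_left_unit G.lax_left_unit)
    finally show "fmap ?GF (lam S a) \<cdot>\<^bsub>Q\<^esub> lax2 S Q ?H (KUnit S) a \<cdot>\<^bsub>Q\<^esub>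
        (lax0 S Q ?H \<otimes>\<^bsub>Q\<^esub> \<one>\<^bsub>Q\<^esub> (FOb ?GF a))
      = lam Q (FOb ?GF a)"
      by (simp add: H)
  next
    fix a assume [simp]: "a \<in> KOb S"
    let ?f = "lax2 S R F" and ?g = "lax2 R Q G" and ?fu = "lax0 S R F" and ?gu = "lax0 R Q G"
    have t1: "\<one>\<^bsub>Q\<^esub> (G.ob (F.ob a)) \<otimes>\<^bsub>Q\<^esub> (G.ar ?fu \<cdot>\<^bsub>Q\<^esub> ?gu)
        = (G.ar (\<one>\<^bsub>R\<^esub> (F.ob a)) \<otimes>\<^bsub>Q\<^esub> G.ar ?fu) \<cdot>\<^bsub>Q\<^esub> (\<one>\<^bsub>Q\<^esub> (G.ob (F.ob a)) \<otimes>\<^bsub>Q\<^esub> ?gu)"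
      using G.R.ten_acomp[of "\<one>\<^bsub>Q\<^esub> (G.ob (F.ob a))" ?gu "\<one>\<^bsub>Q\<^esub> (G.ob (F.ob a))" "G.ar ?fu"] by simp
    have n1: "?g (F.ob a) (F.ob (KUnit S)) \<cdot>\<^bsub>Q\<^esub> (G.ar (\<one>\<^bsub>R\<^esub> (F.ob a)) \<otimes>\<^bsub>Q\<^esub> G.ar ?fu)
        = G.ar (\<one>\<^bsub>R\<^esub> (F.ob a) \<otimes>\<^bsub>R\<^esub> ?fu) \<cdot>\<^bsub>Q\<^esub> ?g (F.ob a) (KUnit R)"
      using G.lax2_natural[of "\<one>\<^bsub>R\<^esub> (F.ob a)" ?fu] by simp
    have "(G.ar (?f a (KUnit S)) \<cdot>\<^bsub>Q\<^esub> ?g (F.ob a) (F.ob (KUnit S))) \<cdot>\<^bsub>Q\<^esub>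
          (\<one>\<^bsub>Q\<^esub> (G.ob (F.ob a)) \<otimes>\<^bsub>Q\<^esub> (G.ar ?fu \<cdot>\<^bsub>Q\<^esub> ?gu)) \<cdot>\<^bsub>Q\<^esub> rho Q (G.ob (F.ob a))
        = G.ar (?f a (KUnit S) \<cdot>\<^bsub>R\<^esub> (\<one>\<^bsub>R\<^esub> (F.ob a) \<otimes>\<^bsub>R\<^esub> ?fu)) \<cdot>\<^bsub>Q\<^esub>
          ?g (F.ob a) (KUnit R) \<cdot>\<^bsub>Q\<^esub> (\<one>\<^bsub>Q\<^esub> (G.ob (F.ob a)) \<otimes>\<^bsub>Q\<^esub> ?gu) \<cdot>\<^bsub>Q\<^esub> rho Q (G.ob (F.ob a))"
      unfolding t1 using G.R.acomp_extend[OF n1] by (simp add: assoc G.fmap_acomp del: G.fmap_ide)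
    also have "\<dots> = G.ar (F.ar (rho S a))"
      by (simp add: G.lax_right_unit G.fmap_acomp[symmetric] assoc F.R.acomp_assoc F.lax_right_unit)
    finally show "lax2 S Q ?H a (KUnit S) \<cdot>\<^bsub>Q\<^esub>
        (\<one>\<^bsub>Q\<^esub> (FOb ?GF a) \<otimes>\<^bsub>Q\<^esub> lax0 S Q ?H) \<cdot>\<^bsub>Q\<^esub>
        rho Q (FOb ?GF a)
      = fmap ?GF (rho S a)"
      by (simp add: H)
  qed
qed

lemma laxfun_arr_eqI:
  assumes "lax_functor S R F" "lax_functor S R G"
    and "\<And>a. a \<in> KOb S \<Longrightarrow> FOb (LFun F) a = FOb (LFun G) a"
    and "\<And>f. f \<in> karrs S \<Longrightarrow> fmap (LFun F) f = fmap (LFun G) f"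
    and "lax0 S R F = lax0 S R G"
    and "\<And>a b. \<lbrakk>a \<in> KOb S; b \<in> KOb S\<rbrakk> \<Longrightarrow> lax2 S R F a b = lax2 S R G a b"
  shows "F = G"
proof -
  interpret F: lax_functor S R F by fact
  interpret G: lax_functor S R G by fact
  have "LFun F = LFun G"
  proof (rule functor_eqI[OF F.LFun_functor G.LFun_functor])
    fix a b f assume "a \<in> KOb S" "b \<in> KOb S" "f \<in> Hom (KCat S) a b"
    then show "FHom (LFun F) a b f = FHom (LFun G) a b f"
      using assms(4)[of "Arr a b f"] by (simp add: fmap_def)
  qed (rule assms(3))
  then show ?thesis
    using assms(5,6) F.lax_monoidal_axioms G.lax_monoidal_axioms
    by (intro laxfun_eqI) (auto simp: lax0_def lax2_def)
qed

lemma category_SkMon: "category (SkMon :: (('o, 'a) skmon, ('o, 'a) laxfun) cat)"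
proof
  let ?C = "SkMon :: (('o, 'a) skmon, ('o, 'a) laxfun) cat"
  note defs = SkMon_def
  show "Id ?C S \<in> Hom ?C S S" if "S \<in> Ob ?C" for S
    using that id_lax_lax_monoidal[of S S] by (simp add: defs same_skew_refl)
  have comp: "lax_functor S Q (comp_lax S R Q G F)" if "lax_functor S R F" "lax_functor R Q G"
    for S R Q :: "('o, 'a) skmon" and F G
    using that comp_lax_lax_monoidal[OF that] by (simp add: lax_functor_def)
  then show "Cmp ?C S R Q G F \<in> Hom ?C S Q"
    if "S \<in> Ob ?C" "R \<in> Ob ?C" "Q \<in> Ob ?C" "F \<in> Hom ?C S R" "G \<in> Hom ?C R Q" for S R Q F G
    using that by (simp add: defs lax_functor_def)
  have id: "lax_functor S S (id_lax S)" if "skew_monoidal S" for S :: "('o, 'a) skmon"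
    using that id_lax_lax_monoidal[of S S] by (simp add: lax_functor_def same_skew_refl)
  have id0: "lax0 S S (id_lax S) = \<one>\<^bsub>S\<^esub> (KUnit S)" if "skew_monoidal S" for S :: "('o, 'a) skmon"
    using that skew_monoidal.KUnit_in[OF that] by (simp add: lax0_def ide_def)
  have id2: "lax2 S S (id_lax S) a b = \<one>\<^bsub>S\<^esub> (a \<odot>\<^bsub>S\<^esub> b)"
    if "skew_monoidal S" "a \<in> KOb S" "b \<in> KOb S" for S :: "('o, 'a) skmon" and a b
    using that skew_monoidal.ten_ob_in[OF that] by (simp add: lax2_def ide_def)
  show "Cmp ?C S S R F (Id ?C S) = F" if "S \<in> Ob ?C" "R \<in> Ob ?C" "F \<in> Hom ?C S R" for S R F
  proof -
    interpret lax_functor S R F using that by (simp add: defs lax_functor_def)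
    have "comp_lax S S R F (id_lax S) = F"
      by (rule laxfun_arr_eqI[of S R], rule comp)
        (use id[of S] lax_functor_axioms S.skew_monoidal_axioms in
          \<open>auto simp: comp_lax_simps(1) comp_lax_simps(2,3)[of S S] id0 id2 fmap_id_func FOb_id_func\<close>)
    then show ?thesis by (simp add: defs)
  qed
  show "Cmp ?C S R R (Id ?C R) F = F" if "S \<in> Ob ?C" "R \<in> Ob ?C" "F \<in> Hom ?C S R" for S R F
  proof -
    interpret lax_functor S R F using that by (simp add: defs lax_functor_def)
    have "comp_lax S R R (id_lax R) F = F"
      by (rule laxfun_arr_eqI[of S R], rule comp)
        (use id[of R] lax_functor_axioms R.skew_monoidal_axioms in
          \<open>auto simp: comp_lax_simps(1) comp_lax_simps(2,3)[of S R _ R] id0 id2\<close>)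
    then show ?thesis by (simp add: defs)
  qed
  show "Cmp ?C S R T (Cmp ?C R Q T H G) F = Cmp ?C S Q T H (Cmp ?C S R Q G F)"
    if "S \<in> Ob ?C" "R \<in> Ob ?C" "Q \<in> Ob ?C" "T \<in> Ob ?C"
      "F \<in> Hom ?C S R" "G \<in> Hom ?C R Q" "H \<in> Hom ?C Q T" for S R Q T F G H
  proof -
    interpret F: lax_functor S R F using that by (simp add: defs lax_functor_def)
    interpret G: lax_functor R Q G using that by (simp add: defs lax_functor_def)
    interpret H: lax_functor Q T H using that by (simp add: defs lax_functor_def)
    note ax = F.lax_functor_axioms G.lax_functor_axioms H.lax_functor_axioms
    note ax2 = comp[OF ax(1,2)] comp[OF ax(2,3)]
    have "comp_lax S R T (comp_lax R Q T H G) F = comp_lax S Q T H (comp_lax S R Q G F)"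
      by (rule laxfun_arr_eqI[of S T], rule comp[OF ax(1) ax2(2)], rule comp[OF ax2(1) ax(3)])
        (simp_all add: ax ax2 comp_lax_simps(1) comp_lax_simps(2,3)[OF ax(1) ax2(2)]
           comp_lax_simps(2,3)[OF ax2(1) ax(3)] comp_lax_simps(2,3)[OF ax(1,2)]
           comp_lax_simps(2,3)[OF ax(2,3)] H.fmap_acomp H.R.acomp_assoc)
    then show ?thesis by (simp add: defs)
  qed
qed


section \<open>Partial multicategories\<close>

text \<open>Whether an \<open>m\<close>-ary map may be substituted into an \<open>n\<close>-ary one. If \<open>sh\<close> holds, these are
  the substitutions of a short multicategory and the actions of its unary maps; otherwise there
  is no bound, as in a multicategory. The flag makes it possible to treat both structures by
  the same proofs.\<close>

definition ok :: "bool \<Rightarrow> nat \<Rightarrow> nat \<Rightarrow> bool" where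
  "ok sh n m \<longleftrightarrow> n \<ge> 1 \<and> (sh \<longrightarrow> n = 1 \<and> m \<le> 4 \<or> m = 1 \<and> n \<le> 4 \<or> (n, m) \<in> sub_arities)"

lemma ok_simps [simp]:
  "ok sh (Suc 0) 0" "ok sh (Suc 0) (Suc 0)" "ok sh (Suc 0) (Suc (Suc 0))"
  "ok sh (Suc 0) (Suc (Suc (Suc 0)))" "ok sh (Suc 0) (Suc (Suc (Suc (Suc 0))))"
  "ok sh (Suc (Suc 0)) 0" "ok sh (Suc (Suc 0)) (Suc 0)" "ok sh (Suc (Suc 0)) (Suc (Suc 0))"
  "ok sh (Suc (Suc 0)) (Suc (Suc (Suc 0)))"
  "ok sh (Suc (Suc (Suc 0))) 0" "ok sh (Suc (Suc (Suc 0))) (Suc 0)"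
  "ok sh (Suc (Suc (Suc 0))) (Suc (Suc 0))"
  "ok sh (Suc (Suc (Suc (Suc 0)))) (Suc 0)"
  "\<not> ok sh 0 m"
  by (simp_all add: ok_def sub_arities_def)

lemma ok_arity:
  assumes "ok sh n m"
  shows "ok sh (Suc 0) n" "ok sh (Suc 0) m" "ok sh (Suc 0) (n + m - Suc 0)" "ok sh n (Suc 0)" "0 < n"
  using assms by (auto simp: ok_def sub_arities_def)

lemma ok_post: "ok sh (Suc 0) n \<Longrightarrow> 0 < n \<Longrightarrow> ok sh n (Suc 0)"
  by (auto simp: ok_def sub_arities_def)

text \<open>A multimap bundled with its inputs and its output, for the same reason as \<open>arr\<close>.\<close>

datatype ('o, 'a) mmap = MMap (src: "'o list") (tgt: 'o) (val: 'a)

definition mcomp :: "('o, 'a) comp_data \<Rightarrow> ('o, 'a) mmap \<Rightarrow> nat \<Rightarrow> ('o, 'a) mmap \<Rightarrow> ('o, 'a) mmap" where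
  "mcomp X f i g = MMap (plug (src f) i (src g)) (tgt f)
     (DComp X (src f) (tgt f) i (src g) (val f) (val g))"

definition maps :: "('o, 'a) comp_data \<Rightarrow> bool \<Rightarrow> ('o, 'a) mmap set" where
  "maps X sh = {f. set (src f) \<subseteq> Ob (DCat X) \<and> tgt f \<in> Ob (DCat X) \<and>
     val f \<in> DHom X (src f) (tgt f) \<and> ok sh (Suc 0) (length (src f))}"

definition um :: "('o, 'a) arr \<Rightarrow> ('o, 'a) mmap" where
  "um f = MMap [dm f] (cd f) (raw f)"

definition fits :: "bool \<Rightarrow> ('o, 'a) mmap \<Rightarrow> nat \<Rightarrow> ('o, 'a) mmap \<Rightarrow> bool" where
  "fits sh f i g \<longleftrightarrow> 0 < i \<and> i \<le> length (src f) \<and> src f ! (i - Suc 0) = tgt g \<and>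
     ok sh (length (src f)) (length (src g))"

lemma src_mcomp [simp]: "src (mcomp X f i g) = plug (src f) i (src g)"
  and tgt_mcomp [simp]: "tgt (mcomp X f i g) = tgt f"
  by (simp_all add: mcomp_def)

lemma src_um [simp]: "src (um f) = [dm f]" and tgt_um [simp]: "tgt (um f) = cd f"
  and val_um [simp]: "val (um f) = raw f"
  by (simp_all add: um_def)

lemma um_inject: "um f = um g \<longleftrightarrow> f = g"
  by (cases f; cases g) (auto simp: um_def)

lemma length_plug: "\<lbrakk>0 < i; i \<le> length bs\<rbrakk> \<Longrightarrow> length (plug bs i as) = length bs + length as - Suc 0"
  by (auto simp: plug_def)

lemma set_plug: "set bs \<subseteq> A \<Longrightarrow> set as \<subseteq> A \<Longrightarrow> set (plug bs i as) \<subseteq> A"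
  by (auto simp: plug_def dest: in_set_takeD in_set_dropD)

lemma map_plug: "map F (plug bs i as) = plug (map F bs) i (map F as)"
  by (simp add: plug_def take_map drop_map)

lemma plug_append [simp]: "plug (xs @ b # ys) (Suc (length xs)) as = xs @ as @ ys"
  by (simp add: plug_def)

lemma plug_Cons1 [simp]: "plug (b # ys) (Suc 0) as = as @ ys"
  by (simp add: plug_def)

lemma plug_Cons_Suc [simp]: "plug (b # ys) (Suc (Suc i)) as = b # plug ys (Suc i) as"
  by (simp add: plug_def)

lemma plug_Cons_numeral [simp]:
  "plug (b # ys) 2 as = b # plug ys (Suc 0) as" "plug (b # ys) 3 as = b # plug ys 2 as"
  by (simp_all add: plug_def)

text \<open>Units and the two associativity laws, the latter whenever all composites in them exist.
  The one exception is a pair of nullary maps in a ternary one: the parallel law of a short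
  multicategory concerns binary maps, and does not yield this case.\<close>

locale partial_multicategory =
  fixes X :: "('o, 'a) comp_data" and sh :: bool
  assumes DCat_category: "category (DCat X)"
    and DHom_unary: "\<lbrakk>a \<in> Ob (DCat X); b \<in> Ob (DCat X)\<rbrakk> \<Longrightarrow> DHom X [a] b = Hom (DCat X) a b"
    and DComp_unary: "\<lbrakk>a \<in> Ob (DCat X); b \<in> Ob (DCat X); c \<in> Ob (DCat X);
        f \<in> Hom (DCat X) a b; g \<in> Hom (DCat X) b c\<rbrakk>
      \<Longrightarrow> DComp X [b] c (Suc 0) [a] g f = Cmp (DCat X) a b c g f"
    and mcomp_in: "\<lbrakk>p \<in> maps X sh; q \<in> maps X sh; fits sh p i q\<rbrakk> \<Longrightarrow> mcomp X p i q \<in> maps X sh"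
    and mcomp_Id: "\<lbrakk>p \<in> maps X sh; 0 < i; i \<le> length (src p); src p ! (i - Suc 0) = a\<rbrakk>
      \<Longrightarrow> mcomp X p i (um (ide (DCat X) a)) = p"
    and Id_mcomp: "\<lbrakk>p \<in> maps X sh; tgt p = a\<rbrakk> \<Longrightarrow> mcomp X (um (ide (DCat X) a)) (Suc 0) p = p"
    and mcomp_nested: "\<lbrakk>p \<in> maps X sh; q \<in> maps X sh; r \<in> maps X sh; fits sh p i q; fits sh q j r;
        ok sh (length (src p) + length (src q) - Suc 0) (length (src r));
        ok sh (length (src p)) (length (src q) + length (src r) - Suc 0)\<rbrakk>
      \<Longrightarrow> mcomp X p i (mcomp X q j r) = mcomp X (mcomp X p i q) (j + i - Suc 0) r"
    and mcomp_parallel: "\<lbrakk>p \<in> maps X sh; q \<in> maps X sh; r \<in> maps X sh; i < j; fits sh p i q; fits sh p j r;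
        ok sh (length (src p) + length (src q) - Suc 0) (length (src r));
        ok sh (length (src p) + length (src r) - Suc 0) (length (src q));
        \<not> (length (src p) = 3 \<and> length (src q) = 0 \<and> length (src r) = 0)\<rbrakk>
      \<Longrightarrow> mcomp X (mcomp X p j r) i q = mcomp X (mcomp X p i q) (j + length (src q) - Suc 0) r"

context partial_multicategory
begin

abbreviation obs where "obs \<equiv> Ob (DCat X)"
abbreviation comp_at ("_ \<bullet>\<^bsub>_\<^esub> _" [70, 0, 71] 70) where "f \<bullet>\<^bsub>i\<^esub> g \<equiv> mcomp X f i g"
abbreviation comp_first ("_ \<bullet>\<^sub>1 _" [70, 71] 70) where "f \<bullet>\<^sub>1 g \<equiv> mcomp X f (Suc 0) g"
abbreviation M where "M \<equiv> maps X sh"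
abbreviation idm where "idm a \<equiv> um (ide (DCat X) a)"

sublocale category "DCat X"
  by (rule DCat_category)

lemma um_maps [simp]: "um f \<in> M \<longleftrightarrow> f \<in> arrs (DCat X)"
  by (auto simp: um_def maps_def arrs_def DHom_unary)

lemma mapsD: "f \<in> M \<Longrightarrow> tgt f \<in> obs" "f \<in> M \<Longrightarrow> set (src f) \<subseteq> obs"
  "f \<in> M \<Longrightarrow> val f \<in> DHom X (src f) (tgt f)" "f \<in> M \<Longrightarrow> ok sh (Suc 0) (length (src f))"
  by (simp_all add: maps_def)

lemma mcomp_maps [simp]: "\<lbrakk>f \<in> M; g \<in> M; 0 < i; i \<le> length (src f); src f ! (i - Suc 0) = tgt g;
     ok sh (length (src f)) (length (src g))\<rbrakk> \<Longrightarrow> f \<bullet>\<^bsub>i\<^esub> g \<in> M"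
  by (rule mcomp_in) (simp_all add: fits_def)

lemma um_acomp: "\<lbrakk>f \<in> arrs (DCat X); g \<in> arrs (DCat X); dm g = cd f\<rbrakk>
    \<Longrightarrow> um (acomp (DCat X) g f) = um g \<bullet>\<^sub>1 um f"
  using DComp_unary[of "dm f" "cd f" "cd g" "raw f" "raw g"] arrsD[of f] arrsD[of g]
  by (simp add: um_def mcomp_def acomp_def)

lemma unary_map:
  assumes "f \<in> M" "src f = [a]"
  obtains g where "g \<in> arrs (DCat X)" "dm g = a" "cd g = tgt f" "f = um g"
proof
  show "f = um (Arr a (tgt f) (val f))"
    by (rule mmap.expand) (simp add: assms um_def)
  then show "Arr a (tgt f) (val f) \<in> arrs (DCat X)" using assms(1) by (metis um_maps)
qed simp_all

text \<open>Read from left to right, the two laws bring a composite into a normal form: a word of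
  maps bracketed to the left in which lower positions are filled first.\<close>

lemmas mcomp_word = mcomp_nested[unfolded fits_def] mcomp_parallel[unfolded fits_def]

end

section \<open>Left universal binary and nullary maps\<close>

text \<open>Universality is asked for exactly those arities for which the substitution is defined,
  which in a short multicategory is the definition of left representability.\<close>

locale left_universal = partial_multicategory +
  fixes \<chi> :: "('a, 'b) classifiers"
  assumes Ten_in [simp]: "\<lbrakk>a \<in> obs; b \<in> obs\<rbrakk> \<Longrightarrow> Ten \<chi> a b \<in> obs"
    and Th_in: "\<lbrakk>a \<in> obs; b \<in> obs\<rbrakk> \<Longrightarrow> Th \<chi> a b \<in> DHom X [a, b] (Ten \<chi> a b)"
    and Unt_in [simp]: "Unt \<chi> \<in> obs"
    and Nul_in: "Nul \<chi> \<in> DHom X [] (Unt \<chi>)"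
    and Th_univ: "\<lbrakk>a \<in> obs; b \<in> obs; ok sh (Suc (length xs)) 2; set xs \<subseteq> obs; d \<in> obs\<rbrakk>
      \<Longrightarrow> bij_betw (\<lambda>f. DComp X (Ten \<chi> a b # xs) d 1 [a, b] f (Th \<chi> a b))
            (DHom X (Ten \<chi> a b # xs) d) (DHom X (a # b # xs) d)"
    and Nul_univ: "\<lbrakk>ok sh (Suc (length xs)) 0; set xs \<subseteq> obs; d \<in> obs\<rbrakk>
      \<Longrightarrow> bij_betw (\<lambda>f. DComp X (Unt \<chi> # xs) d 1 [] f (Nul \<chi>))
            (DHom X (Unt \<chi> # xs) d) (DHom X xs d)"
begin

definition th :: "'a \<Rightarrow> 'a \<Rightarrow> ('a, 'b) mmap" where
  "th a b = MMap [a, b] (Ten \<chi> a b) (Th \<chi> a b)"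

definition nu :: "('a, 'b) mmap" where
  "nu = MMap [] (Unt \<chi>) (Nul \<chi>)"

lemma th_nu_simps [simp]: "src (th a b) = [a, b]" "tgt (th a b) = Ten \<chi> a b" "val (th a b) = Th \<chi> a b"
  "src nu = []" "tgt nu = Unt \<chi>" "val nu = Nul \<chi>"
  by (simp_all add: th_def nu_def)

lemma th_maps [simp]: "\<lbrakk>a \<in> obs; b \<in> obs\<rbrakk> \<Longrightarrow> th a b \<in> M"
  and nu_maps [simp]: "nu \<in> M"
  by (simp_all add: maps_def Th_in Nul_in)

text \<open>Universality as a proof principle: maps out of a tensor product are compared after
  substituting \<open>\<theta>\<close>.\<close>

lemma th_cancel:
  assumes "f \<bullet>\<^sub>1 th a b = g \<bullet>\<^sub>1 th a b" "f \<in> M" "g \<in> M" "src f = Ten \<chi> a b # xs" "src g = Ten \<chi> a b # xs"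
    "tgt f = tgt g" "ok sh (Suc (length xs)) 2" "a \<in> obs" "b \<in> obs"
  shows "f = g"
proof -
  have "set xs \<subseteq> obs" "tgt g \<in> obs" using assms mapsD[of g] by auto
  then have "inj_on (\<lambda>f. DComp X (Ten \<chi> a b # xs) (tgt g) 1 [a, b] f (Th \<chi> a b)) (DHom X (Ten \<chi> a b # xs) (tgt g))"
    using Th_univ assms by (auto simp: bij_betw_def)
  from inj_onD[OF this, of "val f" "val g"] have "val f = val g"
    using assms mapsD(3)[of f] mapsD(3)[of g] by (simp add: mcomp_def)
  then show ?thesis using assms by (intro mmap.expand) simp
qed

lemma nu_cancel:
  assumes "f \<bullet>\<^sub>1 nu = g \<bullet>\<^sub>1 nu" "f \<in> M" "g \<in> M" "src f = Unt \<chi> # xs" "src g = Unt \<chi> # xs"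
    "tgt f = tgt g" "ok sh (Suc (length xs)) 0"
  shows "f = g"
proof -
  have "set xs \<subseteq> obs" "tgt g \<in> obs" using assms mapsD[of g] by auto
  then have "inj_on (\<lambda>f. DComp X (Unt \<chi> # xs) (tgt g) 1 [] f (Nul \<chi>)) (DHom X (Unt \<chi> # xs) (tgt g))"
    using Nul_univ assms by (auto simp: bij_betw_def)
  from inj_onD[OF this, of "val f" "val g"] have "val f = val g"
    using assms mapsD(3)[of f] mapsD(3)[of g] by (simp add: mcomp_def)
  then show ?thesis using assms by (intro mmap.expand) simp
qed

lemma ok_pred: "ok sh (Suc 0) (Suc (Suc n)) \<Longrightarrow> ok sh (Suc n) 2 \<and> ok sh (Suc 0) (Suc n)"
  by (auto simp: ok_def sub_arities_def)

lemma th_factor: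
  assumes "f \<in> M" "src f = a # b # xs"
  obtains g where "g \<in> M" "src g = Ten \<chi> a b # xs" "tgt g = tgt f" "g \<bullet>\<^sub>1 th a b = f"
proof -
  have ok: "ok sh (Suc (length xs)) 2" "ok sh (Suc 0) (Suc (length xs))"
    using mapsD(4)[OF assms(1)] assms(2) ok_pred[of "length xs"] by auto
  have *: "set xs \<subseteq> obs" "a \<in> obs" "b \<in> obs" "tgt f \<in> obs"
    using mapsD(1,2)[OF assms(1)] assms(2) by auto
  have "val f \<in> DHom X (a # b # xs) (tgt f)" using mapsD(3)[OF assms(1)] assms(2) by simp
  then obtain h where h: "h \<in> DHom X (Ten \<chi> a b # xs) (tgt f)"
      "val f = DComp X (Ten \<chi> a b # xs) (tgt f) 1 [a, b] h (Th \<chi> a b)"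
    using bij_betw_imp_surj_on[OF Th_univ[OF *(2,3) ok(1) *(1,4)]] by blast
  show ?thesis
    by (rule that[of "MMap (Ten \<chi> a b # xs) (tgt f) h"])
      (use h * ok assms in \<open>auto simp: maps_def mcomp_def intro!: mmap.expand\<close>)
qed

lemma nu_factor:
  assumes "f \<in> M" "src f = xs" "ok sh (Suc (length xs)) 0"
  obtains g where "g \<in> M" "src g = Unt \<chi> # xs" "tgt g = tgt f" "g \<bullet>\<^sub>1 nu = f"
proof -
  have ok: "ok sh (Suc 0) (Suc (length xs))" using assms(3) by (rule ok_arity)
  have *: "set xs \<subseteq> obs" "tgt f \<in> obs"
    using mapsD(1,2)[OF assms(1)] assms(2) by auto
  have "val f \<in> DHom X xs (tgt f)" using mapsD(3)[OF assms(1)] assms(2) by simp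
  then obtain h where h: "h \<in> DHom X (Unt \<chi> # xs) (tgt f)"
      "val f = DComp X (Unt \<chi> # xs) (tgt f) 1 [] h (Nul \<chi>)"
    using bij_betw_imp_surj_on[OF Nul_univ[OF assms(3) *]] by blast
  show ?thesis
    by (rule that[of "MMap (Unt \<chi> # xs) (tgt f) h"])
      (use h * ok assms in \<open>auto simp: maps_def mcomp_def intro!: mmap.expand\<close>)
qed

lemma th_factor_unary:
  assumes "f \<in> M" "src f = [a, b]"
  obtains g where "g \<in> arrs (DCat X)" "dm g = Ten \<chi> a b" "cd g = tgt f" "um g \<bullet>\<^sub>1 th a b = f"
proof -
  obtain g where g: "g \<in> M" "src g = [Ten \<chi> a b]" "tgt g = tgt f" "g \<bullet>\<^sub>1 th a b = f"
    using th_factor[OF assms] by metis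
  obtain h where "h \<in> arrs (DCat X)" "dm h = Ten \<chi> a b" "cd h = tgt g" "g = um h"
    using unary_map[OF g(1,2)] by metis
  then show ?thesis using g that by metis
qed

lemma nu_factor_unary:
  assumes "f \<in> M" "src f = []"
  obtains g where "g \<in> arrs (DCat X)" "dm g = Unt \<chi>" "cd g = tgt f" "um g \<bullet>\<^sub>1 nu = f"
proof -
  obtain g where g: "g \<in> M" "src g = [Unt \<chi>]" "tgt g = tgt f" "g \<bullet>\<^sub>1 nu = f"
    using nu_factor[OF assms] by auto
  obtain h where "h \<in> arrs (DCat X)" "dm h = Unt \<chi>" "cd h = tgt g" "g = um h"
    using unary_map[OF g(1,2)] by metis
  then show ?thesis using g that by metis
qed

lemma th_cancel_um:
  assumes "um f \<bullet>\<^sub>1 th a b = um g \<bullet>\<^sub>1 th a b" "f \<in> arrs (DCat X)" "g \<in> arrs (DCat X)" "dm f = Ten \<chi> a b" "dm g = Ten \<chi> a b"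
    "cd f = cd g" "a \<in> obs" "b \<in> obs"
  shows "f = g"
  using th_cancel[OF assms(1)] assms by (simp add: um_inject ok_def)

lemma nu_cancel_um:
  assumes "um f \<bullet>\<^sub>1 nu = um g \<bullet>\<^sub>1 nu" "f \<in> arrs (DCat X)" "g \<in> arrs (DCat X)" "dm f = Unt \<chi>" "dm g = Unt \<chi>"
    "cd f = cd g"
  shows "f = g"
  using nu_cancel[OF assms(1)] assms by (simp add: um_inject)

abbreviation S where "S \<equiv> skew_of X \<chi>"

lemma S_simps [simp]: "KCat S = DCat X" "KUnit S = Unt \<chi>"
  "\<lbrakk>a \<in> obs; b \<in> obs\<rbrakk> \<Longrightarrow> FOb (KTen S) (a, b) = Ten \<chi> a b"
  by (simp_all add: skew_of_def)

text \<open>Turns the definite descriptions in the structure of \<open>S\<close> and in lax functors into equations;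
  universality makes the described arrow unique.\<close>

lemma the_arr:
  assumes "\<And>k. k \<in> Hom (DCat X) a b \<Longrightarrow> P k \<longleftrightarrow> Q (Arr a b k)"
    and "\<exists>!f. f \<in> arrs (DCat X) \<and> dm f = a \<and> cd f = b \<and> Q f" "a \<in> obs" "b \<in> obs"
  shows "Arr a b (THE k. k \<in> Hom (DCat X) a b \<and> P k) \<in> arrs (DCat X) \<and> Q (Arr a b (THE k. k \<in> Hom (DCat X) a b \<and> P k))"
proof -
  obtain f where f: "f \<in> arrs (DCat X)" "dm f = a" "cd f = b" "Q f" using assms(2) by auto
  have "(THE k. k \<in> Hom (DCat X) a b \<and> P k) = raw f"
  proof (rule the_equality)
    show "raw f \<in> Hom (DCat X) a b \<and> P (raw f)"
      using f assms(1)[of "raw f"] by (cases f) auto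
  next
    fix k assume k: "k \<in> Hom (DCat X) a b \<and> P k"
    then have "Arr a b k = f"
      using assms f by (metis Arr_in_arrs arr.sel(1,2))
    then show "k = raw f" by auto
  qed
  moreover have "Arr a b (raw f) = f" using f by (cases f) simp
  ultimately show ?thesis using f by simp
qed

lemma ten_S:
  assumes "f \<in> arrs (DCat X)" "g \<in> arrs (DCat X)"
  shows "f \<otimes>\<^bsub>S\<^esub> g \<in> arrs (DCat X)"
    and "um (f \<otimes>\<^bsub>S\<^esub> g) \<bullet>\<^sub>1 th (dm f) (dm g) = (th (cd f) (cd g) \<bullet>\<^sub>1 um f) \<bullet>\<^bsub>2\<^esub> um g"
proof -
  note [simp] = arrsD[OF assms(1)] arrsD[OF assms(2)]
  let ?r = "(th (cd f) (cd g) \<bullet>\<^sub>1 um f) \<bullet>\<^bsub>2\<^esub> um g"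
  have r: "?r \<in> M" "src ?r = [dm f, dm g]" "tgt ?r = Ten \<chi> (cd f) (cd g)"
    using assms by simp_all
  let ?P = "\<lambda>h. DComp X [Ten \<chi> (dm f) (dm g)] (Ten \<chi> (cd f) (cd g)) 1 [dm f, dm g] h (Th \<chi> (dm f) (dm g))
        = DComp X [dm f, cd g] (Ten \<chi> (cd f) (cd g)) 2 [dm g]
            (DComp X [cd f, cd g] (Ten \<chi> (cd f) (cd g)) 1 [dm f] (Th \<chi> (cd f) (cd g)) (raw f)) (raw g)"
  have eq: "f \<otimes>\<^bsub>S\<^esub> g = Arr (Ten \<chi> (dm f) (dm g)) (Ten \<chi> (cd f) (cd g))
      (THE h. h \<in> Hom (DCat X) (Ten \<chi> (dm f) (dm g)) (Ten \<chi> (cd f) (cd g)) \<and> ?P h)"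
    using assms by (simp add: ten_def skew_of_def tensor_ar_def)
  have "f \<otimes>\<^bsub>S\<^esub> g \<in> arrs (DCat X) \<and> um (f \<otimes>\<^bsub>S\<^esub> g) \<bullet>\<^sub>1 th (dm f) (dm g) = ?r"
    unfolding eq
  proof (rule the_arr)
    show "?P k \<longleftrightarrow> um (Arr (Ten \<chi> (dm f) (dm g)) (Ten \<chi> (cd f) (cd g)) k) \<bullet>\<^sub>1 th (dm f) (dm g) = ?r" for k
      by (simp add: mcomp_def)
    obtain h where h: "h \<in> arrs (DCat X)" "dm h = Ten \<chi> (dm f) (dm g)" "cd h = tgt ?r"
        "um h \<bullet>\<^sub>1 th (dm f) (dm g) = ?r"
      using th_factor_unary[OF r(1,2)] by metis
    then show "\<exists>!h. h \<in> arrs (DCat X) \<and> dm h = Ten \<chi> (dm f) (dm g) \<and> cd h = Ten \<chi> (cd f) (cd g) \<and>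
        um h \<bullet>\<^sub>1 th (dm f) (dm g) = ?r"
    proof (intro ex1I[of _ h] conjI)
      fix k assume "k \<in> arrs (DCat X) \<and> dm k = Ten \<chi> (dm f) (dm g) \<and> cd k = Ten \<chi> (cd f) (cd g) \<and>
        um k \<bullet>\<^sub>1 th (dm f) (dm g) = ?r"
      then show "k = h"
        using h by (intro th_cancel_um[of k "dm f" "dm g" h]) (auto simp: r)
    qed (use r in auto)
  qed simp_all
  then show "f \<otimes>\<^bsub>S\<^esub> g \<in> arrs (DCat X)"
    and "um (f \<otimes>\<^bsub>S\<^esub> g) \<bullet>\<^sub>1 th (dm f) (dm g) = ?r" by auto
qed

lemma asc_S:
  assumes [simp]: "a \<in> obs" "b \<in> obs" "c \<in> obs"
  shows "asc S a b c \<in> arrs (DCat X)"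
    and "(um (asc S a b c) \<bullet>\<^sub>1 th (Ten \<chi> a b) c) \<bullet>\<^sub>1 th a b = th a (Ten \<chi> b c) \<bullet>\<^bsub>2\<^esub> th b c"
proof -
  let ?r = "th a (Ten \<chi> b c) \<bullet>\<^bsub>2\<^esub> th b c"
  let ?l = "Ten \<chi> (Ten \<chi> a b) c" and ?m = "Ten \<chi> a (Ten \<chi> b c)"
  let ?P = "\<lambda>h. DComp X [Ten \<chi> a b, c] ?m 1 [a, b] (DComp X [?l] ?m 1 [Ten \<chi> a b, c] h (Th \<chi> (Ten \<chi> a b) c)) (Th \<chi> a b)
        = DComp X [a, Ten \<chi> b c] ?m 2 [b, c] (Th \<chi> a (Ten \<chi> b c)) (Th \<chi> b c)"
  have eq: "asc S a b c = Arr ?l ?m (THE h. h \<in> Hom (DCat X) ?l ?m \<and> ?P h)"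
    by (simp add: asc_def skew_of_def associator_def Let_def)
  have "asc S a b c \<in> arrs (DCat X) \<and> (um (asc S a b c) \<bullet>\<^sub>1 th (Ten \<chi> a b) c) \<bullet>\<^sub>1 th a b = ?r"
    unfolding eq
  proof (rule the_arr)
    show "?P k \<longleftrightarrow> (um (Arr ?l ?m k) \<bullet>\<^sub>1 th (Ten \<chi> a b) c) \<bullet>\<^sub>1 th a b = ?r" for k
      by (simp add: mcomp_def)
    obtain g where g: "g \<in> M" "src g = [Ten \<chi> a b, c]" "tgt g = ?m" "g \<bullet>\<^sub>1 th a b = ?r"
      using th_factor[of ?r a b "[c]"] by auto
    obtain h where h: "h \<in> arrs (DCat X)" "dm h = ?l" "cd h = tgt g"
        "um h \<bullet>\<^sub>1 th (Ten \<chi> a b) c = g"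
      using th_factor_unary[OF g(1,2)] by metis
    show "\<exists>!h. h \<in> arrs (DCat X) \<and> dm h = ?l \<and> cd h = ?m \<and> (um h \<bullet>\<^sub>1 th (Ten \<chi> a b) c) \<bullet>\<^sub>1 th a b = ?r"
    proof (intro ex1I[of _ h] conjI)
      fix k assume k: "k \<in> arrs (DCat X) \<and> dm k = ?l \<and> cd k = ?m \<and> (um k \<bullet>\<^sub>1 th (Ten \<chi> a b) c) \<bullet>\<^sub>1 th a b = ?r"
      have "um k \<bullet>\<^sub>1 th (Ten \<chi> a b) c = g"
        by (rule th_cancel[of _ a b _ "[c]"]) (use k g in \<open>auto simp: ok_def sub_arities_def\<close>)
      then show "k = h"
        using k h g by (intro th_cancel_um[of k "Ten \<chi> a b" c h]) auto
    qed (use h g in auto)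
  qed simp_all
  then show "asc S a b c \<in> arrs (DCat X)"
    and "(um (asc S a b c) \<bullet>\<^sub>1 th (Ten \<chi> a b) c) \<bullet>\<^sub>1 th a b = ?r" by auto
qed

lemma lam_S:
  assumes [simp]: "a \<in> obs"
  shows "lam S a \<in> arrs (DCat X)"
    and "(um (lam S a) \<bullet>\<^sub>1 th (Unt \<chi>) a) \<bullet>\<^sub>1 nu = idm a"
proof -
  let ?l = "Ten \<chi> (Unt \<chi>) a"
  let ?P = "\<lambda>h. DComp X [Unt \<chi>, a] a 1 [] (DComp X [?l] a 1 [Unt \<chi>, a] h (Th \<chi> (Unt \<chi>) a)) (Nul \<chi>) = Id (DCat X) a"
  have eq: "lam S a = Arr ?l a (THE h. h \<in> Hom (DCat X) ?l a \<and> ?P h)"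
    by (simp add: lam_def skew_of_def left_unitor_def Let_def)
  have "lam S a \<in> arrs (DCat X) \<and> (um (lam S a) \<bullet>\<^sub>1 th (Unt \<chi>) a) \<bullet>\<^sub>1 nu = idm a"
    unfolding eq
  proof (rule the_arr)
    show "?P k \<longleftrightarrow> (um (Arr ?l a k) \<bullet>\<^sub>1 th (Unt \<chi>) a) \<bullet>\<^sub>1 nu = idm a" for k
      by (simp add: mcomp_def um_def ide_def)
    obtain g where g: "g \<in> M" "src g = [Unt \<chi>, a]" "tgt g = a" "g \<bullet>\<^sub>1 nu = idm a"
      using nu_factor[of "idm a" "[a]"] by auto
    obtain h where h: "h \<in> arrs (DCat X)" "dm h = ?l" "cd h = tgt g"
        "um h \<bullet>\<^sub>1 th (Unt \<chi>) a = g"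
      using th_factor_unary[OF g(1,2)] by metis
    show "\<exists>!h. h \<in> arrs (DCat X) \<and> dm h = ?l \<and> cd h = a \<and> (um h \<bullet>\<^sub>1 th (Unt \<chi>) a) \<bullet>\<^sub>1 nu = idm a"
    proof (intro ex1I[of _ h] conjI)
      fix k assume k: "k \<in> arrs (DCat X) \<and> dm k = ?l \<and> cd k = a \<and> (um k \<bullet>\<^sub>1 th (Unt \<chi>) a) \<bullet>\<^sub>1 nu = idm a"
      have "um k \<bullet>\<^sub>1 th (Unt \<chi>) a = g"
        by (rule nu_cancel[of _ _ "[a]"]) (use k g in auto)
      then show "k = h"
        using k h g by (intro th_cancel_um[of k "Unt \<chi>" a h]) auto
    qed (use h g in auto)
  qed simp_all
  then show "lam S a \<in> arrs (DCat X)"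
    and "(um (lam S a) \<bullet>\<^sub>1 th (Unt \<chi>) a) \<bullet>\<^sub>1 nu = idm a" by auto
qed

lemma rho_S:
  assumes [simp]: "a \<in> obs"
  shows "rho S a \<in> arrs (DCat X)" and "um (rho S a) = th a (Unt \<chi>) \<bullet>\<^bsub>2\<^esub> nu"
proof -
  show *: "um (rho S a) = th a (Unt \<chi>) \<bullet>\<^bsub>2\<^esub> nu"
    by (simp add: rho_def skew_of_def right_unitor_def um_def mcomp_def plug_def)
  then show "rho S a \<in> arrs (DCat X)"
    by (subst um_maps[symmetric]) simp
qed

end


section \<open>The skew monoidal category of a left universal family\<close>

context left_universal
begin

lemma ok_1_2: "ok sh (Suc 0) 2" "ok sh 2 m \<longleftrightarrow> ok sh (Suc (Suc 0)) m" "ok sh 3 m \<longleftrightarrow> ok sh (Suc (Suc (Suc 0))) m"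
    "ok sh n 2 \<longleftrightarrow> ok sh n (Suc (Suc 0))" "ok sh n 3 \<longleftrightarrow> ok sh n (Suc (Suc (Suc 0)))"
  by (simp_all add: numeral_eq_Suc ok_def sub_arities_def)

text \<open>The next rules eliminate \<open>f \<otimes> g\<close>, \<open>\<alpha>\<close> and \<open>\<lambda>\<close> from words: each is absorbed by the copies
  of \<open>\<theta>\<close> and \<open>u\<close> that follow it. The word \<open>P\<close> in front is arbitrary because words are bracketed to
  the left.\<close>

lemma ten_word:
  assumes "f \<in> arrs (DCat X)" "g \<in> arrs (DCat X)" "P \<in> M" "0 < i" "i \<le> length (src P)"
    "src P ! (i - Suc 0) = Ten \<chi> (cd f) (cd g)" "ok sh (length (src P)) 2" "a = dm f" "b = dm g"
  shows "(P \<bullet>\<^bsub>i\<^esub> um (f \<otimes>\<^bsub>S\<^esub> g)) \<bullet>\<^bsub>i\<^esub> th a b = ((P \<bullet>\<^bsub>i\<^esub> th (cd f) (cd g)) \<bullet>\<^bsub>i\<^esub> um f) \<bullet>\<^bsub>Suc i\<^esub> um g"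
proof -
  note [simp] = arrsD[OF assms(1)] arrsD[OF assms(2)] ten_S(1)[OF assms(1,2)] ok_1_2
  have ok: "ok sh (length (src P)) (Suc (Suc 0))" "ok sh (length (src P)) (Suc 0)" "ok sh (length (src P) + 2 - Suc 0) (Suc 0)"
    using assms(7) by (simp_all add: ok_def sub_arities_def) auto
  have "(P \<bullet>\<^bsub>i\<^esub> um (f \<otimes>\<^bsub>S\<^esub> g)) \<bullet>\<^bsub>i\<^esub> th a b = P \<bullet>\<^bsub>i\<^esub> ((th (cd f) (cd g) \<bullet>\<^sub>1 um f) \<bullet>\<^bsub>2\<^esub> um g)"
    unfolding ten_S(2)[OF assms(1,2), symmetric] assms(8,9)
    by (subst mcomp_nested) (use assms ok in \<open>auto simp: fits_def\<close>)
  also have "\<dots> = (P \<bullet>\<^bsub>i\<^esub> (th (cd f) (cd g) \<bullet>\<^sub>1 um f)) \<bullet>\<^bsub>Suc i\<^esub> um g"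
    by (subst mcomp_nested) (use assms ok in \<open>auto simp: fits_def\<close>)
  also have "P \<bullet>\<^bsub>i\<^esub> (th (cd f) (cd g) \<bullet>\<^sub>1 um f) = (P \<bullet>\<^bsub>i\<^esub> th (cd f) (cd g)) \<bullet>\<^bsub>i\<^esub> um f"
    by (subst mcomp_nested) (use assms ok in \<open>auto simp: fits_def\<close>)
  finally show ?thesis .
qed

lemma asc_word:
  assumes [simp]: "a \<in> obs" "b \<in> obs" "c \<in> obs" and P: "P \<in> M" "0 < i" "i \<le> length (src P)"
    "src P ! (i - Suc 0) = Ten \<chi> a (Ten \<chi> b c)" "ok sh (length (src P)) 3"
  shows "((P \<bullet>\<^bsub>i\<^esub> um (asc S a b c)) \<bullet>\<^bsub>i\<^esub> th (Ten \<chi> a b) c) \<bullet>\<^bsub>i\<^esub> th a b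
    = (P \<bullet>\<^bsub>i\<^esub> th a (Ten \<chi> b c)) \<bullet>\<^bsub>Suc i\<^esub> th b c"
proof -
  note [simp] = asc_S(1) ok_1_2
  have ok: "ok sh (length (src P)) (Suc (Suc 0))" "ok sh (length (src P)) (Suc 0)"
     "ok sh (length (src P)) (Suc (Suc (Suc 0)))" "ok sh (length (src P) + 2 - Suc 0) (Suc (Suc 0))"
    using P(5) by (auto simp add: ok_def sub_arities_def)
  have "((P \<bullet>\<^bsub>i\<^esub> um (asc S a b c)) \<bullet>\<^bsub>i\<^esub> th (Ten \<chi> a b) c) \<bullet>\<^bsub>i\<^esub> th a b
      = (P \<bullet>\<^bsub>i\<^esub> (um (asc S a b c) \<bullet>\<^sub>1 th (Ten \<chi> a b) c)) \<bullet>\<^bsub>i\<^esub> th a b"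
    by (subst mcomp_nested) (use P ok in \<open>auto simp: fits_def\<close>)
  also have "\<dots> = P \<bullet>\<^bsub>i\<^esub> (th a (Ten \<chi> b c) \<bullet>\<^bsub>2\<^esub> th b c)"
    unfolding asc_S(2)[OF assms(1-3), symmetric]
    by (subst mcomp_nested) (use P ok in \<open>auto simp: fits_def\<close>)
  also have "\<dots> = (P \<bullet>\<^bsub>i\<^esub> th a (Ten \<chi> b c)) \<bullet>\<^bsub>Suc i\<^esub> th b c"
    by (subst mcomp_nested) (use P ok in \<open>auto simp: fits_def\<close>)
  finally show ?thesis .
qed

lemma lam_word:
  assumes [simp]: "a \<in> obs" and P: "P \<in> M" "0 < i" "i \<le> length (src P)"
    "src P ! (i - Suc 0) = a" "ok sh (length (src P)) 2" "ok sh (Suc (length (src P))) 0"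
  shows "((P \<bullet>\<^bsub>i\<^esub> um (lam S a)) \<bullet>\<^bsub>i\<^esub> th (Unt \<chi>) a) \<bullet>\<^bsub>i\<^esub> nu = P"
proof -
  note [simp] = lam_S(1) ok_1_2
  have ok: "ok sh (length (src P)) (Suc (Suc 0))" "ok sh (length (src P)) (Suc 0)"
     "ok sh (length (src P) + 2 - Suc 0) 0"
    using P(5,6) by (auto simp add: ok_def sub_arities_def)
  have "((P \<bullet>\<^bsub>i\<^esub> um (lam S a)) \<bullet>\<^bsub>i\<^esub> th (Unt \<chi>) a) \<bullet>\<^bsub>i\<^esub> nu
      = (P \<bullet>\<^bsub>i\<^esub> (um (lam S a) \<bullet>\<^sub>1 th (Unt \<chi>) a)) \<bullet>\<^bsub>i\<^esub> nu"
    by (subst mcomp_nested) (use P ok in \<open>auto simp: fits_def\<close>)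
  also have "\<dots> = P \<bullet>\<^bsub>i\<^esub> idm a"
    unfolding lam_S(2)[OF assms(1), symmetric]
    by (subst mcomp_nested) (use P ok in \<open>auto simp: fits_def\<close>)
  also have "\<dots> = P"
    using P by (simp add: mcomp_Id)
  finally show ?thesis .
qed

lemma ten_word1:
  assumes "f \<in> arrs (DCat X)" "g \<in> arrs (DCat X)" "a = dm f" "b = dm g"
  shows "um (f \<otimes>\<^bsub>S\<^esub> g) \<bullet>\<^sub>1 th a b = (th (cd f) (cd g) \<bullet>\<^sub>1 um f) \<bullet>\<^bsub>2\<^esub> um g"
  using assms ten_S(2) by simp

lemmas words = ten_word asc_word lam_word ten_word1 asc_S(2) lam_S(2) rho_S(2) mcomp_Id Id_mcomp
  mcomp_word um_acomp numeral_2_eq_2 numeral_3_eq_3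
lemmas typings = ten_S(1) asc_S(1) lam_S(1) rho_S(1) arrsD(1,2) ok_1_2

lemma skew_functor: "is_functor (prod_cat (DCat X) (DCat X)) (DCat X) (KTen S)"
proof -
  have A: "FHom (KTen S) (dm f, dm g) (cd f, cd g) (raw f, raw g) = raw (f \<otimes>\<^bsub>S\<^esub> g)" for f g
    by (simp add: ten_def)
  show ?thesis
  proof (rule is_functor.intro)
    fix x :: "'a \<times> 'a" assume "x \<in> Ob (prod_cat (DCat X) (DCat X))"
    then show "FOb (KTen S) x \<in> obs" by (cases x) simp
  next
    fix x y :: "'a \<times> 'a" and k :: "'b \<times> 'b"
    assume A: "x \<in> Ob (prod_cat (DCat X) (DCat X))" "y \<in> Ob (prod_cat (DCat X) (DCat X))"
      "k \<in> Hom (prod_cat (DCat X) (DCat X)) x y"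
    obtain a b c d f g where [simp]: "x = (a, c)" "y = (b, d)" "k = (f, g)" by (cases x; cases y; cases k)
    show "FHom (KTen S) x y k \<in> Hom (DCat X) (FOb (KTen S) x) (FOb (KTen S) y)"
      using ten_S(1)[of "Arr a b f" "Arr c d g"] A by (simp add: ten_def)
  next
    fix x :: "'a \<times> 'a" assume A: "x \<in> Ob (prod_cat (DCat X) (DCat X))"
    obtain a c where [simp]: "x = (a, c)" by (cases x)
    have ac: "a \<in> obs" "c \<in> obs" using A by simp_all
    have "ide (DCat X) a \<otimes>\<^bsub>S\<^esub> ide (DCat X) c = ide (DCat X) (Ten \<chi> a c)"
      by (rule th_cancel_um[of _ a c]) (use ac in \<open>simp_all add: words typings\<close>)
    then show "FHom (KTen S) x x (Id (prod_cat (DCat X) (DCat X)) x) = Id (DCat X) (FOb (KTen S) x)"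
      using ac by (simp add: ten_def ide_def)
  next
    fix x y z :: "'a \<times> 'a" and k l :: "'b \<times> 'b"
    assume A: "x \<in> Ob (prod_cat (DCat X) (DCat X))" "y \<in> Ob (prod_cat (DCat X) (DCat X))"
      "z \<in> Ob (prod_cat (DCat X) (DCat X))"
      "k \<in> Hom (prod_cat (DCat X) (DCat X)) x y" "l \<in> Hom (prod_cat (DCat X) (DCat X)) y z"
    obtain a b c a' b' c' f f' g g' where
      [simp]: "x = (a, a')" "y = (b, b')" "z = (c, c')" "k = (f, f')" "l = (g, g')"
      by (cases x; cases y; cases z; cases k; cases l)
    let ?f = "Arr a b f" and ?f' = "Arr a' b' f'" and ?g = "Arr b c g" and ?g' = "Arr b' c' g'"
    have fg: "?f \<in> arrs (DCat X)" "?f' \<in> arrs (DCat X)" "?g \<in> arrs (DCat X)" "?g' \<in> arrs (DCat X)" using A by simp_all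
    note [simp] = ten_S(1)[OF fg(1,2)] ten_S(1)[OF fg(3,4)]
    have ob: "a \<in> obs" "b \<in> obs" "c \<in> obs" "a' \<in> obs" "b' \<in> obs" "c' \<in> obs" using A by simp_all
    have fg': "acomp (DCat X) ?g ?f \<in> arrs (DCat X)" "acomp (DCat X) ?g' ?f' \<in> arrs (DCat X)"
      using fg by (simp_all del: Arr_in_arrs)
    have w: "um (?g \<otimes>\<^bsub>S\<^esub> ?g') \<bullet>\<^sub>1 th b b' = (th c c' \<bullet>\<^sub>1 um ?g) \<bullet>\<^bsub>2\<^esub> um ?g'"
      using ten_S(2)[OF fg(3,4)] by simp
    have "acomp (DCat X) ?g ?f \<otimes>\<^bsub>S\<^esub> acomp (DCat X) ?g' ?f' = acomp (DCat X) (?g \<otimes>\<^bsub>S\<^esub> ?g') (?f \<otimes>\<^bsub>S\<^esub> ?f')"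
    proof (rule th_cancel_um[of _ a a'])
      show "um (acomp (DCat X) ?g ?f \<otimes>\<^bsub>S\<^esub> acomp (DCat X) ?g' ?f') \<bullet>\<^sub>1 th a a' =
        um (acomp (DCat X) (?g \<otimes>\<^bsub>S\<^esub> ?g') (?f \<otimes>\<^bsub>S\<^esub> ?f')) \<bullet>\<^sub>1 th a a'"
        using fg fg' ob by (simp add: words typings w del: Arr_in_arrs)
    qed (use fg fg' ob in \<open>simp_all add: typings del: Arr_in_arrs\<close>)
    then show "FHom (KTen S) x z (Cmp (prod_cat (DCat X) (DCat X)) x y z l k)
        = Cmp (DCat X) (FOb (KTen S) x) (FOb (KTen S) y) (FOb (KTen S) z) (FHom (KTen S) y z l) (FHom (KTen S) x y k)"
      using ob by (simp add: ten_def acomp_def)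
  next
    show "KTen S = mk_func (prod_cat (DCat X) (DCat X)) (FOb (KTen S)) (FHom (KTen S))"
      by (simp add: skew_of_def mk_func_normal[symmetric])
  qed
qed

text \<open>An axiom is an equation between arrows out of an iterated tensor product. Substituting
  \<open>\<theta>\<close> and \<open>u\<close> for the factors, from the outside to the inside, loses no information and turns
  both sides into words with the same normal form.\<close>

lemma skew_monoidal_S: "skew_monoidal S"
proof (rule skew_monoidalI, unfold S_simps(1,2))
  fix f g h assume A: "f \<in> arrs (DCat X)" "g \<in> arrs (DCat X)" "h \<in> arrs (DCat X)"
  note [simp] = arrsD[OF A(1)] arrsD[OF A(2)] arrsD[OF A(3)]
  show "acomp (DCat X) (asc S (cd f) (cd g) (cd h)) ((f \<otimes>\<^bsub>S\<^esub> g) \<otimes>\<^bsub>S\<^esub> h)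
      = acomp (DCat X) (f \<otimes>\<^bsub>S\<^esub> (g \<otimes>\<^bsub>S\<^esub> h)) (asc S (dm f) (dm g) (dm h))" (is "?l = ?r")
  proof (rule th_cancel_um[of _ "Ten \<chi> (dm f) (dm g)" "dm h"])
    show "um ?l \<bullet>\<^sub>1 th (Ten \<chi> (dm f) (dm g)) (dm h) = um ?r \<bullet>\<^sub>1 th (Ten \<chi> (dm f) (dm g)) (dm h)" (is "?l' = ?r'")
    proof (rule th_cancel[of _ "dm f" "dm g" _ "[dm h]"])
      show "?l' \<bullet>\<^sub>1 th (dm f) (dm g) = ?r' \<bullet>\<^sub>1 th (dm f) (dm g)"
        using A by (simp add: words typings)
    qed (use A in \<open>simp_all add: typings\<close>)
  qed (use A in \<open>simp_all add: typings\<close>)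
next
  fix a b c d assume [simp]: "a \<in> obs" "b \<in> obs" "c \<in> obs" "d \<in> obs"
  show "acomp (DCat X) (asc S a b (c \<odot>\<^bsub>S\<^esub> d)) (asc S (a \<odot>\<^bsub>S\<^esub> b) c d) =
        acomp (DCat X) (ide (DCat X) a \<otimes>\<^bsub>S\<^esub> asc S b c d)
          (acomp (DCat X) (asc S a (b \<odot>\<^bsub>S\<^esub> c) d) (asc S a b c \<otimes>\<^bsub>S\<^esub> ide (DCat X) d))" (is "?l = ?r")
  proof (rule th_cancel_um[of _ "Ten \<chi> (Ten \<chi> a b) c" d])
    show "um ?l \<bullet>\<^sub>1 th (Ten \<chi> (Ten \<chi> a b) c) d = um ?r \<bullet>\<^sub>1 th (Ten \<chi> (Ten \<chi> a b) c) d" (is "?l' = ?r'")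
    proof (rule th_cancel[of _ "Ten \<chi> a b" c _ "[d]"])
      show "?l' \<bullet>\<^sub>1 th (Ten \<chi> a b) c = ?r' \<bullet>\<^sub>1 th (Ten \<chi> a b) c" (is "?l'' = ?r''")
      proof (rule th_cancel[of _ a b _ "[c, d]"])
        show "?l'' \<bullet>\<^sub>1 th a b = ?r'' \<bullet>\<^sub>1 th a b"
          by (simp add: words typings)
      qed (simp_all add: typings)
    qed (simp_all add: typings)
  qed (simp_all add: typings)
next
  fix a b assume [simp]: "a \<in> obs" "b \<in> obs"
  show "acomp (DCat X) (lam S (a \<odot>\<^bsub>S\<^esub> b)) (asc S (Unt \<chi>) a b) = lam S a \<otimes>\<^bsub>S\<^esub> ide (DCat X) b" (is "?l = ?r")
  proof (rule th_cancel_um[of _ "Ten \<chi> (Unt \<chi>) a" b])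
    show "um ?l \<bullet>\<^sub>1 th (Ten \<chi> (Unt \<chi>) a) b = um ?r \<bullet>\<^sub>1 th (Ten \<chi> (Unt \<chi>) a) b" (is "?l' = ?r'")
    proof (rule th_cancel[of _ "Unt \<chi>" a _ "[b]"])
      show "?l' \<bullet>\<^sub>1 th (Unt \<chi>) a = ?r' \<bullet>\<^sub>1 th (Unt \<chi>) a" (is "?l'' = ?r''")
      proof (rule nu_cancel[of _ _ "[a, b]"])
        show "?l'' \<bullet>\<^sub>1 nu = ?r'' \<bullet>\<^sub>1 nu"
          by (simp add: words typings)
      qed (simp_all add: typings)
    qed (simp_all add: typings)
  qed (simp_all add: typings)
next
  fix a b assume [simp]: "a \<in> obs" "b \<in> obs"
  show "acomp (DCat X) (asc S a b (Unt \<chi>)) (rho S (a \<odot>\<^bsub>S\<^esub> b)) = ide (DCat X) a \<otimes>\<^bsub>S\<^esub> rho S b" (is "?l = ?r")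
  proof (rule th_cancel_um[of _ a b])
    show "um ?l \<bullet>\<^sub>1 th a b = um ?r \<bullet>\<^sub>1 th a b"
      by (simp add: words typings)
  qed (simp_all add: typings)
next
  fix a b assume [simp]: "a \<in> obs" "b \<in> obs"
  show "acomp (DCat X) (ide (DCat X) a \<otimes>\<^bsub>S\<^esub> lam S b) (acomp (DCat X) (asc S a (Unt \<chi>) b) (rho S a \<otimes>\<^bsub>S\<^esub> ide (DCat X) b))
      = ide (DCat X) (a \<odot>\<^bsub>S\<^esub> b)" (is "?l = ?r")
  proof (rule th_cancel_um[of _ a b])
    show "um ?l \<bullet>\<^sub>1 th a b = um ?r \<bullet>\<^sub>1 th a b"
      by (simp add: words typings)
  qed (simp_all add: typings)
next
  show "acomp (DCat X) (lam S (Unt \<chi>)) (rho S (Unt \<chi>)) = ide (DCat X) (Unt \<chi>)" (is "?l = ?r")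
  proof (rule nu_cancel_um)
    show "um ?l \<bullet>\<^sub>1 nu = um ?r \<bullet>\<^sub>1 nu"
      by (simp add: words typings)
  qed (simp_all add: typings)
next
  fix f assume A: "f \<in> arrs (DCat X)"
  note [simp] = arrsD[OF A(1)]
  show "acomp (DCat X) (lam S (cd f)) (ide (DCat X) (Unt \<chi>) \<otimes>\<^bsub>S\<^esub> f) = acomp (DCat X) f (lam S (dm f))" (is "?l = ?r")
  proof (rule th_cancel_um[of _ "Unt \<chi>" "dm f"])
    show "um ?l \<bullet>\<^sub>1 th (Unt \<chi>) (dm f) = um ?r \<bullet>\<^sub>1 th (Unt \<chi>) (dm f)" (is "?l'' = ?r''")
    proof (rule nu_cancel[of _ _ "[dm f]"])
      show "?l'' \<bullet>\<^sub>1 nu = ?r'' \<bullet>\<^sub>1 nu"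
        using A by (simp add: words typings)
    qed (use A in \<open>simp_all add: typings\<close>)
  qed (use A in \<open>simp_all add: typings\<close>)
next
  fix f assume A: "f \<in> arrs (DCat X)"
  note [simp] = arrsD[OF A(1)]
  show "acomp (DCat X) (rho S (cd f)) f = acomp (DCat X) (f \<otimes>\<^bsub>S\<^esub> ide (DCat X) (Unt \<chi>)) (rho S (dm f))" (is "?l = ?r")
    unfolding um_inject[symmetric]
    using A by (simp add: words typings)
qed (simp_all add: skew_functor DCat_category typings)

definition lam_inv :: "'a \<Rightarrow> ('a, 'b) arr" where
  "lam_inv a = Arr a (Ten \<chi> (Unt \<chi>) a) (val (th (Unt \<chi>) a \<bullet>\<^sub>1 nu))"

lemma um_lam_inv: "um (lam_inv a) = th (Unt \<chi>) a \<bullet>\<^sub>1 nu"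
  by (rule mmap.expand) (simp add: lam_inv_def um_def)

lemma lam_inv_ends [simp]: "dm (lam_inv a) = a" "cd (lam_inv a) = Ten \<chi> (Unt \<chi>) a"
  by (simp_all add: lam_inv_def)

lemma lam_inv_arrs: "a \<in> obs \<Longrightarrow> lam_inv a \<in> arrs (DCat X)"
  by (subst um_maps[symmetric]) (simp add: um_lam_inv)

text \<open>\<open>(\<lambda> \<circ> \<theta>) \<circ>\<^sub>1 u = 1\<close> says that \<open>\<theta> \<circ>\<^sub>1 u\<close> is a right inverse of \<open>\<lambda>\<close>. Since \<open>u\<close> is substituted into
  the first input, where it is universal, the other composite can be tested in the same way;
  for \<open>\<rho> = \<theta> \<circ>\<^sub>2 u\<close> there is no such argument.\<close>

lemma inverse_lam:
  assumes [simp]: "a \<in> obs"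
  shows "inverse_arrs (DCat X) (lam S a) (lam_inv a)"
proof -
  note [simp] = lam_inv_arrs lam_S(1)
  have "acomp (DCat X) (lam_inv a) (lam S a) = ide (DCat X) (Ten \<chi> (Unt \<chi>) a)" (is "?l = ?r")
  proof (rule th_cancel_um[of _ "Unt \<chi>" a])
    show "um ?l \<bullet>\<^sub>1 th (Unt \<chi>) a = um ?r \<bullet>\<^sub>1 th (Unt \<chi>) a" (is "?l' = ?r'")
    proof (rule nu_cancel[of _ _ "[a]"])
      show "?l' \<bullet>\<^sub>1 nu = ?r' \<bullet>\<^sub>1 nu"
        by (simp add: words typings um_lam_inv)
    qed (simp_all add: typings)
  qed (simp_all add: typings)
  moreover have "acomp (DCat X) (lam S a) (lam_inv a) = ide (DCat X) a"
    unfolding um_inject[symmetric] by (simp add: words typings um_lam_inv)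
  ultimately show ?thesis by (simp add: inverse_arrs_def)
qed

lemma left_normal_S: "left_normal S"
  unfolding left_normal_def
proof
  fix a assume "a \<in> KOb S"
  then show "iso_in (KCat S) (KUnit S \<odot>\<^bsub>S\<^esub> a) a (KLam S a)"
    using inverse_lam[of a] by (auto simp: iso_in_arrs lam_def)
qed

end


section \<open>Morphisms and lax monoidal functors\<close>

text \<open>\<open>F\<close> acts on objects and on unary maps, \<open>\<phi>\<close> on all maps.\<close>

definition act :: "('o, 'a, 'o, 'a) func \<Rightarrow> ('o list \<Rightarrow> 'o \<Rightarrow> 'a \<Rightarrow> 'a) \<Rightarrow> ('o, 'a) mmap \<Rightarrow> ('o, 'a) mmap" where
  "act F \<phi> f = MMap (map (FOb F) (src f)) (FOb F (tgt f)) (\<phi> (src f) (tgt f) (val f))"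

lemma act_ends [simp]: "src (act F \<phi> f) = map (FOb F) (src f)" "tgt (act F \<phi> f) = FOb F (tgt f)"
  by (simp_all add: act_def)

text \<open>Naturality of a morphism is preservation of the substitutions of unary maps, hence a case
  of preservation of substitution.\<close>

locale multi_morphism = X: partial_multicategory X sh + Y: partial_multicategory Y sh +
    is_functor "DCat X" "DCat Y" F
  for X Y :: "('o, 'a) comp_data" and sh :: bool and F :: "('o, 'a, 'o, 'a) func" +
  fixes \<phi> :: "'o list \<Rightarrow> 'o \<Rightarrow> 'a \<Rightarrow> 'a"
  assumes act_maps [simp]: "p \<in> maps X sh \<Longrightarrow> act F \<phi> p \<in> maps Y sh"
    and act_um: "k \<in> arrs (DCat X) \<Longrightarrow> act F \<phi> (um k) = um (fmap F k)"
    and act_mcomp: "\<lbrakk>p \<in> maps X sh; q \<in> maps X sh; fits sh p i q\<rbrakk>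
      \<Longrightarrow> act F \<phi> (mcomp X p i q) = mcomp Y (act F \<phi> p) i (act F \<phi> q)"

lemma multi_morphism_id:
  assumes "partial_multicategory X sh"
  shows "multi_morphism X X sh (id_func (DCat X)) (\<lambda>as b f. f)"
proof -
  interpret X: partial_multicategory X sh by fact
  have [simp]: "act (id_func (DCat X)) (\<lambda>as b f. f) p = p" if "p \<in> maps X sh" for p
    using X.mapsD(1,2)[OF that] by (intro mmap.expand) (auto simp: act_def map_idI subset_iff)
  interpret is_functor "DCat X" "DCat X" "id_func (DCat X)"
    by (rule id_func_is_functor) (rule X.DCat_category)
  show ?thesis
    by unfold_locales (simp_all add: X.mcomp_in)
qed

lemma multi_morphism_comp:
  assumes "multi_morphism X Y sh F \<phi>" "multi_morphism Y Z sh G \<psi>"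
  shows "multi_morphism X Z sh (comp_func (DCat X) G F)
    (\<lambda>as b f. \<psi> (map (FOb F) as) (FOb F b) (\<phi> as b f))"
proof -
  interpret F: multi_morphism X Y sh F \<phi> by fact
  interpret G: multi_morphism Y Z sh G \<psi> by fact
  have [simp]: "act (comp_func (DCat X) G F) (\<lambda>as b f. \<psi> (map (FOb F) as) (FOb F b) (\<phi> as b f)) p
      = act G \<psi> (act F \<phi> p)" if "p \<in> maps X sh" for p
    using F.X.mapsD(1,2)[OF that] by (intro mmap.expand) (auto simp: act_def subset_iff)
  have fits: "fits sh (act F \<phi> p) i (act F \<phi> q)" if "fits sh p i q" for p q i
    using that by (auto simp: fits_def)
  interpret is_functor "DCat X" "DCat Z" "comp_func (DCat X) G F"
    by (rule comp_func_is_functor[where D = "DCat Y"])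
      (auto simp: F.X.DCat_category F.is_functor_axioms G.is_functor_axioms)
  show ?thesis
    by unfold_locales (simp_all add: F.X.mcomp_in F.act_um G.act_um F.act_mcomp G.act_mcomp fits)
qed

locale universal_pair = X: left_universal X sh \<chi> + Y: left_universal Y sh \<psi>
  for X Y :: "('o, 'a) comp_data" and sh \<chi> \<psi>
begin

abbreviation compX ("_ \<circ>\<^bsub>_\<^esub> _" [70, 0, 71] 70) where "f \<circ>\<^bsub>i\<^esub> g \<equiv> mcomp X f i g"
abbreviation compY ("_ \<star>\<^bsub>_\<^esub> _" [70, 0, 71] 70) where "f \<star>\<^bsub>i\<^esub> g \<equiv> mcomp Y f i g"
abbreviation comp_firstX ("_ \<circ>\<^sub>1 _" [70, 71] 70) where "f \<circ>\<^sub>1 g \<equiv> mcomp X f (Suc 0) g"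
abbreviation comp_firstY ("_ \<star>\<^sub>1 _" [70, 71] 70) where "f \<star>\<^sub>1 g \<equiv> mcomp Y f (Suc 0) g"

end

locale universal_morphism = universal_pair X Y sh \<chi> \<psi> + multi_morphism X Y sh F \<phi>
  for X Y :: "('o, 'a) comp_data" and sh \<chi> \<psi> F \<phi>
begin

abbreviation L where "L \<equiv> lax_of X \<chi> Y \<psi> F \<phi>"
abbreviation A where "A \<equiv> act F \<phi>"

lemma LFun_L [simp]: "LFun L = F"
  by (simp add: lax_of_def)

lemma lax0_L:
  shows "lax0 X.S Y.S L \<in> arrs (DCat Y)"
    and "um (lax0 X.S Y.S L) \<star>\<^sub>1 Y.nu = A X.nu"
proof -
  let ?r = "A X.nu"
  let ?P = "\<lambda>h. DComp Y [Unt \<psi>] (FOb F (Unt \<chi>)) 1 [] h (Nul \<psi>) = \<phi> [] (Unt \<chi>) (Nul \<chi>)"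
  have eq: "lax0 X.S Y.S L = Arr (Unt \<psi>) (FOb F (Unt \<chi>)) (THE h. h \<in> Hom (DCat Y) (Unt \<psi>) (FOb F (Unt \<chi>)) \<and> ?P h)"
    by (simp add: lax0_def lax_of_def)
  have "lax0 X.S Y.S L \<in> arrs (DCat Y) \<and> um (lax0 X.S Y.S L) \<star>\<^sub>1 Y.nu = ?r"
    unfolding eq
  proof (rule Y.the_arr)
    show "?P k \<longleftrightarrow> um (Arr (Unt \<psi>) (FOb F (Unt \<chi>)) k) \<star>\<^sub>1 Y.nu = ?r" for k
      by (simp add: mcomp_def act_def)
    obtain h where h: "h \<in> arrs (DCat Y)" "dm h = Unt \<psi>" "cd h = tgt ?r"
        "um h \<star>\<^sub>1 Y.nu = ?r"
      using Y.nu_factor_unary[of ?r] by auto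
    then show "\<exists>!h. h \<in> arrs (DCat Y) \<and> dm h = Unt \<psi> \<and> cd h = FOb F (Unt \<chi>) \<and> um h \<star>\<^sub>1 Y.nu = ?r"
    proof (intro ex1I[of _ h] conjI)
      fix k assume "k \<in> arrs (DCat Y) \<and> dm k = Unt \<psi> \<and> cd k = FOb F (Unt \<chi>) \<and> um k \<star>\<^sub>1 Y.nu = ?r"
      then show "k = h"
        using h by (intro Y.nu_cancel_um[of k h]) auto
    qed auto
  qed (simp_all add: FOb_in)
  then show "lax0 X.S Y.S L \<in> arrs (DCat Y)" "um (lax0 X.S Y.S L) \<star>\<^sub>1 Y.nu = ?r" by auto
qed

lemma lax2_L:
  assumes [simp]: "a \<in> X.obs" "b \<in> X.obs"
  shows "lax2 X.S Y.S L a b \<in> arrs (DCat Y)"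
    and "um (lax2 X.S Y.S L a b) \<star>\<^sub>1 Y.th (FOb F a) (FOb F b) = A (X.th a b)"
proof -
  let ?r = "A (X.th a b)" and ?m = "Ten \<psi> (FOb F a) (FOb F b)" and ?n = "FOb F (Ten \<chi> a b)"
  let ?P = "\<lambda>h. DComp Y [?m] ?n 1 [FOb F a, FOb F b] h (Th \<psi> (FOb F a) (FOb F b)) = \<phi> [a, b] (Ten \<chi> a b) (Th \<chi> a b)"
  have eq: "lax2 X.S Y.S L a b = Arr ?m ?n (THE h. h \<in> Hom (DCat Y) ?m ?n \<and> ?P h)"
    by (simp add: lax2_def lax_of_def FOb_in)
  have "lax2 X.S Y.S L a b \<in> arrs (DCat Y) \<and> um (lax2 X.S Y.S L a b) \<star>\<^sub>1 Y.th (FOb F a) (FOb F b) = ?r"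
    unfolding eq
  proof (rule Y.the_arr)
    show "?P k \<longleftrightarrow> um (Arr ?m ?n k) \<star>\<^sub>1 Y.th (FOb F a) (FOb F b) = ?r" for k
      by (simp add: mcomp_def act_def)
    obtain h where h: "h \<in> arrs (DCat Y)" "dm h = ?m" "cd h = tgt ?r"
        "um h \<star>\<^sub>1 Y.th (FOb F a) (FOb F b) = ?r"
      using Y.th_factor_unary[of ?r "FOb F a" "FOb F b"] by auto
    then show "\<exists>!h. h \<in> arrs (DCat Y) \<and> dm h = ?m \<and> cd h = ?n \<and> um h \<star>\<^sub>1 Y.th (FOb F a) (FOb F b) = ?r"
    proof (intro ex1I[of _ h] conjI)
      fix k assume "k \<in> arrs (DCat Y) \<and> dm k = ?m \<and> cd k = ?n \<and> um k \<star>\<^sub>1 Y.th (FOb F a) (FOb F b) = ?r"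
      then show "k = h"
        using h by (intro Y.th_cancel_um[of k "FOb F a" "FOb F b" h]) (auto simp: FOb_in)
    qed auto
  qed (simp_all add: FOb_in)
  then show "lax2 X.S Y.S L a b \<in> arrs (DCat Y)"
    "um (lax2 X.S Y.S L a b) \<star>\<^sub>1 Y.th (FOb F a) (FOb F b) = ?r" by auto
qed

lemma lax2_word:
  assumes [simp]: "a \<in> X.obs" "b \<in> X.obs" and P: "P \<in> maps Y sh" "0 < i" "i \<le> length (src P)"
    "src P ! (i - Suc 0) = FOb F (Ten \<chi> a b)" "ok sh (length (src P)) 2" "c = FOb F a" "d = FOb F b"
  shows "(P \<star>\<^bsub>i\<^esub> um (lax2 X.S Y.S L a b)) \<star>\<^bsub>i\<^esub> Y.th c d = P \<star>\<^bsub>i\<^esub> A (X.th a b)"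
  unfolding lax2_L(2)[OF assms(1,2), symmetric] P(6,7)
  by (subst Y.mcomp_nested) (use P in \<open>auto simp: fits_def FOb_in lax2_L(1) Y.ok_1_2 ok_arity(4) ok_def sub_arities_def\<close>)

lemma lax0_word:
  assumes P: "P \<in> maps Y sh" "0 < i" "i \<le> length (src P)"
    "src P ! (i - Suc 0) = FOb F (Unt \<chi>)" "ok sh (length (src P)) 0"
  shows "(P \<star>\<^bsub>i\<^esub> um (lax0 X.S Y.S L)) \<star>\<^bsub>i\<^esub> Y.nu = P \<star>\<^bsub>i\<^esub> A X.nu"
  unfolding lax0_L(2)[symmetric]
  by (subst Y.mcomp_nested) (use P in \<open>auto simp: fits_def FOb_in lax0_L(1) ok_arity(4) ok_def sub_arities_def\<close>)

lemma act_structure: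
  "\<lbrakk>f \<in> arrs (DCat X); g \<in> arrs (DCat X); a = dm f; b = dm g\<rbrakk>
    \<Longrightarrow> um (fmap F (f \<otimes>\<^bsub>X.S\<^esub> g)) \<star>\<^sub>1 A (X.th a b)
      = (A (X.th (cd f) (cd g)) \<star>\<^sub>1 um (fmap F f)) \<star>\<^bsub>2\<^esub> um (fmap F g)"
  "\<lbrakk>a \<in> X.obs; b \<in> X.obs; c \<in> X.obs\<rbrakk>
    \<Longrightarrow> (um (fmap F (asc X.S a b c)) \<star>\<^sub>1 A (X.th (Ten \<chi> a b) c)) \<star>\<^sub>1 A (X.th a b)
      = A (X.th a (Ten \<chi> b c)) \<star>\<^bsub>2\<^esub> A (X.th b c)"
  "a \<in> X.obs \<Longrightarrow> (um (fmap F (lam X.S a)) \<star>\<^sub>1 A (X.th (Unt \<chi>) a)) \<star>\<^sub>1 A X.nu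
      = um (ide (DCat Y) (FOb F a))"
  "a \<in> X.obs \<Longrightarrow> um (fmap F (rho X.S a)) = A (X.th a (Unt \<chi>)) \<star>\<^bsub>2\<^esub> A X.nu"
proof -
  assume "f \<in> arrs (DCat X)" "g \<in> arrs (DCat X)" "a = dm f" "b = dm g"
  then show "um (fmap F (f \<otimes>\<^bsub>X.S\<^esub> g)) \<star>\<^sub>1 A (X.th a b)
      = (A (X.th (cd f) (cd g)) \<star>\<^sub>1 um (fmap F f)) \<star>\<^bsub>2\<^esub> um (fmap F g)"
    using arg_cong[OF X.ten_S(2)[of f g], of A]
    by (simp add: act_mcomp fits_def X.typings act_um)
next
  assume "a \<in> X.obs" "b \<in> X.obs" "c \<in> X.obs"
  then show "(um (fmap F (asc X.S a b c)) \<star>\<^sub>1 A (X.th (Ten \<chi> a b) c)) \<star>\<^sub>1 A (X.th a b)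
      = A (X.th a (Ten \<chi> b c)) \<star>\<^bsub>2\<^esub> A (X.th b c)"
    using arg_cong[OF X.asc_S(2)[of a b c], of A]
    by (simp add: act_mcomp fits_def X.typings act_um)
next
  assume "a \<in> X.obs"
  then show "(um (fmap F (lam X.S a)) \<star>\<^sub>1 A (X.th (Unt \<chi>) a)) \<star>\<^sub>1 A X.nu
      = um (ide (DCat Y) (FOb F a))"
    using arg_cong[OF X.lam_S(2)[of a], of A]
    by (simp add: act_mcomp fits_def X.typings act_um)
next
  assume "a \<in> X.obs"
  then show "um (fmap F (rho X.S a)) = A (X.th a (Unt \<chi>)) \<star>\<^bsub>2\<^esub> A X.nu"
    using arg_cong[OF X.rho_S(2)[of a], of A]
    by (simp add: act_mcomp fits_def X.typings act_um)
qed

lemmas L_words = lax2_word lax0_word lax2_L(2) lax0_L(2) act_structure Y.words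
lemmas L_typings = lax2_L(1) lax0_L(1) FOb_in X.typings Y.typings

text \<open>After substituting the universal maps of \<open>Y\<close>, the components \<open>f\<^sub>2\<close> and \<open>f\<^sub>0\<close> become the
  images of \<open>\<theta>\<close> and \<open>u\<close>. Since a morphism preserves words, the axioms of a lax functor are
  images of the equations that define \<open>\<alpha>\<close>, \<open>\<lambda>\<close> and \<open>\<rho>\<close> in \<open>X\<close>.\<close>

lemma lax_monoidal_L: "lax_monoidal X.S Y.S L"
proof (rule lax_monoidalI, unfold LFun_L X.S_simps(1,2) Y.S_simps(1,2))
  show "is_functor (DCat X) (DCat Y) F" by unfold_locales
  show "lax0 X.S Y.S L \<in> arrs (DCat Y)" by (rule lax0_L)
  show "lax2 X.S Y.S L a b \<in> arrs (DCat Y)" if "a \<in> X.obs" "b \<in> X.obs" for a b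
    using that by (rule lax2_L)
  show "Lax2 L = restrict_Lax2 X.S (Lax2 L)"
    by (simp add: lax_of_def restrict_Lax2_def fun_eq_iff)
next
  fix f g assume fg: "f \<in> arrs (DCat X)" "g \<in> arrs (DCat X)"
  note [simp] = arrsD[OF fg(1)] arrsD[OF fg(2)]
  show "acomp (DCat Y) (lax2 X.S Y.S L (cd f) (cd g)) (fmap F f \<otimes>\<^bsub>Y.S\<^esub> fmap F g)
      = acomp (DCat Y) (fmap F (f \<otimes>\<^bsub>X.S\<^esub> g)) (lax2 X.S Y.S L (dm f) (dm g))" (is "?l = ?r")
  proof (rule Y.th_cancel_um[of _ "FOb F (dm f)" "FOb F (dm g)"])
    show "um ?l \<star>\<^sub>1 Y.th (FOb F (dm f)) (FOb F (dm g)) = um ?r \<star>\<^sub>1 Y.th (FOb F (dm f)) (FOb F (dm g))"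
      using fg by (simp add: L_words L_typings)
  qed (use fg in \<open>simp_all add: L_typings\<close>)
next
  fix a b c assume [simp]: "a \<in> X.obs" "b \<in> X.obs" "c \<in> X.obs"
  let ?a = "FOb F a" and ?b = "FOb F b" and ?c = "FOb F c"
  have [simp]: "?a \<in> Y.obs" "?b \<in> Y.obs" "?c \<in> Y.obs" by (simp_all add: FOb_in)
  show "acomp (DCat Y) (fmap F (asc X.S a b c)) (acomp (DCat Y) (lax2 X.S Y.S L (a \<odot>\<^bsub>X.S\<^esub> b) c)
        (lax2 X.S Y.S L a b \<otimes>\<^bsub>Y.S\<^esub> ide (DCat Y) ?c))
      = acomp (DCat Y) (lax2 X.S Y.S L a (b \<odot>\<^bsub>X.S\<^esub> c)) (acomp (DCat Y) (ide (DCat Y) ?a \<otimes>\<^bsub>Y.S\<^esub> lax2 X.S Y.S L b c)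
        (asc Y.S ?a ?b ?c))" (is "?l = ?r")
  proof (rule Y.th_cancel_um[of _ "Ten \<psi> ?a ?b" ?c])
    show "um ?l \<star>\<^sub>1 Y.th (Ten \<psi> ?a ?b) ?c = um ?r \<star>\<^sub>1 Y.th (Ten \<psi> ?a ?b) ?c" (is "?l' = ?r'")
    proof (rule Y.th_cancel[of _ ?a ?b _ "[?c]"])
      show "?l' \<star>\<^sub>1 Y.th ?a ?b = ?r' \<star>\<^sub>1 Y.th ?a ?b"
        by (simp add: L_words L_typings)
    qed (simp_all add: L_typings)
  qed (simp_all add: L_typings)
next
  fix a assume [simp]: "a \<in> X.obs"
  let ?a = "FOb F a"
  have [simp]: "?a \<in> Y.obs" by (simp_all add: FOb_in)
  show "acomp (DCat Y) (fmap F (lam X.S a)) (acomp (DCat Y) (lax2 X.S Y.S L (Unt \<chi>) a)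
        (lax0 X.S Y.S L \<otimes>\<^bsub>Y.S\<^esub> ide (DCat Y) ?a)) = lam Y.S ?a" (is "?l = ?r")
  proof (rule Y.th_cancel_um[of _ "Unt \<psi>" ?a])
    show "um ?l \<star>\<^sub>1 Y.th (Unt \<psi>) ?a = um ?r \<star>\<^sub>1 Y.th (Unt \<psi>) ?a" (is "?l' = ?r'")
    proof (rule Y.nu_cancel[of _ _ "[?a]"])
      show "?l' \<star>\<^sub>1 Y.nu = ?r' \<star>\<^sub>1 Y.nu"
        by (simp add: L_words L_typings)
    qed (simp_all add: L_typings)
  qed (simp_all add: L_typings)
next
  fix a assume [simp]: "a \<in> X.obs"
  let ?a = "FOb F a"
  have [simp]: "?a \<in> Y.obs" by (simp_all add: FOb_in)
  show "acomp (DCat Y) (lax2 X.S Y.S L a (Unt \<chi>)) (acomp (DCat Y) (ide (DCat Y) ?a \<otimes>\<^bsub>Y.S\<^esub> lax0 X.S Y.S L)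
        (rho Y.S ?a)) = fmap F (rho X.S a)" (is "?l = ?r")
    unfolding um_inject[symmetric] by (simp add: L_words L_typings)
qed

lemma lax_functor_L: "lax_functor X.S Y.S L"
  by (intro lax_functor.intro X.skew_monoidal_S Y.skew_monoidal_S lax_monoidal_L)

lemma L_unique:
  assumes "lax_functor X.S Y.S K" "LFun K = F"
    "um (lax0 X.S Y.S K) \<star>\<^sub>1 Y.nu = A X.nu"
    "\<And>a b. \<lbrakk>a \<in> X.obs; b \<in> X.obs\<rbrakk>
      \<Longrightarrow> um (lax2 X.S Y.S K a b) \<star>\<^sub>1 Y.th (FOb F a) (FOb F b) = A (X.th a b)"
  shows "K = L"
proof -
  interpret K: lax_functor X.S Y.S K by fact
  have "lax0 X.S Y.S K = lax0 X.S Y.S L"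
    by (rule Y.nu_cancel_um)
      (use assms(2,3) lax0_L K.lax0_arrs in simp_all)
  moreover have "lax2 X.S Y.S K a b = lax2 X.S Y.S L a b" if "a \<in> X.obs" "b \<in> X.obs" for a b
    by (rule Y.th_cancel_um[of _ "FOb F a" "FOb F b"])
      (use that assms(2,4) lax2_L K.lax2_arrs in \<open>simp_all add: FOb_in\<close>)
  ultimately show ?thesis
    by (intro laxfun_arr_eqI[OF K.lax_functor_axioms lax_functor_L]) (simp_all add: assms(2))
qed

end

lemma lax_of_id:
  assumes "left_universal X sh \<chi>"
  shows "lax_of X \<chi> X \<chi> (id_func (DCat X)) (\<lambda>as b f. f) = id_lax (skew_of X \<chi>)"
proof -
  interpret X: left_universal X sh \<chi> by fact
  interpret multi_morphism X X sh "id_func (DCat X)" "\<lambda>as b f. f"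
    by (rule multi_morphism_id) unfold_locales
  interpret universal_morphism X X sh \<chi> \<chi> "id_func (DCat X)" "\<lambda>as b f. f"
    by unfold_locales
  have lf: "lax_functor X.S X.S (id_lax X.S)"
    by (intro lax_functor.intro X.skew_monoidal_S id_lax_lax_monoidal same_skew_refl)
  have A: "A p = p" if "p \<in> X.M" for p
    using X.mapsD(1,2)[OF that] by (intro mmap.expand) (auto simp: act_def map_idI subset_iff)
  have "id_lax X.S = L"
  proof (rule L_unique[OF lf])
    have "lax0 X.S X.S (id_lax X.S) = ide (DCat X) (Unt \<chi>)"
      by (simp add: lax0_def ide_def)
    then show "mcomp X (um (lax0 X.S X.S (id_lax X.S))) (Suc 0) X.nu = A X.nu"
      by (simp add: A X.Id_mcomp)
    fix a b assume ab: "a \<in> X.obs" "b \<in> X.obs"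
    then have "lax2 X.S X.S (id_lax X.S) a b = ide (DCat X) (Ten \<chi> a b)"
      by (simp add: lax2_def ide_def)
    then show "mcomp X (um (lax2 X.S X.S (id_lax X.S) a b)) (Suc 0) (X.th (FOb (id_func (DCat X)) a) (FOb (id_func (DCat X)) b)) = A (X.th a b)"
      using ab by (simp add: A X.Id_mcomp)
  qed simp
  then show ?thesis by simp
qed

lemma lax_of_comp:
  assumes "left_universal X sh \<chi>" "left_universal Y sh \<psi>" "left_universal Z sh \<omega>"
    and "multi_morphism X Y sh F \<phi>" "multi_morphism Y Z sh G \<gamma>"
  shows "lax_of X \<chi> Z \<omega> (comp_func (DCat X) G F) (\<lambda>as b f. \<gamma> (map (FOb F) as) (FOb F b) (\<phi> as b f))
    = comp_lax (skew_of X \<chi>) (skew_of Y \<psi>) (skew_of Z \<omega>) (lax_of Y \<psi> Z \<omega> G \<gamma>) (lax_of X \<chi> Y \<psi> F \<phi>)"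
proof -
  interpret X: left_universal X sh \<chi> by fact
  interpret Y: left_universal Y sh \<psi> by fact
  interpret Z: left_universal Z sh \<omega> by fact
  interpret F: universal_morphism X Y sh \<chi> \<psi> F \<phi>
    by (intro universal_morphism.intro universal_pair.intro assms)
  interpret G: universal_morphism Y Z sh \<psi> \<omega> G \<gamma>
    by (intro universal_morphism.intro universal_pair.intro assms)
  interpret H: universal_morphism X Z sh \<chi> \<omega> "comp_func (DCat X) G F" "\<lambda>as b f. \<gamma> (map (FOb F) as) (FOb F b) (\<phi> as b f)"
    by (intro universal_morphism.intro universal_pair.intro assms multi_morphism_comp[where Y = Y])
  have A: "H.A p = G.A (F.A p)" if "p \<in> X.M" for p
    using X.mapsD(1,2)[OF that] by (intro mmap.expand) (auto simp: act_def subset_iff)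
  note cl = comp_lax_simps(2,3)[OF F.lax_functor_L G.lax_functor_L]
  have lf: "lax_functor X.S Z.S (comp_lax X.S Y.S Z.S G.L F.L)"
    by (intro lax_functor.intro X.skew_monoidal_S Z.skew_monoidal_S comp_lax_lax_monoidal
        F.lax_functor_L G.lax_functor_L)
  have "comp_lax X.S Y.S Z.S G.L F.L = H.L"
  proof (rule H.L_unique[OF lf])
    show "LFun (comp_lax X.S Y.S Z.S G.L F.L) = comp_func (DCat X) G F"
      by (simp add: comp_lax_simps(1))
    have "mcomp Z (um (lax0 X.S Z.S (comp_lax X.S Y.S Z.S G.L F.L))) (Suc 0) Z.nu
      = mcomp Z (um (fmap G (lax0 X.S Y.S F.L))) (Suc 0) (G.A Y.nu)"
      using F.lax0_L(1) G.lax0_L(1)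
      by (simp add: cl G.L_words F.L_typings G.L_typings)
    also have "\<dots> = G.A (mcomp Y (um (lax0 X.S Y.S F.L)) (Suc 0) Y.nu)"
      using F.lax0_L(1) by (simp add: G.act_mcomp fits_def G.act_um)
    finally show "mcomp Z (um (lax0 X.S Z.S (comp_lax X.S Y.S Z.S G.L F.L))) (Suc 0) Z.nu = H.A X.nu"
      by (simp add: F.lax0_L(2) A)
  next
    fix a b assume [simp]: "a \<in> X.obs" "b \<in> X.obs"
    have [simp]: "FOb F a \<in> Y.obs" "FOb F b \<in> Y.obs" by (simp_all add: F.FOb_in)
    have "mcomp Z (um (lax2 X.S Z.S (comp_lax X.S Y.S Z.S G.L F.L) a b)) (Suc 0) (Z.th (FOb G (FOb F a)) (FOb G (FOb F b)))
      = mcomp Z (um (fmap G (lax2 X.S Y.S F.L a b))) (Suc 0) (G.A (Y.th (FOb F a) (FOb F b)))"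
      using F.lax2_L(1)[of a b] G.lax2_L(1)[of "FOb F a" "FOb F b"]
      by (simp add: cl G.L_words F.L_typings G.L_typings)
    also have "\<dots> = G.A (mcomp Y (um (lax2 X.S Y.S F.L a b)) (Suc 0) (Y.th (FOb F a) (FOb F b)))"
      using F.lax2_L(1)[of a b] by (simp add: G.act_mcomp fits_def G.act_um)
    finally show "mcomp Z (um (lax2 X.S Z.S (comp_lax X.S Y.S Z.S G.L F.L) a b)) (Suc 0)
        (Z.th (FOb (comp_func (DCat X) G F) a) (FOb (comp_func (DCat X) G F) b)) = H.A (X.th a b)"
      by (simp add: F.lax2_L(2) A)
  qed
  then show ?thesis by simp
qed


section \<open>Morphisms are determined by their lax monoidal functors\<close>

text \<open>By left universality every map is built from unary maps, \<open>\<theta>\<close> and \<open>u\<close> by substitutions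
  into the first input alone: a nullary map is \<open>q \<circ> u\<close>, and a map with two or more inputs is
  \<open>g \<circ>\<^sub>1 \<theta>\<close> for a map \<open>g\<close> with one input less.\<close>

lemma (in left_universal) map_induct [consumes 1, case_names nullary unary th]:
  assumes "p \<in> M"
    and nullary: "\<And>q. \<lbrakk>q \<in> arrs (DCat X); dm q = Unt \<chi>\<rbrakk> \<Longrightarrow> P (um q \<bullet>\<^sub>1 nu)"
    and unary: "\<And>q. q \<in> arrs (DCat X) \<Longrightarrow> P (um q)"
    and th: "\<And>g a b xs. \<lbrakk>g \<in> M; src g = Ten \<chi> a b # xs; a \<in> obs; b \<in> obs;
        ok sh (Suc (length xs)) (Suc (Suc 0)); P g\<rbrakk> \<Longrightarrow> P (g \<bullet>\<^sub>1 th a b)"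
  shows "P p"
  using assms(1)
proof (induction "length (src p)" arbitrary: p rule: less_induct)
  case less
  consider "src p = []" | a where "src p = [a]" | a b xs where "src p = a # b # xs"
    by (metis list.exhaust)
  then show ?case
  proof cases
    case 1
    with less.prems nullary show ?thesis by (metis nu_factor_unary)
  next
    case 2
    with less.prems unary show ?thesis by (metis unary_map)
  next
    case 3
    obtain g where g: "g \<in> M" "src g = Ten \<chi> a b # xs" "tgt g = tgt p" "g \<bullet>\<^sub>1 th a b = p"
      using th_factor[OF less.prems 3] by metis
    have "P g" using less.hyps[of g] g 3 by simp
    moreover have "ok sh (Suc (length xs)) (Suc (Suc 0))"
      using mapsD(4)[OF less.prems] 3 ok_pred[of "length xs"] by (simp add: ok_1_2)
    moreover have "a \<in> obs" "b \<in> obs" using mapsD(2)[OF less.prems] 3 by simp_all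
    ultimately show ?thesis using th[of g a b xs] g by simp
  qed
qed

text \<open>The lax functor records the values of the morphism on unary maps, and its components
  record those on \<open>\<theta>\<close> and \<open>u\<close>.\<close>

lemma (in universal_pair) morphism_determined:
  assumes "multi_morphism X Y sh F \<phi>" "multi_morphism X Y sh F \<phi>'"
    and eq: "lax_of X \<chi> Y \<psi> F \<phi> = lax_of X \<chi> Y \<psi> F \<phi>'"
    and "p \<in> maps X sh"
  shows "act F \<phi> p = act F \<phi>' p"
proof -
  interpret A: universal_morphism X Y sh \<chi> \<psi> F \<phi>
    by (intro universal_morphism.intro universal_pair_axioms assms)
  interpret B: universal_morphism X Y sh \<chi> \<psi> F \<phi>'
    by (intro universal_morphism.intro universal_pair_axioms assms)
  note simps = fits_def A.act_mcomp B.act_mcomp A.act_um B.act_um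
  show ?thesis
    using assms(4)
  proof (induction rule: X.map_induct)
    case (nullary q)
    have "A.A X.nu = B.A X.nu"
      using A.lax0_L(2) B.lax0_L(2) eq by simp
    then show ?case using nullary by (simp add: simps)
  next
    case (th g a b xs)
    have "A.A (X.th a b) = B.A (X.th a b)"
      using A.lax2_L(2)[of a b] B.lax2_L(2)[of a b] eq th by simp
    then show ?case using th by (simp add: simps)
  qed (simp add: simps)
qed

section \<open>Every lax monoidal functor comes from a morphism\<close>

text \<open>A lax functor \<open>L\<close> prescribes the values \<open>t\<close> on \<open>\<theta>\<close> and \<open>v\<close> on \<open>u\<close>, and hence by
  induction a value \<open>E f\<close> on every map \<open>f\<close>. What has to be shown is that \<open>E\<close> preserves
  substitution.\<close>

locale lax_lift = universal_pair X Y sh \<chi> \<psi> + lax_functor "skew_of X \<chi>" "skew_of Y \<psi>" L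
  for X Y :: "('o, 'a) comp_data" and sh \<chi> \<psi> L
begin

abbreviation l2 where "l2 \<equiv> lax2 X.S Y.S L"
abbreviation l0 where "l0 \<equiv> lax0 X.S Y.S L"

definition t :: "'o \<Rightarrow> 'o \<Rightarrow> ('o, 'a) mmap" where
  "t a b = um (l2 a b) \<star>\<^sub>1 Y.th (ob a) (ob b)"

definition v :: "('o, 'a) mmap" where
  "v = um l0 \<star>\<^sub>1 Y.nu"

lemma fn: "is_functor (DCat X) (DCat Y) (LFun L)"
  using LFun_functor by simp

lemma ob_Y [simp]: "a \<in> X.obs \<Longrightarrow> ob a \<in> Y.obs"
  using ob_in by simp

lemma ar_Y [simp]: "f \<in> arrs (DCat X) \<Longrightarrow> ar f \<in> arrs (DCat Y)"
  using fmap_arrs by simp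

lemma ar_acomp [simp]: "\<lbrakk>f \<in> arrs (DCat X); g \<in> arrs (DCat X); dm g = cd f\<rbrakk>
    \<Longrightarrow> ar (acomp (DCat X) g f) = acomp (DCat Y) (ar g) (ar f)"
  using fmap_acomp by simp

lemma ar_ide [simp]: "a \<in> X.obs \<Longrightarrow> ar (ide (DCat X) a) = ide (DCat Y) (ob a)"
  using fmap_ide by simp

lemma l_arrs [simp]: "l0 \<in> arrs (DCat Y)" "\<lbrakk>a \<in> X.obs; b \<in> X.obs\<rbrakk> \<Longrightarrow> l2 a b \<in> arrs (DCat Y)"
  using lax0_arrs lax2_arrs by simp_all

lemma t_simps [simp]:
  "\<lbrakk>a \<in> X.obs; b \<in> X.obs\<rbrakk> \<Longrightarrow> src (t a b) = [ob a, ob b]"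
  "\<lbrakk>a \<in> X.obs; b \<in> X.obs\<rbrakk> \<Longrightarrow> tgt (t a b) = ob (Ten \<chi> a b)"
  "\<lbrakk>a \<in> X.obs; b \<in> X.obs\<rbrakk> \<Longrightarrow> t a b \<in> maps Y sh"
  "src v = []" "tgt v = ob (Unt \<chi>)" "v \<in> maps Y sh"
  by (simp_all add: t_def v_def)

text \<open>Transposed along the universal maps of \<open>Y\<close>, the axioms of a lax functor say that
  \<open>t\<close> and \<open>v\<close> satisfy the equations that hold between \<open>\<theta>\<close> and \<open>u\<close>.\<close>

lemma t_natural:
  assumes "f \<in> arrs (DCat X)" "g \<in> arrs (DCat X)" "a = dm f" "b = dm g"
  shows "um (ar (f \<otimes>\<^bsub>X.S\<^esub> g)) \<star>\<^sub>1 t a b = (t (cd f) (cd g) \<star>\<^sub>1 um (ar f)) \<star>\<^bsub>2\<^esub> um (ar g)"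
proof -
  note [simp] = arrsD[OF assms(1)] arrsD[OF assms(2)]
  have "acomp (DCat Y) (l2 (cd f) (cd g)) (ar f \<otimes>\<^bsub>Y.S\<^esub> ar g)
      = acomp (DCat Y) (ar (f \<otimes>\<^bsub>X.S\<^esub> g)) (l2 (dm f) (dm g))"
    using lax2_natural[of f g] assms by simp
  from arg_cong[OF this, of "\<lambda>x. um x \<star>\<^sub>1 Y.th (ob (dm f)) (ob (dm g))"]
  show ?thesis
    using assms by (simp add: t_def Y.words Y.typings X.ten_S(1))
qed

lemma t_assoc:
  assumes [simp]: "a \<in> X.obs" "b \<in> X.obs" "c \<in> X.obs"
  shows "(um (ar (asc X.S a b c)) \<star>\<^sub>1 t (Ten \<chi> a b) c) \<star>\<^sub>1 t a b = t a (Ten \<chi> b c) \<star>\<^bsub>2\<^esub> t b c"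
proof -
  have "acomp (DCat Y) (ar (asc X.S a b c)) (acomp (DCat Y) (l2 (Ten \<chi> a b) c) (l2 a b \<otimes>\<^bsub>Y.S\<^esub> ide (DCat Y) (ob c)))
      = acomp (DCat Y) (l2 a (Ten \<chi> b c)) (acomp (DCat Y) (ide (DCat Y) (ob a) \<otimes>\<^bsub>Y.S\<^esub> l2 b c) (asc Y.S (ob a) (ob b) (ob c)))"
    using lax_assoc[of a b c] by simp
  from arg_cong[OF this, of "\<lambda>x. (um x \<star>\<^sub>1 Y.th (Ten \<psi> (ob a) (ob b)) (ob c)) \<star>\<^sub>1 Y.th (ob a) (ob b)"]
  show ?thesis
    by (simp add: t_def Y.words Y.typings X.asc_S(1))
qed

lemma t_right_unit:
  assumes [simp]: "a \<in> X.obs"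
  shows "um (ar (rho X.S a)) = t a (Unt \<chi>) \<star>\<^bsub>2\<^esub> v"
proof -
  have "acomp (DCat Y) (l2 a (Unt \<chi>)) (acomp (DCat Y) (ide (DCat Y) (ob a) \<otimes>\<^bsub>Y.S\<^esub> l0) (rho Y.S (ob a))) = ar (rho X.S a)"
    using lax_right_unit[of a] by simp
  from arg_cong[OF this, of um]
  show ?thesis
    by (simp add: t_def v_def Y.words Y.typings X.rho_S(1))
qed

lemma t_left_unit:
  assumes [simp]: "a \<in> X.obs"
  shows "um (ar (X.lam_inv a)) = t (Unt \<chi>) a \<star>\<^sub>1 v"
proof -
  note [simp] = X.lam_inv_arrs X.lam_S(1)
  have "acomp (DCat Y) (ar (lam X.S a)) (acomp (DCat Y) (l2 (Unt \<chi>) a) (l0 \<otimes>\<^bsub>Y.S\<^esub> ide (DCat Y) (ob a))) = lam Y.S (ob a)"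
    using lax_left_unit[of a] by simp
  from arg_cong[OF this, of "\<lambda>x. (um x \<star>\<^sub>1 Y.th (Unt \<psi>) (ob a)) \<star>\<^sub>1 Y.nu"]
  have *: "um (ar (lam X.S a)) \<star>\<^sub>1 (t (Unt \<chi>) a \<star>\<^sub>1 v) = um (ide (DCat Y) (ob a))"
    by (simp add: t_def v_def Y.words Y.typings)
  have "um (ar (acomp (DCat X) (X.lam_inv a) (lam X.S a))) \<star>\<^sub>1 (t (Unt \<chi>) a \<star>\<^sub>1 v)
      = um (ar (X.lam_inv a)) \<star>\<^sub>1 (um (ar (lam X.S a)) \<star>\<^sub>1 (t (Unt \<chi>) a \<star>\<^sub>1 v))"
    by (simp add: Y.words)
  moreover have "um (ar (acomp (DCat X) (X.lam_inv a) (lam X.S a))) = um (ide (DCat Y) (ob (Ten \<chi> (Unt \<chi>) a)))"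
    using X.inverse_lam[of a] by (simp add: inverse_arrs_def del: ar_acomp)
  ultimately show ?thesis
    unfolding * by (simp add: Y.mcomp_Id Y.Id_mcomp del: ar_acomp)
qed

text \<open>The choices are unique by universality, which the lemmas \<open>E_nullary\<close> and \<open>E_th_raw\<close>
  turn into recursion equations for \<open>E\<close>.\<close>

fun ext :: "'o list \<Rightarrow> ('o, 'a) mmap \<Rightarrow> ('o, 'a) mmap" where
  "ext [] f = um (ar (SOME q. q \<in> arrs (DCat X) \<and> dm q = Unt \<chi> \<and> cd q = tgt f \<and> um q \<circ>\<^sub>1 X.nu = f)) \<star>\<^sub>1 v"
| "ext [a] f = um (ar (Arr a (tgt f) (val f)))"
| "ext (a # b # xs) f = ext (Ten \<chi> a b # xs)
     (SOME g. g \<in> maps X sh \<and> src g = Ten \<chi> a b # xs \<and> tgt g = tgt f \<and> g \<circ>\<^sub>1 X.th a b = f) \<star>\<^sub>1 t a b"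

definition E :: "('o, 'a) mmap \<Rightarrow> ('o, 'a) mmap" where
  "E f = ext (src f) f"

lemma E_nullary:
  assumes "q \<in> arrs (DCat X)" "dm q = Unt \<chi>"
  shows "E (um q \<circ>\<^sub>1 X.nu) = um (ar q) \<star>\<^sub>1 v"
proof -
  have "(SOME p. p \<in> arrs (DCat X) \<and> dm p = Unt \<chi> \<and> cd p = cd q \<and> um p \<circ>\<^sub>1 X.nu = um q \<circ>\<^sub>1 X.nu) = q"
    by (rule some_equality) (use assms in \<open>auto intro: X.nu_cancel_um\<close>)
  then show ?thesis by (simp add: E_def)
qed

lemma E_um: "E (um q) = um (ar q)"
  by (cases q) (simp add: E_def)

lemma E_th_raw:
  assumes "g \<in> maps X sh" "src g = Ten \<chi> a b # xs" "a \<in> X.obs" "b \<in> X.obs" "ok sh (Suc (length xs)) (Suc (Suc 0))"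
  shows "E (g \<circ>\<^sub>1 X.th a b) = E g \<star>\<^sub>1 t a b"
proof -
  have "(SOME h. h \<in> maps X sh \<and> src h = Ten \<chi> a b # xs \<and> tgt h = tgt g \<and> h \<circ>\<^sub>1 X.th a b = g \<circ>\<^sub>1 X.th a b) = g"
    by (rule some_equality) (use assms in \<open>auto intro: X.th_cancel simp: X.ok_1_2\<close>)
  then show ?thesis using assms by (simp add: E_def)
qed

lemma E_typing:
  assumes "f \<in> maps X sh"
  shows "E f \<in> maps Y sh \<and> src (E f) = map ob (src f) \<and> tgt (E f) = ob (tgt f)"
  using assms
proof (induction rule: X.map_induct)
  case (nullary q)
  then show ?case by (simp add: E_nullary)
next
  case (unary q)
  then show ?case by (simp add: E_um)
next
  case (th g a b xs)
  then show ?case by (simp add: E_th_raw)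
qed

lemma E_simps [simp]:
  "f \<in> maps X sh \<Longrightarrow> E f \<in> maps Y sh"
  "f \<in> maps X sh \<Longrightarrow> src (E f) = map ob (src f)"
  "f \<in> maps X sh \<Longrightarrow> tgt (E f) = ob (tgt f)"
  using E_typing by blast+

lemma E_th: "\<lbrakk>a \<in> X.obs; b \<in> X.obs\<rbrakk> \<Longrightarrow> E (X.th a b) = t a b"
  using E_th_raw[of "um (ide (DCat X) (Ten \<chi> a b))" a b "[]"]
  by (simp add: E_um X.Id_mcomp Y.Id_mcomp)

lemma E_nu: "E X.nu = v"
  using E_nullary[of "ide (DCat X) (Unt \<chi>)"]
  by (simp add: X.Id_mcomp Y.Id_mcomp)

text \<open>Preservation is shown in stages: for unary \<open>f\<close>, then for unary \<open>g\<close> in the first input, then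
  for \<open>g\<close> a generator (unary, \<open>u\<close> or \<open>\<theta>\<close>) in any input, and finally in general.\<close>

definition preserved :: "('o, 'a) mmap \<Rightarrow> nat \<Rightarrow> ('o, 'a) mmap \<Rightarrow> bool" where
  "preserved f i g \<longleftrightarrow> E (f \<circ>\<^bsub>i\<^esub> g) = E f \<star>\<^bsub>i\<^esub> E g"

lemma fits_E: "\<lbrakk>f \<in> maps X sh; g \<in> maps X sh; fits sh f i g\<rbrakk> \<Longrightarrow> fits sh (E f) i (E g)"
  by (auto simp: fits_def)

lemma preserved_th:
  assumes "g \<in> maps X sh" "src g = Ten \<chi> a b # xs" "a \<in> X.obs" "b \<in> X.obs" "ok sh (Suc (length xs)) (Suc (Suc 0))"
  shows "preserved g (Suc 0) (X.th a b)"
  using assms by (simp add: preserved_def E_th_raw E_th)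

lemma preserved_nested:
  assumes "f \<in> maps X sh" "g \<in> maps X sh" "h \<in> maps X sh" "fits sh f i g" "fits sh g j h"
    "ok sh (length (src f) + length (src g) - Suc 0) (length (src h))"
    "ok sh (length (src f)) (length (src g) + length (src h) - Suc 0)"
    and "preserved f i g" "preserved g j h" "preserved (f \<circ>\<^bsub>i\<^esub> g) (j + i - Suc 0) h"
  shows "preserved f i (g \<circ>\<^bsub>j\<^esub> h)"
  using assms X.mcomp_nested[OF assms(1-7)] Y.mcomp_nested[of "E f" "E g" "E h" i j]
  by (simp add: preserved_def fits_E)

lemma preserved_post:
  assumes "f \<in> maps X sh" "q \<in> arrs (DCat X)" "dm q = tgt f"
  shows "preserved (um q) (Suc 0) f"
  using assms(1,3)
proof (induction rule: X.map_induct)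
  case (nullary p)
  have "um q \<circ>\<^sub>1 (um p \<circ>\<^sub>1 X.nu) = um (acomp (DCat X) q p) \<circ>\<^sub>1 X.nu"
    using nullary assms(2) by (simp add: X.words)
  then show ?case
    using nullary assms(2) by (simp add: preserved_def E_um E_nullary Y.words)
next
  case (unary p)
  then show ?case
    using assms(2) X.um_acomp[of p q] E_um[of "acomp (DCat X) q p"]
    by (simp add: preserved_def E_um Y.um_acomp)
next
  case (th g a b xs)
  show ?case
    by (rule preserved_nested)
      (use th assms(2) X.mapsD(4)[OF th(1)] ok_arity[OF th(5)] in \<open>auto simp: fits_def preserved_th intro!: preserved_th\<close>)
qed

text \<open>The step used at the inputs of \<open>\<theta>\<close> in \<open>g \<circ>\<^sub>1 \<theta>\<close>: if \<open>\<theta> \<circ>\<^sub>k h\<close> equals some \<open>w\<close>, and \<open>E\<close> respects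
  this equation, the question is passed on to the substitution of \<open>w\<close> into \<open>g\<close>.\<close>

lemma preserved_at_th:
  assumes "g \<in> maps X sh" "src g = Ten \<chi> a b # xs" "a \<in> X.obs" "b \<in> X.obs" "ok sh (Suc (length xs)) (Suc (Suc 0))"
    and "h \<in> maps X sh" "fits sh (X.th a b) k h" "X.th a b \<circ>\<^bsub>k\<^esub> h = w"
      "ok sh (Suc (Suc (length xs))) (length (src h))" "ok sh (Suc (length xs)) (Suc (length (src h)))"
    and "preserved g (Suc 0) w" "t a b \<star>\<^bsub>k\<^esub> E h = E w"
  shows "preserved (g \<circ>\<^sub>1 X.th a b) k h"
proof -
  have f: "fits sh g (Suc 0) (X.th a b)" using assms by (simp add: fits_def)
  have k: "Suc 0 + 0 < Suc k" using assms(7) by (simp add: fits_def)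
  have "g \<circ>\<^sub>1 w = (g \<circ>\<^sub>1 X.th a b) \<circ>\<^bsub>k\<^esub> h"
    using X.mcomp_nested[OF assms(1) _ assms(6) f assms(7)] assms by simp
  moreover have "E g \<star>\<^sub>1 E w = (E g \<star>\<^sub>1 E (X.th a b)) \<star>\<^bsub>k\<^esub> E h"
    using Y.mcomp_nested[of "E g" "E (X.th a b)" "E h" "Suc 0" k] fits_E[OF _ _ f] fits_E[OF _ _ assms(7)] assms
    by (simp add: E_th)
  ultimately show ?thesis
    using assms by (simp add: preserved_def E_th_raw E_th)
qed

lemma preserved_pre1:
  assumes "f \<in> maps X sh"
  shows "\<forall>p b xs. src f = b # xs \<and> p \<in> arrs (DCat X) \<and> cd p = b \<longrightarrow> preserved f (Suc 0) (um p)"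
  using assms
proof (induction rule: X.map_induct)
  case (nullary q)
  then show ?case by simp
next
  case (unary q)
  then show ?case by (auto intro: preserved_post)
next
  case (th g a b xs)
  show ?case
  proof (intro allI impI)
    fix p b' xs' assume "src (g \<circ>\<^sub>1 X.th a b) = b' # xs' \<and> p \<in> arrs (DCat X) \<and> cd p = b'"
    then have p: "p \<in> arrs (DCat X)" "cd p = a" using th by auto
    let ?r = "p \<otimes>\<^bsub>X.S\<^esub> ide (DCat X) b"
    have r: "?r \<in> arrs (DCat X)" "dm ?r = Ten \<chi> (dm p) b" "cd ?r = Ten \<chi> a b"
      using p th by (simp_all add: X.ten_S arrsD)
    note ok = ok_arity[OF th(5)]
    show "preserved (g \<circ>\<^sub>1 X.th a b) (Suc 0) (um p)"
    proof (rule preserved_at_th[OF th(1-5)])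
      show "X.th a b \<circ>\<^sub>1 um p = um ?r \<circ>\<^sub>1 X.th (dm p) b"
        using p th by (simp add: X.words X.typings)
      have "E (um ?r \<circ>\<^sub>1 X.th (dm p) b) = um (ar ?r) \<star>\<^sub>1 t (dm p) b"
        using r p th E_th_raw[of "um ?r" "dm p" b "[]"] by (simp add: E_um arrsD)
      then show "t a b \<star>\<^sub>1 E (um p) = E (um ?r \<circ>\<^sub>1 X.th (dm p) b)"
        using p th by (simp add: E_um t_natural Y.mcomp_Id)
      show "preserved g (Suc 0) (um ?r \<circ>\<^sub>1 X.th (dm p) b)"
        by (rule preserved_nested)
          (use th p r ok in \<open>auto simp: fits_def arrsD intro!: preserved_th\<close>)
    qed (use p th ok ok_post[OF ok(3)] in \<open>simp_all add: fits_def\<close>)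
  qed
qed

lemma ok_shift:
  assumes "ok sh (Suc (Suc n)) p" "p \<le> 2"
  shows "0 < n \<Longrightarrow> ok sh (Suc n) p" "0 < n \<Longrightarrow> ok sh (n + p) (Suc (Suc 0))" "ok sh (Suc n) (Suc p)"
  using assms by (auto simp: ok_def sub_arities_def)

lemma ok_peel:
  assumes "ok sh n (Suc (Suc m))"
  shows "ok sh n (Suc m)" "ok sh (n + m) (Suc (Suc 0))"
  using assms by (auto simp: ok_def sub_arities_def)

lemma plug_nth [simp]: "\<lbrakk>0 < i; i \<le> length bs\<rbrakk> \<Longrightarrow> plug bs i (a # as) ! (i - Suc 0) = a"
  by (simp add: plug_def nth_append)

text \<open>Induction on the outer map \<open>g \<circ>\<^sub>1 \<theta>\<close>. A generator in one of the inputs of \<open>\<theta>\<close> is absorbed: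
  \<open>\<theta> \<circ>\<^sub>1 p = (p \<otimes> 1) \<circ> \<theta>\<close>, \<open>\<theta> \<circ>\<^sub>1 u = \<lambda>\<inverse>\<close>, \<open>\<theta> \<circ>\<^sub>2 p = (1 \<otimes> p) \<circ> \<theta>\<close>, \<open>\<theta> \<circ>\<^sub>2 u = \<rho>\<close> and
  \<open>\<theta> \<circ>\<^sub>2 \<theta> = (\<alpha> \<circ> \<theta>) \<circ>\<^sub>1 \<theta>\<close>, and each of these is matched by one axiom of a lax functor. (A
  generator \<open>\<theta>\<close> in the first input is the recursion equation for \<open>E\<close>.) A generator in a later
  input goes into \<open>g\<close> by the parallel law, where the induction hypothesis applies.\<close>

lemma preserved_generator:
  assumes "f \<in> maps X sh" and h: "h \<in> maps X sh"
    "h \<in> um ` arrs (DCat X) \<or> h = X.nu \<or> (\<exists>c d. c \<in> X.obs \<and> d \<in> X.obs \<and> h = X.th c d)"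
  shows "\<forall>i. fits sh f i h \<longrightarrow> preserved f i h"
  using assms(1)
proof (induction rule: X.map_induct)
  case (nullary q)
  then show ?case by (simp add: fits_def)
next
  case (unary q)
  then show ?case using h by (auto simp: fits_def le_Suc_eq intro!: preserved_post)
next
  case (th g a b xs)
  note ok = ok_arity[OF th(5)]
  have pre1: "preserved g (Suc 0) (um p)" if "p \<in> arrs (DCat X)" "cd p = Ten \<chi> a b" for p
    using preserved_pre1[OF th(1)] th(2) that by simp
  have pre1_th: "preserved g (Suc 0) (um p \<circ>\<^sub>1 X.th c d)"
    if "p \<in> arrs (DCat X)" "cd p = Ten \<chi> a b" "dm p = Ten \<chi> c d" "c \<in> X.obs" "d \<in> X.obs" for p c d
    by (rule preserved_nested) (use th ok that pre1 in \<open>auto simp: fits_def intro!: preserved_th\<close>)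
  show ?case
  proof (intro allI impI)
    fix i assume fits: "fits sh (g \<circ>\<^sub>1 X.th a b) i h"
    then have okh: "ok sh (Suc (Suc (length xs))) (length (src h))"
      using th by (simp add: fits_def)
    have p: "length (src h) \<le> 2" using h by auto
    have okh2: "ok sh (Suc (length xs)) (Suc (length (src h)))"
      using ok_shift(3)[OF okh p] .
    consider (one) "i = Suc 0" | (two) "i = Suc (Suc 0)" | (more) j where "i = Suc (Suc (Suc j))"
      using fits by (cases i; cases "i - 1"; cases "i - 2") (auto simp: fits_def)
    then show "preserved (g \<circ>\<^sub>1 X.th a b) i h"
    proof cases
      case one
      then have a: "tgt h = a" using fits th by (simp add: fits_def)
      consider (um) p where "p \<in> arrs (DCat X)" "h = um p" | (nu) "h = X.nu"
        | (th) c d where "c \<in> X.obs" "d \<in> X.obs" "h = X.th c d" using h by auto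
      then show ?thesis
      proof cases
        case um
        then show ?thesis
          using preserved_pre1[of "g \<circ>\<^sub>1 X.th a b"] th one a by simp
      next
        case nu
        have a: "a = Unt \<chi>" using a nu by simp
        show ?thesis
          unfolding one
        proof (rule preserved_at_th[OF th(1-5) h(1)])
          show "X.th a b \<circ>\<^sub>1 h = um (X.lam_inv b)" by (simp add: a nu X.um_lam_inv)
          show "preserved g (Suc 0) (um (X.lam_inv b))"
            by (rule pre1) (use th a in \<open>simp_all add: X.lam_inv_arrs\<close>)
          show "t a b \<star>\<^sub>1 E h = E (um (X.lam_inv b))"
            using th by (simp add: a nu E_nu E_um t_left_unit)
        qed (use fits okh okh2 one th in \<open>simp_all add: fits_def nu a\<close>)
      next
        case (th c d)
        note h = this
        show ?thesis
          unfolding one h(3)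
          by (rule preserved_th[where xs = "b # xs"])
            (use th.prems fits one a h okh \<open>g \<in> maps X sh\<close> \<open>src g = Ten \<chi> a b # xs\<close> \<open>a \<in> X.obs\<close> \<open>b \<in> X.obs\<close> \<open>ok sh (Suc (length xs)) (Suc (Suc 0))\<close> in simp_all)
      qed
    next
      case two
      then have b: "tgt h = b" using fits th by (simp add: fits_def)
      consider (um) p where "p \<in> arrs (DCat X)" "h = um p" | (nu) "h = X.nu"
        | (th) c d where "c \<in> X.obs" "d \<in> X.obs" "h = X.th c d" using h by auto
      then show ?thesis
      proof cases
        case um
        have p: "p \<in> arrs (DCat X)" "cd p = b" using um b by simp_all
        let ?r = "ide (DCat X) a \<otimes>\<^bsub>X.S\<^esub> p"
        have r: "?r \<in> arrs (DCat X)" "dm ?r = Ten \<chi> a (dm p)" "cd ?r = Ten \<chi> a b"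
          using p th by (simp_all add: X.ten_S arrsD)
        show ?thesis
          unfolding two
        proof (rule preserved_at_th[OF th(1-5) h(1)])
          show "X.th a b \<circ>\<^bsub>Suc (Suc 0)\<^esub> h = um ?r \<circ>\<^sub>1 X.th a (dm p)"
            using p th by (simp add: um X.words X.typings)
          have "E (um ?r \<circ>\<^sub>1 X.th a (dm p)) = um (ar ?r) \<star>\<^sub>1 t a (dm p)"
            using r p th E_th_raw[of "um ?r" a "dm p" "[]"] by (simp add: E_um arrsD)
          then show "t a b \<star>\<^bsub>Suc (Suc 0)\<^esub> E h = E (um ?r \<circ>\<^sub>1 X.th a (dm p))"
            using p th by (simp add: um E_um t_natural Y.mcomp_Id numeral_2_eq_2)
          show "preserved g (Suc 0) (um ?r \<circ>\<^sub>1 X.th a (dm p))"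
            by (rule pre1_th) (use r p th in \<open>simp_all add: arrsD\<close>)
        qed (use fits okh okh2 two th p in \<open>simp_all add: fits_def um\<close>)
      next
        case nu
        have b: "b = Unt \<chi>" using b nu by simp
        show ?thesis
          unfolding two
        proof (rule preserved_at_th[OF th(1-5) h(1)])
          show "X.th a b \<circ>\<^bsub>Suc (Suc 0)\<^esub> h = um (rho X.S a)"
            using th by (simp add: b nu X.rho_S(2) numeral_2_eq_2)
          show "preserved g (Suc 0) (um (rho X.S a))"
            by (rule pre1) (use th b in \<open>simp_all add: X.rho_S(1)\<close>)
          show "t a b \<star>\<^bsub>Suc (Suc 0)\<^esub> E h = E (um (rho X.S a))"
            using th by (simp add: b nu E_nu E_um t_right_unit numeral_2_eq_2)
        qed (use fits okh okh2 two th in \<open>simp_all add: fits_def nu b\<close>)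
      next
        case h: (th c d)
        have b: "b = Ten \<chi> c d" using b h by simp
        let ?\<alpha> = "asc X.S a c d"
        have \<alpha>: "?\<alpha> \<in> arrs (DCat X)" "dm ?\<alpha> = Ten \<chi> (Ten \<chi> a c) d" "cd ?\<alpha> = Ten \<chi> a b"
          using th h by (simp_all add: X.asc_S b)
        let ?w = "um ?\<alpha> \<circ>\<^sub>1 X.th (Ten \<chi> a c) d"
        have E1: "E ?w = um (ar ?\<alpha>) \<star>\<^sub>1 t (Ten \<chi> a c) d"
          using E_th_raw[of "um ?\<alpha>" "Ten \<chi> a c" d "[]"] \<alpha> th h by (simp add: E_um)
        have E2: "E (?w \<circ>\<^sub>1 X.th a c) = E ?w \<star>\<^sub>1 t a c"
          by (rule E_th_raw[where xs = "[d]"]) (use \<alpha> th h in simp_all)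
        show ?thesis
          unfolding two
        proof (rule preserved_at_th[OF th(1-5)])
          show "X.th a b \<circ>\<^bsub>Suc (Suc 0)\<^esub> h = ?w \<circ>\<^sub>1 X.th a c"
            using th h X.asc_S(2)[of a c d] by (simp add: b numeral_2_eq_2)
          show "t a b \<star>\<^bsub>Suc (Suc 0)\<^esub> E h = E (?w \<circ>\<^sub>1 X.th a c)"
            unfolding E2 E1 using th h by (simp add: b E_th t_assoc numeral_2_eq_2)
          have "preserved g (Suc 0) ?w"
            by (rule pre1_th) (use \<alpha> h th in simp_all)
          moreover have "preserved ?w (Suc 0) (X.th a c)"
            by (rule preserved_th[where xs = "[d]"]) (use \<alpha> th h in simp_all)
          moreover have "preserved (g \<circ>\<^sub>1 ?w) (Suc 0) (X.th a c)"
            by (rule preserved_th[where xs = "d # xs"]) (use \<alpha> th h ok okh okh2 in simp_all)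
          ultimately show "preserved g (Suc 0) (?w \<circ>\<^sub>1 X.th a c)"
            using \<alpha> th h ok okh okh2
            by (intro preserved_nested[of g ?w "X.th a c" "Suc 0" "Suc 0"]) (simp_all add: fits_def)
        qed (use fits okh okh2 two th h in \<open>simp_all add: fits_def b\<close>)
      qed
    next
      case (more j)
      have len: "j < length xs" using fits th more by (simp add: fits_def)
      have oks: "ok sh (Suc (length xs)) (length (src h))" "ok sh (length xs + length (src h)) (Suc (Suc 0))"
        using len by (auto intro: ok_shift[OF okh p])
      have [simp]: "Suc (length xs + length (src h) - Suc 0) = length xs + length (src h)"
        using len by simp
      have f1: "fits sh g (Suc (Suc j)) h"
        using fits th more oks by (simp add: fits_def)
      have f2: "fits sh g (Suc 0) (X.th a b)"
        using th by (simp add: fits_def)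
      have "(g \<circ>\<^bsub>Suc (Suc j)\<^esub> h) \<circ>\<^sub>1 X.th a b = (g \<circ>\<^sub>1 X.th a b) \<circ>\<^bsub>i\<^esub> h"
        using X.mcomp_parallel[OF th(1) _ h(1) _ f2 f1] th oks okh more by simp
      moreover have "(E g \<star>\<^bsub>Suc (Suc j)\<^esub> E h) \<star>\<^sub>1 E (X.th a b) = (E g \<star>\<^sub>1 E (X.th a b)) \<star>\<^bsub>i\<^esub> E h"
        using Y.mcomp_parallel[OF _ _ _ _ fits_E[OF _ _ f2] fits_E[OF _ _ f1]] th oks okh more h by simp
      moreover have "preserved g (Suc (Suc j)) h"
        using th f1 by blast
      moreover have "E ((g \<circ>\<^bsub>Suc (Suc j)\<^esub> h) \<circ>\<^sub>1 X.th a b) = E (g \<circ>\<^bsub>Suc (Suc j)\<^esub> h) \<star>\<^sub>1 t a b"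
        by (rule E_th_raw[where xs = "plug xs (Suc j) (src h)"])
          (use th h f1 oks len X.mcomp_in[OF th(1) h(1) f1] in \<open>simp_all add: length_plug\<close>)
      ultimately show ?thesis
        using th by (simp add: preserved_def E_th_raw E_th)
    qed
  qed
qed

text \<open>Induction on the inner map: \<open>f \<circ>\<^sub>i (g \<circ>\<^sub>1 \<theta>) = (f \<circ>\<^sub>i g) \<circ>\<^sub>i \<theta>\<close>, with smaller \<open>g\<close> on the right and
  the generator \<open>\<theta>\<close> substituted last.\<close>

lemma preserved_all:
  assumes "g \<in> maps X sh"
  shows "\<forall>f i. f \<in> maps X sh \<and> fits sh f i g \<longrightarrow> preserved f i g"
  using assms
proof (induction rule: X.map_induct)
  case (nullary q)
  show ?case
  proof (intro allI impI)
    fix f i assume A: "f \<in> maps X sh \<and> fits sh f i (um q \<circ>\<^sub>1 X.nu)"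
    then have f: "fits sh f i (um q)" "i > 0" "ok sh (length (src f)) 0"
      using nullary by (auto simp: fits_def intro: ok_arity)
    have "preserved (f \<circ>\<^bsub>i\<^esub> um q) i X.nu"
      by (rule preserved_generator[rule_format])
        (use A f nullary X.mcomp_in[of f "um q" i] in \<open>auto simp: fits_def length_plug\<close>)
    then show "preserved f i (um q \<circ>\<^sub>1 X.nu)"
      using A f nullary preserved_generator[of f "um q"] preserved_post[of X.nu q]
      by (intro preserved_nested[of f "um q" X.nu]) (auto simp: fits_def)
  qed
next
  case (unary q)
  then show ?case using preserved_generator[of _ "um q"] by auto
next
  case (th g a b xs)
  show ?case
  proof (intro allI impI)
    fix f i assume A: "f \<in> maps X sh \<and> fits sh f i (g \<circ>\<^sub>1 X.th a b)"
    then have ok: "ok sh (length (src f)) (Suc (Suc (length xs)))"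
      using th by (simp add: fits_def)
    then have ok2: "ok sh (length (src f)) (Suc (length xs))" "ok sh (length (src f) + length xs) (Suc (Suc 0))"
      by (auto intro: ok_peel)
    have f: "fits sh f i g" "i > 0"
      using A th ok2 by (auto simp: fits_def)
    have "preserved (f \<circ>\<^bsub>i\<^esub> g) i (X.th a b)"
      by (rule preserved_generator[rule_format])
        (use A f th ok2 X.mcomp_in[of f g i] in \<open>auto simp: fits_def length_plug\<close>)
    then show "preserved f i (g \<circ>\<^sub>1 X.th a b)"
      using A f th ok ok2
      by (intro preserved_nested[of f g "X.th a b"]) (auto simp: fits_def intro: preserved_th)
  qed
qed

definition lift :: "'o list \<Rightarrow> 'o \<Rightarrow> 'a \<Rightarrow> 'a" where
  "lift as b f = val (E (MMap as b f))"

lemma act_lift: "p \<in> maps X sh \<Longrightarrow> act (LFun L) lift p = E p"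
  by (rule mmap.expand) (simp add: act_def lift_def)

lemma multi_morphism_lift: "multi_morphism X Y sh (LFun L) lift"
proof -
  interpret F: is_functor "DCat X" "DCat Y" "LFun L" by (rule fn)
  show ?thesis
    by unfold_locales
      (use preserved_all in \<open>auto simp: act_lift E_um X.mcomp_in preserved_def\<close>)
qed

lemma lax_of_lift: "lax_of X \<chi> Y \<psi> (LFun L) lift = L"
proof -
  interpret F: universal_morphism X Y sh \<chi> \<psi> "LFun L" lift
    by (intro universal_morphism.intro universal_pair_axioms multi_morphism_lift)
  show ?thesis
    by (rule F.L_unique[symmetric])
      (simp_all add: lax_functor_axioms act_lift E_nu E_th v_def t_def)
qed

end

lemma (in universal_pair) lax_lifts:
  assumes "lax_monoidal X.S Y.S L"
  shows "\<exists>\<phi>. multi_morphism X Y sh (LFun L) \<phi> \<and> lax_of X \<chi> Y \<psi> (LFun L) \<phi> = L"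
proof -
  interpret lax_lift X Y sh \<chi> \<psi> L
    by (intro lax_lift.intro universal_pair_axioms lax_functor.intro X.skew_monoidal_S Y.skew_monoidal_S assms)
  show ?thesis using multi_morphism_lift lax_of_lift by blast
qed


section \<open>Short multicategories as partial multicategories\<close>

lemma plug_nested:
  assumes "0 < i" "i \<le> length as" "0 < j" "j \<le> length bs"
  shows "plug as i (plug bs j cs) = plug (plug as i bs) (j + i - Suc 0) cs"
proof -
  obtain m n where "i = Suc m" "j = Suc n" using assms by (metis gr0_conv_Suc)
  then show ?thesis using assms by (simp add: plug_def min_def)
qed

lemma plug_parallel:
  assumes "0 < i" "i < j" "j \<le> length as"
  shows "plug (plug as j cs) i bs = plug (plug as i bs) (j + length bs - Suc 0) cs"
proof -
  obtain m n where m: "i = Suc m" and n: "j = Suc n" using assms by (metis gr0_conv_Suc less_imp_Suc_add)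
  have "n + length bs - Suc 0 = m" if "n + length bs - Suc 0 \<le> m" using assms m n that by simp
  then show ?thesis using assms by (auto simp: plug_def min_def m n drop_take)
qed

lemma plug_single: "\<lbrakk>0 < i; i \<le> length bs\<rbrakk> \<Longrightarrow> plug bs i [a] = bs[i - Suc 0 := a]"
  by (auto simp: plug_def upd_conv_take_nth_drop)

lemma nth_Cmp_list: "k < length ps \<Longrightarrow> Cmp_list C as bs cs qs ps ! k = Cmp C (as ! k) (bs ! k) (cs ! k) (qs ! k) (ps ! k)"
  by (simp add: Cmp_list_def)

lemma length_Cmp_list [simp]: "length (Cmp_list C as bs cs qs ps) = length ps"
  by (simp add: Cmp_list_def)

context short_multicategory
begin

abbreviation "D \<equiv> SUnary C"
abbreviation "ids as \<equiv> map (Id D) as"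

sublocale D: category D
  by (rule unary_category)

lemma nth_SOb: "set as \<subseteq> SOb C \<Longrightarrow> k < length as \<Longrightarrow> as ! k \<in> SOb C"
  by (auto simp: subset_iff)

lemma hom_list_ids [simp]: "set as \<subseteq> SOb C \<Longrightarrow> hom_list D as as (ids as)"
  by (auto simp: hom_list_def D.Id_in nth_SOb)

lemma hom_list_update [simp]:
  assumes "hom_list D as bs ps" "p \<in> Hom D a (bs ! i)"
  shows "hom_list D (as[i := a]) bs (ps[i := p])"
proof -
  have "ps[i := p] ! k \<in> Hom D (as[i := a] ! k) (bs ! k)" if "k < length ps" for k
    using assms that by (cases "k = i") (auto simp: hom_list_def)
  then show ?thesis using assms by (simp add: hom_list_def)
qed

lemma set_update: "set as \<subseteq> SOb C \<Longrightarrow> a \<in> SOb C \<Longrightarrow> set (as[i := a]) \<subseteq> SOb C"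
  using set_update_subset_insert by fastforce

lemma Cmp_list_ids [simp]:
  assumes "hom_list D as bs ps" "set as \<subseteq> SOb C" "set bs \<subseteq> SOb C"
  shows "Cmp_list D as bs bs (ids bs) ps = ps" "Cmp_list D as as bs ps (ids as) = ps"
  using assms
  by (auto intro!: nth_equalityI simp: hom_list_def nth_Cmp_list nth_SOb D.Id_Cmp D.Cmp_Id)

text \<open>Functoriality of \<open>SAct\<close> in all variables together gives the usual laws for the actions in
  a single variable.\<close>

lemma post_pre:
  assumes "length as \<le> 4" "set as \<subseteq> SOb C" "a \<in> SOb C" "b \<in> SOb C" "c \<in> SOb C" "0 < i" "i \<le> length as"
    "p \<in> Hom D a (as ! (i - 1))" "q \<in> Hom D b c" "f \<in> SHom C as b"
  shows "post C (as[i - 1 := a]) b c q (pre C as b i a f p) = pre C as c i a (post C as b c q f) p"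
proof -
  have h: "hom_list D (as[i - 1 := a]) as ((ids as)[i - 1 := p])"
    using assms by simp
  note s = set_update[OF assms(2,3), of "i - 1"]
  have "post C (as[i - 1 := a]) b c q (pre C as b i a f p) = SAct C as (as[i - 1 := a]) b c ((ids as)[i - 1 := p]) q f"
    using SAct_Cmp[of as "as[i - 1 := a]" "as[i - 1 := a]" b b c "(ids as)[i - 1 := p]" "ids (as[i - 1 := a])" "Id D b" q f]
      assms h s by (simp add: post_def pre_def D.Id_in D.Cmp_Id)
  moreover have "pre C as c i a (post C as b c q f) p = SAct C as (as[i - 1 := a]) b c ((ids as)[i - 1 := p]) q f"
    using SAct_Cmp[of as as "as[i - 1 := a]" b c c "ids as" "(ids as)[i - 1 := p]" q "Id D c" f]
      assms h s by (simp add: post_def pre_def D.Id_in D.Id_Cmp)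
  ultimately show ?thesis by simp
qed

lemma pre_pre_same:
  assumes "length as \<le> 4" "set as \<subseteq> SOb C" "a \<in> SOb C" "a' \<in> SOb C" "b \<in> SOb C" "0 < i" "i \<le> length as"
    "p \<in> Hom D a (as ! (i - 1))" "p' \<in> Hom D a' a" "f \<in> SHom C as b"
  shows "pre C (as[i - 1 := a]) b i a' (pre C as b i a f p) p' = pre C as b i a' f (Cmp D a' a (as ! (i - 1)) p p')"
proof -
  let ?j = "i - 1"
  have j: "?j < length as" using assms by simp
  have h: "hom_list D (as[?j := a]) as ((ids as)[?j := p])"
    "hom_list D ((as[?j := a])[?j := a']) (as[?j := a]) ((ids (as[?j := a]))[?j := p'])"
    using assms j by (simp_all del: list_update_overwrite add: set_update)
  have "Cmp_list D ((as[?j := a])[?j := a']) (as[?j := a]) as ((ids as)[?j := p]) ((ids (as[?j := a]))[?j := p'])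
      = (ids as)[?j := Cmp D a' a (as ! ?j) p p']"
    using assms j by (intro nth_equalityI) (auto simp: nth_Cmp_list nth_list_update D.Id_Cmp D.Id_in nth_SOb)
  then show ?thesis
    using SAct_Cmp[of as "as[?j := a]" "as[?j := a']" b b b "(ids as)[?j := p]" "(ids (as[?j := a]))[?j := p']" "Id D b" "Id D b" f]
      assms h by (simp add: pre_def D.Id_in D.Cmp_Id set_update)
qed

lemma pre_pre_other:
  assumes "length as \<le> 4" "set as \<subseteq> SOb C" "a \<in> SOb C" "a' \<in> SOb C" "b \<in> SOb C"
    "0 < i" "i \<le> length as" "0 < j" "j \<le> length as" "i \<noteq> j"
    "p \<in> Hom D a (as ! (i - 1))" "p' \<in> Hom D a' (as ! (j - 1))" "f \<in> SHom C as b"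
  shows "pre C (as[i - 1 := a]) b j a' (pre C as b i a f p) p'
    = SAct C as (as[i - 1 := a, j - 1 := a']) b b ((ids as)[i - 1 := p, j - 1 := p']) (Id D b) f"
proof -
  have j: "i - 1 < length as" "j - 1 < length as" "i - 1 \<noteq> j - 1" using assms by auto
  have h: "hom_list D (as[i - 1 := a]) as ((ids as)[i - 1 := p])"
    "hom_list D (as[i - 1 := a, j - 1 := a']) (as[i - 1 := a]) ((ids (as[i - 1 := a]))[j - 1 := p'])"
    using assms j by (simp_all add: set_update)
  have "Cmp_list D (as[i - 1 := a, j - 1 := a']) (as[i - 1 := a]) as ((ids as)[i - 1 := p]) ((ids (as[i - 1 := a]))[j - 1 := p'])
      = (ids as)[i - 1 := p, j - 1 := p']"
    using assms j by (intro nth_equalityI)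
      (auto simp: nth_Cmp_list nth_list_update D.Id_Cmp D.Cmp_Id D.Id_in nth_SOb)
  then show ?thesis
    using SAct_Cmp[of as "as[i - 1 := a]" "as[i - 1 := a, j - 1 := a']" b b b "(ids as)[i - 1 := p]" "(ids (as[i - 1 := a]))[j - 1 := p']" "Id D b" "Id D b" f]
      assms h by (simp add: pre_def D.Id_in D.Cmp_Id set_update)
qed

lemma pre_pre_commute:
  assumes "length as \<le> 4" "set as \<subseteq> SOb C" "a \<in> SOb C" "a' \<in> SOb C" "b \<in> SOb C"
    "0 < i" "i \<le> length as" "0 < j" "j \<le> length as" "i \<noteq> j"
    "p \<in> Hom D a (as ! (i - 1))" "p' \<in> Hom D a' (as ! (j - 1))" "f \<in> SHom C as b"
  shows "pre C (as[i - 1 := a]) b j a' (pre C as b i a f p) p' = pre C (as[j - 1 := a']) b i a (pre C as b j a' f p') p"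
proof -
  have "i - 1 \<noteq> j - 1" using assms by auto
  note swap = list_update_swap[OF this, of as a a'] list_update_swap[OF this, of "ids as" p p']
  show ?thesis
    using swap pre_pre_other[OF assms] pre_pre_other[of as a' a b j i p' p f] assms by simp
qed

lemma post_post:
  assumes "length as \<le> 4" "set as \<subseteq> SOb C" "b \<in> SOb C" "c \<in> SOb C" "d \<in> SOb C"
    "q \<in> Hom D b c" "r \<in> Hom D c d" "f \<in> SHom C as b"
  shows "post C as c d r (post C as b c q f) = post C as b d (Cmp D b c d r q) f"
  using SAct_Cmp[of as as as b c d "ids as" "ids as" q r f] assms by (simp add: post_def)

lemma post_unary: "\<lbrakk>a \<in> SOb C; b \<in> SOb C; c \<in> SOb C; f \<in> Hom D a b; g \<in> Hom D b c\<rbrakk>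
    \<Longrightarrow> post C [a] b c g f = Cmp D a b c g f"
  using SAct_unary[of a a b c "Id D a" g f] by (simp add: post_def D.Id_in D.Cmp_Id)

lemma pre_unary: "\<lbrakk>a \<in> SOb C; b \<in> SOb C; c \<in> SOb C; f \<in> Hom D a b; g \<in> Hom D b c\<rbrakk>
    \<Longrightarrow> pre C [b] c (Suc 0) a g f = Cmp D a b c g f"
  using SAct_unary[of b a c c f "Id D c" g] by (simp add: pre_def D.Id_in D.Cmp_in D.Id_Cmp)

lemma scomp_pre: "\<lbrakk>set bs \<subseteq> SOb C; c \<in> SOb C; a \<in> SOb C; 0 < i; i \<le> length bs; f \<in> SHom C bs c;
     g \<in> SHom C [a] (bs ! (i - Suc 0))\<rbrakk> \<Longrightarrow> scomp C bs c i [a] f g = pre C bs c i a f g"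
  by (cases bs) (auto simp: scomp_def length_Suc_conv le_Suc_eq SHom_unary post_unary pre_unary)

lemma scomp_post: "scomp C [b] c i as f g = post C as b c f g"
  by (simp add: scomp_def)

lemma scomp_SSub: "(length bs, length as) \<in> sub_arities \<Longrightarrow> scomp C bs c i as f g = SSub C bs c i as f g"
  by (auto simp: scomp_def sub_arities_def)

lemma post_in: "\<lbrakk>length as \<le> 4; set as \<subseteq> SOb C; b \<in> SOb C; c \<in> SOb C; q \<in> Hom D b c; f \<in> SHom C as b\<rbrakk>
    \<Longrightarrow> post C as b c q f \<in> SHom C as c"
  unfolding post_def by (rule SAct_in) simp_all

lemma pre_in: "\<lbrakk>length as \<le> 4; set as \<subseteq> SOb C; a \<in> SOb C; b \<in> SOb C; 0 < i; i \<le> length as;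
    p \<in> Hom D a (as ! (i - 1)); f \<in> SHom C as b\<rbrakk> \<Longrightarrow> pre C as b i a f p \<in> SHom C (as[i - 1 := a]) b"
  unfolding pre_def by (rule SAct_in) (simp_all add: set_update D.Id_in)

lemma post_Id: "\<lbrakk>length as \<le> 4; set as \<subseteq> SOb C; b \<in> SOb C; f \<in> SHom C as b\<rbrakk>
    \<Longrightarrow> post C as b b (Id D b) f = f"
  unfolding post_def by (rule SAct_Id)

lemma pre_Id: "\<lbrakk>length as \<le> 4; set as \<subseteq> SOb C; b \<in> SOb C; f \<in> SHom C as b; 0 < i; i \<le> length as\<rbrakk>
    \<Longrightarrow> pre C as b i (as ! (i - 1)) f (Id D (as ! (i - 1))) = f"
  unfolding pre_def using SAct_Id[of as b f]
  by (simp add: map_update[symmetric] del: map_update)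

abbreviation "X \<equiv> short_data C"
abbreviation "M \<equiv> maps X True"

lemma X_simps [simp]: "DCat X = D" "DHom X = SHom C" "DComp X = scomp C"
  by (simp_all add: short_data_def)

lemma ok_True: "ok True n m \<longleftrightarrow> n = 1 \<and> m \<le> 4 \<or> m = 1 \<and> 1 \<le> n \<and> n \<le> 4 \<or> (n, m) \<in> sub_arities"
  by (auto simp: ok_def sub_arities_def)

lemma ok_True_bounds: "ok True n m \<Longrightarrow> n \<le> 4" "ok True n m \<Longrightarrow> m \<le> 4"
  by (auto simp: ok_True sub_arities_def)

lemma sub_aritiesD:
  assumes "(n, m) \<in> sub_arities"
  shows "n = 2 \<or> n = 3" "m = 0 \<or> m = 2 \<or> m = 3"
  using assms by (auto simp: sub_arities_def)

text \<open>Among maps none of which is unary, the bound on the arities leaves exactly the cases of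
  the associativity axioms, here and in the next lemma.\<close>

lemma ok_True_parallel:
  assumes "(n, m) \<in> sub_arities" "(n, p) \<in> sub_arities"
    "ok True (n + m - 1) p" "ok True (n + p - 1) m" "\<not> (n = 3 \<and> m = 0 \<and> p = 0)"
  shows "n = 2" "(m, p) \<in> {(2, 2), (2, 0), (0, 2), (0, 0)}"
proof -
  note sub_aritiesD[OF assms(1)] sub_aritiesD[OF assms(2)]
  then show "n = 2" and "(m, p) \<in> {(2, 2), (2, 0), (0, 2), (0, 0)}"
    using assms by (elim disjE; simp add: ok_True sub_arities_def; fail)+
qed

lemma ok_True_nested:
  assumes "(n, m) \<in> sub_arities" "(m, p) \<in> sub_arities"
    "ok True (n + m - 1) p" "ok True n (m + p - 1)"
  shows "n = 2" "(m, p) \<in> {(2, 2), (2, 0)}"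
proof -
  note sub_aritiesD[OF assms(1)] sub_aritiesD[OF assms(2)]
  then show "n = 2" and "(m, p) \<in> {(2, 2), (2, 0)}"
    using assms by (elim disjE; simp add: ok_True sub_arities_def; fail)+
qed

lemma M_iff: "p \<in> M \<longleftrightarrow> set (src p) \<subseteq> SOb C \<and> tgt p \<in> SOb C \<and> val p \<in> SHom C (src p) (tgt p) \<and> length (src p) \<le> 4"
  by (auto simp: maps_def ok_True sub_arities_def)

lemma scomp_in:
  assumes "set bs \<subseteq> SOb C" "set as \<subseteq> SOb C" "c \<in> SOb C" "f \<in> SHom C bs c" "0 < i" "i \<le> length bs"
    "g \<in> SHom C as (bs ! (i - 1))" "ok True (length bs) (length as)"
  shows "scomp C bs c i as f g \<in> SHom C (plug bs i as) c"
proof -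
  consider (post) b where "bs = [b]" "i = 1" "length as \<le> 4" | (pre) a where "as = [a]" "length bs \<le> 4"
    | (sub) "(length bs, length as) \<in> sub_arities"
    using assms(5,6,8) by (cases bs; cases as) (auto simp: ok_True)
  then show ?thesis
  proof cases
    case post
    then show ?thesis using assms by (simp add: scomp_post post_in SHom_unary)
  next
    case pre
    moreover have "bs ! (i - Suc 0) \<in> SOb C" using assms nth_SOb by simp
    ultimately show ?thesis using assms pre_in[of bs a c i g f] by (simp add: scomp_pre SHom_unary plug_single)
  next
    case sub
    then show ?thesis using assms by (simp add: scomp_SSub SSub_in)
  qed
qed

text \<open>The cases are the positions at which unary maps occur. The law is then functoriality of the
  actions, naturality of substitution in the target or in an inner variable, dinaturality, or
  the axiom.\<close>

lemma scomp_nested: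
  assumes bs: "set bs \<subseteq> SOb C" and as: "set as \<subseteq> SOb C" and xs: "set xs \<subseteq> SOb C" and d: "d \<in> SOb C"
    and f: "f \<in> SHom C bs d" and g: "g \<in> SHom C as (bs ! (i - 1))" and h: "h \<in> SHom C xs (as ! (j - 1))"
    and i: "0 < i" "i \<le> length bs" and j: "0 < j" "j \<le> length as"
    and ok: "ok True (length bs) (length as)" "ok True (length as) (length xs)"
      "ok True (length bs + length as - 1) (length xs)" "ok True (length bs) (length as + length xs - 1)"
  shows "scomp C bs d i (plug as j xs) f (scomp C as (bs ! (i - 1)) j xs g h)
      = scomp C (plug bs i as) d (j + i - 1) xs (scomp C bs d i as f g) h"
proof -
  let ?b = "bs ! (i - 1)" and ?a = "as ! (j - 1)"
  have b: "?b \<in> SOb C" and a: "?a \<in> SOb C" using bs as i j by (auto intro: nth_SOb)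
  have gh: "scomp C as ?b j xs g h \<in> SHom C (plug as j xs) ?b"
    using scomp_in[OF as xs b g j h ok(2)] .
  have fg: "scomp C bs d i as f g \<in> SHom C (plug bs i as) d"
    using scomp_in[OF bs as d f i g ok(1)] .
  have pa: "set (plug as j xs) \<subseteq> SOb C" "set (plug bs i as) \<subseteq> SOb C"
    using bs as xs by (simp_all add: set_plug)
  have la: "length as \<le> 4" "length bs \<le> 4" "length xs \<le> 4"
    using ok_True_bounds[OF ok(1)] ok_True_bounds[OF ok(2)] by simp_all
  have nth: "plug bs i as ! (j + i - Suc (Suc 0)) = ?a" "plug bs i as ! (i + j - Suc (Suc 0)) = ?a"
    using i j by (auto simp: plug_def nth_append min_def)
  consider (post) b' where "bs = [b']" "i = 1" | (mid) a' where "as = [a']" "j = 1" "length bs \<noteq> 1"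
    | (pre) x where "xs = [x]" "length bs \<noteq> 1" "length as \<noteq> 1"
    | (sub) "length bs \<noteq> 1" "length as \<noteq> 1" "length xs \<noteq> 1"
  proof -
    have "length bs = 1 \<Longrightarrow> \<exists>b'. bs = [b'] \<and> i = 1" "length as = 1 \<Longrightarrow> \<exists>b'. as = [b'] \<and> j = 1"
      "length xs = 1 \<Longrightarrow> \<exists>b'. xs = [b']"
      using i j by (auto simp: length_Suc_conv)
    then show ?thesis using that by metis
  qed
  then show ?thesis
  proof cases
    case post
    note f' = f[unfolded post]
    have q: "f \<in> Hom D b' d" using f' bs d by (simp add: post SHom_unary)
    consider (post2) a' where "as = [a']" "j = 1" | (pre) x where "xs = [x]" "length as \<noteq> 1"
      | (sub) "length as \<noteq> 1" "length xs \<noteq> 1"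
    proof -
      have "length as = 1 \<Longrightarrow> \<exists>b'. as = [b'] \<and> j = 1" "length xs = 1 \<Longrightarrow> \<exists>b'. xs = [b']"
        using j by (auto simp: length_Suc_conv)
      then show ?thesis using that by metis
    qed
    then show ?thesis
    proof cases
      case post2
      then show ?thesis
        using post_post[of xs a' b' d g f h] la xs a d h g as bs b post_unary[of a' b' d g f] q
        by (simp add: post scomp_post SHom_unary)
    next
      case pre
      have x: "x \<in> SOb C" "h \<in> Hom D x ?a" using xs h a by (simp_all add: pre SHom_unary)
      have "scomp C as b' j [x] g h = pre C as b' j x g h" "scomp C as d j [x] (post C as b' d f g) h = pre C as d j x (post C as b' d f g) h"
        using as b d j x g h la q by (auto intro!: scomp_pre post_in simp: post pre)
      then show ?thesis
        using post_pre[of as x b' d j h f g] la as x b d j q g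
        by (simp add: post pre scomp_post plug_single)
    next
      case sub
      then have "(length as, length xs) \<in> sub_arities" using ok(2) by (auto simp: ok_True)
      then show ?thesis
        using SSub_nat_target[of as xs j b' d g h f] as xs b d g h q j
        by (simp add: post scomp_post scomp_SSub)
    qed
  next
    case mid
    have g': "g \<in> Hom D a' ?b" using g as b by (simp add: mid SHom_unary)
    have a': "a' \<in> SOb C" using as mid by simp
    have pre1: "scomp C bs d i [a'] f g = pre C bs d i a' f g"
      using scomp_pre[of bs d a' i f g] bs d a' i f g by (simp add: mid)
    have bs': "set (bs[i - Suc 0 := a']) \<subseteq> SOb C" using bs a' by (rule set_update)
    have prein: "pre C bs d i a' f g \<in> SHom C (bs[i - Suc 0 := a']) d"
      using pre_in[of bs a' d i g f] la bs a' d i g' f by simp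
    have gh': "scomp C [a'] ?b 1 xs g h = post C xs a' ?b g h" by (simp add: scomp_post)
    show ?thesis
    proof (cases "length xs = 1")
      case True
      then obtain x where x: "xs = [x]" by (auto simp: length_Suc_conv)
      have x': "x \<in> SOb C" "h \<in> Hom D x a'" using xs h a' by (simp_all add: x mid SHom_unary)
      have "scomp C bs d i [x] f (post C [x] a' ?b g h) = pre C bs d i x f (Cmp D x a' ?b g h)"
        using scomp_pre[of bs d x i f "Cmp D x a' ?b g h"] post_unary[of x a' ?b h g] bs d x' i f b a' g'
        by (simp add: SHom_unary D.Cmp_in)
      moreover have "scomp C (bs[i - Suc 0 := a']) d i [x] (pre C bs d i a' f g) h = pre C (bs[i - Suc 0 := a']) d i x (pre C bs d i a' f g) h"
        using bs' d x' i prein a' by (intro scomp_pre) (auto simp: SHom_unary)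
      ultimately show ?thesis
        using pre_pre_same[of bs a' x d i g h f] la bs a' x' d i g' f gh' pre1
        by (simp add: mid x plug_single)
    next
      case False
      then have sub: "(length bs, length xs) \<in> sub_arities" using ok(4) mid by (auto simp: ok_True)
      then show ?thesis
        using SSub_dinat[of bs xs i a' d f h g] bs xs a' d f h g' i gh' pre1
        by (simp add: mid plug_single scomp_SSub)
    qed
  next
    case pre
    then have sub: "(length bs, length as) \<in> sub_arities" using ok(1) by (auto simp: ok_True)
    have x: "x \<in> SOb C" "h \<in> Hom D x ?a" using xs h a by (simp_all add: pre SHom_unary)
    have 1: "scomp C as ?b j [x] g h = pre C as ?b j x g h"
      using scomp_pre[of as ?b x j g h] as b x j g h pre by simp
    have 2: "scomp C (plug bs i as) d (j + i - 1) [x] (scomp C bs d i as f g) h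
        = pre C (plug bs i as) d (j + i - 1) x (scomp C bs d i as f g) h"
      using pa d x fg i j h pre nth
      by (intro scomp_pre) (auto simp: length_plug)
    show ?thesis
      unfolding pre(1) 1 2
      using SSub_nat_inner[of bs as i j x d f g h] sub i j bs as x d f g
      by (simp add: plug_single scomp_SSub add.commute)
  next
    case sub
    then have "(length bs, length as) \<in> sub_arities" "(length as, length xs) \<in> sub_arities"
      using ok(1,2) by (auto simp: ok_True)
    moreover have "length bs = 2" "(length as, length xs) \<in> {(2, 2), (2, 0)}"
      using ok_True_nested[OF calculation ok(3,4)] by simp_all
    ultimately show ?thesis
      using assoc_nested[of bs as xs i j d f g h] assms by simp
  qed
qed

text \<open>As before: commutation of actions in different variables, naturality in an earlier or a
  later variable, or the axiom.\<close>

lemma scomp_parallel: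
  assumes bs: "set bs \<subseteq> SOb C" and as: "set as \<subseteq> SOb C" and xs: "set xs \<subseteq> SOb C" and d: "d \<in> SOb C"
    and f: "f \<in> SHom C bs d" and g: "g \<in> SHom C as (bs ! (i - 1))" and h: "h \<in> SHom C xs (bs ! (j - 1))"
    and i: "0 < i" "i < j" and j: "j \<le> length bs"
    and ok: "ok True (length bs) (length as)" "ok True (length bs) (length xs)"
      "ok True (length bs + length as - 1) (length xs)" "ok True (length bs + length xs - 1) (length as)"
    and not300: "\<not> (length bs = 3 \<and> length as = 0 \<and> length xs = 0)"
  shows "scomp C (plug bs j xs) d i as (scomp C bs d j xs f h) g
      = scomp C (plug bs i as) d (j + length as - 1) xs (scomp C bs d i as f g) h"
proof -
  let ?b = "bs ! (i - 1)" and ?c = "bs ! (j - 1)"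
  have b: "?b \<in> SOb C" and c: "?c \<in> SOb C" using bs i j by (auto intro: nth_SOb)
  have fh: "scomp C bs d j xs f h \<in> SHom C (plug bs j xs) d"
    using scomp_in[OF bs xs d f _ j h ok(2)] i by simp
  have fg: "scomp C bs d i as f g \<in> SHom C (plug bs i as) d"
    using scomp_in[OF bs as d f i(1) _ g ok(1)] i j by simp
  have pa: "set (plug bs j xs) \<subseteq> SOb C" "set (plug bs i as) \<subseteq> SOb C"
    using bs as xs by (simp_all add: set_plug)
  have la: "length as \<le> 4" "length bs \<le> 4" "length xs \<le> 4"
    using ok_True_bounds[OF ok(1)] ok_True_bounds[OF ok(2)] by simp_all
  have nb: "length bs \<noteq> 1" using i j by simp
  have nth1: "plug bs j xs ! (i - Suc 0) = ?b" and len1: "i \<le> length (plug bs j xs)"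
    using i j by (auto simp: plug_def nth_append)
  have nth2: "plug bs i as ! (j + length as - Suc (Suc 0)) = ?c" and len2: "j + length as - Suc 0 \<le> length (plug bs i as)"
    using i j by (auto simp: plug_def nth_append min_def)
  have pre_g: "scomp C (plug bs j xs) d i [a] (scomp C bs d j xs f h) g = pre C (plug bs j xs) d i a (scomp C bs d j xs f h) g"
    "scomp C bs d i [a] f g = pre C bs d i a f g" if "as = [a]" for a
    using that as bs f g d pa fh i j nth1 len1 by (auto intro!: scomp_pre)
  have pre_h: "scomp C (plug bs i as) d (j + length as - 1) [x] (scomp C bs d i as f g) h = pre C (plug bs i as) d (j + length as - 1) x (scomp C bs d i as f g) h"
    "scomp C bs d j [x] f h = pre C bs d j x f h" if "xs = [x]" for x
    using that xs bs f h d pa fg i j nth2 len2 by (auto intro!: scomp_pre)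
  have one: "\<exists>a. as = [a]" if "length as = 1" for as :: "'o list" using that by (auto simp: length_Suc_conv)
  consider (both) a x where "as = [a]" "xs = [x]" | (as) a where "as = [a]" "length xs \<noteq> 1"
    | (xs) x where "xs = [x]" "length as \<noteq> 1" | (none) "length as \<noteq> 1" "length xs \<noteq> 1"
    using one by metis
  then show ?thesis
  proof cases
    case both
    have "a \<in> SOb C" "x \<in> SOb C" "g \<in> Hom D a ?b" "h \<in> Hom D x ?c"
      using as xs b c g h by (simp_all add: both SHom_unary)
    then show ?thesis
      using pre_pre_commute[of bs x a d j i h g f] pre_g[OF both(1)] pre_h[OF both(2)] la bs d f i j
      by (simp add: both plug_single)
  next
    case as: as
    then have sub: "(length bs, length xs) \<in> sub_arities" using ok(2) nb by (auto simp: ok_True)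
    have "a \<in> SOb C" "g \<in> Hom D a ?b" using assms(2) b g by (simp_all add: as SHom_unary)
    then show ?thesis
      using SSub_nat_before[of bs xs j i a d f h g] sub pre_g[OF as(1)] bs xs d f h i j
      by (simp add: as plug_single scomp_SSub)
  next
    case xs: xs
    then have sub: "(length bs, length as) \<in> sub_arities" using ok(1) nb by (auto simp: ok_True)
    have "x \<in> SOb C" "h \<in> Hom D x ?c" using assms(3) c h by (simp_all add: xs SHom_unary)
    then show ?thesis
      using SSub_nat_after[of bs as i j x d f g h] sub pre_h[OF xs(1)] bs as d f g i j
      by (simp add: xs plug_single scomp_SSub)
  next
    case none
    then have "(length bs, length as) \<in> sub_arities" "(length bs, length xs) \<in> sub_arities"
      using ok(1,2) nb by (auto simp: ok_True)
    moreover have n: "length bs = 2" "(length as, length xs) \<in> {(2, 2), (2, 0), (0, 2), (0, 0)}"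
      using ok_True_parallel[OF calculation ok(3,4) not300] by simp_all
    moreover have ij: "i = 1" "j = 2" using n(1) i j by auto
    ultimately show ?thesis
      using assoc_parallel[of bs as xs d f g h] assms unfolding ij by (simp add: numeral_2_eq_2)
  qed
qed

lemma partial_multicategory_short: "partial_multicategory X True"
proof (rule partial_multicategory.intro)
  show "category (DCat X)" using unary_category by simp
next
  fix p q :: "('o, 'a) mmap" and i
  assume "p \<in> M" "q \<in> M" "fits True p i q"
  then show "mcomp X p i q \<in> M"
    using scomp_in[of "src p" "src q" "tgt p" "val p" i "val q"] ok_arity(3)[of True "length (src p)" "length (src q)"]
    by (cases p; cases q) (auto simp: maps_def fits_def mcomp_def length_plug set_plug)
next
  fix p :: "('o, 'a) mmap" and i a
  assume p: "p \<in> M" "0 < i" "i \<le> length (src p)" "src p ! (i - Suc 0) = a"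
  then have "a \<in> SOb C" using nth_SOb by (auto simp: M_iff)
  then show "mcomp X p i (um (ide (DCat X) a)) = p"
    using p scomp_pre[of "src p" "tgt p" a i "val p" "Id D a"] pre_Id[of "src p" "tgt p" "val p" i]
    by (cases p) (auto simp: mcomp_def M_iff um_def ide_def SHom_unary D.Id_in plug_single)
next
  fix p :: "('o, 'a) mmap" and a
  assume "p \<in> M" "tgt p = a"
  then show "mcomp X (um (ide (DCat X) a)) (Suc 0) p = p"
    by (cases p) (auto simp: mcomp_def M_iff um_def ide_def scomp_post post_Id)
next
  fix p q r :: "('o, 'a) mmap" and i j
  assume "p \<in> M" "q \<in> M" "r \<in> M" "fits True p i q" "fits True q j r"
    "ok True (length (src p) + length (src q) - Suc 0) (length (src r))"
    "ok True (length (src p)) (length (src q) + length (src r) - Suc 0)"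
  then show "mcomp X p i (mcomp X q j r) = mcomp X (mcomp X p i q) (j + i - Suc 0) r"
    using scomp_nested[of "src p" "src q" "src r" "tgt p" "val p" "val q" i "val r" j]
    by (simp add: mcomp_def M_iff fits_def plug_nested)
next
  fix p q r :: "('o, 'a) mmap" and i j
  assume "p \<in> M" "q \<in> M" "r \<in> M" "i < j" "fits True p i q" "fits True p j r"
    "ok True (length (src p) + length (src q) - Suc 0) (length (src r))"
    "ok True (length (src p) + length (src r) - Suc 0) (length (src q))"
    "\<not> (length (src p) = 3 \<and> length (src q) = 0 \<and> length (src r) = 0)"
  then show "mcomp X (mcomp X p j r) i q = mcomp X (mcomp X p i q) (j + length (src q) - Suc 0) r"
    using scomp_parallel[of "src p" "src q" "src r" "tgt p" "val p" "val q" i "val r" j]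
    by (auto simp: mcomp_def M_iff fits_def plug_parallel)
qed (simp_all add: SHom_unary scomp_post post_unary)

end


section \<open>Acting by unary maps in all inputs\<close>

definition arr_list :: "'o list \<Rightarrow> 'o list \<Rightarrow> 'a list \<Rightarrow> ('o, 'a) arr list" where
  "arr_list as' as ps = map (\<lambda>k. Arr (as' ! k) (as ! k) (ps ! k)) [0..<length ps]"

lemma length_arr_list [simp]: "length (arr_list as' as ps) = length ps"
  by (simp add: arr_list_def)

lemma nth_arr_list [simp]: "k < length ps \<Longrightarrow> arr_list as' as ps ! k = Arr (as' ! k) (as ! k) (ps ! k)"
  by (simp add: arr_list_def)

text \<open>\<open>f \<circ>\<^sub>1 p\<^sub>1 \<circ>\<^sub>2 \<dots> \<circ>\<^sub>k p\<^sub>k\<close>.\<close>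

primrec acts :: "('o, 'a) comp_data \<Rightarrow> ('o, 'a) mmap \<Rightarrow> ('o, 'a) arr list \<Rightarrow> nat \<Rightarrow> ('o, 'a) mmap" where
  "acts X f ps 0 = f"
| "acts X f ps (Suc k) = mcomp X (acts X f ps k) (Suc k) (um (ps ! k))"

lemma plug_take_drop: "\<lbrakk>k < length as; k < length as'; a = as' ! k\<rbrakk>
    \<Longrightarrow> plug (take k as' @ drop k as) (Suc k) [a] = take (Suc k) as' @ drop (Suc k) as"
  by (simp add: plug_def take_Suc_conv_app_nth)

context partial_multicategory
begin

definition composable :: "('o, 'a) mmap \<Rightarrow> ('o, 'a) arr list \<Rightarrow> nat \<Rightarrow> bool" where
  "composable f ps k \<longleftrightarrow> f \<in> M \<and> k \<le> length (src f) \<and> k \<le> length ps \<and>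
     (\<forall>l<k. ps ! l \<in> arrs (DCat X) \<and> cd (ps ! l) = src f ! l)"

lemma composable_pred: "composable f ps (Suc k) \<Longrightarrow> composable f ps k"
  by (auto simp: composable_def)

lemma acts_typing:
  assumes "composable f ps k"
  shows "acts X f ps k \<in> M \<and> src (acts X f ps k) = take k (map dm ps) @ drop k (src f) \<and> tgt (acts X f ps k) = tgt f"
  using assms
proof (induction k)
  case (Suc k)
  then have IH: "acts X f ps k \<in> M" "src (acts X f ps k) = take k (map dm ps) @ drop k (src f)" "tgt (acts X f ps k) = tgt f"
    and c: "k < length (src f)" "k < length ps" "ps ! k \<in> arrs (DCat X)" "cd (ps ! k) = src f ! k"
    using composable_pred by (auto simp: composable_def)
  have l: "length (src (acts X f ps k)) = length (src f)" using c by (simp add: IH)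
  have "ok sh (length (src f)) (Suc 0)"
    using mapsD(4)[OF IH(1)] c by (intro ok_post) (auto simp: l)
  moreover have "src (acts X f ps k) ! k = src f ! k" using c by (simp add: IH nth_append)
  ultimately show ?case
    using IH c l plug_take_drop[of k "src f" "map dm ps" "dm (ps ! k)"] by simp
qed (simp add: composable_def)

lemmas acts_simps = acts_typing[THEN conjunct1] acts_typing[THEN conjunct2, THEN conjunct1]
  acts_typing[THEN conjunct2, THEN conjunct2]

lemma length_acts: "composable f ps k \<Longrightarrow> length (src (acts X f ps k)) = length (src f)"
  using acts_simps(2)[of f ps k] by (simp add: composable_def)

lemma nth_src_acts: "composable f ps k \<Longrightarrow> k \<le> l \<Longrightarrow> l < length (src f) \<Longrightarrow> src (acts X f ps k) ! l = src f ! l"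
  using acts_simps(2)[of f ps k] by (simp add: composable_def nth_append)

lemma ok_unary: "\<lbrakk>f \<in> M; k < length (src f)\<rbrakk> \<Longrightarrow> ok sh (length (src f)) (Suc 0)"
  using mapsD(4) ok_post[of sh "length (src f)"] by fastforce

lemma acts_ide:
  assumes "f \<in> M" "k \<le> length (src f)" "\<And>l. l < k \<Longrightarrow> ps ! l = ide (DCat X) (src f ! l)"
  shows "acts X f ps k = f"
  using assms by (induction k) (simp_all add: mcomp_Id)

lemma acts_single:
  assumes "f \<in> M" "0 < i" "i \<le> length (src f)" "length ps = length (src f)" "p \<in> arrs (DCat X)" "cd p = src f ! (i - Suc 0)"
    "ps ! (i - Suc 0) = p" "\<And>l. l < length (src f) \<Longrightarrow> l \<noteq> i - Suc 0 \<Longrightarrow> ps ! l = ide (DCat X) (src f ! l)"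
  shows "acts X f ps (length (src f)) = f \<bullet>\<^bsub>i\<^esub> um p"
proof -
  have *: "acts X f ps k = f \<bullet>\<^bsub>i\<^esub> um p" if "i \<le> k" "k \<le> length (src f)" for k
    using that
  proof (induction k)
    case (Suc k)
    show ?case
    proof (cases "i = Suc k")
      case True
      then show ?thesis using acts_ide[of f k ps] assms Suc by simp
    next
      case False
      then have "acts X f ps k = f \<bullet>\<^bsub>i\<^esub> um p" using Suc by simp
      moreover have "src (f \<bullet>\<^bsub>i\<^esub> um p) ! k = src f ! k"
        using assms Suc False by (simp add: plug_single)
      ultimately show ?thesis
        using assms Suc False ok_unary[OF assms(1), of k] by (simp add: mcomp_Id length_plug)
    qed
  qed (use assms in simp)
  show ?thesis using * assms by simp
qed

lemma acts_post:
  assumes "composable f ps k" "q \<in> arrs (DCat X)" "dm q = tgt f"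
  shows "acts X (um q \<bullet>\<^sub>1 f) ps k = um q \<bullet>\<^sub>1 acts X f ps k"
  using assms(1)
proof (induction k)
  case (Suc k)
  note c = composable_pred[OF Suc.prems]
  have f: "f \<in> M" "k < length (src f)" using Suc.prems by (simp_all add: composable_def)
  have "um q \<bullet>\<^sub>1 (acts X f ps k \<bullet>\<^bsub>Suc k\<^esub> um (ps ! k)) = (um q \<bullet>\<^sub>1 acts X f ps k) \<bullet>\<^bsub>Suc k + Suc 0 - Suc 0\<^esub> um (ps ! k)"
    by (rule mcomp_nested)
      (use Suc.prems c f assms(2,3) acts_simps[OF c] length_acts[OF c] nth_src_acts[OF c, of k] mapsD(4)[OF f(1)] ok_unary[OF f(1,2)]
        in \<open>auto simp: composable_def fits_def\<close>)
  then show ?case using Suc.IH[OF c] by simp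
qed simp

lemma acts_commute:
  assumes "composable f ps k" "k < j" "j \<le> length (src f)" "p \<in> arrs (DCat X)" "cd p = src f ! (j - Suc 0)"
  shows "acts X (f \<bullet>\<^bsub>j\<^esub> um p) ps k = acts X f ps k \<bullet>\<^bsub>j\<^esub> um p"
  using assms(1,2)
proof (induction k)
  case (Suc k)
  note c = composable_pred[OF Suc.prems(1)]
  have f: "f \<in> M" "k < length (src f)" using Suc.prems by (simp_all add: composable_def)
  have "(acts X f ps k \<bullet>\<^bsub>j\<^esub> um p) \<bullet>\<^bsub>Suc k\<^esub> um (ps ! k)
      = (acts X f ps k \<bullet>\<^bsub>Suc k\<^esub> um (ps ! k)) \<bullet>\<^bsub>j + length (src (um (ps ! k))) - Suc 0\<^esub> um p"
    by (rule mcomp_parallel)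
      (use Suc.prems c f assms(3-5) acts_simps[OF c] length_acts[OF c] nth_src_acts[OF c, of k] nth_src_acts[OF c, of "j - Suc 0"]
         mapsD(4)[OF f(1)] ok_unary[OF f(1,2)] in \<open>auto simp: composable_def fits_def\<close>)
  then show ?case using Suc c by simp
qed simp

lemma acts_acts:
  assumes "composable f ps k" "length ps' = length ps" "\<And>l. l < k \<Longrightarrow> ps' ! l \<in> arrs (DCat X) \<and> cd (ps' ! l) = dm (ps ! l)"
    "\<And>l. l < k \<Longrightarrow> qs ! l = acomp (DCat X) (ps ! l) (ps' ! l)"
  shows "acts X f qs k = acts X (acts X f ps k) ps' k"
  using assms
proof (induction k)
  case (Suc k)
  note c = composable_pred[OF Suc.prems(1)]
  have f: "f \<in> M" "k < length (src f)" "ps ! k \<in> arrs (DCat X)" "cd (ps ! k) = src f ! k"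
    "ps' ! k \<in> arrs (DCat X)" "cd (ps' ! k) = dm (ps ! k)" "k < length ps"
    using Suc.prems by (auto simp: composable_def)
  let ?g = "acts X f ps k"
  note g = acts_simps[OF c] length_acts[OF c] nth_src_acts[OF c order_refl f(2)]
  have c': "composable ?g ps' k"
    using Suc.prems f g c by (auto simp: composable_def nth_append)
  note g' = acts_simps[OF c'] length_acts[OF c'] nth_src_acts[OF c' order_refl, unfolded g(4,5), OF f(2)]
  have ok: "ok sh (length (src f)) (Suc 0)" "ok sh (Suc 0) (length (src f))" using ok_unary[OF f(1,2)] mapsD(4)[OF f(1)] f(2) by auto
  have "acts X f qs (Suc k) = acts X ?g ps' k \<bullet>\<^bsub>Suc k\<^esub> (um (ps ! k) \<bullet>\<^sub>1 um (ps' ! k))"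
    using Suc.IH[OF c] Suc.prems f by (simp add: um_acomp)
  also have "\<dots> = (acts X ?g ps' k \<bullet>\<^bsub>Suc k\<^esub> um (ps ! k)) \<bullet>\<^bsub>Suc 0 + Suc k - Suc 0\<^esub> um (ps' ! k)"
    by (rule mcomp_nested) (use f g g' ok in \<open>auto simp: fits_def\<close>)
  also have "acts X ?g ps' k \<bullet>\<^bsub>Suc k\<^esub> um (ps ! k) = acts X (?g \<bullet>\<^bsub>Suc k\<^esub> um (ps ! k)) ps' k"
    by (rule acts_commute[symmetric]) (use c' f g in auto)
  finally show ?case by simp
qed simp

end

lemma (in multi_morphism) act_acts:
  assumes "X.composable f ps k"
  shows "act F \<phi> (acts X f ps k) = acts Y (act F \<phi> f) (map (fmap F) ps) k"
  using assms
proof (induction k)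
  case (Suc k)
  note c = X.composable_pred[OF Suc.prems]
  have "fits sh (acts X f ps k) (Suc k) (um (ps ! k))"
    using Suc.prems X.length_acts[OF c] X.nth_src_acts[OF c, of k] X.ok_unary[of f k]
    by (auto simp: X.composable_def fits_def)
  then show ?case
    using Suc c X.acts_simps[OF c] by (auto simp: X.composable_def act_mcomp act_um)
qed simp

text \<open>By functoriality the action of many arrows at once is a composite of actions in one variable.
  A short multicategory therefore carries no more information than its partial multicategory,
  and naturality of morphisms can be tested one variable at a time.\<close>

lemma (in short_multicategory) SAct_acts:
  assumes "length as \<le> 4" "set as \<subseteq> SOb C" "set as' \<subseteq> SOb C" "b \<in> SOb C" "b' \<in> SOb C"
    "hom_list D as' as ps" "q \<in> Hom D b b'" "f \<in> SHom C as b"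
  shows "MMap as' b' (SAct C as as' b b' ps q f)
    = mcomp X (um (Arr b b' q)) (Suc 0) (acts X (MMap as b f) (arr_list as' as ps) (length as))"
proof -
  let ?as = "\<lambda>k. take k as' @ drop k as" and ?ps = "\<lambda>k. take k ps @ drop k (ids as)"
  have l: "length as = length ps" "length as' = length ps" using assms(6) by (simp_all add: hom_list_def)
  have obs: "as ! k \<in> SOb C" "as' ! k \<in> SOb C" "ps ! k \<in> Hom D (as' ! k) (as ! k)" if "k < length ps" for k
    using assms that l nth_SOb by (auto simp: hom_list_def)
  have set: "set (?as k) \<subseteq> SOb C" for k
    using assms by (auto dest: in_set_takeD in_set_dropD)
  have hom: "hom_list D (?as k) as (?ps k)" if "k \<le> length ps" for k
    using that l obs by (auto simp: hom_list_def nth_append D.Id_in)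
  have main: "acts X (MMap as b f) (arr_list as' as ps) k = MMap (?as k) b (SAct C as (?as k) b b (?ps k) (Id D b) f)"
    if "k \<le> length ps" for k
    using that
  proof (induction k)
    case 0
    then show ?case using SAct_Id assms by simp
  next
    case (Suc k)
    let ?g = "SAct C as (?as k) b b (?ps k) (Id D b) f"
    have k: "k < length ps" and k': "k \<le> length ps" using Suc.prems by simp_all
    have nth: "?as k ! k = as ! k" using k l by (simp add: nth_append)
    have g: "?g \<in> SHom C (?as k) b"
      by (rule SAct_in) (use assms set hom[OF k'] D.Id_in in auto)
    have upd: "(?as k)[k := as' ! k] = ?as (Suc k)"
      using plug_single[of "Suc k" "?as k" "as' ! k"] plug_take_drop[of k as as' "as' ! k"] k l by simp
    have ps: "(ids (?as k))[k := ps ! k] ! l \<in> Hom D (?as (Suc k) ! l) (?as k ! l)" if "l < length ps" for l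
    proof (cases "l = k")
      case True
      then show ?thesis using obs[OF k] k l by (simp add: nth_append take_Suc_conv_app_nth)
    next
      case False
      have "?as (Suc k) ! l = ?as k ! l" using upd[symmetric] False by simp
      moreover have "?as k ! l \<in> SOb C" using that l k set nth_SOb by simp
      moreover have "ids (?as k) ! l = Id D (?as k ! l)" using that l k by (intro nth_map) simp
      ultimately show ?thesis using False D.Id_in[of "?as k ! l"] by (metis nth_list_update_neq)
    qed
    have hl: "hom_list D (?as (Suc k)) (?as k) ((ids (?as k))[k := ps ! k])"
      using ps k l by (simp add: hom_list_def)
    have "Cmp_list D (?as (Suc k)) (?as k) as (?ps k) ((ids (?as k))[k := ps ! k]) = ?ps (Suc k)"
    proof (rule nth_equalityI)
      fix j assume "j < length (Cmp_list D (?as (Suc k)) (?as k) as (?ps k) ((ids (?as k))[k := ps ! k]))"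
      then have j: "j < length ps" using k l by simp
      consider "j < k" | "j = k" | "j > k" by linarith
      then show "Cmp_list D (?as (Suc k)) (?as k) as (?ps k) ((ids (?as k))[k := ps ! k]) ! j = ?ps (Suc k) ! j"
      proof cases
        case 1
        then show ?thesis using j k l obs[OF j]
          by (simp add: nth_Cmp_list nth_append D.Cmp_Id)
      next
        case 2
        then show ?thesis using k l obs[OF k]
          by (simp add: nth_Cmp_list nth_append take_Suc_conv_app_nth D.Id_Cmp)
      next
        case 3
        then show ?thesis using j k l obs[OF j]
          by (simp add: nth_Cmp_list nth_append D.Id_Cmp D.Id_in)
      qed
    qed (use k l in simp)
    then have "pre C (?as k) b (Suc k) (as' ! k) ?g (ps ! k) = SAct C as (?as (Suc k)) b b (?ps (Suc k)) (Id D b) f"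
      using SAct_Cmp[of as "?as k" "?as (Suc k)" b b b "?ps k" "(ids (?as k))[k := ps ! k]" "Id D b" "Id D b" f]
        hl hom[OF k'] assms set by (simp add: pre_def upd D.Id_in D.Id_Cmp del: map_append)
    moreover have "scomp C (?as k) b (Suc k) [as' ! k] ?g (ps ! k) = pre C (?as k) b (Suc k) (as' ! k) ?g (ps ! k)"
      by (rule scomp_pre) (use set assms obs[OF k] k l g nth in \<open>simp_all add: SHom_unary del: append_take_drop_id\<close>)
    ultimately show ?case
      using Suc k l plug_take_drop[of k as as' "as' ! k"] by (simp add: mcomp_def)
  qed
  have "SAct C as as' b b' ps q f = post C as' b b' q (SAct C as as' b b ps (Id D b) f)"
    using SAct_Cmp[of as as' as' b b b' ps "ids as'" "Id D b" q f] assms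
    by (simp add: post_def D.Id_in D.Cmp_Id)
  then show ?thesis
    using main[of "length ps"] l by (simp add: mcomp_def scomp_post)
qed

section \<open>Morphisms of short multicategories\<close>

lemma multi_morphism_cong:
  assumes "multi_morphism X Y sh F \<phi>"
    and "\<And>as b f. MMap as b f \<in> maps X sh \<Longrightarrow> \<phi>' as b f = \<phi> as b f"
  shows "multi_morphism X Y sh F \<phi>'"
proof -
  interpret multi_morphism X Y sh F \<phi> by fact
  have [simp]: "act F \<phi>' p = act F \<phi> p" if "p \<in> maps X sh" for p
    using assms(2)[of "src p" "tgt p" "val p"] that by (simp add: act_def)
  show ?thesis
    by unfold_locales (simp_all add: X.mcomp_in act_um act_mcomp)
qed

lemma short_morphism_is_multi_morphism:
  fixes C D :: "('o, 'a) shmulti"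
  assumes "short_multicategory C" "short_multicategory D" "short_multi_morphism C D F"
  shows "multi_morphism (short_data C) (short_data D) True (SFun F) (SMap F)"
proof -
  interpret C: short_multicategory C by fact
  interpret D: short_multicategory D by fact
  interpret F: short_multi_morphism C D F by fact
  interpret G: is_functor "SUnary C" "SUnary D" "SFun F" by (rule F.unary_functor)
  let ?F = "FOb (SFun F)"
  interpret CX: partial_multicategory C.X True by (rule C.partial_multicategory_short)
  interpret DX: partial_multicategory D.X True by (rule D.partial_multicategory_short)
  have map_in: "set (map ?F as) \<subseteq> SOb D" if "set as \<subseteq> SOb C" for as
    using that G.FOb_in by auto
  have FHom_ids: "FHom_list (SFun F) as as (C.ids as) = D.ids (map ?F as)" if "set as \<subseteq> SOb C" for as
    using that by (intro nth_equalityI) (auto simp: FHom_list_def G.FHom_Id C.nth_SOb)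
  have post_eq: "SMap F as c (post C as b c q f) = post D (map ?F as) (?F b) (?F c) (FHom (SFun F) b c q) (SMap F as b f)"
    if "length as \<le> 4" "set as \<subseteq> SOb C" "b \<in> SOb C" "c \<in> SOb C" "q \<in> Hom C.D b c" "f \<in> SHom C as b" for as b c q f
    using F.SMap_natural[of as as b c "C.ids as" q f] that by (simp add: post_def FHom_ids)
  have pre_eq: "SMap F (as[i - 1 := a]) b (pre C as b i a f p)
      = pre D (map ?F as) (?F b) i (?F a) (SMap F as b f) (FHom (SFun F) a (as ! (i - 1)) p)"
    if "length as \<le> 4" "set as \<subseteq> SOb C" "a \<in> SOb C" "b \<in> SOb C" "0 < i" "i \<le> length as"
      "p \<in> Hom C.D a (as ! (i - 1))" "f \<in> SHom C as b" for as a b i p f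
  proof -
    have "FHom_list (SFun F) (as[i - 1 := a]) as ((C.ids as)[i - 1 := p])
        = (D.ids (map ?F as))[i - 1 := FHom (SFun F) a (as ! (i - 1)) p]"
      using that by (intro nth_equalityI) (auto simp: FHom_list_def G.FHom_Id C.nth_SOb nth_list_update)
    then show ?thesis
      using F.SMap_natural[of as "as[i - 1 := a]" b b "(C.ids as)[i - 1 := p]" "Id C.D b" f] that C.set_update[of as a "i - 1"]
      by (simp add: pre_def C.D.Id_in G.FHom_Id map_update)
  qed
  show ?thesis
  proof (intro multi_morphism.intro multi_morphism_axioms.intro C.partial_multicategory_short D.partial_multicategory_short)
    show "is_functor (DCat C.X) (DCat D.X) (SFun F)" using F.unary_functor by simp
  next
    fix p assume "p \<in> C.M"
    then show "act (SFun F) (SMap F) p \<in> D.M"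
      using F.SMap_in[of "src p" "tgt p" "val p"] G.FOb_in by (auto simp: C.M_iff D.M_iff act_def)
  next
    fix k :: "('o, 'a) arr" assume "k \<in> arrs (DCat C.X)"
    then show "act (SFun F) (SMap F) (um k) = um (fmap (SFun F) k)"
      using F.SMap_unary[of "dm k" "cd k" "raw k"] by (simp add: act_def um_def fmap_def arrs_def)
  next
    fix p q :: "('o, 'a) mmap" and i assume A: "p \<in> C.M" "q \<in> C.M" "fits True p i q"
    obtain bs c f as b g where pq: "p = MMap bs c f" "q = MMap as b g" by (cases p; cases q)
    have b: "b = bs ! (i - 1)" using A by (simp add: fits_def pq)
    have t: "set bs \<subseteq> SOb C" "c \<in> SOb C" "f \<in> SHom C bs c" "set as \<subseteq> SOb C" "b \<in> SOb C" "g \<in> SHom C as b"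
      "length bs \<le> 4" "length as \<le> 4" "0 < i" "i \<le> length bs"
      using A by (auto simp: C.M_iff pq fits_def)
    have Ff: "SMap F bs c f \<in> SHom D (map ?F bs) (?F c)" "SMap F as b g \<in> SHom D (map ?F as) (?F b)"
      using t by (auto intro: F.SMap_in)
    have "SMap F (plug bs i as) c (scomp C bs c i as f g)
        = scomp D (map ?F bs) (?F c) i (map ?F as) (SMap F bs c f) (SMap F as b g)"
    proof -
      consider (post) b' where "bs = [b']" "i = 1" | (pre) a where "as = [a]" | (sub) "(length bs, length as) \<in> sub_arities"
        using A by (cases bs; cases as) (auto simp: fits_def pq C.ok_True)
      then show ?thesis
      proof cases
        case post
        then show ?thesis using post_eq[of as b c f g] t b F.SMap_unary[of b c f]
          by (simp add: C.scomp_post D.scomp_post C.SHom_unary)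
      next
        case pre
        have g: "g \<in> Hom C.D a b" and a: "a \<in> SOb C" using t by (simp_all add: pre C.SHom_unary)
        have "scomp C bs c i [a] f g = pre C bs c i a f g"
          using t b pre by (intro C.scomp_pre) auto
        moreover have "scomp D (map ?F bs) (?F c) i [?F a] (SMap F bs c f) (SMap F as b g)
            = pre D (map ?F bs) (?F c) i (?F a) (SMap F bs c f) (SMap F as b g)"
          using t b pre Ff G.FOb_in map_in by (intro D.scomp_pre) auto
        ultimately show ?thesis
          using pre_eq[of bs a c i g f]
            t b g a F.SMap_unary[of a b g] by (simp add: pre plug_single)
      next
        case sub
        then show ?thesis using F.SMap_SSub[of bs as i c f g] t b
          by (simp add: C.scomp_SSub D.scomp_SSub)
      qed
    qed
    then show "act (SFun F) (SMap F) (mcomp C.X p i q) = mcomp D.X (act (SFun F) (SMap F) p) i (act (SFun F) (SMap F) q)"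
      by (simp add: pq act_def mcomp_def map_plug)
  qed
qed

lemma restrict_SMap_idem: "restrict_SMap C (restrict_SMap C \<phi>) = restrict_SMap C \<phi>"
  by (simp add: restrict_SMap_def fun_eq_iff)

lemma multi_morphism_is_short_morphism:
  fixes C D :: "('o, 'a) shmulti"
  assumes "short_multicategory C" "short_multicategory D"
    and "multi_morphism (short_data C) (short_data D) True G \<phi>"
  shows "short_multi_morphism C D \<lparr>SFun = G, SMap = restrict_SMap C \<phi>\<rparr>"
proof -
  interpret C: short_multicategory C by fact
  interpret D: short_multicategory D by fact
  have r: "restrict_SMap C \<phi> as b f = \<phi> as b f" if "MMap as b f \<in> C.M" for as b f
    using that by (simp add: restrict_SMap_def C.M_iff)
  interpret F: multi_morphism C.X D.X True G "restrict_SMap C \<phi>"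
    by (rule multi_morphism_cong[OF assms(3) r])
  let ?\<phi> = "restrict_SMap C \<phi>"
  have comp: "?\<phi> (plug bs i as) c (scomp C bs c i as f g)
      = scomp D (map (FOb G) bs) (FOb G c) i (map (FOb G) as) (?\<phi> bs c f) (?\<phi> as b g)"
    if "MMap bs c f \<in> C.M" "MMap as b g \<in> C.M" "fits True (MMap bs c f) i (MMap as b g)" for bs c f as b g i
    using F.act_mcomp[OF that] by (simp add: act_def mcomp_def)
  show ?thesis
  proof (rule short_multi_morphism.intro, unfold shmor.simps)
    show "is_functor C.D D.D G" using F.is_functor_axioms by simp
  next
    fix as b f assume "length as \<le> 4" "set as \<subseteq> SOb C" "b \<in> SOb C" "f \<in> SHom C as b"
    then show "?\<phi> as b f \<in> SHom D (map (FOb G) as) (FOb G b)"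
      using F.act_maps[of "MMap as b f"] by (simp add: C.M_iff D.M_iff act_def)
  next
    fix as as' b b' ps q f
    assume A: "length as \<le> 4" "set as \<subseteq> SOb C" "set as' \<subseteq> SOb C" "b \<in> SOb C" "b' \<in> SOb C"
      "hom_list C.D as' as ps" "q \<in> Hom C.D b b'" "f \<in> SHom C as b"
    let ?F = "FOb G"
    have l: "length as = length ps" "length as' = length ps" using A(6) by (simp_all add: hom_list_def)
    have ps: "as' ! k \<in> SOb C" "as ! k \<in> SOb C" "ps ! k \<in> Hom C.D (as' ! k) (as ! k)" if "k < length ps" for k
      using A that l C.nth_SOb by (auto simp: hom_list_def)
    have c: "F.X.composable (MMap as b f) (arr_list as' as ps) (length as)"
      using A ps l by (simp add: F.X.composable_def C.M_iff)
    have fm: "fmap G (Arr a c k) = Arr (?F a) (?F c) (FHom G a c k)" for a c k by (simp add: fmap_def)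
    have al: "map (fmap G) (arr_list as' as ps) = arr_list (map ?F as') (map ?F as) (FHom_list G as' as ps)"
      using l by (intro nth_equalityI) (simp_all add: fm FHom_list_def)
    have hl: "hom_list D.D (map ?F as') (map ?F as) (FHom_list G as' as ps)"
      using l ps F.FHom_in by (auto simp: hom_list_def FHom_list_def)
    have mi: "set (map ?F xs) \<subseteq> SOb D" if "set xs \<subseteq> SOb C" for xs
      using that F.FOb_in by auto
    have Af: "?\<phi> as b f \<in> SHom D (map ?F as) (?F b)"
      using F.act_maps[of "MMap as b f"] A by (simp add: C.M_iff D.M_iff act_def)
    have "act G ?\<phi> (MMap as' b' (SAct C as as' b b' ps q f))
        = mcomp D.X (um (fmap G (Arr b b' q))) (Suc 0)
          (acts D.X (act G ?\<phi> (MMap as b f)) (map (fmap G) (arr_list as' as ps)) (length as))"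
      unfolding C.SAct_acts[OF A]
      using F.act_acts[OF c] F.X.acts_simps[OF c] A l ok_arity(1)[of True] F.act_um[of "Arr b b' q"] F.X.mapsD(4)[OF F.X.acts_simps(1)[OF c]]
      by (subst F.act_mcomp) (simp_all add: fits_def)
    also have "\<dots> = MMap (map ?F as') (?F b') (SAct D (map ?F as) (map ?F as') (?F b) (?F b') (FHom_list G as' as ps) (FHom G b b' q) (?\<phi> as b f))"
      using D.SAct_acts[of "map ?F as" "map ?F as'" "?F b" "?F b'" "FHom_list G as' as ps" "FHom G b b' q" "?\<phi> as b f"]
        A hl mi F.FOb_in F.FHom_in Af by (simp add: al fm act_def)
    finally show "?\<phi> as' b' (SAct C as as' b b' ps q f)
        = SAct D (map ?F as) (map ?F as') (?F b) (?F b') (FHom_list G as' as ps) (FHom G b b' q) (?\<phi> as b f)"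
      by (simp add: act_def)
  next
    fix a b f assume "a \<in> SOb C" "b \<in> SOb C" "f \<in> Hom C.D a b"
    then show "?\<phi> [a] b f = FHom G a b f"
      using F.act_um[of "Arr a b f"] by (simp add: act_def um_def fmap_def)
  next
    fix bs as :: "'o list" and i c f g
    assume A: "(length bs, length as) \<in> sub_arities" "i \<in> {1..length bs}" "set bs \<subseteq> SOb C" "set as \<subseteq> SOb C"
      "c \<in> SOb C" "f \<in> SHom C bs c" "g \<in> SHom C as (bs ! (i - 1))"
    moreover have "length bs \<le> 4" "length as \<le> 4" using A(1) by (auto simp: sub_arities_def)
    moreover have "bs ! (i - Suc 0) \<in> SOb C" using A C.nth_SOb by auto
    ultimately show "?\<phi> (plug bs i as) c (SSub C bs c i as f g)
        = SSub D (map (FOb G) bs) (FOb G c) i (map (FOb G) as) (?\<phi> bs c f) (?\<phi> as (bs ! (i - 1)) g)"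
      using comp[of bs c f as "bs ! (i - 1)" g i]
      by (simp add: C.M_iff fits_def C.ok_True C.scomp_SSub D.scomp_SSub)
  next
    show "?\<phi> = restrict_SMap C ?\<phi>" by (simp add: restrict_SMap_idem)
  qed
qed


section \<open>Multicategories as partial multicategories\<close>

lemma ok_False [simp]: "ok False n m \<longleftrightarrow> 0 < n"
  by (auto simp: ok_def)

context multicategory
begin

abbreviation "X \<equiv> multi_data M"
abbreviation "MM \<equiv> maps X False"

lemma X_simps [simp]: "DCat X = unary_cat M" "DHom X = MHom M" "DComp X = MSub M"
  by (simp_all add: multi_data_def)

lemma unary_cat_simps [simp]: "Ob (unary_cat M) = MOb M" "Hom (unary_cat M) a b = MHom M [a] b"
  "Id (unary_cat M) = MId M" "Cmp (unary_cat M) a b c g f = MSub M [b] c 1 [a] g f"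
  by (simp_all add: unary_cat_def)

lemma MM_iff: "p \<in> MM \<longleftrightarrow> set (src p) \<subseteq> MOb M \<and> tgt p \<in> MOb M \<and> val p \<in> MHom M (src p) (tgt p)"
  by (simp add: maps_def)

lemma nth_MOb: "set as \<subseteq> MOb M \<Longrightarrow> k < length as \<Longrightarrow> as ! k \<in> MOb M"
  by (auto simp: subset_iff)

lemma set_plug_MOb [simp]: "\<lbrakk>set as \<subseteq> MOb M; set bs \<subseteq> MOb M\<rbrakk> \<Longrightarrow> set (plug as i bs) \<subseteq> MOb M"
  by (rule set_plug)

lemma category_unary_cat: "category (unary_cat M)"
proof
  fix a b c d f g h
  assume "a \<in> Ob (unary_cat M)" "b \<in> Ob (unary_cat M)" "c \<in> Ob (unary_cat M)" "d \<in> Ob (unary_cat M)"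
    "f \<in> Hom (unary_cat M) a b" "g \<in> Hom (unary_cat M) b c" "h \<in> Hom (unary_cat M) c d"
  then show "Cmp (unary_cat M) a b d (Cmp (unary_cat M) b c d h g) f = Cmp3 (unary_cat M) a b c d h g f"
    using MSub_nested[of 1 "[c]" 1 "[b]" "[a]" d h g f] by simp
next
  fix a b c f g
  assume "a \<in> Ob (unary_cat M)" "b \<in> Ob (unary_cat M)" "c \<in> Ob (unary_cat M)"
    "f \<in> Hom (unary_cat M) a b" "g \<in> Hom (unary_cat M) b c"
  then show "Cmp (unary_cat M) a b c g f \<in> Hom (unary_cat M) a c"
    using MSub_in[of 1 "[b]" "[a]" c g f] by simp
next
  fix a b f assume "a \<in> Ob (unary_cat M)" "b \<in> Ob (unary_cat M)" "f \<in> Hom (unary_cat M) a b"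
  then show "Cmp (unary_cat M) a a b f (Id (unary_cat M) a) = f"
    and "Cmp (unary_cat M) a b b (Id (unary_cat M) b) f = f"
    using MSub_MId[of 1 "[a]" b f] MId_MSub[of "[a]" b f] by simp_all
qed (simp add: MId_in)

lemma partial_multicategory_multi: "partial_multicategory X False"
proof (rule partial_multicategory.intro)
  fix p q :: "('o, 'a) mmap" and i assume "p \<in> MM" "q \<in> MM" "fits False p i q"
  then show "mcomp X p i q \<in> MM"
    using MSub_in[of i "src p" "src q" "tgt p" "val p" "val q"] set_plug[of "src p" "MOb M" "src q" i]
    by (simp add: MM_iff fits_def mcomp_def)
next
  fix p :: "('o, 'a) mmap" and i a
  assume "p \<in> MM" "0 < i" "i \<le> length (src p)" "src p ! (i - Suc 0) = a"
  then show "mcomp X p i (um (ide (DCat X) a)) = p"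
    using MSub_MId[of i "src p" "tgt p" "val p"]
    by (cases p) (auto simp: MM_iff mcomp_def um_def ide_def plug_single)
next
  fix p :: "('o, 'a) mmap" and a assume "p \<in> MM" "tgt p = a"
  then show "mcomp X (um (ide (DCat X) a)) (Suc 0) p = p"
    using MId_MSub[of "src p" "tgt p" "val p"]
    by (cases p) (auto simp: MM_iff mcomp_def um_def ide_def)
next
  fix p q r :: "('o, 'a) mmap" and i j
  assume "p \<in> MM" "q \<in> MM" "r \<in> MM" "fits False p i q" "fits False q j r"
  then show "mcomp X p i (mcomp X q j r) = mcomp X (mcomp X p i q) (j + i - Suc 0) r"
    using MSub_nested[of i "src p" j "src q" "src r" "tgt p" "val p" "val q" "val r"]
    by (simp add: MM_iff mcomp_def fits_def plug_nested)
next
  fix p q r :: "('o, 'a) mmap" and i j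
  assume "p \<in> MM" "q \<in> MM" "r \<in> MM" "i < j" "fits False p i q" "fits False p j r"
  then show "mcomp X (mcomp X p j r) i q = mcomp X (mcomp X p i q) (j + length (src q) - Suc 0) r"
    using MSub_parallel[of i j "src p" "src q" "src r" "tgt p" "val p" "val q" "val r"]
    by (simp add: MM_iff mcomp_def fits_def plug_parallel)
qed (simp_all add: category_unary_cat)

sublocale pm: partial_multicategory X False
  by (rule partial_multicategory_multi)

lemma pre_upto_acts:
  assumes "length as' = length ps" "length as = length ps" "k \<le> length ps"
  shows "acts X (MMap as b f) (arr_list as' as ps) k = MMap (take k as' @ drop k as) b (pre_upto M as as' b ps f k)"
  using assms(3)
proof (induction k)
  case (Suc k)
  then show ?case
    using assms plug_take_drop[of k as as' "as' ! k"] by (simp add: mcomp_def del: append_take_drop_id)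
qed simp

abbreviation "U \<equiv> U_obj M"

lemma U_simps [simp]: "SUnary U = unary_cat M" "SHom U as b = (if length as \<le> 4 then MHom M as b else {})"
  "(length bs, length as) \<in> sub_arities \<Longrightarrow> SSub U bs c i as f g = MSub M bs c i as f g"
  by (simp_all add: U_obj_def)

lemma hom_listD:
  assumes "hom_list (unary_cat M) as' as ps" "set as \<subseteq> MOb M" "set as' \<subseteq> MOb M"
  shows "length as' = length ps" "length as = length ps"
    "k < length ps \<Longrightarrow> arr_list as' as ps ! k \<in> arrs (unary_cat M)"
  using assms nth_MOb by (auto simp: hom_list_def)

lemma SAct_U:
  assumes "hom_list (unary_cat M) as' as ps" "length as \<le> 4"
  shows "MMap as' b' (SAct U as as' b b' ps q f)
    = mcomp X (um (Arr b b' q)) (Suc 0) (acts X (MMap as b f) (arr_list as' as ps) (length as))"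
  using assms pre_upto_acts[of as' ps as "length ps" b f]
  by (simp add: hom_list_def U_obj_def mcomp_def)

lemma composable_U:
  assumes "hom_list (unary_cat M) as' as ps" "set as \<subseteq> MOb M" "set as' \<subseteq> MOb M"
    "b \<in> MOb M" "f \<in> MHom M as b"
  shows "pm.composable (MMap as b f) (arr_list as' as ps) (length as)"
  using assms hom_listD[OF assms(1-3)] by (auto simp: pm.composable_def MM_iff)

lemma src_acts_U:
  assumes "hom_list (unary_cat M) as' as ps" "set as \<subseteq> MOb M" "set as' \<subseteq> MOb M"
    "b \<in> MOb M" "f \<in> MHom M as b"
  shows "src (acts X (MMap as b f) (arr_list as' as ps) (length as)) = as'"
proof -
  have "map dm (arr_list as' as ps) = as'"
    using hom_listD[OF assms(1-3)] by (intro nth_equalityI) simp_all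
  then show ?thesis
    using pm.acts_simps(2)[OF composable_U[OF assms]] hom_listD[OF assms(1-3)] by simp
qed

lemma post_U:
  assumes "length as \<le> 4" "set as \<subseteq> MOb M" "b \<in> MOb M" "f \<in> MHom M as b"
  shows "post U as b c q f = MSub M [b] c 1 as q f"
proof -
  have hl: "hom_list (unary_cat M) as as (map (MId M) as)"
    using assms nth_MOb by (auto simp: hom_list_def MId_in)
  have "acts X (MMap as b f) (arr_list as as (map (MId M) as)) (length as) = MMap as b f"
    by (rule pm.acts_ide) (use assms in \<open>auto simp: MM_iff ide_def\<close>)
  then have "MMap as c (SAct U as as b c (map (MId M) as) q f) = mcomp X (um (Arr b c q)) (Suc 0) (MMap as b f)"
    using SAct_U[OF hl] assms by simp
  then show ?thesis by (simp add: post_def mcomp_def)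
qed

lemma pre_U:
  assumes "length as \<le> 4" "set as \<subseteq> MOb M" "b \<in> MOb M" "f \<in> MHom M as b" "0 < i" "i \<le> length as"
    "a \<in> MOb M" "p \<in> MHom M [a] (as ! (i - 1))"
  shows "pre U as b i a f p = MSub M as b i [a] f p"
proof -
  let ?ps = "(map (MId M) as)[i - 1 := p]" and ?as = "as[i - 1 := a]"
  have hl: "hom_list (unary_cat M) ?as as ?ps"
    using assms nth_MOb by (auto simp: hom_list_def MId_in nth_list_update)
  have as': "set ?as \<subseteq> MOb M"
    using assms set_update_subset_insert[of as "i - 1" a] by fastforce
  have o: "as ! (i - Suc 0) \<in> MOb M" using assms nth_MOb by simp
  have "acts X (MMap as b f) (arr_list ?as as ?ps) (length as)
      = mcomp X (MMap as b f) i (um (Arr a (as ! (i - 1)) p))"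
    using assms o pm.acts_single[of "MMap as b f" i "arr_list ?as as ?ps" "Arr a (as ! (i - 1)) p"]
    by (auto simp: MM_iff ide_def)
  moreover have mem: "mcomp X (MMap as b f) i (um (Arr a (as ! (i - 1)) p)) \<in> MM"
    by (rule pm.mcomp_maps) (use assms o in \<open>auto simp: MM_iff[of "MMap as b f"]\<close>)
  moreover have "mcomp X (um (ide (unary_cat M) b)) (Suc 0) (mcomp X (MMap as b f) i (um (Arr a (as ! (i - 1)) p)))
      = mcomp X (MMap as b f) i (um (Arr a (as ! (i - 1)) p))"
    using pm.Id_mcomp[OF mem, of b] by simp
  ultimately have "MMap ?as b (SAct U as ?as b b ?ps (MId M b) f) = mcomp X (MMap as b f) i (um (Arr a (as ! (i - 1)) p))"
    using SAct_U[OF hl, of b b "MId M b" f] assms by (simp add: ide_def)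
  then show ?thesis using assms(5,6) by (simp add: pre_def mcomp_def um_def plug_single)
qed

text \<open>In \<open>U\<close> the actions of unary maps are substitutions of \<open>M\<close>, so that all instances of \<open>\<circ>\<^sub>i\<close>
  agree with those of \<open>M\<close>.\<close>

lemma scomp_U:
  assumes "set bs \<subseteq> MOb M" "set as \<subseteq> MOb M" "c \<in> MOb M" "f \<in> MHom M bs c" "0 < i" "i \<le> length bs"
    "g \<in> MHom M as (bs ! (i - 1))" "ok True (length bs) (length as)"
  shows "scomp U bs c i as f g = MSub M bs c i as f g"
proof -
  have b: "bs ! (i - Suc 0) \<in> MOb M" using assms nth_MOb by simp
  show ?thesis
  proof (cases "length bs = 1")
    case True
    then obtain b where "bs = [b]" "i = 1" "length as \<le> 4"
      using assms(5,6,8) by (auto simp: length_Suc_conv ok_def sub_arities_def)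
    then show ?thesis using assms by (simp add: scomp_def post_U)
  next
    case bs: False
    show ?thesis
    proof (cases "length as = 1")
      case True
      then obtain a where "as = [a]" by (auto simp: length_Suc_conv)
      moreover have "length bs \<le> 4" using assms(8) by (auto simp: ok_def sub_arities_def)
      ultimately show ?thesis using assms bs by (simp add: scomp_def pre_U)
    next
      case False
      then show ?thesis using assms(8) bs by (simp add: scomp_def ok_def)
    qed
  qed
qed

lemma sub_arities_plug:
  assumes "(length bs, length as) \<in> sub_arities" "i \<in> {1..length bs}"
  shows "length bs \<le> 4" "length as \<le> 4" "length (plug bs i as) \<le> 4"
  using assms by (auto simp: length_plug sub_arities_def)

text \<open>Once actions are replaced by substitutions, functoriality, (di)naturality and
  associativity are all cases of the nested and the parallel law of \<open>M\<close>.\<close>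

lemma short_multicategory_U: "short_multicategory U"
proof (rule short_multicategory.intro, unfold U_simps(1) unary_cat_simps)
  show "category (unary_cat M)" by (rule category_unary_cat)
next
  fix as as' b b' ps q f
  assume A: "length as \<le> 4" "set as \<subseteq> MOb M" "set as' \<subseteq> MOb M" "b \<in> MOb M" "b' \<in> MOb M"
    "hom_list (unary_cat M) as' as ps" "q \<in> MHom M [b] b'" "f \<in> SHom U as b"
  have f: "f \<in> MHom M as b" using A by simp
  note h = A(6,2-4) f
  have "MMap as' b' (SAct U as as' b b' ps q f) \<in> MM"
    unfolding SAct_U[OF A(6,1)]
    by (rule pm.mcomp_maps) (use A pm.acts_simps(1,3)[OF composable_U[OF h]] in simp_all)
  then show "SAct U as as' b b' ps q f \<in> SHom U as' b'"
    using A(1) hom_listD[OF A(6,2,3)] by (simp add: MM_iff)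
next
  fix as b f assume A: "length as \<le> 4" "set as \<subseteq> MOb M" "b \<in> MOb M" "f \<in> SHom U as b"
  then show "SAct U as as b b (map (MId M) as) (MId M b) f = f"
    using post_U[of as b f b "MId M b"] MId_MSub[of as b f] by (simp add: post_def)
next
  fix as as' as'' b b' b'' ps ps' q q' f
  assume A: "length as \<le> 4" "set as \<subseteq> MOb M" "set as' \<subseteq> MOb M" "set as'' \<subseteq> MOb M" "b \<in> MOb M" "b' \<in> MOb M" "b'' \<in> MOb M"
    "hom_list (unary_cat M) as' as ps" "hom_list (unary_cat M) as'' as' ps'"
    "q \<in> MHom M [b] b'" "q' \<in> MHom M [b'] b''" "f \<in> SHom U as b"
  have f: "f \<in> MHom M as b" using A by simp
  note d = hom_listD[OF A(8,2,3)] and d' = hom_listD[OF A(9,3,4)]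
  have l: "length ps' = length ps" using d d' by simp
  let ?qs = "Cmp_list (unary_cat M) as'' as' as ps ps'"
  interpret c: category "unary_cat M" by (rule category_unary_cat)
  have hl: "hom_list (unary_cat M) as'' as ?qs"
    unfolding hom_list_def
  proof (intro conjI allI impI)
    fix k assume "k < length ?qs"
    then have k: "k < length ps'" by simp
    then show "?qs ! k \<in> Hom (unary_cat M) (as'' ! k) (as ! k)"
      using c.Cmp_in[of "as'' ! k" "as' ! k" "as ! k" "ps' ! k" "ps ! k"] A d d' nth_MOb
      by (simp add: nth_Cmp_list hom_list_def)
  qed (use d d' in simp_all)
  have qs: "arr_list as'' as ?qs ! k = acomp (unary_cat M) (arr_list as' as ps ! k) (arr_list as'' as' ps' ! k)"
    if "k < length ps" for k
    using that l by (simp add: nth_Cmp_list acomp_def)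
  let ?f = "MMap as b f" and ?q = "Arr b b' q" and ?q' = "Arr b' b'' q'"
  have q: "?q \<in> arrs (unary_cat M)" "?q' \<in> arrs (unary_cat M)" using A by simp_all
  note c1 = composable_U[OF A(8,2,3,5) f]
  let ?g = "acts X ?f (arr_list as' as ps) (length as)"
  have g: "?g \<in> MM" "src ?g = as'" "tgt ?g = b"
    using pm.acts_simps[OF c1] src_acts_U[OF A(8,2,3,5) f] by simp_all
  have c2: "pm.composable ?g (arr_list as'' as' ps') (length as)"
    using g d d' by (auto simp: pm.composable_def)
  have "MMap as'' b'' (SAct U as as'' b b'' ?qs (Cmp (unary_cat M) b b' b'' q' q) f)
      = mcomp X (um (acomp (unary_cat M) ?q' ?q)) (Suc 0) (acts X ?f (arr_list as'' as ?qs) (length as))"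
    unfolding SAct_U[OF hl A(1)] by (simp add: acomp_def)
  also have "acts X ?f (arr_list as'' as ?qs) (length as) = acts X ?g (arr_list as'' as' ps') (length as)"
    by (rule pm.acts_acts[OF c1]) (use d d' qs in auto)
  also have "mcomp X (um (acomp (unary_cat M) ?q' ?q)) (Suc 0) \<dots>
      = mcomp X (um ?q') (Suc 0) (mcomp X (um ?q) (Suc 0) (acts X ?g (arr_list as'' as' ps') (length as)))"
    using q pm.acts_simps[OF c2] g
    by (simp add: pm.um_acomp[simplified] pm.mcomp_nested fits_def del: Arr_in_arrs)
  also have "mcomp X (um ?q) (Suc 0) (acts X ?g (arr_list as'' as' ps') (length as))
      = acts X (mcomp X (um ?q) (Suc 0) ?g) (arr_list as'' as' ps') (length as)"
    by (rule pm.acts_post[symmetric, OF c2]) (use q g in simp_all)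
  also have "mcomp X (um ?q) (Suc 0) ?g = MMap as' b' (SAct U as as' b b' ps q f)"
    using SAct_U[OF A(8,1)] by simp
  also have "mcomp X (um ?q') (Suc 0) (acts X (MMap as' b' (SAct U as as' b b' ps q f)) (arr_list as'' as' ps') (length as))
      = MMap as'' b'' (SAct U as' as'' b' b'' ps' q' (SAct U as as' b b' ps q f))"
    using SAct_U[OF A(9)] A(1) d d' by simp
  finally show "SAct U as as'' b b'' ?qs (MSub M [b'] b'' 1 [b] q' q) f = SAct U as' as'' b' b'' ps' q' (SAct U as as' b b' ps q f)"
    by simp
next
  fix a b assume "a \<in> MOb M" "b \<in> MOb M" then show "SHom U [a] b = MHom M [a] b" by simp
next
  fix a a' b b' p q f
  assume "a \<in> MOb M" "a' \<in> MOb M" "b \<in> MOb M" "b' \<in> MOb M" "p \<in> MHom M [a'] a" "q \<in> MHom M [b] b'" "f \<in> MHom M [a] b"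
  then show "SAct U [a] [a'] b b' [p] q f = MSub M [b] b' 1 [a'] q (MSub M [a] b 1 [a'] f p)"
    by (simp add: U_obj_def)
next
  fix bs as :: "'o list" and i c f g
  assume "(length bs, length as) \<in> sub_arities" "i \<in> {1..length bs}" "set bs \<subseteq> MOb M" "set as \<subseteq> MOb M"
    "c \<in> MOb M" "f \<in> SHom U bs c" "g \<in> SHom U as (bs ! (i - 1))"
  moreover from this have "length (plug bs i as) \<le> 4"
    by (auto simp: length_plug sub_arities_def)
  ultimately show "SSub U bs c i as f g \<in> SHom U (plug bs i as) c"
    using MSub_in[of i bs as c f g] by (simp split: if_splits)
next
  fix bs as :: "'o list" and i c c' f g q
  assume A: "(length bs, length as) \<in> sub_arities" "i \<in> {1..length bs}" "set bs \<subseteq> MOb M" "set as \<subseteq> MOb M"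
    "c \<in> MOb M" "c' \<in> MOb M" "f \<in> SHom U bs c" "g \<in> SHom U as (bs ! (i - 1))" "q \<in> MHom M [c] c'"
  note l = sub_arities_plug[OF A(1,2)]
  then show "SSub U bs c' i as (post U bs c c' q f) g = post U (plug bs i as) c c' q (SSub U bs c i as f g)"
    using A MSub_nested[of 1 "[c]" i bs as c' q f g] MSub_in[of i bs as c f g] by (simp add: post_U)
next
  fix bs as :: "'o list" and i k a' c f g p
  assume A: "(length bs, length as) \<in> sub_arities" "i \<in> {1..length bs}" "k \<in> {1..length as}" "set bs \<subseteq> MOb M" "set as \<subseteq> MOb M"
    "a' \<in> MOb M" "c \<in> MOb M" "f \<in> SHom U bs c" "g \<in> SHom U as (bs ! (i - 1))" "p \<in> MHom M [a'] (as ! (k - 1))"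
  note l = sub_arities_plug[OF A(1,2)]
  have b: "bs ! (i - Suc 0) \<in> MOb M" using A nth_MOb by auto
  have n: "plug bs i as ! (i + k - Suc (Suc 0)) = as ! (k - Suc 0)" "i + k - Suc 0 \<le> length (plug bs i as)"
    using A by (auto simp: plug_def nth_append min_def)
  show "SSub U bs c i (as[k - 1 := a']) f (pre U as (bs ! (i - 1)) k a' g p)
      = pre U (plug bs i as) c (i + k - 1) a' (SSub U bs c i as f g) p"
    using A l b n MSub_nested[of i bs k as "[a']" c f g p] MSub_in[of i bs as c f g]
    by (simp add: pre_U plug_single add.commute)
next
  fix bs as :: "'o list" and i k b' c f g p
  assume A: "(length bs, length as) \<in> sub_arities" "i \<in> {1..length bs}" "k \<in> {1..<i}" "set bs \<subseteq> MOb M" "set as \<subseteq> MOb M"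
    "b' \<in> MOb M" "c \<in> MOb M" "f \<in> SHom U bs c" "g \<in> SHom U as (bs ! (i - 1))" "p \<in> MHom M [b'] (bs ! (k - 1))"
  note l = sub_arities_plug[OF A(1,2)]
  have n: "plug bs i as ! (k - Suc 0) = bs ! (k - Suc 0)" "k \<le> length (plug bs i as)"
    using A by (auto simp: plug_def nth_append min_def)
  show "SSub U (bs[k - 1 := b']) c i as (pre U bs c k b' f p) g = pre U (plug bs i as) c k b' (SSub U bs c i as f g) p"
    using A l n MSub_parallel[of k i bs "[b']" as c f p g] MSub_in[of i bs as c f g]
    by (simp add: pre_U plug_single)
next
  fix bs as :: "'o list" and i k b' c f g p
  assume A: "(length bs, length as) \<in> sub_arities" "i \<in> {1..length bs}" "k \<in> {i<..length bs}" "set bs \<subseteq> MOb M" "set as \<subseteq> MOb M"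
    "b' \<in> MOb M" "c \<in> MOb M" "f \<in> SHom U bs c" "g \<in> SHom U as (bs ! (i - 1))" "p \<in> MHom M [b'] (bs ! (k - 1))"
  note l = sub_arities_plug[OF A(1,2)]
  have n: "plug bs i as ! (k + length as - Suc (Suc 0)) = bs ! (k - Suc 0)" "k + length as - Suc 0 \<le> length (plug bs i as)"
    using A by (auto simp: plug_def nth_append min_def)
  show "SSub U (bs[k - 1 := b']) c i as (pre U bs c k b' f p) g
      = pre U (plug bs i as) c (k + length as - 1) b' (SSub U bs c i as f g) p"
    using A l n MSub_parallel[of i k bs as "[b']" c f g p] MSub_in[of i bs as c f g]
    by (simp add: pre_U plug_single)
next
  fix bs as :: "'o list" and i b' c f g p
  assume A: "(length bs, length as) \<in> sub_arities" "i \<in> {1..length bs}" "set bs \<subseteq> MOb M" "set as \<subseteq> MOb M"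
    "b' \<in> MOb M" "c \<in> MOb M" "f \<in> SHom U bs c" "g \<in> SHom U as b'" "p \<in> MHom M [b'] (bs ! (i - 1))"
  have l: "length bs \<le> 4" "length as \<le> 4"
    using A by (auto simp: sub_arities_def)
  have b: "bs ! (i - Suc 0) \<in> MOb M" using A nth_MOb by auto
  show "SSub U (bs[i - 1 := b']) c i as (pre U bs c i b' f p) g = SSub U bs c i as f (post U as b' (bs ! (i - 1)) p g)"
    using A l b MSub_nested[of i bs 1 "[b']" as c f p g] by (simp add: pre_U post_U plug_single)
next
  fix bs as xs :: "'o list" and i j d f g h
  assume A: "length bs = 2" "(length as, length xs) \<in> {(2, 2), (2, 0)}" "i \<in> {1..2}" "j \<in> {1..length as}"
    "set bs \<subseteq> MOb M" "set as \<subseteq> MOb M" "set xs \<subseteq> MOb M" "d \<in> MOb M"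
    "f \<in> SHom U bs d" "g \<in> SHom U as (bs ! (i - 1))" "h \<in> SHom U xs (as ! (j - 1))"
  have l: "length as = 2" "length xs = 2 \<or> length xs = 0" using A by auto
  have b: "bs ! (i - Suc 0) \<in> MOb M" using A nth_MOb by auto
  have fgh: "f \<in> MHom M bs d" "g \<in> MHom M as (bs ! (i - Suc 0))" "h \<in> MHom M xs (as ! (j - Suc 0))" using A l by auto
  note i = A(3,4)[unfolded l atLeastAtMost_iff]
  have n: "plug bs i as ! (j + i - Suc (Suc 0)) = as ! (j - Suc 0)" "j + i - Suc 0 \<le> length (plug bs i as)"
    using A(1) l i by (auto simp: plug_def nth_append min_def)
  have gh: "scomp U as (bs ! (i - 1)) j xs g h = MSub M as (bs ! (i - 1)) j xs g h"
    by (rule scomp_U) (use A l b fgh in \<open>auto simp: ok_def sub_arities_def\<close>)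
  have fg: "scomp U bs d i as f g = MSub M bs d i as f g"
    by (rule scomp_U) (use A l b fgh in \<open>auto simp: ok_def sub_arities_def\<close>)
  have 1: "scomp U bs d i (plug as j xs) f (MSub M as (bs ! (i - 1)) j xs g h) = MSub M bs d i (plug as j xs) f (MSub M as (bs ! (i - 1)) j xs g h)"
    by (rule scomp_U) (use A l b i fgh MSub_in[of j as xs "bs ! (i - 1)" g h] in \<open>auto simp: ok_def sub_arities_def length_plug\<close>)
  have 2: "scomp U (plug bs i as) d (j + i - 1) xs (MSub M bs d i as f g) h = MSub M (plug bs i as) d (j + i - 1) xs (MSub M bs d i as f g) h"
    by (rule scomp_U) (use A l b i fgh n MSub_in[of i bs as d f g] in \<open>auto simp: ok_def sub_arities_def length_plug\<close>)
  show "scomp U bs d i (plug as j xs) f (scomp U as (bs ! (i - 1)) j xs g h)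
      = scomp U (plug bs i as) d (j + i - 1) xs (scomp U bs d i as f g) h"
    unfolding gh fg 1 2 using MSub_nested[of i bs j as xs d f g h] A fgh by simp
next
  fix bs as xs :: "'o list" and d f g h
  assume A: "length bs = 2" "(length as, length xs) \<in> {(2, 2), (2, 0), (0, 2), (0, 0)}"
    "set bs \<subseteq> MOb M" "set as \<subseteq> MOb M" "set xs \<subseteq> MOb M" "d \<in> MOb M"
    "f \<in> SHom U bs d" "g \<in> SHom U as (bs ! 0)" "h \<in> SHom U xs (bs ! 1)"
  have l: "length as = 2 \<or> length as = 0" "length xs = 2 \<or> length xs = 0" using A by auto
  have fgh: "f \<in> MHom M bs d" "g \<in> MHom M as (bs ! 0)" "h \<in> MHom M xs (bs ! Suc 0)" using A l by auto
  obtain b c where bs: "bs = [b, c]" using A(1) by (auto simp: length_Suc_conv numeral_2_eq_2)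
  have n: "plug bs 1 as ! length as = bs ! Suc 0" "plug bs 2 xs ! 0 = bs ! 0"
    by (simp_all add: bs nth_append)
  have fg: "scomp U bs d 1 as f g = MSub M bs d 1 as f g"
    by (rule scomp_U) (use A l fgh in \<open>auto simp: ok_def sub_arities_def\<close>)
  have fh: "scomp U bs d 2 xs f h = MSub M bs d 2 xs f h"
    by (rule scomp_U) (use A l fgh in \<open>auto simp: ok_def sub_arities_def\<close>)
  have 1: "scomp U (plug bs 1 as) d (length as + 1) xs (MSub M bs d 1 as f g) h = MSub M (plug bs 1 as) d (length as + 1) xs (MSub M bs d 1 as f g) h"
    by (rule scomp_U) (use A l fgh n MSub_in[of 1 bs as d f g] in \<open>auto simp: ok_def sub_arities_def length_plug\<close>)
  have 2: "scomp U (plug bs 2 xs) d 1 as (MSub M bs d 2 xs f h) g = MSub M (plug bs 2 xs) d 1 as (MSub M bs d 2 xs f h) g"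
    by (rule scomp_U) (use A l fgh n MSub_in[of 2 bs xs d f h] in \<open>auto simp: ok_def sub_arities_def length_plug\<close>)
  show "scomp U (plug bs 1 as) d (length as + 1) xs (scomp U bs d 1 as f g) h
      = scomp U (plug bs 2 xs) d 1 as (scomp U bs d 2 xs f h) g"
    unfolding fg fh 1 2 using MSub_parallel[of 1 2 bs as xs d f g h] A fgh by simp
qed

end


section \<open>The categories of multicategories and the forgetful functor\<close>

lemma mk_multifun_simps [simp]:
  "a \<in> MOb M \<Longrightarrow> MFOb (mk_multifun M F0 F1) a = F0 a"
  "\<lbrakk>set as \<subseteq> MOb M; b \<in> MOb M; f \<in> MHom M as b\<rbrakk> \<Longrightarrow> MFMap (mk_multifun M F0 F1) as b f = F1 as b f"
  by (auto simp: mk_multifun_def)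

lemma map_MFOb_mk_multifun [simp]: "set as \<subseteq> MOb M \<Longrightarrow> map (MFOb (mk_multifun M F0 F1)) as = map F0 as"
  by (auto simp: subset_iff)

lemma mk_multifun_cong:
  assumes "\<And>a. a \<in> MOb M \<Longrightarrow> F0 a = G0 a"
    "\<And>as b f. \<lbrakk>set as \<subseteq> MOb M; b \<in> MOb M; f \<in> MHom M as b\<rbrakk> \<Longrightarrow> F1 as b f = G1 as b f"
  shows "mk_multifun M F0 F1 = mk_multifun M G0 G1"
  using assms by (auto simp: mk_multifun_def fun_eq_iff)

lemma multifun_eqI:
  assumes "multifunctor M N F" "multifunctor M N' G"
    "\<And>a. a \<in> MOb M \<Longrightarrow> MFOb F a = MFOb G a"
    "\<And>as b f. \<lbrakk>set as \<subseteq> MOb M; b \<in> MOb M; f \<in> MHom M as b\<rbrakk> \<Longrightarrow> MFMap F as b f = MFMap G as b f"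
  shows "F = G"
  using multifunctor.MF_normal[OF assms(1)] multifunctor.MF_normal[OF assms(2)]
    mk_multifun_cong[of M "MFOb F" "MFOb G" "MFMap F" "MFMap G"] assms(3,4) by metis

lemma FOb_unary_functor_of [simp]: "a \<in> MOb M \<Longrightarrow> FOb (unary_functor_of M F) a = MFOb F a"
  by (simp add: unary_functor_of_def unary_cat_def)

lemma map_FOb_unary_functor_of: "set as \<subseteq> MOb M \<Longrightarrow> map (FOb (unary_functor_of M F)) as = map (MFOb F) as"
  by (auto simp: subset_iff)

lemma multifunctor_is_multi_morphism:
  fixes M N :: "('o, 'a) multi"
  assumes "multicategory M" "multicategory N" "multifunctor M N F"
  shows "multi_morphism (multi_data M) (multi_data N) False (unary_functor_of M F) (MFMap F)"
proof -
  interpret M: multicategory M by fact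
  interpret N: multicategory N by fact
  interpret F: multifunctor M N F by fact
  have fn: "is_functor (unary_cat M) (unary_cat N) (unary_functor_of M F)"
    unfolding unary_functor_of_def
  proof (rule mk_func_is_functor)
    fix a b c f g assume "a \<in> Ob (unary_cat M)" "b \<in> Ob (unary_cat M)" "c \<in> Ob (unary_cat M)"
      "f \<in> Hom (unary_cat M) a b" "g \<in> Hom (unary_cat M) b c"
    then show "MFMap F [a] c (Cmp (unary_cat M) a b c g f)
      = Cmp (unary_cat N) (MFOb F a) (MFOb F b) (MFOb F c) (MFMap F [b] c g) (MFMap F [a] b f)"
      using F.MFMap_MSub[of 1 "[b]" "[a]" c g f] by simp
  next
    fix a b f assume "a \<in> Ob (unary_cat M)" "b \<in> Ob (unary_cat M)" "f \<in> Hom (unary_cat M) a b"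
    then show "MFMap F [a] b f \<in> Hom (unary_cat N) (MFOb F a) (MFOb F b)"
      using F.MFMap_in[of "[a]" b f] by simp
  qed (simp_all add: F.MFOb_in F.MFMap_MId M.category_unary_cat)
  have ob: "FOb (unary_functor_of M F) a = MFOb F a" if "a \<in> MOb M" for a
    using that by (simp add: unary_functor_of_def)
  have obs: "map (FOb (unary_functor_of M F)) as = map (MFOb F) as" if "set as \<subseteq> MOb M" for as
    using that ob by (auto simp: subset_iff)
  have A: "act (unary_functor_of M F) (MFMap F) p = MMap (map (MFOb F) (src p)) (MFOb F (tgt p)) (MFMap F (src p) (tgt p) (val p))"
    if "p \<in> M.MM" for p
    using that by (simp add: act_def M.MM_iff obs ob del: map_eq_conv)
  show ?thesis
  proof (intro multi_morphism.intro multi_morphism_axioms.intro M.partial_multicategory_multi N.partial_multicategory_multi)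
    show "is_functor (DCat M.X) (DCat N.X) (unary_functor_of M F)" using fn by simp
  next
    fix p assume "p \<in> M.MM"
    then show "act (unary_functor_of M F) (MFMap F) p \<in> N.MM"
      by (simp add: A) (auto simp: M.MM_iff N.MM_iff F.MFOb_in F.MFMap_in)
  next
    fix k :: "('o, 'a) arr" assume "k \<in> arrs (DCat M.X)"
    then show "act (unary_functor_of M F) (MFMap F) (um k) = um (fmap (unary_functor_of M F) k)"
      by (cases k) (simp add: act_def um_def fmap_def unary_functor_of_def)
  next
    fix p q :: "('o, 'a) mmap" and i assume pq: "p \<in> M.MM" "q \<in> M.MM" "fits False p i q"
    then have "mcomp M.X p i q \<in> M.MM" by (rule M.pm.mcomp_in)
    then show "act (unary_functor_of M F) (MFMap F) (mcomp M.X p i q)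
      = mcomp N.X (act (unary_functor_of M F) (MFMap F) p) i (act (unary_functor_of M F) (MFMap F) q)"
      using pq F.MFMap_MSub[of i "src p" "src q" "tgt p" "val p" "val q"]
      by (simp add: A) (simp add: mcomp_def fits_def M.MM_iff map_plug)
  qed
qed

lemma multi_morphism_is_multifunctor:
  fixes M N :: "('o, 'a) multi"
  assumes "multicategory M" "multicategory N"
    and "multi_morphism (multi_data M) (multi_data N) False G \<phi>"
  shows "multifunctor M N (mk_multifun M (FOb G) \<phi>)"
    and "unary_functor_of M (mk_multifun M (FOb G) \<phi>) = G"
proof -
  interpret M: multicategory M by fact
  interpret N: multicategory N by fact
  interpret G: multi_morphism M.X N.X False G \<phi> by fact
  let ?F = "mk_multifun M (FOb G) \<phi>"
  have ob: "map (MFOb ?F) as = map (FOb G) as" if "set as \<subseteq> MOb M" for as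
    using that by (auto simp: subset_iff)
  have G_in: "FOb G a \<in> MOb N" if "a \<in> MOb M" for a using G.FOb_in that by simp
  have t: "\<phi> as b f \<in> MHom N (map (FOb G) as) (FOb G b)" if "set as \<subseteq> MOb M" "b \<in> MOb M" "f \<in> MHom M as b" for as b f
    using G.act_maps[of "MMap as b f"] that by (simp add: M.MM_iff N.MM_iff act_def)
  have un: "\<phi> [a] b f = FHom G a b f" if "a \<in> MOb M" "b \<in> MOb M" "f \<in> MHom M [a] b" for a b f
    using G.act_um[of "Arr a b f"] that by (simp add: act_def um_def fmap_def)
  show "multifunctor M N ?F"
  proof
    fix as b f assume "set as \<subseteq> MOb M" "b \<in> MOb M" "f \<in> MHom M as b"
    then show "MFMap ?F as b f \<in> MHom N (map (MFOb ?F) as) (MFOb ?F b)"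
      using t by (simp add: ob del: map_eq_conv)
  next
    fix a assume "a \<in> MOb M"
    then show "MFMap ?F [a] a (MId M a) = MId N (MFOb ?F a)"
      using G.FHom_Id[of a] un[of a a "MId M a"] by (simp add: M.MId_in)
  next
    fix i bs as c f g
    assume A: "i \<in> {1..length bs}" "set bs \<subseteq> MOb M" "set as \<subseteq> MOb M" "c \<in> MOb M" "f \<in> MHom M bs c" "g \<in> MHom M as (bs ! (i - 1))"
    then have b: "bs ! (i - Suc 0) \<in> MOb M" and bs: "bs \<noteq> []" using M.nth_MOb by auto
    have "\<phi> (plug bs i as) c (MSub M bs c i as f g)
        = MSub N (map (FOb G) bs) (FOb G c) i (map (FOb G) as) (\<phi> bs c f) (\<phi> as (bs ! (i - 1)) g)"
      using G.act_mcomp[of "MMap bs c f" "MMap as (bs ! (i - 1)) g" i] A b bs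
      by (auto simp: M.MM_iff act_def mcomp_def fits_def)
    then show "MFMap ?F (plug bs i as) c (MSub M bs c i as f g)
        = MSub N (map (MFOb ?F) bs) (MFOb ?F c) i (map (MFOb ?F) as) (MFMap ?F bs c f) (MFMap ?F as (bs ! (i - 1)) g)"
      using A b M.MSub_in[OF A] by (simp add: ob del: map_eq_conv)
  next
    show "?F = mk_multifun M (MFOb ?F) (MFMap ?F)" by (rule mk_multifun_cong) simp_all
  qed (simp add: G_in)
  have "mk_func (unary_cat M) (MFOb ?F) (\<lambda>a b f. MFMap ?F [a] b f) = mk_func (unary_cat M) (FOb G) (FHom G)"
    by (rule mk_func_cong) (simp_all add: un)
  then show "unary_functor_of M ?F = G"
    using G.F_normal by (simp add: unary_functor_of_def)
qed

lemma category_Multi: "category (Multi :: (('o, 'a) multi, ('o, 'a) multifun) cat)"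
proof -
  have id: "multifunctor M M (mk_multifun M (\<lambda>a. a) (\<lambda>as b f. f))" if "multicategory M" for M :: "('o, 'a) multi"
  proof -
    interpret M: multicategory M by fact
    have e: "mk_multifun M (\<lambda>a. a) (\<lambda>as b f. f) = mk_multifun M (FOb (id_func (DCat M.X))) (\<lambda>as b f. f)"
      by (rule mk_multifun_cong) simp_all
    show ?thesis
      unfolding e by (intro multi_morphism_is_multifunctor multi_morphism_id that M.partial_multicategory_multi)
  qed
  have comp: "multifunctor M P (mk_multifun M (\<lambda>a. MFOb G (MFOb F a)) (\<lambda>as b f. MFMap G (map (MFOb F) as) (MFOb F b) (MFMap F as b f)))"
    if "multicategory M" "multicategory N" "multicategory P" "multifunctor M N F" "multifunctor N P G" for M N P :: "('o, 'a) multi" and F G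
  proof -
    interpret F: multifunctor M N F by fact
    interpret M: multicategory M by fact
    let ?F = "unary_functor_of M F" and ?G = "unary_functor_of N G"
    have e: "mk_multifun M (\<lambda>a. MFOb G (MFOb F a)) (\<lambda>as b f. MFMap G (map (MFOb F) as) (MFOb F b) (MFMap F as b f))
        = mk_multifun M (FOb (comp_func (DCat (multi_data M)) ?G ?F)) (\<lambda>as b f. MFMap G (map (FOb ?F) as) (FOb ?F b) (MFMap F as b f))"
      by (rule mk_multifun_cong)
        (simp_all add: map_FOb_unary_functor_of F.MFOb_in M.X_simps M.unary_cat_simps del: map_eq_conv)
    show ?thesis
      unfolding e
      by (intro multi_morphism_is_multifunctor multi_morphism_comp[where Y = "multi_data N"] multifunctor_is_multi_morphism that)
  qed
  have mi: "set (map (MFOb F) as) \<subseteq> MOb N" if "multifunctor M N F" "set as \<subseteq> MOb M" for M N :: "('o, 'a) multi" and F as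
    using that multifunctor.MFOb_in by fastforce
  let ?C = "Multi :: (('o, 'a) multi, ('o, 'a) multifun) cat"
  show ?thesis
  proof (rule category.intro)
    fix M N P Q :: "('o, 'a) multi" and F G H
    assume A: "M \<in> Ob ?C" "N \<in> Ob ?C" "P \<in> Ob ?C" "Q \<in> Ob ?C" "F \<in> Hom ?C M N" "G \<in> Hom ?C N P" "H \<in> Hom ?C P Q"
    interpret F: multifunctor M N F using A by (simp add: Multi_def)
    interpret G: multifunctor N P G using A by (simp add: Multi_def)
    show "Cmp ?C M N Q (Cmp ?C N P Q H G) F = Cmp3 ?C M N P Q H G F"
      unfolding Multi_def cat.simps
      by (rule mk_multifun_cong)
        (simp_all add: F.MFOb_in F.MFMap_in mi[OF F.multifunctor_axioms, simplified] o_def del: map_eq_conv)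
  next
    fix M N :: "('o, 'a) multi" and F
    assume A: "M \<in> Ob ?C" "N \<in> Ob ?C" "F \<in> Hom ?C M N"
    interpret F: multifunctor M N F using A by (simp add: Multi_def)
    have [simp]: "map (MFOb (mk_multifun M (\<lambda>a. a) (\<lambda>as b f. f))) as = as" if "set as \<subseteq> MOb M" for as
      using that by (auto intro: map_idI)
    have "Cmp ?C M M N F (Id ?C M) = mk_multifun M (MFOb F) (MFMap F)"
      unfolding Multi_def cat.simps
      by (rule mk_multifun_cong) simp_all
    then show "Cmp ?C M M N F (Id ?C M) = F" using F.MF_normal by simp
    have "Cmp ?C M N N (Id ?C N) F = mk_multifun M (MFOb F) (MFMap F)"
      unfolding Multi_def cat.simps
      by (rule mk_multifun_cong) (simp_all add: F.MFOb_in F.MFMap_in mi[OF F.multifunctor_axioms, simplified])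
    then show "Cmp ?C M N N (Id ?C N) F = F" using F.MF_normal by simp
  qed (auto simp: Multi_def id comp)
qed

lemma shmor_eqI:
  assumes "short_multi_morphism C D F" "short_multi_morphism C D' G" "SFun F = SFun G"
    "\<And>as b f. \<lbrakk>length as \<le> 4; set as \<subseteq> SOb C; b \<in> SOb C; f \<in> SHom C as b\<rbrakk> \<Longrightarrow> SMap F as b f = SMap G as b f"
  shows "F = G"
proof -
  have "restrict_SMap C (SMap F) = restrict_SMap C (SMap G)"
    using assms(4) by (simp add: restrict_SMap_def fun_eq_iff)
  then have "SMap F = SMap G"
    using short_multi_morphism.SMap_normal[OF assms(1)] short_multi_morphism.SMap_normal[OF assms(2)] by argo
  then show ?thesis using assms(3) by simp
qed

lemma restrict_SMap_apply [simp]: "\<lbrakk>length as \<le> 4; set as \<subseteq> SOb C; b \<in> SOb C; f \<in> SHom C as b\<rbrakk>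
    \<Longrightarrow> restrict_SMap C \<phi> as b f = \<phi> as b f"
  by (simp add: restrict_SMap_def)

lemma category_ShMulti: "category (ShMulti :: (('o, 'a) shmulti, ('o, 'a) shmor) cat)"
proof -
  let ?C = "ShMulti :: (('o, 'a) shmulti, ('o, 'a) shmor) cat"
  have id: "short_multi_morphism C C (id_shmor C)" if "short_multicategory C" for C :: "('o, 'a) shmulti"
    using multi_morphism_is_short_morphism[OF that that multi_morphism_id[OF short_multicategory.partial_multicategory_short[OF that]]]
    by (simp add: id_shmor_def short_data_def)
  have comp: "short_multi_morphism C E (comp_shmor C G F)"
    if "short_multicategory C" "short_multicategory D" "short_multicategory E" "short_multi_morphism C D F" "short_multi_morphism D E G"
    for C D E :: "('o, 'a) shmulti" and F G
    using multi_morphism_is_short_morphism[OF that(1,3) multi_morphism_comp[OF short_morphism_is_multi_morphism[OF that(1,2,4)]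
      short_morphism_is_multi_morphism[OF that(2,3,5)]]]
    by (simp add: comp_shmor_def short_data_def)
  have SMap_comp: "SMap (comp_shmor C G F) as b f = SMap G (map (FOb (SFun F)) as) (FOb (SFun F) b) (SMap F as b f)"
    if "length as \<le> 4" "set as \<subseteq> SOb C" "b \<in> SOb C" "f \<in> SHom C as b" for C :: "('o, 'a) shmulti" and G F as b f
    using that by (simp add: comp_shmor_def)
  have SMap_id: "SMap (id_shmor C) as b f = f"
    if "length as \<le> 4" "set as \<subseteq> SOb C" "b \<in> SOb C" "f \<in> SHom C as b" for C :: "('o, 'a) shmulti" and as b f
    using that by (simp add: id_shmor_def)
  have SFun: "SFun (comp_shmor C G F) = comp_func (SUnary C) (SFun G) (SFun F)" "SFun (id_shmor C) = id_func (SUnary C)"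
    for C :: "('o, 'a) shmulti" and G F
    by (simp_all add: comp_shmor_def id_shmor_def)
  show ?thesis
  proof (rule category.intro)
    fix C D E E' :: "('o, 'a) shmulti" and F G H
    assume A: "C \<in> Ob ?C" "D \<in> Ob ?C" "E \<in> Ob ?C" "E' \<in> Ob ?C" "F \<in> Hom ?C C D" "G \<in> Hom ?C D E" "H \<in> Hom ?C E E'"
    interpret F: short_multi_morphism C D F using A by (simp add: ShMulti_def)
    interpret G: short_multi_morphism D E G using A by (simp add: ShMulti_def)
    interpret H: short_multi_morphism E E' H using A by (simp add: ShMulti_def)
    interpret f: is_functor "SUnary C" "SUnary D" "SFun F" by (rule F.unary_functor)
    interpret g: is_functor "SUnary D" "SUnary E" "SFun G" by (rule G.unary_functor)
    interpret h: is_functor "SUnary E" "SUnary E'" "SFun H" by (rule H.unary_functor)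
    have s: "short_multicategory C" "short_multicategory D" "short_multicategory E" "short_multicategory E'" using A by (simp_all add: ShMulti_def)
    have mi: "set (map (FOb (SFun F)) as) \<subseteq> SOb D" if "set as \<subseteq> SOb C" for as
      using that f.FOb_in by auto
    have cat: "category (SUnary C)" "category (SUnary D)" using s by (auto intro: short_multicategory.unary_category)
    have "comp_shmor C (comp_shmor D H G) F = comp_shmor C H (comp_shmor C G F)"
    proof (rule shmor_eqI)
      show "SFun (comp_shmor C (comp_shmor D H G) F) = SFun (comp_shmor C H (comp_shmor C G F))"
        unfolding SFun
        by (rule functor_eqI[of _ "SUnary E'"])
          (use cat f.is_functor_axioms g.is_functor_axioms h.is_functor_axioms in
            \<open>auto intro!: comp_func_is_functor simp: f.FOb_in f.FHom_in g.FOb_in g.FHom_in\<close>)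
    next
      fix as b f assume t: "length as \<le> 4" "set as \<subseteq> SOb C" "b \<in> SOb C" "f \<in> SHom C as b"
      have Ft: "length (map (FOb (SFun F)) as) \<le> 4" "set (map (FOb (SFun F)) as) \<subseteq> SOb D" "FOb (SFun F) b \<in> SOb D"
        "SMap F as b f \<in> SHom D (map (FOb (SFun F)) as) (FOb (SFun F) b)"
        using t mi f.FOb_in F.SMap_in by auto
      have "map (FOb (comp_func (SUnary C) (SFun G) (SFun F))) as = map (FOb (SFun G)) (map (FOb (SFun F)) as)"
        using t by auto
      then show "SMap (comp_shmor C (comp_shmor D H G) F) as b f = SMap (comp_shmor C H (comp_shmor C G F)) as b f"
        using t by (simp only: SMap_comp[OF t] SMap_comp[OF Ft] SFun FOb_comp_func)
    next
      show "short_multi_morphism C E' (comp_shmor C (comp_shmor D H G) F)"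
        by (rule comp[OF s(1,2,4) F.short_multi_morphism_axioms comp[OF s(2,3,4) G.short_multi_morphism_axioms H.short_multi_morphism_axioms]])
      show "short_multi_morphism C E' (comp_shmor C H (comp_shmor C G F))"
        by (rule comp[OF s(1,3,4) comp[OF s(1,2,3) F.short_multi_morphism_axioms G.short_multi_morphism_axioms] H.short_multi_morphism_axioms])
    qed
    then show "Cmp ?C C D E' (Cmp ?C D E E' H G) F = Cmp3 ?C C D E E' H G F"
      by (simp add: ShMulti_def)
  next
    fix C D :: "('o, 'a) shmulti" and F
    assume A: "C \<in> Ob ?C" "D \<in> Ob ?C" "F \<in> Hom ?C C D"
    interpret F: short_multi_morphism C D F using A by (simp add: ShMulti_def)
    interpret f: is_functor "SUnary C" "SUnary D" "SFun F" by (rule F.unary_functor)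
    have s: "short_multicategory C" "short_multicategory D" using A by (simp_all add: ShMulti_def)
    have cat: "category (SUnary C)" "category (SUnary D)" using s by (auto intro: short_multicategory.unary_category)
    have m: "map (FOb (id_func (SUnary C))) as = as" if "set as \<subseteq> SOb C" for as
      by (rule map_idI) (use that in auto)
    have mi: "set (map (FOb (SFun F)) as) \<subseteq> SOb D" if "set as \<subseteq> SOb C" for as
      using that f.FOb_in by auto
    have "comp_shmor C F (id_shmor C) = F"
    proof (rule shmor_eqI[OF comp[OF s(1,1,2) id[OF s(1)] F.short_multi_morphism_axioms] F.short_multi_morphism_axioms])
      show "SFun (comp_shmor C F (id_shmor C)) = SFun F"
        unfolding SFun
        by (rule functor_eqI[of _ "SUnary D"]) (use cat f.is_functor_axioms in \<open>auto intro!: comp_func_is_functor id_func_is_functor\<close>)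
    qed (simp add: SMap_comp SMap_id SFun m)
    then show "Cmp ?C C C D F (Id ?C C) = F" by (simp add: ShMulti_def)
    have "comp_shmor C (id_shmor D) F = F"
    proof (rule shmor_eqI[OF comp[OF s(1,2,2) F.short_multi_morphism_axioms id[OF s(2)]] F.short_multi_morphism_axioms])
      show "SFun (comp_shmor C (id_shmor D) F) = SFun F"
        unfolding SFun
        by (rule functor_eqI[of _ "SUnary D"])
          (use cat f.is_functor_axioms in \<open>auto intro!: comp_func_is_functor id_func_is_functor simp: f.FOb_in f.FHom_in\<close>)
    qed (simp add: SMap_comp SMap_id SFun f.FOb_in F.SMap_in mi del: set_map)
    then show "Cmp ?C C D D (Id ?C D) F = F" by (simp add: ShMulti_def)
  qed (auto simp: ShMulti_def id comp)
qed


section \<open>The multicategory of a left normal skew monoidal category\<close>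

context skew_monoidal
begin

abbreviation obs where "obs \<equiv> KOb S"
abbreviation I where "I \<equiv> KUnit S"

text \<open>\<open>x \<cdot> as = ((x a\<^sub>1) a\<^sub>2 \<dots>) a\<^sub>n\<close>; its action \<open>dota\<close> on arrows; and the iterated associator
  \<open>al y x as : (y x) \<cdot> as \<rightarrow> y (x \<cdot> as)\<close>.\<close>

definition dot :: "'o \<Rightarrow> 'o list \<Rightarrow> 'o" where
  "dot = foldl (\<odot>)"

definition dota :: "('o, 'a) arr \<Rightarrow> 'o list \<Rightarrow> ('o, 'a) arr" where
  "dota = foldl (\<lambda>f a. f \<otimes> \<one> a)"

primrec al :: "'o \<Rightarrow> 'o \<Rightarrow> 'o list \<Rightarrow> ('o, 'a) arr" where
  "al y x [] = \<one> (y \<odot> x)"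
| "al y x (a # as) = al y (x \<odot> a) as \<cdot> dota (asc S y x a) as"

lemma dot_simps [simp]: "dot x [] = x" "dot x (a # as) = dot (x \<odot> a) as" "dot x (as @ bs) = dot (dot x as) bs"
  by (simp_all add: dot_def)

lemma dota_simps [simp]: "dota f [] = f" "dota f (a # as) = dota (f \<otimes> \<one> a) as" "dota f (as @ bs) = dota (dota f as) bs"
  by (simp_all add: dota_def)

lemma dot_in [simp]: "x \<in> obs \<Longrightarrow> set as \<subseteq> obs \<Longrightarrow> dot x as \<in> obs"
  by (induction as arbitrary: x) simp_all

lemma dota_ends [simp]: "dm (dota f as) = dot (dm f) as" "cd (dota f as) = dot (cd f) as"
  by (induction as arbitrary: f) simp_all

lemma dota_arrs [simp]: "f \<in> karrs S \<Longrightarrow> set as \<subseteq> obs \<Longrightarrow> dota f as \<in> karrs S"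
  by (induction as arbitrary: f) simp_all

lemma dota_ide [simp]: "x \<in> obs \<Longrightarrow> set as \<subseteq> obs \<Longrightarrow> dota (\<one> x) as = \<one> (dot x as)"
  by (induction as arbitrary: x) simp_all

lemma acomp_ten_ide: "\<lbrakk>f \<in> karrs S; g \<in> karrs S; dm g = cd f; a \<in> obs\<rbrakk> \<Longrightarrow> (g \<cdot> f) \<otimes> \<one> a = (g \<otimes> \<one> a) \<cdot> (f \<otimes> \<one> a)"
  using ten_acomp[of f "\<one> a" g "\<one> a"] by simp

lemma ide_ten_acomp: "\<lbrakk>f \<in> karrs S; g \<in> karrs S; dm g = cd f; a \<in> obs\<rbrakk> \<Longrightarrow> \<one> a \<otimes> (g \<cdot> f) = (\<one> a \<otimes> g) \<cdot> (\<one> a \<otimes> f)"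
  using ten_acomp[of "\<one> a" f "\<one> a" g] by simp

lemma dota_acomp: "\<lbrakk>f \<in> karrs S; g \<in> karrs S; dm g = cd f; set as \<subseteq> obs\<rbrakk> \<Longrightarrow> dota (g \<cdot> f) as = dota g as \<cdot> dota f as"
  by (induction as arbitrary: f g) (simp_all add: acomp_ten_ide)

lemma al_ends [simp]: "dm (al y x as) = dot (y \<odot> x) as" "cd (al y x as) = y \<odot> dot x as"
  by (induction as arbitrary: x) simp_all

lemma al_arrs [simp]: "\<lbrakk>y \<in> obs; x \<in> obs; set as \<subseteq> obs\<rbrakk> \<Longrightarrow> al y x as \<in> karrs S"
  by (induction as arbitrary: x) simp_all

lemma al_append: "\<lbrakk>y \<in> obs; x \<in> obs; set as \<subseteq> obs; set bs \<subseteq> obs\<rbrakk>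
    \<Longrightarrow> al y x (as @ bs) = al y (dot x as) bs \<cdot> dota (al y x as) bs"
  by (induction as arbitrary: x) (simp_all add: dota_acomp acomp_assoc)

lemma al_natural: "\<lbrakk>y \<in> obs; h \<in> karrs S; x = dm h; x' = cd h; set as \<subseteq> obs\<rbrakk>
    \<Longrightarrow> al y x' as \<cdot> dota (\<one> y \<otimes> h) as = (\<one> y \<otimes> dota h as) \<cdot> al y x as"
proof (induction as arbitrary: h x x')
  case (Cons a as)
  note [simp] = arrsD[OF Cons.prems(2)]
  have a: "a \<in> obs" "set as \<subseteq> obs" using Cons.prems by simp_all
  have "al y x' (a # as) \<cdot> dota (\<one> y \<otimes> h) (a # as)
      = al y (x' \<odot> a) as \<cdot> dota (asc S y x' a \<cdot> ((\<one> y \<otimes> h) \<otimes> \<one> a)) as"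
    using Cons.prems by (simp add: dota_acomp acomp_assoc)
  also have "asc S y x' a \<cdot> ((\<one> y \<otimes> h) \<otimes> \<one> a) = (\<one> y \<otimes> (h \<otimes> \<one> a)) \<cdot> asc S y x a"
    using asc_natural[of "\<one> y" h "\<one> a"] Cons.prems by simp
  also have "al y (x' \<odot> a) as \<cdot> dota \<dots> as
      = (al y (x' \<odot> a) as \<cdot> dota (\<one> y \<otimes> (h \<otimes> \<one> a)) as) \<cdot> dota (asc S y x a) as"
    using Cons.prems by (simp add: dota_acomp acomp_assoc)
  also have "al y (x' \<odot> a) as \<cdot> dota (\<one> y \<otimes> (h \<otimes> \<one> a)) as = (\<one> y \<otimes> dota (h \<otimes> \<one> a) as) \<cdot> al y (x \<odot> a) as"
    by (rule Cons.IH) (use Cons.prems in simp_all)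
  finally show ?case using Cons.prems by (simp add: acomp_assoc)
qed simp

lemma al_natural_left: "\<lbrakk>k \<in> karrs S; y = dm k; y' = cd k; x \<in> obs; set as \<subseteq> obs\<rbrakk>
    \<Longrightarrow> al y' x as \<cdot> dota (k \<otimes> \<one> x) as = (k \<otimes> \<one> (dot x as)) \<cdot> al y x as"
proof (induction as arbitrary: x)
  case Nil
  then show ?case by (simp add: arrsD)
next
  case (Cons a as)
  note [simp] = arrsD[OF Cons.prems(1)]
  have "al y' x (a # as) \<cdot> dota (k \<otimes> \<one> x) (a # as)
      = al y' (x \<odot> a) as \<cdot> dota (asc S y' x a \<cdot> ((k \<otimes> \<one> x) \<otimes> \<one> a)) as"
    using Cons.prems by (simp add: dota_acomp acomp_assoc)
  also have "asc S y' x a \<cdot> ((k \<otimes> \<one> x) \<otimes> \<one> a) = (k \<otimes> \<one> (x \<odot> a)) \<cdot> asc S y x a"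
    using asc_natural[of k "\<one> x" "\<one> a"] Cons.prems by simp
  also have "al y' (x \<odot> a) as \<cdot> dota \<dots> as
      = (al y' (x \<odot> a) as \<cdot> dota (k \<otimes> \<one> (x \<odot> a)) as) \<cdot> dota (asc S y x a) as"
    using Cons.prems by (simp add: dota_acomp acomp_assoc)
  also have "al y' (x \<odot> a) as \<cdot> dota (k \<otimes> \<one> (x \<odot> a)) as = (k \<otimes> \<one> (dot (x \<odot> a) as)) \<cdot> al y (x \<odot> a) as"
    by (rule Cons.IH) (use Cons.prems in simp_all)
  finally show ?case using Cons.prems by (simp add: acomp_assoc)
qed

lemma al_pentagon: "\<lbrakk>y \<in> obs; x \<in> obs; z \<in> obs; set as \<subseteq> obs\<rbrakk>
    \<Longrightarrow> asc S y x (dot z as) \<cdot> al (y \<odot> x) z as = (\<one> y \<otimes> al x z as) \<cdot> al y (x \<odot> z) as \<cdot> dota (asc S y x z) as"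
proof (induction as arbitrary: z)
  case (Cons a as)
  have [simp]: "a \<in> obs" "set as \<subseteq> obs" "y \<in> obs" "x \<in> obs" "z \<in> obs" using Cons.prems by simp_all
  have "asc S y x (dot z (a # as)) \<cdot> al (y \<odot> x) z (a # as)
      = (asc S y x (dot (z \<odot> a) as) \<cdot> al (y \<odot> x) (z \<odot> a) as) \<cdot> dota (asc S (y \<odot> x) z a) as"
    by (simp add: acomp_assoc)
  also have "asc S y x (dot (z \<odot> a) as) \<cdot> al (y \<odot> x) (z \<odot> a) as
      = (\<one> y \<otimes> al x (z \<odot> a) as) \<cdot> al y (x \<odot> (z \<odot> a)) as \<cdot> dota (asc S y x (z \<odot> a)) as"
    by (rule Cons.IH) simp_all
  also have "\<dots> \<cdot> dota (asc S (y \<odot> x) z a) as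
      = (\<one> y \<otimes> al x (z \<odot> a) as) \<cdot> al y (x \<odot> (z \<odot> a)) as \<cdot> dota (asc S y x (z \<odot> a) \<cdot> asc S (y \<odot> x) z a) as"
    by (simp add: acomp_assoc dota_acomp)
  also have "\<dots> = (\<one> y \<otimes> al x (z \<odot> a) as) \<cdot> (al y (x \<odot> (z \<odot> a)) as \<cdot> dota (\<one> y \<otimes> asc S x z a) as) \<cdot>
      dota (asc S y (x \<odot> z) a) as \<cdot> dota (asc S y x z \<otimes> \<one> a) as"
    by (simp add: arr_pentagon acomp_assoc dota_acomp)
  also have "al y (x \<odot> (z \<odot> a)) as \<cdot> dota (\<one> y \<otimes> asc S x z a) as
      = (\<one> y \<otimes> dota (asc S x z a) as) \<cdot> al y ((x \<odot> z) \<odot> a) as"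
    by (rule al_natural) simp_all
  finally show ?case by (simp add: acomp_assoc ide_ten_acomp)
qed simp

lemma al_left_unit: "\<lbrakk>x \<in> obs; set as \<subseteq> obs\<rbrakk> \<Longrightarrow> lam S (dot x as) \<cdot> al I x as = dota (lam S x) as"
proof (induction as arbitrary: x)
  case (Cons a as)
  have [simp]: "a \<in> obs" "set as \<subseteq> obs" "x \<in> obs" using Cons.prems by simp_all
  have "lam S (dot x (a # as)) \<cdot> al I x (a # as) = (lam S (dot (x \<odot> a) as) \<cdot> al I (x \<odot> a) as) \<cdot> dota (asc S I x a) as"
    by (simp add: acomp_assoc)
  also have "lam S (dot (x \<odot> a) as) \<cdot> al I (x \<odot> a) as = dota (lam S (x \<odot> a)) as"
    by (rule Cons.IH) simp_all
  also have "\<dots> \<cdot> dota (asc S I x a) as = dota (lam S (x \<odot> a) \<cdot> asc S I x a) as"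
    by (simp add: dota_acomp)
  finally show ?case by (simp add: arr_left_unit)
qed simp

subsection \<open>Linear families\<close>

text \<open>A map with inputs \<open>as\<close> and output \<open>b\<close> is encoded by what it does behind an arbitrary
  object \<open>x\<close>: arrows \<open>\<phi>\<^sub>x : x \<cdot> as \<rightarrow> x b\<close>, natural in \<open>x\<close> and compatible with the associator.
  Substitution becomes composition of arrows, and no coherence theorem is involved in its
  associativity.\<close>

definition fam :: "'o list \<Rightarrow> 'o \<Rightarrow> ('o \<Rightarrow> ('o, 'a) arr) \<Rightarrow> bool" where
  "fam as b \<phi> \<longleftrightarrow>
     (\<forall>x. if x \<in> obs then \<phi> x \<in> karrs S \<and> dm (\<phi> x) = dot x as \<and> cd (\<phi> x) = x \<odot> b else \<phi> x = undefined) \<and>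
     (\<forall>h\<in>karrs S. (h \<otimes> \<one> b) \<cdot> \<phi> (dm h) = \<phi> (cd h) \<cdot> dota h as) \<and>
     (\<forall>y\<in>obs. \<forall>x\<in>obs. asc S y x b \<cdot> \<phi> (y \<odot> x) = (\<one> y \<otimes> \<phi> x) \<cdot> al y x as)"

lemma famI:
  assumes "\<And>x. x \<in> obs \<Longrightarrow> \<phi> x \<in> karrs S" "\<And>x. x \<in> obs \<Longrightarrow> dm (\<phi> x) = dot x as" "\<And>x. x \<in> obs \<Longrightarrow> cd (\<phi> x) = x \<odot> b"
    "\<And>h. h \<in> karrs S \<Longrightarrow> (h \<otimes> \<one> b) \<cdot> \<phi> (dm h) = \<phi> (cd h) \<cdot> dota h as"
    "\<And>y x. \<lbrakk>y \<in> obs; x \<in> obs\<rbrakk> \<Longrightarrow> asc S y x b \<cdot> \<phi> (y \<odot> x) = (\<one> y \<otimes> \<phi> x) \<cdot> al y x as"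
  shows "fam as b (restrict \<phi> obs)"
  using assms by (auto simp: fam_def arrsD)

lemma famD:
  assumes "fam as b \<phi>"
  shows "x \<in> obs \<Longrightarrow> \<phi> x \<in> karrs S" "x \<in> obs \<Longrightarrow> dm (\<phi> x) = dot x as" "x \<in> obs \<Longrightarrow> cd (\<phi> x) = x \<odot> b"
    "h \<in> karrs S \<Longrightarrow> (h \<otimes> \<one> b) \<cdot> \<phi> (dm h) = \<phi> (cd h) \<cdot> dota h as"
    "\<lbrakk>y \<in> obs; x \<in> obs\<rbrakk> \<Longrightarrow> asc S y x b \<cdot> \<phi> (y \<odot> x) = (\<one> y \<otimes> \<phi> x) \<cdot> al y x as"
  using assms by (auto simp: fam_def)

lemma fam_eqI:
  assumes "fam as b \<phi>" "fam as' b' \<psi>" "\<And>x. x \<in> obs \<Longrightarrow> \<phi> x = \<psi> x"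
  shows "\<phi> = \<psi>"
proof
  fix x show "\<phi> x = \<psi> x"
    using assms by (cases "x \<in> obs") (auto simp: fam_def)
qed

definition fcomp :: "'o list \<Rightarrow> ('o \<Rightarrow> ('o, 'a) arr) \<Rightarrow> ('o \<Rightarrow> ('o, 'a) arr) \<Rightarrow> 'o list \<Rightarrow> 'o \<Rightarrow> ('o, 'a) arr" where
  "fcomp xs \<phi> \<psi> ys = (\<lambda>x\<in>obs. \<phi> x \<cdot> dota (\<psi> (dot x xs)) ys)"

text \<open>\<open>dota (\<psi> (dot x xs)) ys\<close> is \<open>\<psi>\<close> applied in the context of \<open>xs\<close> and \<open>ys\<close>. That it is linear and
  natural in \<open>x\<close>, here and in the next lemma, gives closure under composition.\<close>

lemma fam_al:
  assumes "fam as b \<psi>" "b \<in> obs" "set xs \<subseteq> obs" "set as \<subseteq> obs" "set ys \<subseteq> obs" "y \<in> obs" "x \<in> obs"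
  shows "al y x (xs @ b # ys) \<cdot> dota (\<psi> (dot (y \<odot> x) xs)) ys = (\<one> y \<otimes> dota (\<psi> (dot x xs)) ys) \<cdot> al y x (xs @ as @ ys)"
proof -
  note [simp] = assms(2-7) famD(1-3)[OF assms(1)]
  let ?z = "dot x xs"
  have "al y x (xs @ b # ys) \<cdot> dota (\<psi> (dot (y \<odot> x) xs)) ys
      = al y (?z \<odot> b) ys \<cdot> dota (asc S y ?z b \<cdot> (al y x xs \<otimes> \<one> b) \<cdot> \<psi> (dot (y \<odot> x) xs)) ys"
    by (simp add: al_append dota_acomp acomp_assoc)
  also have "(al y x xs \<otimes> \<one> b) \<cdot> \<psi> (dot (y \<odot> x) xs) = \<psi> (y \<odot> ?z) \<cdot> dota (al y x xs) as"
    using famD(4)[OF assms(1), of "al y x xs"] by simp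
  also have "asc S y ?z b \<cdot> \<psi> (y \<odot> ?z) \<cdot> dota (al y x xs) as = ((\<one> y \<otimes> \<psi> ?z) \<cdot> al y ?z as) \<cdot> dota (al y x xs) as"
    by (rule acomp_extend[OF famD(5)[OF assms(1)]]) simp_all
  also have "\<dots> = (\<one> y \<otimes> \<psi> ?z) \<cdot> al y x (xs @ as)"
    by (simp add: acomp_assoc al_append)
  also have "al y (?z \<odot> b) ys \<cdot> dota \<dots> ys = (al y (?z \<odot> b) ys \<cdot> dota (\<one> y \<otimes> \<psi> ?z) ys) \<cdot> dota (al y x (xs @ as)) ys"
    by (simp add: dota_acomp acomp_assoc)
  also have "al y (?z \<odot> b) ys \<cdot> dota (\<one> y \<otimes> \<psi> ?z) ys = (\<one> y \<otimes> dota (\<psi> ?z) ys) \<cdot> al y (dot x (xs @ as)) ys"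
    by (rule al_natural) simp_all
  also have "\<dots> \<cdot> dota (al y x (xs @ as)) ys = (\<one> y \<otimes> dota (\<psi> ?z) ys) \<cdot> al y x ((xs @ as) @ ys)"
    by (simp add: acomp_assoc al_append[of _ _ "xs @ as"] del: append_assoc)
  finally show ?thesis by simp
qed

lemma fam_dota:
  assumes "fam as b \<psi>" "b \<in> obs" "set xs \<subseteq> obs" "set as \<subseteq> obs" "set ys \<subseteq> obs" "h \<in> karrs S"
  shows "dota h (xs @ b # ys) \<cdot> dota (\<psi> (dot (dm h) xs)) ys = dota (\<psi> (dot (cd h) xs)) ys \<cdot> dota h (xs @ as @ ys)"
proof -
  note [simp] = assms(2-6) famD(1-3)[OF assms(1)] arrsD[OF assms(6)]
  have "(dota h xs \<otimes> \<one> b) \<cdot> \<psi> (dot (dm h) xs) = \<psi> (dot (cd h) xs) \<cdot> dota (dota h xs) as"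
    using famD(4)[OF assms(1), of "dota h xs"] by simp
  then show ?thesis by (simp add: dota_acomp[symmetric])
qed

lemma fcomp_fam:
  assumes \<phi>: "fam (xs @ b # ys) c \<phi>" and \<psi>: "fam as b \<psi>" and "b \<in> obs" "c \<in> obs" "set xs \<subseteq> obs" "set as \<subseteq> obs" "set ys \<subseteq> obs"
  shows "fam (xs @ as @ ys) c (fcomp xs \<phi> \<psi> ys)"
  unfolding fcomp_def
proof (rule famI)
  note [simp] = assms(3-) famD(1-3)[OF \<phi>] famD(1-3)[OF \<psi>]
  show "\<And>x. x \<in> obs \<Longrightarrow> \<phi> x \<cdot> dota (\<psi> (dot x xs)) ys \<in> karrs S" by simp
  show "\<And>x. x \<in> obs \<Longrightarrow> dm (\<phi> x \<cdot> dota (\<psi> (dot x xs)) ys) = dot x (xs @ as @ ys)" by simp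
  show "\<And>x. x \<in> obs \<Longrightarrow> cd (\<phi> x \<cdot> dota (\<psi> (dot x xs)) ys) = x \<odot> c" by simp
next
  note [simp] = assms(3-) famD(1-3)[OF \<phi>] famD(1-3)[OF \<psi>]
  fix h assume h: "h \<in> karrs S"
  note [simp] = arrsD[OF h] h
  have "(h \<otimes> \<one> c) \<cdot> \<phi> (dm h) \<cdot> dota (\<psi> (dot (dm h) xs)) ys = \<phi> (cd h) \<cdot> dota h (xs @ b # ys) \<cdot> dota (\<psi> (dot (dm h) xs)) ys"
    using acomp_extend[OF famD(4)[OF \<phi> h]] by (simp add: acomp_assoc)
  also have "\<dots> = \<phi> (cd h) \<cdot> dota (\<psi> (dot (cd h) xs)) ys \<cdot> dota h (xs @ as @ ys)"
    using fam_dota[OF \<psi> assms(3,5,6,7) h] by simp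
  finally show "(h \<otimes> \<one> c) \<cdot> \<phi> (dm h) \<cdot> dota (\<psi> (dot (dm h) xs)) ys = (\<phi> (cd h) \<cdot> dota (\<psi> (dot (cd h) xs)) ys) \<cdot> dota h (xs @ as @ ys)"
    by (simp add: acomp_assoc)
next
  note [simp] = assms(3-) famD(1-3)[OF \<phi>] famD(1-3)[OF \<psi>]
  fix y x assume yx [simp]: "y \<in> obs" "x \<in> obs"
  have "asc S y x c \<cdot> \<phi> (y \<odot> x) \<cdot> dota (\<psi> (dot (y \<odot> x) xs)) ys
      = (\<one> y \<otimes> \<phi> x) \<cdot> al y x (xs @ b # ys) \<cdot> dota (\<psi> (dot (y \<odot> x) xs)) ys"
    using acomp_extend[OF famD(5)[OF \<phi> yx]] by (simp add: acomp_assoc)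
  also have "\<dots> = (\<one> y \<otimes> \<phi> x) \<cdot> (\<one> y \<otimes> dota (\<psi> (dot x xs)) ys) \<cdot> al y x (xs @ as @ ys)"
    using fam_al[OF \<psi> assms(3,5,6,7) yx] by simp
  finally show "asc S y x c \<cdot> \<phi> (y \<odot> x) \<cdot> dota (\<psi> (dot (y \<odot> x) xs)) ys = (\<one> y \<otimes> (\<phi> x \<cdot> dota (\<psi> (dot x xs)) ys)) \<cdot> al y x (xs @ as @ ys)"
    by (simp add: ide_ten_acomp acomp_assoc)
qed

text \<open>Division by a pointwise invertible family. The inverses go from \<open>x m\<close> to \<open>x \<cdot> as\<close> and are not
  a family themselves, but the quotient is one, since its defining equations can be tested after
  composing with \<open>\<theta>\<close>. This makes the classifying maps of a monoidal category universal.\<close>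

lemma fam_divide:
  assumes \<psi>: "fam (xs @ as @ ys) c \<psi>" and \<theta>: "fam as m \<theta>" and "m \<in> obs" "c \<in> obs" "set xs \<subseteq> obs" "set as \<subseteq> obs" "set ys \<subseteq> obs"
    and inv: "\<And>x. x \<in> obs \<Longrightarrow> inverse_arrs (KCat S) (\<theta> x) (\<kappa> x)"
  shows "fam (xs @ m # ys) c (fcomp xs \<psi> \<kappa> ys)"
    and "fcomp xs (fcomp xs \<psi> \<kappa> ys) \<theta> ys = \<psi>"
proof -
  note [simp] = assms(3-7) famD(1-3)[OF \<psi>] famD(1-3)[OF \<theta>]
  have \<kappa> [simp]: "\<kappa> x \<in> karrs S" "dm (\<kappa> x) = x \<odot> m" "cd (\<kappa> x) = dot x as" "\<kappa> x \<cdot> \<theta> x = \<one> (dot x as)" "\<theta> x \<cdot> \<kappa> x = \<one> (x \<odot> m)"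
    if "x \<in> obs" for x
    using inv[OF that] that by (simp_all add: inverse_arrs_def)
  let ?\<phi> = "\<lambda>x. \<psi> x \<cdot> dota (\<kappa> (dot x xs)) ys"
  have div: "?\<phi> x \<cdot> dota (\<theta> (dot x xs)) ys = \<psi> x" if "x \<in> obs" for x
    using that by (simp add: acomp_assoc dota_acomp[symmetric])
  have cancel: "f = g" if "f \<cdot> dota (\<theta> z) ys = g \<cdot> dota (\<theta> z) ys" "f \<in> karrs S" "g \<in> karrs S" "dm f = dot (z \<odot> m) ys" "dm g = dot (z \<odot> m) ys" "z \<in> obs" for f g z
  proof -
    have "f = (f \<cdot> dota (\<theta> z) ys) \<cdot> dota (\<kappa> z) ys"
      using that(2-) by (simp add: acomp_assoc dota_acomp[symmetric])
    also have "\<dots> = g" unfolding that(1) using that(2-) by (simp add: acomp_assoc dota_acomp[symmetric])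
    finally show ?thesis .
  qed
  show F: "fam (xs @ m # ys) c (fcomp xs \<psi> \<kappa> ys)"
    unfolding fcomp_def
  proof (rule famI)
    fix h assume h: "h \<in> karrs S"
    note [simp] = h arrsD[OF h]
    show "(h \<otimes> \<one> c) \<cdot> ?\<phi> (dm h) = ?\<phi> (cd h) \<cdot> dota h (xs @ m # ys)"
    proof (rule cancel[of _ "dot (dm h) xs"])
      have "((h \<otimes> \<one> c) \<cdot> ?\<phi> (dm h)) \<cdot> dota (\<theta> (dot (dm h) xs)) ys = (h \<otimes> \<one> c) \<cdot> (?\<phi> (dm h) \<cdot> dota (\<theta> (dot (dm h) xs)) ys)"
        by (simp add: acomp_assoc)
      also have "\<dots> = (?\<phi> (cd h) \<cdot> dota (\<theta> (dot (cd h) xs)) ys) \<cdot> dota h (xs @ as @ ys)"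
        unfolding div[OF arrsD(1)[OF h]] div[OF arrsD(2)[OF h]] by (rule famD(4)[OF \<psi> h])
      also have "\<dots> = ?\<phi> (cd h) \<cdot> (dota h (xs @ m # ys) \<cdot> dota (\<theta> (dot (dm h) xs)) ys)"
        unfolding fam_dota[OF \<theta> assms(3,5,6,7) h] by (simp add: acomp_assoc)
      finally show "((h \<otimes> \<one> c) \<cdot> ?\<phi> (dm h)) \<cdot> dota (\<theta> (dot (dm h) xs)) ys
          = (?\<phi> (cd h) \<cdot> dota h (xs @ m # ys)) \<cdot> dota (\<theta> (dot (dm h) xs)) ys"
        by (simp add: acomp_assoc)
    qed simp_all
  next
    fix y x assume yx [simp]: "y \<in> obs" "x \<in> obs"
    show "asc S y x c \<cdot> ?\<phi> (y \<odot> x) = (\<one> y \<otimes> ?\<phi> x) \<cdot> al y x (xs @ m # ys)"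
    proof (rule cancel[of _ "dot (y \<odot> x) xs"])
      have "(asc S y x c \<cdot> ?\<phi> (y \<odot> x)) \<cdot> dota (\<theta> (dot (y \<odot> x) xs)) ys = asc S y x c \<cdot> (?\<phi> (y \<odot> x) \<cdot> dota (\<theta> (dot (y \<odot> x) xs)) ys)"
        by (simp add: acomp_assoc)
      also have "\<dots> = (\<one> y \<otimes> (?\<phi> x \<cdot> dota (\<theta> (dot x xs)) ys)) \<cdot> al y x (xs @ as @ ys)"
        unfolding div[OF ten_ob_in[OF yx]] div[OF yx(2)] by (rule famD(5)[OF \<psi> yx])
      also have "\<dots> = (\<one> y \<otimes> ?\<phi> x) \<cdot> ((\<one> y \<otimes> dota (\<theta> (dot x xs)) ys) \<cdot> al y x (xs @ as @ ys))"
        by (simp add: ide_ten_acomp acomp_assoc)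
      also have "\<dots> = (\<one> y \<otimes> ?\<phi> x) \<cdot> (al y x (xs @ m # ys) \<cdot> dota (\<theta> (dot (y \<odot> x) xs)) ys)"
        unfolding fam_al[OF \<theta> assms(3,5,6,7) yx] ..
      finally show "(asc S y x c \<cdot> ?\<phi> (y \<odot> x)) \<cdot> dota (\<theta> (dot (y \<odot> x) xs)) ys
          = ((\<one> y \<otimes> ?\<phi> x) \<cdot> al y x (xs @ m # ys)) \<cdot> dota (\<theta> (dot (y \<odot> x) xs)) ys"
        by (simp add: acomp_assoc)
    qed simp_all
  qed simp_all
  show "fcomp xs (fcomp xs \<psi> \<kappa> ys) \<theta> ys = \<psi>"
    by (rule fam_eqI[OF fcomp_fam[OF F \<theta>] \<psi>]) (simp_all add: fcomp_def div)
qed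

end

subsection \<open>Multimaps as linear families\<close>

locale left_normal_skew = skew_monoidal S for S :: "('o, 'a) skmon" (structure) +
  assumes left_normal: "left_normal S"
begin

definition lami :: "'o \<Rightarrow> ('o, 'a) arr" where
  "lami a = (SOME g. inverse_arrs (KCat S) (lam S a) g)"

lemma inverse_lami: "a \<in> obs \<Longrightarrow> inverse_arrs (KCat S) (lam S a) (lami a)"
  using left_normal someI_ex[of "\<lambda>g. inverse_arrs (KCat S) (lam S a) g"]
  by (simp add: left_normal_def iso_in_arrs lam_def[symmetric] lami_def)

lemma lami_simps [simp]:
  "a \<in> obs \<Longrightarrow> lami a \<in> karrs S" "a \<in> obs \<Longrightarrow> dm (lami a) = a" "a \<in> obs \<Longrightarrow> cd (lami a) = I \<odot> a"
  "a \<in> obs \<Longrightarrow> lam S a \<cdot> lami a = \<one> a" "a \<in> obs \<Longrightarrow> lami a \<cdot> lam S a = \<one> (I \<odot> a)"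
  using inverse_lami by (auto simp: inverse_arrs_def)

text \<open>Multimaps are stored as arrows out of \<open>tn as = (a\<^sub>1 a\<^sub>2 \<dots>) a\<^sub>n\<close>, or out of the unit if there
  are no inputs; left normality gives the isomorphism \<open>kap : i \<cdot> as \<rightarrow> tn as\<close>.\<close>

fun tn :: "'o list \<Rightarrow> 'o" where
  "tn [] = I" | "tn (a # as) = dot a as"

fun kap :: "'o list \<Rightarrow> ('o, 'a) arr" where
  "kap [] = \<one> I" | "kap (a # as) = dota (lam S a) as"

fun kapi :: "'o list \<Rightarrow> ('o, 'a) arr" where
  "kapi [] = \<one> I" | "kapi (a # as) = dota (lami a) as"

lemma tn_kap [simp]:
  assumes "set as \<subseteq> obs"
  shows "tn as \<in> obs" "kap as \<in> karrs S" "dm (kap as) = dot I as" "cd (kap as) = tn as"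
    "kapi as \<in> karrs S" "dm (kapi as) = tn as" "cd (kapi as) = dot I as"
    "kap as \<cdot> kapi as = \<one> (tn as)" "kapi as \<cdot> kap as = \<one> (dot I as)"
  using assms by (cases as; simp add: dota_acomp[symmetric])+

text \<open>A family is determined by its value at the unit: the mutually inverse passages between
  families and arrows.\<close>

definition enc :: "'o list \<Rightarrow> 'o \<Rightarrow> ('o \<Rightarrow> ('o, 'a) arr) \<Rightarrow> ('o, 'a) arr" where
  "enc as b \<phi> = lam S b \<cdot> \<phi> I \<cdot> kapi as"

definition dec :: "'o list \<Rightarrow> ('o, 'a) arr \<Rightarrow> 'o \<Rightarrow> ('o, 'a) arr" where
  "dec as f = (\<lambda>x\<in>obs. (\<one> x \<otimes> (f \<cdot> kap as)) \<cdot> al x I as \<cdot> dota (rho S x) as)"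

lemma enc_arrs:
  assumes "fam as b \<phi>" "set as \<subseteq> obs" "b \<in> obs"
  shows "enc as b \<phi> \<in> karrs S" "dm (enc as b \<phi>) = tn as" "cd (enc as b \<phi>) = b"
  using assms famD(1-3)[OF assms(1), of I] by (simp_all add: enc_def)

lemma dec_fam:
  assumes "f \<in> karrs S" "dm f = tn as" "cd f = b" "set as \<subseteq> obs"
  shows "fam as b (dec as f)"
  unfolding dec_def
proof (rule famI)
  have b: "b \<in> obs" using assms arrsD by blast
  note [simp] = assms b
  let ?g = "f \<cdot> kap as"
  let ?\<phi> = "\<lambda>x. (\<one> x \<otimes> ?g) \<cdot> al x I as \<cdot> dota (rho S x) as"
  show "\<And>x. x \<in> obs \<Longrightarrow> ?\<phi> x \<in> karrs S" "\<And>x. x \<in> obs \<Longrightarrow> dm (?\<phi> x) = dot x as" "\<And>x. x \<in> obs \<Longrightarrow> cd (?\<phi> x) = x \<odot> b"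
    by simp_all
  have gen: "?g \<in> karrs S" "dm ?g = dot I as" "cd ?g = b" by simp_all
  {
    fix h assume h: "h \<in> karrs S"
    note [simp] = h arrsD[OF h]
    have "(h \<otimes> \<one> b) \<cdot> (\<one> (dm h) \<otimes> ?g) = (\<one> (cd h) \<otimes> ?g) \<cdot> (h \<otimes> \<one> (dot I as))"
      using ten_acomp[of "\<one> (dm h)" ?g h "\<one> b"] ten_acomp[of h "\<one> (dot I as)" "\<one> (cd h)" ?g] gen by simp
    from acomp_extend[OF this] have "(h \<otimes> \<one> b) \<cdot> ?\<phi> (dm h) = (\<one> (cd h) \<otimes> ?g) \<cdot> (h \<otimes> \<one> (dot I as)) \<cdot> al (dm h) I as \<cdot> dota (rho S (dm h)) as"
      by (simp add: acomp_assoc)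
    also have "\<dots> = (\<one> (cd h) \<otimes> ?g) \<cdot> ((h \<otimes> \<one> (dot I as)) \<cdot> al (dm h) I as) \<cdot> dota (rho S (dm h)) as"
      by (simp add: acomp_assoc)
    also have "(h \<otimes> \<one> (dot I as)) \<cdot> al (dm h) I as = al (cd h) I as \<cdot> dota (h \<otimes> \<one> I) as"
      by (rule al_natural_left[symmetric]) simp_all
    also have "(al (cd h) I as \<cdot> dota (h \<otimes> \<one> I) as) \<cdot> dota (rho S (dm h)) as = al (cd h) I as \<cdot> dota ((h \<otimes> \<one> I) \<cdot> rho S (dm h)) as"
      by (simp add: dota_acomp acomp_assoc)
    also have "\<dots> = al (cd h) I as \<cdot> dota (rho S (cd h)) as \<cdot> dota h as"
      by (simp add: rho_natural[symmetric] dota_acomp acomp_assoc)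
    finally show "(h \<otimes> \<one> b) \<cdot> ?\<phi> (dm h) = ?\<phi> (cd h) \<cdot> dota h as"
      by (simp add: acomp_assoc)
  }
  fix y x assume [simp]: "y \<in> obs" "x \<in> obs"
  have "asc S y x b \<cdot> (\<one> (y \<odot> x) \<otimes> ?g) = (\<one> y \<otimes> (\<one> x \<otimes> ?g)) \<cdot> asc S y x (dot I as)"
    using asc_natural[of "\<one> y" "\<one> x" ?g] gen by simp
  from acomp_extend[OF this] have "asc S y x b \<cdot> ?\<phi> (y \<odot> x) = (\<one> y \<otimes> (\<one> x \<otimes> ?g)) \<cdot> asc S y x (dot I as) \<cdot> al (y \<odot> x) I as \<cdot> dota (rho S (y \<odot> x)) as"
    by (simp add: acomp_assoc)
  also have "\<dots> = (\<one> y \<otimes> (\<one> x \<otimes> ?g)) \<cdot> (\<one> y \<otimes> al x I as) \<cdot> al y (x \<odot> I) as \<cdot> dota (asc S y x I \<cdot> rho S (y \<odot> x)) as"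
    using acomp_extend[OF al_pentagon[of y x I as]] by (simp add: acomp_assoc dota_acomp)
  also have "\<dots> = (\<one> y \<otimes> (\<one> x \<otimes> ?g)) \<cdot> (\<one> y \<otimes> al x I as) \<cdot> (\<one> y \<otimes> dota (rho S x) as) \<cdot> al y x as"
    using al_natural[of y "rho S x" x "x \<odot> I" as] by (simp add: arr_right_unit)
  finally show "asc S y x b \<cdot> ?\<phi> (y \<odot> x) = (\<one> y \<otimes> ?\<phi> x) \<cdot> al y x as"
    by (simp add: ide_ten_acomp[of _ "\<one> x \<otimes> ?g"] ide_ten_acomp[of _ "al x I as"] acomp_assoc)
qed

text \<open>Naturality of \<open>\<lambda>\<close>, the left unit law for \<open>al\<close>, and \<open>\<lambda>\<^sub>i \<rho>\<^sub>i = 1\<close>.\<close>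

lemma enc_dec:
  assumes "f \<in> karrs S" "dm f = tn as" "cd f = b" "set as \<subseteq> obs"
  shows "enc as b (dec as f) = f"
proof -
  have b: "b \<in> obs" using assms arrsD by blast
  note [simp] = assms b
  let ?g = "f \<cdot> kap as"
  have "enc as b (dec as f) = (lam S b \<cdot> (\<one> I \<otimes> ?g)) \<cdot> al I I as \<cdot> dota (rho S I) as \<cdot> kapi as"
    by (simp add: enc_def dec_def acomp_assoc)
  also have "lam S b \<cdot> (\<one> I \<otimes> ?g) = ?g \<cdot> lam S (dot I as)"
    using lam_natural[of ?g] by simp
  also have "(?g \<cdot> lam S (dot I as)) \<cdot> al I I as \<cdot> dota (rho S I) as \<cdot> kapi as
      = ?g \<cdot> dota (lam S I \<cdot> rho S I) as \<cdot> kapi as"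
    using acomp_extend[OF al_left_unit[of I as]] by (simp add: acomp_assoc dota_acomp)
  also have "\<dots> = f"
    by (simp add: arr_unit_unit acomp_assoc)
  finally show ?thesis .
qed

text \<open>Compatibility with the associator at \<open>(x i) \<cdot> as\<close> and naturality at \<open>\<rho>\<^sub>x\<close> express \<open>\<phi>\<^sub>x\<close> by \<open>\<phi>\<^sub>i\<close>;
  the axiom \<open>(x \<lambda>\<^sub>b) \<alpha> (\<rho>\<^sub>x b) = 1\<close> cancels what remains.\<close>

lemma dec_enc:
  assumes "fam as b \<phi>" "set as \<subseteq> obs" "b \<in> obs"
  shows "dec as (enc as b \<phi>) = \<phi>"
proof (rule fam_eqI[OF dec_fam assms(1)])
  note [simp] = famD(1-3)[OF assms(1)] assms(2,3)
  fix x assume [simp]: "x \<in> obs"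
  have "enc as b \<phi> \<cdot> kap as = lam S b \<cdot> \<phi> I"
    by (simp add: enc_def acomp_assoc)
  then have "dec as (enc as b \<phi>) x = (\<one> x \<otimes> lam S b) \<cdot> ((\<one> x \<otimes> \<phi> I) \<cdot> al x I as) \<cdot> dota (rho S x) as"
    by (simp add: dec_def ide_ten_acomp acomp_assoc)
  also have "(\<one> x \<otimes> \<phi> I) \<cdot> al x I as = asc S x I b \<cdot> \<phi> (x \<odot> I)"
    using famD(5)[OF assms(1), of x I] by simp
  also have "(asc S x I b \<cdot> \<phi> (x \<odot> I)) \<cdot> dota (rho S x) as = asc S x I b \<cdot> (\<phi> (x \<odot> I) \<cdot> dota (rho S x) as)"
    by (simp add: acomp_assoc)
  also have "\<phi> (x \<odot> I) \<cdot> dota (rho S x) as = (rho S x \<otimes> \<one> b) \<cdot> \<phi> x"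
    using famD(4)[OF assms(1), of "rho S x"] by simp
  also have "(\<one> x \<otimes> lam S b) \<cdot> asc S x I b \<cdot> (rho S x \<otimes> \<one> b) \<cdot> \<phi> x
      = ((\<one> x \<otimes> lam S b) \<cdot> asc S x I b \<cdot> (rho S x \<otimes> \<one> b)) \<cdot> \<phi> x"
    by (simp add: acomp_assoc)
  also have "\<dots> = \<phi> x" by (simp add: arr_middle_unit)
  finally show "dec as (enc as b \<phi>) x = \<phi> x" .
qed (use enc_arrs[OF assms] assms in simp_all)

end


context left_normal_skew
begin

abbreviation hom where "hom \<equiv> Hom (KCat S)"

text \<open>Maps are represented by arrows, so that they live in the type of the arrows of \<open>S\<close>, and are
  substituted as families.\<close>

definition Mu :: "('o, 'a) multi" where
  "Mu = \<lparr>
     MOb = obs,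
     MHom = (\<lambda>as b. hom (tn as) b),
     MId = Id (KCat S),
     MSub = (\<lambda>bs c i as f g. raw (enc (plug bs i as) c
       (fcomp (take (i - 1) bs) (dec bs (Arr (tn bs) c f)) (dec as (Arr (tn as) (bs ! (i - 1)) g)) (drop i bs))))\<rparr>"

abbreviation D where "D as b f \<equiv> dec as (Arr (tn as) b f)"

lemma Mu_simps [simp]: "MOb Mu = obs" "MHom Mu as b = hom (tn as) b" "MId Mu = Id (KCat S)"
  by (simp_all add: Mu_def)

lemma D_fam: "\<lbrakk>set as \<subseteq> obs; b \<in> obs; f \<in> hom (tn as) b\<rbrakk> \<Longrightarrow> fam as b (D as b f)"
  by (rule dec_fam) simp_all

lemma MSub_enc: "MSub Mu (xs @ b # ys) c (Suc (length xs)) as f g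
    = raw (enc (xs @ as @ ys) c (fcomp xs (D (xs @ b # ys) c f) (D as b g) ys))"
  by (simp add: Mu_def)

lemma enc_raw: "\<lbrakk>fam as b \<phi>; set as \<subseteq> obs; b \<in> obs\<rbrakk> \<Longrightarrow> Arr (tn as) b (raw (enc as b \<phi>)) = enc as b \<phi>"
  by (rule arr.expand) (simp add: enc_arrs)

lemma raw_enc_in: "\<lbrakk>fam as b \<phi>; set as \<subseteq> obs; b \<in> obs\<rbrakk> \<Longrightarrow> raw (enc as b \<phi>) \<in> hom (tn as) b"
  using enc_arrs[of as b \<phi>] arrsD(3)[of "enc as b \<phi>" "KCat S"] by simp

lemma D_inject:
  assumes "D as b f = D as b g" "set as \<subseteq> obs" "b \<in> obs" "f \<in> hom (tn as) b" "g \<in> hom (tn as) b"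
  shows "f = g"
proof -
  have "Arr (tn as) b f = Arr (tn as) b g"
    using enc_dec[of "Arr (tn as) b f" as b] enc_dec[of "Arr (tn as) b g" as b] assms(2-) unfolding assms(1) by simp
  then show ?thesis by simp
qed

context
  fixes xs ys as :: "'o list" and b c :: 'o and f g :: 'a
  assumes A: "set xs \<subseteq> obs" "set ys \<subseteq> obs" "set as \<subseteq> obs" "b \<in> obs" "c \<in> obs"
    "f \<in> hom (tn (xs @ b # ys)) c" "g \<in> hom (tn as) b"
begin

lemma MSub_fam: "fam (xs @ as @ ys) c (fcomp xs (D (xs @ b # ys) c f) (D as b g) ys)"
  by (rule fcomp_fam) (use A in \<open>auto intro!: D_fam\<close>)

lemma MSub_Hom: "MSub Mu (xs @ b # ys) c (Suc (length xs)) as f g \<in> hom (tn (xs @ as @ ys)) c"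
  unfolding MSub_enc using A by (intro raw_enc_in MSub_fam) auto

lemma D_MSub: "D (xs @ as @ ys) c (MSub Mu (xs @ b # ys) c (Suc (length xs)) as f g)
    = fcomp xs (D (xs @ b # ys) c f) (D as b g) ys"
  unfolding MSub_enc using A MSub_fam by (subst enc_raw) (auto simp: dec_enc)

end

lemma split_at:
  assumes "0 < i" "i \<le> length bs"
  obtains xs b ys where "bs = xs @ b # ys" "i = Suc (length xs)"
  using assms id_take_nth_drop[of "i - 1" bs] that[of "take (i - 1) bs" "bs ! (i - 1)" "drop i bs"] by auto

lemma D_unary:
  assumes f: "f \<in> karrs S" "dm f = a"
  shows "dec [a] f = (\<lambda>x\<in>obs. \<one> x \<otimes> f)"
proof -
  let ?f = f and ?b = "cd f"
  have b: "a \<in> obs" "cd f \<in> obs" using arrsD[OF f(1)] f(2) by simp_all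
  note [simp] = b f
  have F: "fam [a] (cd f) (\<lambda>x\<in>obs. \<one> x \<otimes> ?f)"
  proof (rule famI)
    fix h assume h: "h \<in> karrs S"
    then show "(h \<otimes> \<one> (cd f)) \<cdot> (\<one> (dm h) \<otimes> ?f) = (\<one> (cd h) \<otimes> ?f) \<cdot> dota h [a]"
      using ten_acomp[of "\<one> (dm h)" ?f h "\<one> (cd f)"] ten_acomp[of h "\<one> a" "\<one> (cd h)" ?f] by (simp add: arrsD)
  next
    fix y x assume "y \<in> obs" "x \<in> obs"
    then show "asc S y x (cd f) \<cdot> (\<one> (y \<odot> x) \<otimes> ?f) = (\<one> y \<otimes> (\<one> x \<otimes> ?f)) \<cdot> al y x [a]"
      using asc_natural[of "\<one> y" "\<one> x" ?f] by simp
  qed simp_all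
  have "enc [a] (cd f) (\<lambda>x\<in>obs. \<one> x \<otimes> ?f) = (lam S (cd f) \<cdot> (\<one> I \<otimes> ?f)) \<cdot> lami a"
    by (simp add: enc_def acomp_assoc)
  also have "\<dots> = ?f" using lam_natural[of ?f] by (simp add: acomp_assoc)
  finally show ?thesis using dec_enc[OF F] by simp
qed

lemma D_Id: "a \<in> obs \<Longrightarrow> dec [a] (Arr a a (Id (KCat S) a)) = (\<lambda>x\<in>obs. \<one> (x \<odot> a))"
  using D_unary[of "\<one> a" a] by (auto simp: Arr_Id fun_eq_iff)

text \<open>Through \<open>dec\<close> all laws are equations between composites of components of families. The nested
  law is associativity of composition in \<open>S\<close>; in the parallel law the two maps are interchanged
  by naturality of the second family at a component of the first.\<close>

lemma multicategory_Mu: "multicategory Mu"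
proof (rule multicategory.intro, unfold Mu_simps)
  show "Id (KCat S) a \<in> hom (tn [a]) a" if "a \<in> obs" for a
    using that by (simp add: Id_in)
next
  fix i and bs as :: "'o list" and c f g
  assume A: "i \<in> {1..length bs}" "set bs \<subseteq> obs" "set as \<subseteq> obs" "c \<in> obs" "f \<in> hom (tn bs) c" "g \<in> hom (tn as) (bs ! (i - 1))"
  obtain xs b ys where bs: "bs = xs @ b # ys" "i = Suc (length xs)" using split_at[of i bs] A by auto
  show "MSub Mu bs c i as f g \<in> hom (tn (plug bs i as)) c"
    using MSub_Hom[of xs ys as b c f g] A by (simp add: bs)
next
  fix i and bs :: "'o list" and c f
  assume A: "i \<in> {1..length bs}" "set bs \<subseteq> obs" "c \<in> obs" "f \<in> hom (tn bs) c"
  obtain xs b ys where bs: "bs = xs @ b # ys" "i = Suc (length xs)" using split_at[of i bs] A by auto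
  have b: "set xs \<subseteq> obs" "set ys \<subseteq> obs" "set [b] \<subseteq> obs" "b \<in> obs" "c \<in> obs" "f \<in> hom (tn (xs @ b # ys)) c" "Id (KCat S) b \<in> hom (tn [b]) b"
    using A by (auto simp: bs Id_in)
  note F = D_fam[of bs c f, OF A(2,3,4), unfolded bs]
  have "D (xs @ b # ys) c (MSub Mu (xs @ b # ys) c (Suc (length xs)) [b] f (Id (KCat S) b)) = D (xs @ b # ys) c f"
  proof (rule fam_eqI[OF _ F])
    show "fam (xs @ b # ys) c (D (xs @ b # ys) c (MSub Mu (xs @ b # ys) c (Suc (length xs)) [b] f (Id (KCat S) b)))"
      using MSub_fam[OF b] D_MSub[OF b] by simp
    show "D (xs @ b # ys) c (MSub Mu (xs @ b # ys) c (Suc (length xs)) [b] f (Id (KCat S) b)) x = D (xs @ b # ys) c f x" if "x \<in> obs" for x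
      using D_MSub[OF b] b that famD(1-3)[OF F that] by (simp add: fcomp_def D_Id)
  qed
  from D_inject[OF this] show "MSub Mu bs c i [bs ! (i - 1)] f (Id (KCat S) (bs ! (i - 1))) = f"
    using MSub_Hom[OF b] b by (simp add: bs)
next
  fix as :: "'o list" and b f assume A: "set as \<subseteq> obs" "b \<in> obs" "f \<in> hom (tn as) b"
  have b: "set [] \<subseteq> obs" "set [] \<subseteq> obs" "set as \<subseteq> obs" "b \<in> obs" "b \<in> obs" "Id (KCat S) b \<in> hom (tn ([] @ b # [])) b" "f \<in> hom (tn as) b"
    using A by (auto simp: Id_in)
  note F = D_fam[OF A]
  have "D as b (MSub Mu [b] b (Suc 0) as (Id (KCat S) b) f) = D as b f"
  proof (rule fam_eqI[OF _ F])
    show "fam as b (D as b (MSub Mu [b] b (Suc 0) as (Id (KCat S) b) f))"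
      using MSub_fam[OF b] D_MSub[OF b] by simp
    show "D as b (MSub Mu [b] b (Suc 0) as (Id (KCat S) b) f) x = D as b f x" if "x \<in> obs" for x
      using D_MSub[OF b] b that famD(1-3)[OF F that] by (simp add: fcomp_def D_Id)
  qed
  from D_inject[OF this] show "MSub Mu [b] b 1 as (Id (KCat S) b) f = f"
    using MSub_Hom[OF b] b by simp
next
  fix i j and bs as hs :: "'o list" and d f g h
  assume A: "i \<in> {1..length bs}" "j \<in> {1..length as}" "set bs \<subseteq> obs" "set as \<subseteq> obs" "set hs \<subseteq> obs" "d \<in> obs"
    "f \<in> hom (tn bs) d" "g \<in> hom (tn as) (bs ! (i - 1))" "h \<in> hom (tn hs) (as ! (j - 1))"
  obtain xs b ys where bs: "bs = xs @ b # ys" "i = Suc (length xs)" using split_at[of i bs] A by auto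
  obtain us a vs where as: "as = us @ a # vs" "j = Suc (length us)" using split_at[of j as] A by auto
  have o: "set xs \<subseteq> obs" "set ys \<subseteq> obs" "set us \<subseteq> obs" "set vs \<subseteq> obs" "set hs \<subseteq> obs" "b \<in> obs" "a \<in> obs" "d \<in> obs"
    "f \<in> hom (tn (xs @ b # ys)) d" "g \<in> hom (tn (us @ a # vs)) b" "h \<in> hom (tn hs) a"
    using A by (auto simp: bs as)
  let ?gh = "MSub Mu (us @ a # vs) b (Suc (length us)) hs g h"
  let ?fg = "MSub Mu (xs @ b # ys) d (Suc (length xs)) (us @ a # vs) f g"
  note gh = MSub_Hom[OF o(3,4,5,7,6,10,11)] D_MSub[OF o(3,4,5,7,6,10,11)]
  have as': "set (us @ a # vs) \<subseteq> obs" "set (us @ hs @ vs) \<subseteq> obs" "set (xs @ us) \<subseteq> obs" "set (vs @ ys) \<subseteq> obs"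
    "set (xs @ (us @ hs @ vs) @ ys) \<subseteq> obs" "set (xs @ b # ys) \<subseteq> obs"
    using o by auto
  note fg = MSub_Hom[OF o(1,2) as'(1) o(6,8,9,10)] D_MSub[OF o(1,2) as'(1) o(6,8,9,10)]
  have fg1: "?fg \<in> hom (tn ((xs @ us) @ a # (vs @ ys))) d" using fg(1) by simp
  note l = MSub_Hom[OF o(1,2) as'(2) o(6,8,9) gh(1)] D_MSub[OF o(1,2) as'(2) o(6,8,9) gh(1)] MSub_fam[OF o(1,2) as'(2) o(6,8,9) gh(1)]
  note r = MSub_Hom[OF as'(3,4) o(5,7,8) fg1 o(11)] D_MSub[OF as'(3,4) o(5,7,8) fg1 o(11)] MSub_fam[OF as'(3,4) o(5,7,8) fg1 o(11)]
  note Ff = famD(1-3)[OF D_fam[OF as'(6) o(8,9)]] and Fg = famD(1-3)[OF D_fam[OF as'(1) o(6,10)]] and Fh = famD(1-3)[OF D_fam[OF o(5,7,11)]]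
  have "MSub Mu (xs @ b # ys) d (Suc (length xs)) (us @ hs @ vs) f ?gh
      = MSub Mu ((xs @ us) @ a # (vs @ ys)) d (Suc (length (xs @ us))) hs ?fg h"
  proof (rule D_inject)
    show "D (xs @ (us @ hs @ vs) @ ys) d (MSub Mu (xs @ b # ys) d (Suc (length xs)) (us @ hs @ vs) f ?gh)
        = D (xs @ (us @ hs @ vs) @ ys) d (MSub Mu ((xs @ us) @ a # (vs @ ys)) d (Suc (length (xs @ us))) hs ?fg h)"
    proof (rule fam_eqI)
      show "fam (xs @ (us @ hs @ vs) @ ys) d (D (xs @ (us @ hs @ vs) @ ys) d (MSub Mu (xs @ b # ys) d (Suc (length xs)) (us @ hs @ vs) f ?gh))"
        by (rule D_fam) (use l(1) o in auto)
      show "fam ((xs @ us) @ hs @ (vs @ ys)) d (D (xs @ (us @ hs @ vs) @ ys) d (MSub Mu ((xs @ us) @ a # (vs @ ys)) d (Suc (length (xs @ us))) hs ?fg h))"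
        using D_fam[OF _ o(8) r(1)] o by simp
      fix x assume x [simp]: "x \<in> obs"
      show "D (xs @ (us @ hs @ vs) @ ys) d (MSub Mu (xs @ b # ys) d (Suc (length xs)) (us @ hs @ vs) f ?gh) x
          = D (xs @ (us @ hs @ vs) @ ys) d (MSub Mu ((xs @ us) @ a # (vs @ ys)) d (Suc (length (xs @ us))) hs ?fg h) x"
        using l(2) r(2) o Ff Fg Fh
        by (simp add: gh(2) fg(2) fcomp_def dota_acomp acomp_assoc del: append_assoc) (simp add: fg(2)[simplified] fcomp_def acomp_assoc)
    qed
  qed (use l(1) r(1) o in auto)
  then show "MSub Mu bs d i (plug as j hs) f (MSub Mu as (bs ! (i - 1)) j hs g h)
      = MSub Mu (plug bs i as) d (j + i - 1) hs (MSub Mu bs d i as f g) h"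
    by (simp add: bs as add.commute)
next
  fix i j and bs as hs :: "'o list" and d f g h
  assume A: "i \<in> {1..<j}" "j \<in> {1..length bs}" "set bs \<subseteq> obs" "set as \<subseteq> obs" "set hs \<subseteq> obs" "d \<in> obs"
    "f \<in> hom (tn bs) d" "g \<in> hom (tn as) (bs ! (i - 1))" "h \<in> hom (tn hs) (bs ! (j - 1))"
  obtain xs b bs' where bs1: "bs = xs @ b # bs'" "i = Suc (length xs)" using split_at[of i bs] A by auto
  have "0 < j - i" "j - i \<le> length bs'" using A bs1 by auto
  then obtain ys c zs where bs2: "bs' = ys @ c # zs" "j - i = Suc (length ys)" by (rule split_at)
  have j: "j = Suc (length (xs @ b # ys))" using bs1 bs2 A by simp
  note bs = bs1(1)[unfolded bs2(1)]
  have o: "set xs \<subseteq> obs" "set ys \<subseteq> obs" "set zs \<subseteq> obs" "set as \<subseteq> obs" "set hs \<subseteq> obs" "b \<in> obs" "c \<in> obs" "d \<in> obs"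
    "f \<in> hom (tn (xs @ b # (ys @ c # zs))) d" "g \<in> hom (tn as) b" "h \<in> hom (tn hs) c"
    using A by (auto simp: bs bs1(2) j nth_append)
  have s: "set (ys @ c # zs) \<subseteq> obs" "set (xs @ b # ys) \<subseteq> obs" "set (ys @ hs @ zs) \<subseteq> obs" "set (xs @ as @ ys) \<subseteq> obs"
    "set (xs @ b # (ys @ c # zs)) \<subseteq> obs" "set (xs @ as @ (ys @ hs @ zs)) \<subseteq> obs"
    using o by auto
  have f': "f \<in> hom (tn ((xs @ b # ys) @ c # zs)) d" using o(9) by simp
  let ?fg = "MSub Mu (xs @ b # (ys @ c # zs)) d (Suc (length xs)) as f g"
  let ?fh = "MSub Mu ((xs @ b # ys) @ c # zs) d (Suc (length (xs @ b # ys))) hs f h"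
  note fg = MSub_Hom[OF o(1) s(1) o(4,6,8,9,10)] D_MSub[OF o(1) s(1) o(4,6,8,9,10)]
  note fh = MSub_Hom[OF s(2) o(3,5,7,8) f' o(11)] D_MSub[OF s(2) o(3,5,7,8) f' o(11)]
  have fg': "?fg \<in> hom (tn ((xs @ as @ ys) @ c # zs)) d" using fg(1) by simp
  have fh': "?fh \<in> hom (tn (xs @ b # (ys @ hs @ zs))) d" using fh(1) by simp
  note l = MSub_Hom[OF s(4) o(3,5,7,8) fg' o(11)] D_MSub[OF s(4) o(3,5,7,8) fg' o(11)]
  note r = MSub_Hom[OF o(1) s(3) o(4,6,8) fh' o(10)] D_MSub[OF o(1) s(3) o(4,6,8) fh' o(10)]
  note Ff = famD(1-3)[OF D_fam[OF s(5) o(8,9)]] and Fg = famD(1-3)[OF D_fam[OF o(4,6,10)]] and Fh = famD(1-4)[OF D_fam[OF o(5,7,11)]]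
  have "MSub Mu (xs @ b # (ys @ hs @ zs)) d (Suc (length xs)) as ?fh g
      = MSub Mu ((xs @ as @ ys) @ c # zs) d (Suc (length (xs @ as @ ys))) hs ?fg h"
  proof (rule D_inject)
    show "D (xs @ as @ (ys @ hs @ zs)) d (MSub Mu (xs @ b # (ys @ hs @ zs)) d (Suc (length xs)) as ?fh g)
        = D (xs @ as @ (ys @ hs @ zs)) d (MSub Mu ((xs @ as @ ys) @ c # zs) d (Suc (length (xs @ as @ ys))) hs ?fg h)"
    proof (rule fam_eqI)
      show "fam (xs @ as @ (ys @ hs @ zs)) d (D (xs @ as @ (ys @ hs @ zs)) d (MSub Mu (xs @ b # (ys @ hs @ zs)) d (Suc (length xs)) as ?fh g))"
        by (rule D_fam) (use r(1) o in auto)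
      show "fam (xs @ as @ (ys @ hs @ zs)) d (D (xs @ as @ (ys @ hs @ zs)) d (MSub Mu ((xs @ as @ ys) @ c # zs) d (Suc (length (xs @ as @ ys))) hs ?fg h))"
        by (rule D_fam) (use l(1) o in auto)
      fix x assume x [simp]: "x \<in> obs"
      note [simp] = o(1-8) Ff Fg Fh(1-3)
      let ?f = "D (xs @ b # (ys @ c # zs)) d f" and ?g = "D as b g" and ?h = "D hs c h"
      let ?k = "dota (?g (dot x xs)) ys"
      have L: "D (xs @ as @ (ys @ hs @ zs)) d (MSub Mu ((xs @ as @ ys) @ c # zs) d (Suc (length (xs @ as @ ys))) hs ?fg h) x
          = ?f x \<cdot> dota (?k \<otimes> \<one> c) zs \<cdot> dota (?h (dot (dot (dot x xs) as) ys)) zs"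
        using l(2) fg(2) by (simp add: fcomp_def acomp_assoc)
      have R: "D (xs @ as @ (ys @ hs @ zs)) d (MSub Mu (xs @ b # (ys @ hs @ zs)) d (Suc (length xs)) as ?fh g) x
          = ?f x \<cdot> dota (?h (dot (dot x xs \<odot> b) ys)) zs \<cdot> dota (dota ?k hs) zs"
        using r(2) fh(2) by (simp add: fcomp_def acomp_assoc)
      have "(?k \<otimes> \<one> c) \<cdot> ?h (dot (dot (dot x xs) as) ys) = ?h (dot (dot x xs \<odot> b) ys) \<cdot> dota ?k hs"
        using Fh(4)[of ?k] by simp
      then show "D (xs @ as @ (ys @ hs @ zs)) d (MSub Mu (xs @ b # (ys @ hs @ zs)) d (Suc (length xs)) as ?fh g) x
          = D (xs @ as @ (ys @ hs @ zs)) d (MSub Mu ((xs @ as @ ys) @ c # zs) d (Suc (length (xs @ as @ ys))) hs ?fg h) x"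
        unfolding L R by (simp add: dota_acomp[symmetric])
    qed
  qed (use l(1) r(1) o in auto)
  moreover have "j + length as - 1 = Suc (length (xs @ as @ ys))" by (simp add: j)
  moreover have "plug bs j hs = xs @ b # (ys @ hs @ zs)" "plug bs i as = (xs @ as @ ys) @ c # zs" "bs = (xs @ b # ys) @ c # zs"
    using plug_append[of "xs @ b # ys" c zs hs] by (simp_all add: bs bs1(2) j)
  ultimately show "MSub Mu (plug bs i as) d (j + length as - 1) hs (MSub Mu bs d i as f g) h
      = MSub Mu (plug bs j hs) d i as (MSub Mu bs d j hs f h) g"
    by (simp add: bs1(2) j ac_simps)
qed

sublocale Mu: multicategory Mu
  by (rule multicategory_Mu)

text \<open>\<open>a b\<close> and \<open>i\<close> are classified by their identity arrows, since \<open>tn [a, b] = a b\<close> and \<open>tn [] = i\<close>.\<close>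

definition ch\<^sub>0 :: "('o, 'a) classifiers" where
  "ch\<^sub>0 = \<lparr>Ten = (\<odot>), Th = (\<lambda>a b. Id (KCat S) (a \<odot> b)), Unt = I, Nul = Id (KCat S) I\<rparr>"

lemma ch0_simps [simp]: "Ten ch\<^sub>0 a b = a \<odot> b" "Th ch\<^sub>0 a b = Id (KCat S) (a \<odot> b)" "Unt ch\<^sub>0 = I" "Nul ch\<^sub>0 = Id (KCat S) I"
  by (simp_all add: ch\<^sub>0_def)

text \<open>As families, \<open>\<theta>\<^sub>a\<^sub>,\<^sub>b\<close> is the associator \<open>(x a) b \<rightarrow> x (a b)\<close>, and \<open>u\<close> below is \<open>\<rho>\<close>.\<close>

lemma D_Th:
  assumes [simp]: "a \<in> obs" "b \<in> obs"
  shows "dec [a, b] (Arr (a \<odot> b) (a \<odot> b) (Id (KCat S) (a \<odot> b))) = (\<lambda>x\<in>obs. asc S x a b)"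
proof -
  have F: "fam [a, b] (a \<odot> b) (\<lambda>x\<in>obs. asc S x a b)"
  proof (rule famI)
    fix h assume "h \<in> karrs S"
    then show "(h \<otimes> \<one> (a \<odot> b)) \<cdot> asc S (dm h) a b = asc S (cd h) a b \<cdot> dota h [a, b]"
      using asc_natural[of h "\<one> a" "\<one> b"] by simp
  next
    fix y x assume [simp]: "y \<in> obs" "x \<in> obs"
    show "asc S y x (a \<odot> b) \<cdot> asc S (y \<odot> x) a b = (\<one> y \<otimes> asc S x a b) \<cdot> al y x [a, b]"
      using arr_pentagon[of y x a b] by simp
  qed simp_all
  have "enc [a, b] (a \<odot> b) (\<lambda>x\<in>obs. asc S x a b) = (lam S (a \<odot> b) \<cdot> asc S I a b) \<cdot> (lami a \<otimes> \<one> b)"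
    by (simp add: enc_def acomp_assoc)
  also have "\<dots> = \<one> (a \<odot> b)"
    by (simp add: arr_left_unit acomp_ten_ide[symmetric])
  finally show ?thesis using dec_enc[OF F] by (simp add: Arr_Id)
qed

lemma rho_I: "rho S I = lami I"
proof -
  have "rho S I = (lami I \<cdot> lam S I) \<cdot> rho S I" by simp
  also have "\<dots> = lami I" by (simp add: acomp_assoc arr_unit_unit del: lami_simps(5))
  finally show ?thesis .
qed

lemma D_Nul: "dec [] (Arr I I (Id (KCat S) I)) = (\<lambda>x\<in>obs. rho S x)"
proof -
  have F: "fam [] I (\<lambda>x\<in>obs. rho S x)"
  proof (rule famI)
    fix h assume "h \<in> karrs S"
    then show "(h \<otimes> \<one> I) \<cdot> rho S (dm h) = rho S (cd h) \<cdot> dota h []"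
      using rho_natural[of h] by simp
  next
    fix y x assume [simp]: "y \<in> obs" "x \<in> obs"
    show "asc S y x I \<cdot> rho S (y \<odot> x) = (\<one> y \<otimes> rho S x) \<cdot> al y x []"
      using arr_right_unit[of y x] by simp
  qed simp_all
  have "enc [] I (\<lambda>x\<in>obs. rho S x) = \<one> I"
    by (simp add: enc_def arr_unit_unit)
  then show ?thesis using dec_enc[OF F] by (simp add: Arr_Id)
qed

lemma asc_I_lami: "\<lbrakk>a \<in> obs; b \<in> obs\<rbrakk> \<Longrightarrow> asc S I a b \<cdot> (lami a \<otimes> \<one> b) = lami (a \<odot> b)"
proof -
  assume [simp]: "a \<in> obs" "b \<in> obs"
  have "asc S I a b \<cdot> (lami a \<otimes> \<one> b) = (lami (a \<odot> b) \<cdot> lam S (a \<odot> b)) \<cdot> asc S I a b \<cdot> (lami a \<otimes> \<one> b)" by simp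
  also have "\<dots> = lami (a \<odot> b) \<cdot> (lam S (a \<odot> b) \<cdot> asc S I a b) \<cdot> (lami a \<otimes> \<one> b)"
    by (simp add: acomp_assoc del: lami_simps(5))
  also have "\<dots> = lami (a \<odot> b)"
    by (simp add: arr_left_unit acomp_ten_ide[symmetric])
  finally show ?thesis .
qed

text \<open>\<open>tn (a b, xs)\<close> and \<open>tn (a, b, xs)\<close> are the same object, and substituting \<open>\<theta>\<close> leaves the
  representing arrow unchanged.\<close>

lemma MSub_Th:
  assumes [simp]: "a \<in> obs" "b \<in> obs" "set xs \<subseteq> obs" "d \<in> obs" "f \<in> hom (dot (a \<odot> b) xs) d"
  shows "MSub Mu ((a \<odot> b) # xs) d (Suc 0) [a, b] f (Id (KCat S) (a \<odot> b)) = f"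
proof -
  note F = famD(1-3)[OF D_fam[of "(a \<odot> b) # xs" d f, simplified], simplified]
  have "enc ([] @ [a, b] @ xs) d (fcomp [] (D ([] @ (a \<odot> b) # xs) d f) (D [a, b] (a \<odot> b) (Id (KCat S) (a \<odot> b))) xs)
      = lam S d \<cdot> D ((a \<odot> b) # xs) d f I \<cdot> dota (asc S I a b \<cdot> (lami a \<otimes> \<one> b)) xs"
    using F by (simp add: enc_def fcomp_def D_Th acomp_assoc dota_acomp)
  also have "\<dots> = enc ((a \<odot> b) # xs) d (D ((a \<odot> b) # xs) d f)"
    by (simp add: asc_I_lami enc_def)
  also have "\<dots> = Arr (dot (a \<odot> b) xs) d f"
    by (subst enc_dec) simp_all
  finally show ?thesis
    using MSub_enc[of "[]" "a \<odot> b" xs d "[a, b]" f "Id (KCat S) (a \<odot> b)"] by simp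
qed

text \<open>Substituting \<open>u\<close> is composition with \<open>kapi\<close>, which is built from \<open>\<lambda>\<inverse>\<close>; this is bijective
  by left normality.\<close>

lemma MSub_Nul:
  assumes [simp]: "set xs \<subseteq> obs" "d \<in> obs" "f \<in> hom (dot I xs) d"
  shows "Arr (tn xs) d (MSub Mu (I # xs) d (Suc 0) [] f (Id (KCat S) I)) = Arr (dot I xs) d f \<cdot> kapi xs"
proof -
  note F = famD(1-3)[OF D_fam[of "I # xs" d f, simplified], simplified]
  have "enc ([] @ [] @ xs) d (fcomp [] (D ([] @ I # xs) d f) (D [] I (Id (KCat S) I)) xs)
      = (lam S d \<cdot> D (I # xs) d f I \<cdot> dota (lami I) xs) \<cdot> kapi xs"
    using F by (simp add: enc_def fcomp_def D_Nul acomp_assoc rho_I)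
  also have "\<dots> = enc (I # xs) d (D (I # xs) d f) \<cdot> kapi xs"
    by (simp add: enc_def)
  also have "\<dots> = Arr (dot I xs) d f \<cdot> kapi xs"
    by (subst enc_dec) simp_all
  finally have *: "enc xs d (fcomp [] (D (I # xs) d f) (D [] I (Id (KCat S) I)) xs) = Arr (dot I xs) d f \<cdot> kapi xs" by simp
  have "MSub Mu (I # xs) d (Suc 0) [] f (Id (KCat S) I) = raw (Arr (dot I xs) d f \<cdot> kapi xs)"
    using MSub_enc[of "[]" I xs d "[]" f "Id (KCat S) I"] * by simp
  then show ?thesis by (simp add: acomp_def)
qed

lemma left_universal_Mu: "left_universal (multi_data Mu) False ch\<^sub>0"
proof (intro left_universal.intro Mu.partial_multicategory_multi left_universal_axioms.intro, unfold Mu.X_simps Mu.unary_cat_simps ch0_simps Mu_simps)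
  fix a b d :: 'o and xs assume A: "a \<in> obs" "b \<in> obs" "set xs \<subseteq> obs" "d \<in> obs"
  show "bij_betw (\<lambda>f. MSub Mu ((a \<odot> b) # xs) d 1 [a, b] f (Id (KCat S) (a \<odot> b)))
      (hom (tn ((a \<odot> b) # xs)) d) (hom (tn (a # b # xs)) d)"
    using MSub_Th[OF A] by (intro bij_betwI[where g = "\<lambda>f. f"]) auto
next
  fix d :: 'o and xs assume A: "set xs \<subseteq> obs" "d \<in> obs"
  let ?F = "\<lambda>f. MSub Mu (I # xs) d 1 [] f (Id (KCat S) I)" and ?G = "\<lambda>g. raw (Arr (tn xs) d g \<cdot> kap xs)"
  note [simp] = A
  have in1: "?F f \<in> hom (tn xs) d" if "f \<in> hom (tn (I # xs)) d" for f
    using MSub_Nul[OF A] that arrsD[of "Arr (dot I xs) d f \<cdot> kapi xs"] by (metis MSub_Hom[of "[]" xs "[]" I d f "Id (KCat S) I"] A KUnit_in Id_in append_Nil empty_set empty_subsetI list.size(3) tn.simps One_nat_def)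
  have in2: "?G g \<in> hom (tn (I # xs)) d" if "g \<in> hom (tn xs) d" for g
    using arrsD(3)[of "Arr (tn xs) d g \<cdot> kap xs"] that by simp
  have e1: "Arr (dot I xs) d (?G g) = Arr (tn xs) d g \<cdot> kap xs" for g
    by (simp add: acomp_def)
  show "bij_betw ?F (hom (tn (I # xs)) d) (hom (tn xs) d)"
  proof (rule bij_betwI[where g = ?G])
    fix f assume f: "f \<in> hom (tn (I # xs)) d"
    then show "?G (?F f) = f"
      using MSub_Nul[OF A, of f] by (simp add: acomp_assoc)
  next
    fix g assume g: "g \<in> hom (tn xs) d"
    have "Arr (tn xs) d (?F (?G g)) = Arr (tn xs) d g"
      using MSub_Nul[OF A in2[OF g, simplified]] g by (simp add: e1 acomp_assoc)
    then show "?F (?G g) = g" by simp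
  qed (use in1 in2 in auto)
qed (simp_all add: Id_in)

sublocale lu: left_universal "multi_data Mu" False ch\<^sub>0
  by (rule left_universal_Mu)

abbreviation mc where "mc \<equiv> mcomp (multi_data Mu)"

text \<open>The skew monoidal structure obtained from the classifiers is the given one: each of its
  components is found by evaluating a composite family at the unit.\<close>

lemma same_skew_Mu: "same_skew S (skew_of (multi_data Mu) ch\<^sub>0)"
proof -
  let ?R = "skew_of (multi_data Mu) ch\<^sub>0"
  have comp: "acomp (unary_cat Mu) g f = g \<cdot> f" if "f \<in> karrs S" "g \<in> karrs S" "dm g = cd f" for f g
  proof -
    note [simp] = arrsD[OF that(1)] arrsD(2)[OF that(2)] that
    have g: "raw g \<in> hom (cd f) (cd g)" using arrsD(3)[OF that(2)] that(3) by simp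
    have g': "Arr (cd f) (cd g) (raw g) = g" using that(3) by (metis arr.collapse)
    have "enc ([] @ [dm f] @ []) (cd g) (fcomp [] (D ([] @ cd f # []) (cd g) (raw g)) (D [dm f] (cd f) (raw f)) [])
        = lam S (cd g) \<cdot> ((\<one> I \<otimes> g) \<cdot> (\<one> I \<otimes> f)) \<cdot> lami (dm f)"
      using g by (simp add: enc_def fcomp_def D_unary g' acomp_assoc)
    also have "\<dots> = (lam S (cd g) \<cdot> (\<one> I \<otimes> (g \<cdot> f))) \<cdot> lami (dm f)"
      by (simp add: ide_ten_acomp acomp_assoc)
    also have "\<dots> = g \<cdot> f"
      using lam_natural[of "g \<cdot> f"] by (simp add: acomp_assoc)
    finally have "MSub Mu [cd f] (cd g) (Suc 0) [dm f] (raw g) (raw f) = raw (g \<cdot> f)"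
      using MSub_enc[of "[]" "cd f" "[]" "cd g" "[dm f]" "raw g" "raw f"] by simp
    then show ?thesis by (simp add: acomp_def)
  qed
  have arrs: "arrs (unary_cat Mu) = karrs S" by (auto simp: arrs_def)
  have ide: "ide (unary_cat Mu) a = \<one> a" for a by (simp add: ide_def)
  have th1: "mc (um h) (Suc 0) (lu.th a b) = MMap [a, b] (cd h) (raw h)"
    if "h \<in> karrs S" "dm h = a \<odot> b" "a \<in> obs" "b \<in> obs" for h a b
    using that MSub_Th[of a b "[]" "cd h" "raw h"] arrsD[OF that(1)] by (simp add: mcomp_def)
  have ten: "f \<otimes>\<^bsub>?R\<^esub> g = f \<otimes> g" if f: "f \<in> karrs S" and g: "g \<in> karrs S" for f g
  proof (rule lu.th_cancel_um[of _ "dm f" "dm g"])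
    note [simp] = arrsD[OF f] arrsD[OF g] f g
    have ff: "Arr (dm f) (cd f) (raw f) = f" "Arr (dm g) (cd g) (raw g) = g" by simp_all
    let ?t = "Id (KCat S) (cd f \<odot> cd g)"
    let ?m = "MSub Mu [cd f, cd g] (cd f \<odot> cd g) (Suc 0) [dm f] ?t (raw f)"
    have t: "?t \<in> hom (tn ([] @ cd f # [cd g])) (cd f \<odot> cd g)" by (simp add: Id_in)
    have D1: "D [dm f, cd g] (cd f \<odot> cd g) ?m = fcomp [] (D [cd f, cd g] (cd f \<odot> cd g) ?t) (D [dm f] (cd f) (raw f)) [cd g]"
      using D_MSub[of "[]" "[cd g]" "[dm f]" "cd f" "cd f \<odot> cd g" ?t "raw f"] t by simp
    have "enc ([dm f] @ [dm g] @ []) (cd f \<odot> cd g) (fcomp [dm f] (D ([dm f] @ cd g # []) (cd f \<odot> cd g) ?m) (D [dm g] (cd g) (raw g)) [])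
        = lam S (cd f \<odot> cd g) \<cdot> asc S I (cd f) (cd g) \<cdot> ((\<one> I \<otimes> f) \<otimes> \<one> (cd g)) \<cdot> (\<one> (I \<odot> dm f) \<otimes> g) \<cdot> (lami (dm f) \<otimes> \<one> (dm g))"
      using D1 by (simp add: enc_def fcomp_def D_unary D_Th ff acomp_assoc)
    also have "((\<one> I \<otimes> f) \<otimes> \<one> (cd g)) \<cdot> (\<one> (I \<odot> dm f) \<otimes> g) \<cdot> (lami (dm f) \<otimes> \<one> (dm g)) = ((\<one> I \<otimes> f) \<cdot> lami (dm f)) \<otimes> g"
      by (simp add: ten_acomp[symmetric])
    also have "lam S (cd f \<odot> cd g) \<cdot> asc S I (cd f) (cd g) \<cdot> (((\<one> I \<otimes> f) \<cdot> lami (dm f)) \<otimes> g)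
        = (lam S (cd f) \<otimes> \<one> (cd g)) \<cdot> (((\<one> I \<otimes> f) \<cdot> lami (dm f)) \<otimes> g)"
      using acomp_extend[OF arr_left_unit[of "cd f" "cd g"]] by simp
    also have "\<dots> = ((lam S (cd f) \<cdot> (\<one> I \<otimes> f)) \<cdot> lami (dm f)) \<otimes> g"
      by (simp add: ten_acomp[symmetric] acomp_assoc)
    also have "\<dots> = f \<otimes> g"
      using lam_natural[of f] by (simp add: acomp_assoc)
    finally have "MSub Mu [dm f, cd g] (cd f \<odot> cd g) 2 [dm g] ?m (raw g) = raw (f \<otimes> g)"
      using MSub_enc[of "[dm f]" "cd g" "[]" "cd f \<odot> cd g" "[dm g]" ?m "raw g"] by (simp add: numeral_2_eq_2)
    then have "mc (mc (lu.th (cd f) (cd g)) (Suc 0) (um f)) 2 (um g) = MMap [dm f, dm g] (cd f \<odot> cd g) (raw (f \<otimes> g))"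
      by (simp add: mcomp_def)
    then show "mc (um (f \<otimes>\<^bsub>?R\<^esub> g)) (Suc 0) (lu.th (dm f) (dm g)) = mc (um (f \<otimes> g)) (Suc 0) (lu.th (dm f) (dm g))"
      using lu.ten_S(2)[of f g] by (simp add: arrs th1)
  qed (use f g lu.ten_S(1)[of f g] in \<open>simp_all add: arrs arrsD[OF f] arrsD[OF g]\<close>)
  have asc: "asc ?R a b c = asc S a b c" if "a \<in> obs" "b \<in> obs" "c \<in> obs" for a b c
  proof (rule lu.th_cancel_um[of _ "a \<odot> b" c])
    note [simp] = that
    let ?t = "Id (KCat S) (a \<odot> (b \<odot> c))" and ?u = "Id (KCat S) (b \<odot> c)"
    have l: "mc (MMap [a \<odot> b, c] d f) (Suc 0) (lu.th a b) = MMap [a, b, c] d f"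
      if "d \<in> obs" "f \<in> hom ((a \<odot> b) \<odot> c) d" for d f
      using MSub_Th[of a b "[c]" d f] that by (simp add: mcomp_def)
    have "enc ([a] @ [b, c] @ []) (a \<odot> (b \<odot> c)) (fcomp [a] (D ([a] @ (b \<odot> c) # []) (a \<odot> (b \<odot> c)) ?t) (D [b, c] (b \<odot> c) ?u) [])
        = lam S (a \<odot> (b \<odot> c)) \<cdot> asc S I a (b \<odot> c) \<cdot> asc S (I \<odot> a) b c \<cdot> ((lami a \<otimes> \<one> b) \<otimes> \<one> c)"
      by (simp add: enc_def fcomp_def D_Th acomp_assoc)
    also have "asc S (I \<odot> a) b c \<cdot> ((lami a \<otimes> \<one> b) \<otimes> \<one> c) = (lami a \<otimes> \<one> (b \<odot> c)) \<cdot> asc S a b c"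
      using asc_natural[of "lami a" "\<one> b" "\<one> c"] by simp
    also have "lam S (a \<odot> (b \<odot> c)) \<cdot> asc S I a (b \<odot> c) \<cdot> (lami a \<otimes> \<one> (b \<odot> c)) \<cdot> asc S a b c
        = ((lam S (a \<odot> (b \<odot> c)) \<cdot> asc S I a (b \<odot> c)) \<cdot> (lami a \<otimes> \<one> (b \<odot> c))) \<cdot> asc S a b c"
      by (simp add: acomp_assoc)
    also have "\<dots> = asc S a b c"
      by (simp add: arr_left_unit acomp_ten_ide[symmetric])
    finally have "MSub Mu [a, b \<odot> c] (a \<odot> (b \<odot> c)) 2 [b, c] ?t ?u = raw (asc S a b c)"
      using MSub_enc[of "[a]" "b \<odot> c" "[]" "a \<odot> (b \<odot> c)" "[b, c]" ?t ?u] by (simp add: numeral_2_eq_2)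
    then have r: "mc (lu.th a (b \<odot> c)) 2 (lu.th b c) = MMap [a, b, c] (a \<odot> (b \<odot> c)) (raw (asc S a b c))"
      by (simp add: mcomp_def)
    show "mc (um (asc ?R a b c)) (Suc 0) (lu.th (a \<odot> b) c) = mc (um (asc S a b c)) (Suc 0) (lu.th (a \<odot> b) c)"
    proof (rule lu.th_cancel[of _ a b _ "[c]"])
      show "mc (mc (um (asc ?R a b c)) (Suc 0) (lu.th (a \<odot> b) c)) (Suc 0) (lu.th a b)
          = mc (mc (um (asc S a b c)) (Suc 0) (lu.th (a \<odot> b) c)) (Suc 0) (lu.th a b)"
        using lu.asc_S(2)[of a b c] r th1[of "asc S a b c" "a \<odot> b" c] l[of "a \<odot> (b \<odot> c)" "raw (asc S a b c)"]
          arrsD(3)[OF structure_arrs(1)[OF that]] by simp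
    qed (use lu.asc_S(1)[of a b c] in \<open>simp_all add: arrs\<close>)
  qed (use that lu.asc_S(1)[of a b c] in \<open>simp_all add: arrs\<close>)
  have lam: "lam ?R a = lam S a" if "a \<in> obs" for a
  proof (rule lu.th_cancel_um[of _ I a])
    note [simp] = that
    show "mc (um (lam ?R a)) (Suc 0) (lu.th I a) = mc (um (lam S a)) (Suc 0) (lu.th I a)"
    proof (rule lu.nu_cancel[of _ _ "[a]"])
      have "Arr a a (MSub Mu [I, a] a (Suc 0) [] (raw (lam S a)) (Id (KCat S) I)) = Arr (I \<odot> a) a (raw (lam S a)) \<cdot> lami a"
        using MSub_Nul[of "[a]" a "raw (lam S a)"] arrsD(3)[OF structure_arrs(2)[OF that]] by simp
      also have "Arr (I \<odot> a) a (raw (lam S a)) = lam S a" by (simp add: lam_def)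
      finally have "MSub Mu [I, a] a (Suc 0) [] (raw (lam S a)) (Id (KCat S) I) = Id (KCat S) a"
        by (simp add: ide_def)
      then show "mc (mc (um (lam ?R a)) (Suc 0) (lu.th I a)) (Suc 0) lu.nu
          = mc (mc (um (lam S a)) (Suc 0) (lu.th I a)) (Suc 0) lu.nu"
        using lu.lam_S(2)[of a] th1[of "lam S a" I a] by (simp add: mcomp_def um_def Mu.unary_cat_simps ide_def)
    qed (use lu.lam_S(1)[of a] in \<open>simp_all add: arrs\<close>)
  qed (use that lu.lam_S(1)[of a] in \<open>simp_all add: arrs\<close>)
  have rho: "rho ?R a = rho S a" if "a \<in> obs" for a
  proof -
    note [simp] = that
    let ?t = "Id (KCat S) (a \<odot> I)"
    have "enc ([a] @ [] @ []) (a \<odot> I) (fcomp [a] (D ([a] @ I # []) (a \<odot> I) ?t) (D [] I (Id (KCat S) I)) [])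
        = lam S (a \<odot> I) \<cdot> asc S I a I \<cdot> rho S (I \<odot> a) \<cdot> lami a"
      by (simp add: enc_def fcomp_def D_Th D_Nul acomp_assoc)
    also have "rho S (I \<odot> a) \<cdot> lami a = (lami a \<otimes> \<one> I) \<cdot> rho S a"
      using rho_natural[of "lami a"] by simp
    also have "lam S (a \<odot> I) \<cdot> asc S I a I \<cdot> (lami a \<otimes> \<one> I) \<cdot> rho S a
        = ((lam S (a \<odot> I) \<cdot> asc S I a I) \<cdot> (lami a \<otimes> \<one> I)) \<cdot> rho S a"
      by (simp add: acomp_assoc)
    also have "\<dots> = rho S a"
      by (simp add: arr_left_unit acomp_ten_ide[symmetric])
    finally have "MSub Mu [a, I] (a \<odot> I) 2 [] ?t (Id (KCat S) I) = raw (rho S a)"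
      using MSub_enc[of "[a]" I "[]" "a \<odot> I" "[]" ?t "Id (KCat S) I"] by (simp add: numeral_2_eq_2)
    then have "um (rho ?R a) = um (rho S a)"
      using lu.rho_S(2)[of a] by (simp add: mcomp_def um_def)
    then show ?thesis by (simp add: um_inject)
  qed
  show ?thesis
    unfolding same_skew_def
    by (simp add: arrs comp ten asc lam rho ide)
qed

subsection \<open>Monoidal categories give representable multicategories\<close>

abbreviation mutually_inverse where "mutually_inverse \<equiv> inverse_arrs (KCat S)"

lemma monoidal_inverses:
  assumes "monoidal S"
  shows "\<lbrakk>a \<in> obs; b \<in> obs; c \<in> obs\<rbrakk> \<Longrightarrow> \<exists>g. mutually_inverse (asc S a b c) g"
    and "a \<in> obs \<Longrightarrow> \<exists>g. mutually_inverse (rho S a) g"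
  using assms iso_in_arrs[of "(a \<odot> b) \<odot> c" "KCat S" "a \<odot> (b \<odot> c)" "KAssoc S a b c"]
    iso_in_arrs[of a "KCat S" "a \<odot> I" "KRho S a"]
  by (simp_all add: monoidal_def asc_def rho_def)

lemma inverse_dota:
  assumes "mutually_inverse f g" "set as \<subseteq> obs"
  shows "mutually_inverse (dota f as) (dota g as)"
  using assms arrsD[of f "KCat S"] by (auto simp: inverse_arrs_def dota_acomp[symmetric])

lemma inverse_ide_ten:
  assumes "mutually_inverse f g" "x \<in> obs"
  shows "mutually_inverse (\<one> x \<otimes> f) (\<one> x \<otimes> g)"
  using assms arrsD[of f "KCat S"] by (auto simp: inverse_arrs_def ide_ten_acomp[symmetric])

lemma inverse_al:
  assumes "monoidal S" "y \<in> obs" "x \<in> obs" "set as \<subseteq> obs"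
  shows "\<exists>g. mutually_inverse (al y x as) g"
  using assms(3,4)
proof (induction as arbitrary: x)
  case Nil
  then show ?case using assms(2) by (intro exI[of _ "\<one> (y \<odot> x)"]) (simp add: inverse_arrs_def)
next
  case (Cons a as)
  have a: "a \<in> obs" "set as \<subseteq> obs" using Cons.prems by simp_all
  obtain g where g: "mutually_inverse (asc S y x a) g"
    using monoidal_inverses(1)[OF assms(1,2) _ a(1)] Cons.prems by auto
  obtain k where k: "mutually_inverse (al y (x \<odot> a) as) k"
    using Cons.IH[of "x \<odot> a"] Cons.prems by auto
  show ?case
    using inverse_acomp[OF inverse_dota[OF g a(2)] k] by auto
qed

text \<open>The list \<open>as\<close> is classified by the identity of \<open>tn as\<close>. As a family this is
  \<open>(x kap) (al x i as) (\<rho>\<^sub>x \<cdot> as)\<close>, which is pointwise invertible if \<open>\<alpha>\<close> and \<open>\<rho>\<close> are, and one can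
  divide by it.\<close>

lemma multi_representable_Mu:
  assumes "monoidal S"
  shows "multi_representable Mu"
  unfolding multi_representable_def
proof (intro allI impI)
  fix as assume "set as \<subseteq> MOb Mu"
  then have as [simp]: "set as \<subseteq> obs" by simp
  let ?m = "tn as" and ?t = "Id (KCat S) (tn as)"
  have t: "?t \<in> hom (tn as) ?m" by (simp add: Id_in)
  have m: "?m \<in> obs" by simp
  have "\<exists>g. mutually_inverse (D as ?m ?t x) g" if x [simp]: "x \<in> obs" for x
  proof -
    have k: "mutually_inverse (kap as) (kapi as)" by (simp add: inverse_arrs_def)
    obtain r where r: "mutually_inverse (rho S x) r"
      using monoidal_inverses(2)[OF assms x] by blast
    obtain l where l: "mutually_inverse (al x I as) l" using inverse_al[OF assms, of x I as] by auto
    have "D as ?m ?t x = (\<one> x \<otimes> kap as) \<cdot> al x I as \<cdot> dota (rho S x) as"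
      by (simp add: dec_def Arr_Id)
    then show ?thesis
      using inverse_acomp[OF inverse_acomp[OF inverse_dota[OF r as] l] inverse_ide_ten[OF k x]] by auto
  qed
  then obtain \<kappa> where \<kappa>: "\<And>x. x \<in> obs \<Longrightarrow> mutually_inverse (D as ?m ?t x) (\<kappa> x)" by metis
  have univ: "bij_betw (\<lambda>f. MSub Mu (xs @ [?m] @ ys) b (length xs + 1) as f ?t) (hom (tn (xs @ [?m] @ ys)) b) (hom (tn (xs @ as @ ys)) b)"
    if o [simp]: "set xs \<subseteq> obs" "set ys \<subseteq> obs" "b \<in> obs" for xs ys b
  proof -
    let ?F = "\<lambda>f. MSub Mu (xs @ ?m # ys) b (Suc (length xs)) as f ?t"
    let ?\<theta> = "D as ?m ?t"
    note \<theta> = D_fam[OF as m t]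
    note ty = o(1,2) as m o(3)
    have Fin: "?F f \<in> hom (tn (xs @ as @ ys)) b" if "f \<in> hom (tn (xs @ ?m # ys)) b" for f
      by (rule MSub_Hom[OF ty that t])
    have "inj_on ?F (hom (tn (xs @ ?m # ys)) b)"
    proof (rule inj_onI)
      fix f g assume fg: "f \<in> hom (tn (xs @ ?m # ys)) b" "g \<in> hom (tn (xs @ ?m # ys)) b" "?F f = ?F g"
      then have *: "fcomp xs (D (xs @ ?m # ys) b f) ?\<theta> ys = fcomp xs (D (xs @ ?m # ys) b g) ?\<theta> ys"
        using D_MSub[OF ty fg(1) t] D_MSub[OF ty fg(2) t] by simp
      have Ff: "fam (xs @ ?m # ys) b (D (xs @ ?m # ys) b f)" "fam (xs @ ?m # ys) b (D (xs @ ?m # ys) b g)"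
        by (rule D_fam, use fg in auto)+
      have "D (xs @ ?m # ys) b f = D (xs @ ?m # ys) b g"
      proof (rule fam_eqI[OF Ff])
        fix x assume [simp]: "x \<in> obs"
        let ?z = "dot x xs"
        note i = \<kappa>[of ?z, simplified] inverse_dota[OF \<kappa>[of ?z, simplified] o(2)]
        have t1: "?\<theta> ?z \<in> karrs S" "dm (?\<theta> ?z) = dot ?z as" "cd (?\<theta> ?z) = ?z \<odot> ?m" using famD(1-3)[OF \<theta>, of ?z] by simp_all
        have k1: "dota (?\<theta> ?z) ys \<cdot> dota (\<kappa> ?z) ys = \<one> (dot (?z \<odot> ?m) ys)" "\<kappa> ?z \<in> karrs S" "dm (\<kappa> ?z) = ?z \<odot> ?m" "cd (\<kappa> ?z) = dot ?z as"
          using i t1 by (simp_all add: inverse_arrs_def)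
        have "D (xs @ ?m # ys) b f x \<cdot> dota (?\<theta> ?z) ys = D (xs @ ?m # ys) b g x \<cdot> dota (?\<theta> ?z) ys"
          using fun_cong[OF *, of x] by (simp add: fcomp_def)
        then have "(D (xs @ ?m # ys) b f x \<cdot> dota (?\<theta> ?z) ys) \<cdot> dota (\<kappa> ?z) ys = (D (xs @ ?m # ys) b g x \<cdot> dota (?\<theta> ?z) ys) \<cdot> dota (\<kappa> ?z) ys"
          by simp
        then show "D (xs @ ?m # ys) b f x = D (xs @ ?m # ys) b g x"
          using famD(1-3)[OF Ff(1), of x] famD(1-3)[OF Ff(2), of x] t1 k1 by (simp add: acomp_assoc)
      qed
      then show "f = g" by (rule D_inject) (use fg in auto)
    qed
    moreover have "\<exists>f\<in>hom (tn (xs @ ?m # ys)) b. ?F f = g" if g: "g \<in> hom (tn (xs @ as @ ys)) b" for g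
    proof -
      have s: "set (xs @ as @ ys) \<subseteq> obs" "set (xs @ ?m # ys) \<subseteq> obs" by simp_all
      note Fg = D_fam[OF s(1) o(3) g]
      note div = fam_divide[OF Fg \<theta> m o(3) o(1) as o(2) \<kappa>]
      let ?f = "raw (enc (xs @ ?m # ys) b (fcomp xs (D (xs @ as @ ys) b g) \<kappa> ys))"
      have f: "?f \<in> hom (tn (xs @ ?m # ys)) b"
        by (rule raw_enc_in[OF div(1) s(2) o(3)])
      have Df: "D (xs @ ?m # ys) b ?f = fcomp xs (D (xs @ as @ ys) b g) \<kappa> ys"
        using enc_raw[OF div(1) s(2) o(3)] dec_enc[OF div(1) s(2) o(3)] by simp
      have "D (xs @ as @ ys) b (?F ?f) = D (xs @ as @ ys) b g"
        unfolding D_MSub[OF ty f t] Df by (rule div(2))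
      then have "?F ?f = g" by (rule D_inject) (use g Fin[OF f] in auto)
      then show ?thesis using f by blast
    qed
    ultimately have "bij_betw ?F (hom (tn (xs @ ?m # ys)) b) (hom (tn (xs @ as @ ys)) b)"
      using Fin unfolding bij_betw_def by blast
    then show ?thesis by simp
  qed
  show "\<exists>m\<in>MOb Mu. \<exists>\<theta>\<in>MHom Mu as m. \<forall>xs ys b. set xs \<subseteq> MOb Mu \<and> set ys \<subseteq> MOb Mu \<and> b \<in> MOb Mu \<longrightarrow>
      bij_betw (\<lambda>f. MSub Mu (xs @ [m] @ ys) b (length xs + 1) as f \<theta>) (MHom Mu (xs @ [m] @ ys) b) (MHom Mu (xs @ as @ ys) b)"
    by (rule bexI[of _ ?m], rule bexI[of _ ?t]) (use univ t m in auto)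
qed

end


section \<open>Universal maps\<close>

lemma bij_betw_congI:
  "\<lbrakk>bij_betw g A B; \<And>a. a \<in> A \<Longrightarrow> f a = g a; A' = A; B' = B\<rbrakk> \<Longrightarrow> bij_betw f A' B'"
  using bij_betw_cong[of A f g B] by simp

lemma bij_betw_preimage: "bij_betw F A B \<Longrightarrow> b \<in> B \<Longrightarrow> \<exists>a\<in>A. F a = b"
  by (auto simp: bij_betw_def)

context partial_multicategory
begin

text \<open>The maps of a given type; \<open>unary_universal\<close> tests a map against unary maps, \<open>universal\<close> against
  all maps, in every input and for all arities for which the substitution is defined.\<close>

definition maps_at :: "'o list \<Rightarrow> 'o \<Rightarrow> ('o, 'a) mmap set" where
  "maps_at as d = {f \<in> M. src f = as \<and> tgt f = d}"

definition unary_universal :: "('o, 'a) mmap \<Rightarrow> bool" where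
  "unary_universal q \<longleftrightarrow> q \<in> M \<and> (\<forall>d\<in>obs.
     bij_betw (\<lambda>f. f \<bullet>\<^sub>1 q) (maps_at [tgt q] d) (maps_at (src q) d))"

definition universal :: "('o, 'a) mmap \<Rightarrow> bool" where
  "universal q \<longleftrightarrow> q \<in> M \<and> (\<forall>xs ys d. set xs \<subseteq> obs \<and> set ys \<subseteq> obs \<and> d \<in> obs \<and>
       ok sh (Suc (length xs + length ys)) (length (src q)) \<longrightarrow>
     bij_betw (\<lambda>f. f \<bullet>\<^bsub>Suc (length xs)\<^esub> q) (maps_at (xs @ tgt q # ys) d) (maps_at (xs @ src q @ ys) d))"

lemma universalD:
  assumes "universal q" "set xs \<subseteq> obs" "set ys \<subseteq> obs" "d \<in> obs" "ok sh (Suc (length xs + length ys)) (length (src q))"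
  shows "bij_betw (\<lambda>f. f \<bullet>\<^bsub>Suc (length xs)\<^esub> q) (maps_at (xs @ tgt q # ys) d) (maps_at (xs @ src q @ ys) d)"
  using assms by (simp add: universal_def)

lemma maps_at_raw:
  assumes "set as \<subseteq> obs" "d \<in> obs" "ok sh (Suc 0) (length as)"
  shows "maps_at as d = MMap as d ` DHom X as d"
proof -
  have "f \<in> MMap as d ` DHom X as d" if "f \<in> maps_at as d" for f
    using that by (cases f) (auto simp: maps_at_def maps_def)
  then show ?thesis using assms by (auto simp: maps_at_def maps_def)
qed

lemma bij_betw_raw:
  assumes "set xs \<subseteq> obs" "set ys \<subseteq> obs" "d \<in> obs" "q \<in> M" "ok sh (Suc (length xs + length ys)) (length (src q))"
  shows "bij_betw (\<lambda>f. f \<bullet>\<^bsub>Suc (length xs)\<^esub> q) (maps_at (xs @ tgt q # ys) d) (maps_at (xs @ src q @ ys) d)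
    \<longleftrightarrow> bij_betw (\<lambda>f. DComp X (xs @ [tgt q] @ ys) d (length xs + 1) (src q) f (val q))
      (DHom X (xs @ [tgt q] @ ys) d) (DHom X (xs @ src q @ ys) d)"
proof -
  have inj: "inj_on (MMap as b) A" for as :: "'o list" and b :: 'o and A :: "'a set" by (simp add: inj_on_def)
  have s: "set (xs @ tgt q # ys) \<subseteq> obs" "set (xs @ src q @ ys) \<subseteq> obs"
    using assms(1,2) mapsD(1,2)[OF assms(4)] by auto
  have o: "ok sh (Suc 0) (length (xs @ tgt q # ys))" "ok sh (Suc 0) (length (xs @ src q @ ys))"
    using ok_arity(1,3)[OF assms(5)] by (simp_all add: ac_simps)
  let ?F = "\<lambda>f. f \<bullet>\<^bsub>Suc (length xs)\<^esub> q" and ?G = "\<lambda>f. DComp X (xs @ tgt q # ys) d (Suc (length xs)) (src q) f (val q)"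
  have "?F (MMap (xs @ tgt q # ys) d f) = MMap (xs @ src q @ ys) d (?G f)" for f
    by (simp add: mcomp_def)
  then have eq: "?F \<circ> MMap (xs @ tgt q # ys) d = MMap (xs @ src q @ ys) d \<circ> ?G" by auto
  have "bij_betw ?F (maps_at (xs @ tgt q # ys) d) (maps_at (xs @ src q @ ys) d)
      \<longleftrightarrow> bij_betw (?F \<circ> MMap (xs @ tgt q # ys) d) (DHom X (xs @ tgt q # ys) d) (maps_at (xs @ src q @ ys) d)"
    unfolding maps_at_raw[OF s(1) assms(3) o(1)]
    by (rule bij_betw_comp_iff[OF inj_on_imp_bij_betw[OF inj]])
  also have "\<dots> \<longleftrightarrow> bij_betw ?G (DHom X (xs @ tgt q # ys) d) (DHom X (xs @ src q @ ys) d)"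
  proof -
    have "inj_on (MMap (xs @ src q @ ys) d \<circ> ?G) A \<longleftrightarrow> inj_on ?G A" for A by (simp add: inj_on_def)
    then show ?thesis
      unfolding eq maps_at_raw[OF s(2) assms(3) o(2)] bij_betw_def image_comp[symmetric]
      by (simp only: inj_image_eq_iff[OF inj])
  qed
  finally show ?thesis by simp
qed

lemma universalI:
  assumes "q \<in> M"
    and "\<And>xs ys d. \<lbrakk>set xs \<subseteq> obs; set ys \<subseteq> obs; d \<in> obs; ok sh (Suc (length xs + length ys)) (length (src q))\<rbrakk>
      \<Longrightarrow> bij_betw (\<lambda>f. DComp X (xs @ [tgt q] @ ys) d (length xs + 1) (src q) f (val q))
        (DHom X (xs @ [tgt q] @ ys) d) (DHom X (xs @ src q @ ys) d)"
  shows "universal q"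
  unfolding universal_def using assms bij_betw_raw[OF _ _ _ assms(1)] by blast

lemma unary_universalI:
  assumes "q \<in> M"
    and "\<And>d. d \<in> obs \<Longrightarrow> bij_betw (\<lambda>f. DComp X [tgt q] d 1 (src q) f (val q)) (DHom X [tgt q] d) (DHom X (src q) d)"
  shows "unary_universal q"
  unfolding unary_universal_def using assms bij_betw_raw[of "[]" "[]" _ q] mapsD(4)[OF assms(1)] by simp

text \<open>Universality against unary maps makes \<open>p\<close> and \<open>q\<close> differ by an isomorphism \<open>e\<close>. Substituting
  \<open>q\<close> is substituting first \<open>e\<close> and then \<open>p\<close>, and both are bijective in every input.\<close>

lemma universal_transfer:
  assumes p: "universal p" and q: "unary_universal q" and pq: "src q = src p"
  shows "universal q"
proof -
  have M: "p \<in> M" "q \<in> M" using p q by (simp_all add: universal_def unary_universal_def)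
  have op: "ok sh (Suc 0) (length (src p))" using mapsD(4)[OF M(1)] .
  have t: "tgt p \<in> obs" "tgt q \<in> obs" using M mapsD(1) by auto
  note bp = universalD[OF p _ _ _, of "[]" "[]", simplified, OF _ op]
  have bq: "bij_betw (\<lambda>f. f \<bullet>\<^sub>1 q) (maps_at [tgt q] d) (maps_at (src p) d)" if "d \<in> obs" for d
    using q that pq by (simp add: unary_universal_def)
  have at: "q \<in> maps_at (src p) (tgt q)" "p \<in> maps_at (src p) (tgt p)" using M pq by (simp_all add: maps_at_def)
  obtain e e' where e: "e \<in> maps_at [tgt p] (tgt q)" "e \<bullet>\<^sub>1 p = q"
    and e': "e' \<in> maps_at [tgt q] (tgt p)" "e' \<bullet>\<^sub>1 q = p"
    using bij_betw_preimage[OF bp[OF t(2)] at(1)] bij_betw_preimage[OF bq[OF t(1)] at(2)] by blast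
  have em: "e \<in> M" "src e = [tgt p]" "tgt e = tgt q" "e' \<in> M" "src e' = [tgt q]" "tgt e' = tgt p"
    using e e' by (simp_all add: maps_at_def)
  note oq = op[folded pq]
  have "(e' \<bullet>\<^sub>1 e) \<bullet>\<^sub>1 p = idm (tgt p) \<bullet>\<^sub>1 p"
    using mcomp_nested[of e' e p "Suc 0" "Suc 0"] em M e e' op by (simp add: fits_def Id_mcomp)
  from inj_onD[OF bij_betw_imp_inj_on[OF bp[OF t(1)]] this] have ee: "e' \<bullet>\<^sub>1 e = idm (tgt p)"
    using em t by (simp add: maps_at_def)
  have "(e \<bullet>\<^sub>1 e') \<bullet>\<^sub>1 q = idm (tgt q) \<bullet>\<^sub>1 q"
    using mcomp_nested[of e e' q "Suc 0" "Suc 0"] em M e e' op oq by (simp add: fits_def Id_mcomp)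
  from inj_onD[OF bij_betw_imp_inj_on[OF bq[OF t(2)]] this] have ee': "e \<bullet>\<^sub>1 e' = idm (tgt q)"
    using em t by (simp add: maps_at_def)
  show ?thesis
    unfolding universal_def
  proof (intro conjI allI impI M(2))
    fix xs ys d assume A: "set xs \<subseteq> obs \<and> set ys \<subseteq> obs \<and> d \<in> obs \<and> ok sh (Suc (length xs + length ys)) (length (src q))"
    let ?i = "Suc (length xs)"
    have ok1: "ok sh (Suc (length xs + length ys)) (Suc 0)" using A ok_arity(4) by blast
    have inv: "(f \<bullet>\<^bsub>?i\<^esub> k) \<bullet>\<^bsub>?i\<^esub> k' = f"
      if "f \<in> maps_at (xs @ tgt k # ys) d" "k \<in> M" "k' \<in> M" "src k = [tgt k']" "src k' = [tgt k]" "k \<bullet>\<^sub>1 k' = idm (tgt k)" for f k k'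
      using mcomp_nested[of f k k' ?i "Suc 0"] that ok1 mcomp_Id[of f ?i "tgt k"] by (simp add: fits_def maps_at_def nth_append)
    have in1: "f \<bullet>\<^bsub>?i\<^esub> k \<in> maps_at (xs @ src k @ ys) d" if "f \<in> maps_at (xs @ tgt k # ys) d" "k \<in> M" "length (src k) = Suc 0" for f k
      using that ok1 by (auto simp: maps_at_def)
    have "bij_betw (\<lambda>f. f \<bullet>\<^bsub>?i\<^esub> e) (maps_at (xs @ tgt q # ys) d) (maps_at (xs @ tgt p # ys) d)"
      by (rule bij_betwI[where g = "\<lambda>f. f \<bullet>\<^bsub>?i\<^esub> e'"])
        (use in1[of _ e] in1[of _ e'] inv[of _ e e'] inv[of _ e' e] em ee ee' in auto)
    moreover have "bij_betw (\<lambda>f. f \<bullet>\<^bsub>?i\<^esub> p) (maps_at (xs @ tgt p # ys) d) (maps_at (xs @ src p @ ys) d)"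
      by (rule universalD[OF p]) (use A pq in auto)
    ultimately have "bij_betw ((\<lambda>f. f \<bullet>\<^bsub>?i\<^esub> p) \<circ> (\<lambda>f. f \<bullet>\<^bsub>?i\<^esub> e)) (maps_at (xs @ tgt q # ys) d) (maps_at (xs @ src p @ ys) d)"
      by (rule bij_betw_trans)
    note c1 = this
    have c2: "((\<lambda>f. f \<bullet>\<^bsub>?i\<^esub> p) \<circ> (\<lambda>f. f \<bullet>\<^bsub>?i\<^esub> e)) f = f \<bullet>\<^bsub>?i\<^esub> q" if "f \<in> maps_at (xs @ tgt q # ys) d" for f
      using mcomp_nested[of f e p ?i "Suc 0"] that em M A ok1 op pq e(2) by (simp add: fits_def maps_at_def nth_append)
    show "bij_betw (\<lambda>f. f \<bullet>\<^bsub>?i\<^esub> q) (maps_at (xs @ tgt q # ys) d) (maps_at (xs @ src q @ ys) d)"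
      unfolding pq by (rule bij_betw_cong[THEN iffD1, OF c2 c1])
  qed
qed

end

lemma (in left_universal) unary_universal_th_nu:
  "\<lbrakk>a \<in> obs; b \<in> obs\<rbrakk> \<Longrightarrow> unary_universal (th a b)" "unary_universal nu"
  using bij_betw_raw[of "[]" "[]" _ "th _ _"] bij_betw_raw[of "[]" "[]" _ nu] Th_univ[of _ _ "[]"] Nul_univ[of "[]"]
  by (simp_all add: unary_universal_def ok_1_2)

text \<open>\<open>\<alpha>\<close> compares \<open>(\<theta> \<circ>\<^sub>1 \<theta>)\<close> with \<open>(\<theta> \<circ>\<^sub>2 \<theta>)\<close>. If the latter is universal too, it can be factored
  through in the same way, which gives the inverse. Similarly \<open>\<rho> = \<theta> \<circ>\<^sub>2 u\<close> is inverted by the arrow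
  \<open>h\<close> with \<open>(h \<circ> \<theta>) \<circ>\<^sub>2 u = 1\<close>.\<close>

lemma (in left_universal) monoidal_S:
  assumes th: "\<And>a b. \<lbrakk>a \<in> obs; b \<in> obs\<rbrakk> \<Longrightarrow> universal (th a b)" and nu: "universal nu"
  shows "monoidal S"
proof -
  have asc: "\<exists>g. inverse_arrs (DCat X) (asc S a b c) g" if [simp]: "a \<in> obs" "b \<in> obs" "c \<in> obs" for a b c
  proof -
    note [simp] = asc_S(1)
    let ?p = "th (Ten \<chi> a b) c \<bullet>\<^sub>1 th a b"
    have bij: "bij_betw (\<lambda>f. f \<bullet>\<^bsub>2\<^esub> th b c) (maps_at [a, Ten \<chi> b c] d) (maps_at [a, b, c] d)" if "d \<in> obs" for d
      using universalD[OF th[of b c], of "[a]" "[]" d] that by (simp add: numeral_2_eq_2)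
    obtain g where g: "g \<in> M" "src g = [a, Ten \<chi> b c]" "tgt g = tgt ?p" "g \<bullet>\<^bsub>2\<^esub> th b c = ?p"
      using bij_betw_preimage[OF bij[of "tgt ?p"], of ?p] by (auto simp: maps_at_def)
    obtain h where h: "h \<in> arrs (DCat X)" "dm h = Ten \<chi> a (Ten \<chi> b c)" "cd h = tgt g" "um h \<bullet>\<^sub>1 th a (Ten \<chi> b c) = g"
      using th_factor_unary[OF g(1,2)] by metis
    have h2: "(um h \<bullet>\<^sub>1 th a (Ten \<chi> b c)) \<bullet>\<^bsub>2\<^esub> th b c = ?p" using h g by simp
    have "acomp (DCat X) h (asc S a b c) = ide (DCat X) (Ten \<chi> (Ten \<chi> a b) c)" (is "?l = ?r")
    proof (rule th_cancel_um[of _ "Ten \<chi> a b" c])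
      show "um ?l \<bullet>\<^sub>1 th (Ten \<chi> a b) c = um ?r \<bullet>\<^sub>1 th (Ten \<chi> a b) c"
      proof (rule th_cancel[of _ a b _ "[c]"])
        show "(um ?l \<bullet>\<^sub>1 th (Ten \<chi> a b) c) \<bullet>\<^sub>1 th a b = (um ?r \<bullet>\<^sub>1 th (Ten \<chi> a b) c) \<bullet>\<^sub>1 th a b"
          using h g h2 by (simp add: words typings)
      qed (use h g in \<open>simp_all add: typings\<close>)
    qed (use h g in \<open>simp_all add: typings\<close>)
    moreover have "acomp (DCat X) (asc S a b c) h = ide (DCat X) (Ten \<chi> a (Ten \<chi> b c))" (is "?l = ?r")
    proof (rule th_cancel_um[of _ a "Ten \<chi> b c"])
      show "um ?l \<bullet>\<^sub>1 th a (Ten \<chi> b c) = um ?r \<bullet>\<^sub>1 th a (Ten \<chi> b c)"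
      proof (rule inj_onD[OF bij_betw_imp_inj_on[OF bij[of "Ten \<chi> a (Ten \<chi> b c)"]]])
        have "(um ?l \<bullet>\<^sub>1 th a (Ten \<chi> b c)) \<bullet>\<^bsub>2\<^esub> th b c = um (asc S a b c) \<bullet>\<^sub>1 ((um h \<bullet>\<^sub>1 th a (Ten \<chi> b c)) \<bullet>\<^bsub>2\<^esub> th b c)"
          using h(1-3) g(3) by (simp add: words typings)
        also have "\<dots> = (um (asc S a b c) \<bullet>\<^sub>1 th (Ten \<chi> a b) c) \<bullet>\<^sub>1 th a b"
          unfolding h2 by (simp add: words typings)
        finally show "(um ?l \<bullet>\<^sub>1 th a (Ten \<chi> b c)) \<bullet>\<^bsub>2\<^esub> th b c = (um ?r \<bullet>\<^sub>1 th a (Ten \<chi> b c)) \<bullet>\<^bsub>2\<^esub> th b c"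
          by (simp add: asc_S(2) Id_mcomp)
      qed (use h g in \<open>simp_all add: maps_at_def\<close>)
    qed (use h g in \<open>simp_all add: typings\<close>)
    ultimately show ?thesis
      using h g by (intro exI[of _ h]) (simp add: inverse_arrs_def)
  qed
  have rho: "\<exists>g. inverse_arrs (DCat X) (rho S a) g" if [simp]: "a \<in> obs" for a
  proof -
    note [simp] = rho_S(1)
    have bij: "bij_betw (\<lambda>f. f \<bullet>\<^bsub>2\<^esub> nu) (maps_at [a, Unt \<chi>] d) (maps_at [a] d)" if "d \<in> obs" for d
      using universalD[OF nu, of "[a]" "[]" d] that by (simp add: numeral_2_eq_2)
    have "idm a \<in> maps_at [a] a" by (simp add: maps_at_def)
    then obtain g where g: "g \<in> M" "src g = [a, Unt \<chi>]" "tgt g = a" "g \<bullet>\<^bsub>2\<^esub> nu = idm a"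
      using bij_betw_preimage[OF bij[of a], of "idm a"] by (auto simp: maps_at_def)
    obtain h where h: "h \<in> arrs (DCat X)" "dm h = Ten \<chi> a (Unt \<chi>)" "cd h = tgt g" "um h \<bullet>\<^sub>1 th a (Unt \<chi>) = g"
      using th_factor_unary[OF g(1,2)] by metis
    have h2: "(um h \<bullet>\<^sub>1 th a (Unt \<chi>)) \<bullet>\<^bsub>2\<^esub> nu = idm a" using h g by simp
    have "acomp (DCat X) h (rho S a) = ide (DCat X) a"
      unfolding um_inject[symmetric] using h g h2 by (simp add: words typings)
    moreover have "acomp (DCat X) (rho S a) h = ide (DCat X) (Ten \<chi> a (Unt \<chi>))" (is "?l = ?r")
    proof (rule th_cancel_um[of _ a "Unt \<chi>"])
      show "um ?l \<bullet>\<^sub>1 th a (Unt \<chi>) = um ?r \<bullet>\<^sub>1 th a (Unt \<chi>)"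
      proof (rule inj_onD[OF bij_betw_imp_inj_on[OF bij[of "Ten \<chi> a (Unt \<chi>)"]]])
        have "(um ?l \<bullet>\<^sub>1 th a (Unt \<chi>)) \<bullet>\<^bsub>2\<^esub> nu = um (rho S a) \<bullet>\<^sub>1 ((um h \<bullet>\<^sub>1 th a (Unt \<chi>)) \<bullet>\<^bsub>2\<^esub> nu)"
          using h(1-3) g(3) by (simp add: mcomp_word um_acomp ok_1_2)
        also have "\<dots> = th a (Unt \<chi>) \<bullet>\<^bsub>2\<^esub> nu"
          unfolding h2 by (simp add: mcomp_Id rho_S(2))
        finally show "(um ?l \<bullet>\<^sub>1 th a (Unt \<chi>)) \<bullet>\<^bsub>2\<^esub> nu = (um ?r \<bullet>\<^sub>1 th a (Unt \<chi>)) \<bullet>\<^bsub>2\<^esub> nu"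
          by (simp add: Id_mcomp)
      qed (use h g in \<open>simp_all add: maps_at_def\<close>)
    qed (use h g in \<open>simp_all add: typings\<close>)
    ultimately show ?thesis
      using h g by (intro exI[of _ h]) (simp add: inverse_arrs_def)
  qed
  have lam: "\<exists>g. inverse_arrs (DCat X) (lam S a) g" if "a \<in> obs" for a
    using inverse_lam[OF that] by (rule exI)
  show ?thesis
    using asc rho lam unfolding monoidal_def
    by (auto simp: iso_in_arrs asc_def rho_def lam_def)
qed

section \<open>Classifiers in short multicategories and in multicategories\<close>

lemma (in short_multicategory) left_universal_short:
  assumes "left_classifiers C \<chi>"
  shows "left_universal (short_data C) True \<chi>"
proof -
  interpret L: left_classifiers C \<chi> by fact
  show ?thesis
    by (intro left_universal.intro left_universal_axioms.intro partial_multicategory_short)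
      (use L.Ten_in L.Th_in L.Unt_in L.Nul_in L.Th_left_universal L.Nul_left_universal in
        \<open>auto simp: ok_True sub_arities_def\<close>)
qed

lemma (in short_multicategory) full_classifiers_universal:
  assumes "full_classifiers C \<chi>"
  shows "left_classifiers C \<chi>"
    "\<lbrakk>a \<in> SOb C; b \<in> SOb C\<rbrakk> \<Longrightarrow> partial_multicategory.universal (short_data C) True (MMap [a, b] (Ten \<chi> a b) (Th \<chi> a b))"
    "partial_multicategory.universal (short_data C) True (MMap [] (Unt \<chi>) (Nul \<chi>))"
proof -
  interpret L: full_classifiers C \<chi> by fact
  interpret pm: partial_multicategory X True by (rule partial_multicategory_short)
  show "left_classifiers C \<chi>"
  proof (intro left_classifiers.intro)
    fix a b xs d assume "a \<in> SOb C" "b \<in> SOb C" "length xs \<le> 2" "set xs \<subseteq> SOb C" "d \<in> SOb C"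
    then show "bij_betw (\<lambda>f. scomp C (Ten \<chi> a b # xs) d 1 [a, b] f (Th \<chi> a b)) (SHom C (Ten \<chi> a b # xs) d) (SHom C (a # b # xs) d)"
      using L.Th_universal[of a b "[]" xs d] by simp
  next
    fix xs d assume "length xs \<le> 2" "set xs \<subseteq> SOb C" "d \<in> SOb C"
    then show "bij_betw (\<lambda>f. scomp C (Unt \<chi> # xs) d 1 [] f (Nul \<chi>)) (SHom C (Unt \<chi> # xs) d) (SHom C xs d)"
      using L.Nul_universal[of "[]" xs d] by simp
  qed (auto intro: L.Ten_in L.Th_in L.Unt_in L.Nul_in)
  have l: "length xs + length ys \<le> 2" if "ok True (Suc (length xs + length ys)) m" "m = 0 \<or> m = Suc (Suc 0)" for xs ys :: "'o list" and m
    using that by (auto simp: ok_True sub_arities_def)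
  show "pm.universal (MMap [a, b] (Ten \<chi> a b) (Th \<chi> a b))" if "a \<in> SOb C" "b \<in> SOb C"
    by (rule pm.universalI) (use that L.Th_universal[of a b] l L.Th_in L.Ten_in in \<open>auto simp: M_iff\<close>)
  show "pm.universal (MMap [] (Unt \<chi>) (Nul \<chi>))"
    by (rule pm.universalI) (use L.Nul_universal l L.Nul_in L.Unt_in in \<open>auto simp: M_iff\<close>)
qed

text \<open>The given classifiers need not be the fully universal ones whose existence is assumed, but
  they have the same sources.\<close>

lemma representable_monoidal:
  assumes "short_multicategory C" "representable C" "left_classifiers C \<chi>"
  shows "monoidal (skew_of (short_data C) \<chi>)"
proof -
  interpret short_multicategory C by fact
  obtain \<chi>' where \<chi>': "full_classifiers C \<chi>'" using assms(2) by (auto simp: representable_def)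
  interpret L: left_universal X True \<chi> by (rule left_universal_short) fact
  show ?thesis
  proof (rule L.monoidal_S)
    show "L.universal (L.th a b)" if "a \<in> L.obs" "b \<in> L.obs" for a b
      by (rule L.universal_transfer[OF full_classifiers_universal(2)[OF \<chi>'] L.unary_universal_th_nu(1)])
        (use that in simp_all)
    show "L.universal L.nu"
      by (rule L.universal_transfer[OF full_classifiers_universal(3)[OF \<chi>'] L.unary_universal_th_nu(2)]) simp
  qed
qed

context multicategory
begin

lemma ok_small: "\<lbrakk>n \<le> 2; m = 0 \<or> m = 2\<rbrakk> \<Longrightarrow> ok True (Suc n) m"
proof -
  assume "n \<le> 2" "m = 0 \<or> m = 2"
  moreover from this have "n = 0 \<or> n = 1 \<or> n = 2" by linarith
  ultimately show ?thesis by (elim disjE) (simp_all add: ok_def sub_arities_def)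
qed

lemma left_classifiers_U:
  assumes "left_universal X False \<chi>"
  shows "left_classifiers U \<chi>"
proof -
  interpret L: left_universal X False \<chi> by fact
  show ?thesis
  proof (intro left_classifiers.intro, unfold U_simps(1) unary_cat_simps)
    fix a b xs d assume A: "a \<in> MOb M" "b \<in> MOb M" "length xs \<le> 2" "set xs \<subseteq> MOb M" "d \<in> MOb M"
    have "ok True (Suc (length xs)) 2" using A(3) by (intro ok_small) auto
    then have sc: "scomp U (Ten \<chi> a b # xs) d 1 [a, b] f (Th \<chi> a b) = MSub M (Ten \<chi> a b # xs) d 1 [a, b] f (Th \<chi> a b)"
      if "f \<in> MHom M (Ten \<chi> a b # xs) d" for f
      using that A L.Ten_in[of a b] L.Th_in[of a b] by (intro scomp_U) (simp_all add: numeral_2_eq_2)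
    show "bij_betw (\<lambda>f. scomp U (Ten \<chi> a b # xs) d 1 [a, b] f (Th \<chi> a b)) (SHom U (Ten \<chi> a b # xs) d) (SHom U (a # b # xs) d)"
      by (rule bij_betw_congI[OF L.Th_univ[of a b xs d]]) (use A sc in auto)
  next
    fix xs d assume A: "length xs \<le> 2" "set xs \<subseteq> MOb M" "d \<in> MOb M"
    have "ok True (Suc (length xs)) 0" using A(1) by (intro ok_small) auto
    then have sc: "scomp U (Unt \<chi> # xs) d 1 [] f (Nul \<chi>) = MSub M (Unt \<chi> # xs) d 1 [] f (Nul \<chi>)"
      if "f \<in> MHom M (Unt \<chi> # xs) d" for f
      using that A L.Unt_in L.Nul_in by (intro scomp_U) simp_all
    show "bij_betw (\<lambda>f. scomp U (Unt \<chi> # xs) d 1 [] f (Nul \<chi>)) (SHom U (Unt \<chi> # xs) d) (SHom U xs d)"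
      by (rule bij_betw_congI[OF L.Nul_univ[of xs d]]) (use A sc in auto)
  qed (use L.Ten_in L.Th_in L.Unt_in L.Nul_in in auto)
qed

lemma multi_representableD:
  assumes "multi_representable M" "set as \<subseteq> MOb M"
  obtains m \<theta> where "m \<in> MOb M" "\<theta> \<in> MHom M as m" "pm.universal (MMap as m \<theta>)"
    "\<And>xs ys b. \<lbrakk>set xs \<subseteq> MOb M; set ys \<subseteq> MOb M; b \<in> MOb M\<rbrakk> \<Longrightarrow>
      bij_betw (\<lambda>f. MSub M (xs @ [m] @ ys) b (length xs + 1) as f \<theta>) (MHom M (xs @ [m] @ ys) b) (MHom M (xs @ as @ ys) b)"
proof -
  obtain m \<theta> where m: "m \<in> MOb M" "\<theta> \<in> MHom M as m"
    and u: "\<And>xs ys b. \<lbrakk>set xs \<subseteq> MOb M; set ys \<subseteq> MOb M; b \<in> MOb M\<rbrakk> \<Longrightarrow>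
      bij_betw (\<lambda>f. MSub M (xs @ [m] @ ys) b (length xs + 1) as f \<theta>) (MHom M (xs @ [m] @ ys) b) (MHom M (xs @ as @ ys) b)"
    using assms(1)[unfolded multi_representable_def, rule_format, OF assms(2)] by (elim bexE) blast
  have M: "MMap as m \<theta> \<in> MM" using m assms(2) by (simp add: MM_iff)
  have "pm.universal (MMap as m \<theta>)"
    by (rule pm.universalI[OF M]) (use u in simp)
  then show thesis using that m u by blast
qed

text \<open>Universality in the underlying short multicategory is restricted to small arities.
  Comparison with the classifiers of the multicategory extends it to all of them.\<close>

lemma left_universal_multi:
  assumes "multi_representable M" "left_classifiers U \<chi>"
  shows "left_universal X False \<chi>"
proof -
  interpret C: left_classifiers U \<chi> by fact
  have in': "Ten \<chi> a b \<in> MOb M" "Th \<chi> a b \<in> MHom M [a, b] (Ten \<chi> a b)" if "a \<in> MOb M" "b \<in> MOb M" for a b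
    using that C.Ten_in[of a b] C.Th_in[of a b] by simp_all
  have in0: "Unt \<chi> \<in> MOb M" "Nul \<chi> \<in> MHom M [] (Unt \<chi>)" using C.Unt_in C.Nul_in by simp_all
  have uth: "pm.universal (MMap [a, b] (Ten \<chi> a b) (Th \<chi> a b))" if ab: "a \<in> MOb M" "b \<in> MOb M" for a b
  proof -
    obtain m \<theta> where m: "m \<in> MOb M" "\<theta> \<in> MHom M [a, b] m" "pm.universal (MMap [a, b] m \<theta>)"
      by (rule multi_representableD[OF assms(1), of "[a, b]"]) (use ab in auto)
    have M: "MMap [a, b] (Ten \<chi> a b) (Th \<chi> a b) \<in> MM" using in' ab by (simp add: MM_iff)
    have "bij_betw (\<lambda>f. MSub M [Ten \<chi> a b] d 1 [a, b] f (Th \<chi> a b)) (MHom M [Ten \<chi> a b] d) (MHom M [a, b] d)" if "d \<in> MOb M" for d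
    proof -
      have "scomp U [Ten \<chi> a b] d 1 [a, b] f (Th \<chi> a b) = MSub M [Ten \<chi> a b] d 1 [a, b] f (Th \<chi> a b)" if "f \<in> MHom M [Ten \<chi> a b] d" for f
        using that ab in' \<open>d \<in> MOb M\<close> by (intro scomp_U) simp_all
      then show ?thesis
        by (intro bij_betw_congI[OF C.Th_left_universal[of a b "[]" d]]) (use ab that in auto)
    qed
    then have "pm.unary_universal (MMap [a, b] (Ten \<chi> a b) (Th \<chi> a b))"
      by (intro pm.unary_universalI[OF M]) simp
    from pm.universal_transfer[OF m(3) this] show ?thesis by simp
  qed
  have unu: "pm.universal (MMap [] (Unt \<chi>) (Nul \<chi>))"
  proof -
    obtain m \<theta> where m: "m \<in> MOb M" "\<theta> \<in> MHom M [] m" "pm.universal (MMap [] m \<theta>)"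
      by (rule multi_representableD[OF assms(1), of "[]"]) auto
    have M: "MMap [] (Unt \<chi>) (Nul \<chi>) \<in> MM" using in0 by (simp add: MM_iff)
    have "bij_betw (\<lambda>f. MSub M [Unt \<chi>] d 1 [] f (Nul \<chi>)) (MHom M [Unt \<chi>] d) (MHom M [] d)" if "d \<in> MOb M" for d
    proof -
      have "scomp U [Unt \<chi>] d 1 [] f (Nul \<chi>) = MSub M [Unt \<chi>] d 1 [] f (Nul \<chi>)" if "f \<in> MHom M [Unt \<chi>] d" for f
        using that in0 \<open>d \<in> MOb M\<close> by (intro scomp_U) simp_all
      then show ?thesis
        by (intro bij_betw_congI[OF C.Nul_left_universal[of "[]" d]]) (use that in auto)
    qed
    then have "pm.unary_universal (MMap [] (Unt \<chi>) (Nul \<chi>))"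
      by (intro pm.unary_universalI[OF M]) simp
    from pm.universal_transfer[OF m(3) this] show ?thesis by simp
  qed
  show ?thesis
  proof (intro left_universal.intro left_universal_axioms.intro partial_multicategory_multi, unfold X_simps unary_cat_simps)
    fix a b d xs assume A: "a \<in> MOb M" "b \<in> MOb M" "set xs \<subseteq> MOb M" "d \<in> MOb M"
    show "bij_betw (\<lambda>f. MSub M (Ten \<chi> a b # xs) d 1 [a, b] f (Th \<chi> a b)) (MHom M (Ten \<chi> a b # xs) d) (MHom M (a # b # xs) d)"
      using pm.bij_betw_raw[of "[]" xs d "MMap [a, b] (Ten \<chi> a b) (Th \<chi> a b)"] pm.universalD[OF uth[OF A(1,2)], of "[]" xs d] A in'[OF A(1,2)]
      by (simp add: MM_iff)
  next
    fix d xs assume A: "set xs \<subseteq> MOb M" "d \<in> MOb M"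
    show "bij_betw (\<lambda>f. MSub M (Unt \<chi> # xs) d 1 [] f (Nul \<chi>)) (MHom M (Unt \<chi> # xs) d) (MHom M xs d)"
      using pm.bij_betw_raw[of "[]" xs d "MMap [] (Unt \<chi>) (Nul \<chi>)"] pm.universalD[OF unu, of "[]" xs d] A in0
      by (simp add: MM_iff)
  qed (use in' in0 in auto)
qed

lemma representable_U:
  assumes "multi_representable M"
  shows "representable U"
proof -
  have "\<forall>as. \<exists>m \<theta>. set as \<subseteq> MOb M \<longrightarrow> m \<in> MOb M \<and> \<theta> \<in> MHom M as m \<and>
      (\<forall>xs ys b. set xs \<subseteq> MOb M \<and> set ys \<subseteq> MOb M \<and> b \<in> MOb M \<longrightarrow>
        bij_betw (\<lambda>f. MSub M (xs @ [m] @ ys) b (length xs + 1) as f \<theta>) (MHom M (xs @ [m] @ ys) b) (MHom M (xs @ as @ ys) b))"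
    using assms[unfolded multi_representable_def] by blast
  then obtain m \<theta> where mt: "\<forall>as. set as \<subseteq> MOb M \<longrightarrow> m as \<in> MOb M \<and> \<theta> as \<in> MHom M as (m as) \<and>
      (\<forall>xs ys b. set xs \<subseteq> MOb M \<and> set ys \<subseteq> MOb M \<and> b \<in> MOb M \<longrightarrow>
        bij_betw (\<lambda>f. MSub M (xs @ [m as] @ ys) b (length xs + 1) as f (\<theta> as)) (MHom M (xs @ [m as] @ ys) b) (MHom M (xs @ as @ ys) b))"
    unfolding choice_iff by (elim exE)
  have u: "m as \<in> MOb M" "\<theta> as \<in> MHom M as (m as)"
    "\<lbrakk>set xs \<subseteq> MOb M; set ys \<subseteq> MOb M; b \<in> MOb M\<rbrakk> \<Longrightarrow>
        bij_betw (\<lambda>f. MSub M (xs @ [m as] @ ys) b (length xs + 1) as f (\<theta> as)) (MHom M (xs @ [m as] @ ys) b) (MHom M (xs @ as @ ys) b)"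
    if "set as \<subseteq> MOb M" for as xs ys b
    using mt that by simp_all
  let ?\<chi> = "\<lparr>Ten = \<lambda>a b. m [a, b], Th = \<lambda>a b. \<theta> [a, b], Unt = m [], Nul = \<theta> []\<rparr>"
  have key: "bij_betw (\<lambda>f. scomp U (xs @ [m as] @ ys) d (length xs + 1) as f (\<theta> as)) (SHom U (xs @ [m as] @ ys) d) (SHom U (xs @ as @ ys) d)"
    if A: "set as \<subseteq> MOb M" "length as \<in> {0, 2}" "length xs + length ys \<le> 2" "set xs \<subseteq> MOb M" "set ys \<subseteq> MOb M" "d \<in> MOb M" for xs ys as d
  proof -
    have "ok True (Suc (length xs + length ys)) (length as)"
      using A(2,3) by (intro ok_small) auto
    then have sc: "scomp U (xs @ [m as] @ ys) d (length xs + 1) as f (\<theta> as) = MSub M (xs @ [m as] @ ys) d (length xs + 1) as f (\<theta> as)"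
      if "f \<in> MHom M (xs @ [m as] @ ys) d" for f
      using that A(1,4,5,6) u(1,2)[OF A(1)] by (intro scomp_U) (simp_all add: nth_append)
    have l: "length (xs @ [m as] @ ys) \<le> 4" "length (xs @ as @ ys) \<le> 4" using A(2,3) by auto
    show ?thesis
      by (rule bij_betw_congI[OF u(3)[OF A(1,4,5,6)]]) (use sc l in simp_all)
  qed
  have "full_classifiers U ?\<chi>"
  proof (intro full_classifiers.intro, unfold U_simps(1) unary_cat_simps classifiers.simps)
    fix a b xs ys d assume "a \<in> MOb M" "b \<in> MOb M" "length xs + length ys \<le> 2" "set xs \<subseteq> MOb M" "set ys \<subseteq> MOb M" "d \<in> MOb M"
    then show "bij_betw (\<lambda>f. scomp U (xs @ [m [a, b]] @ ys) d (length xs + 1) [a, b] f (\<theta> [a, b])) (SHom U (xs @ [m [a, b]] @ ys) d) (SHom U (xs @ [a, b] @ ys) d)"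
      by (intro key) auto
  next
    fix xs ys d assume "length xs + length ys \<le> 2" "set xs \<subseteq> MOb M" "set ys \<subseteq> MOb M" "d \<in> MOb M"
    then show "bij_betw (\<lambda>f. scomp U (xs @ [m []] @ ys) d (length xs + 1) [] f (\<theta> [])) (SHom U (xs @ [m []] @ ys) d) (SHom U (xs @ ys) d)"
      using key[of "[]" xs ys d] by simp
  qed (use u(1,2)[of "[_, _]"] u(1,2)[of "[]"] in simp_all)
  then show ?thesis by (auto simp: representable_def)
qed

end


section \<open>Independence of the classifiers\<close>

lemma comp_func_id_id: "comp_func C (id_func C) (id_func C) = id_func C"
  unfolding comp_func_def by (subst (3) id_func_def, rule mk_func_cong) simp_all

lemma iso_in_SkMonI:
  assumes "lax_monoidal S R F" "lax_monoidal R S G" "comp_lax S R S G F = id_lax S" "comp_lax R S R F G = id_lax R"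
  shows "iso_in SkMon S R F"
  using assms by (auto simp: iso_in_def SkMon_def)

text \<open>The identity morphism, read with classifiers \<open>\<chi>\<close> on one side and \<open>\<psi>\<close> on the other, induces
  lax functors in both directions, and composition of morphisms goes to composition of lax
  functors.\<close>

lemma iso_change_of_classifiers:
  assumes "left_universal X sh \<chi>" "left_universal X sh \<psi>"
  shows "iso_in SkMon (skew_of X \<chi>) (skew_of X \<psi>) (lax_of X \<chi> X \<psi> (id_func (DCat X)) (\<lambda>as b f. f))"
proof -
  interpret X: left_universal X sh \<chi> by fact
  note id = multi_morphism_id[OF X.partial_multicategory_axioms]
  have lax: "lax_monoidal (skew_of X \<chi>) (skew_of X \<psi>) (lax_of X \<chi> X \<psi> (id_func (DCat X)) (\<lambda>as b f. f))"
    if "left_universal X sh \<chi>" "left_universal X sh \<psi>" for \<chi> \<psi>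
    by (intro universal_morphism.lax_monoidal_L[where sh = sh] universal_morphism.intro universal_pair.intro that id)
  have comp: "comp_lax (skew_of X \<chi>) (skew_of X \<psi>) (skew_of X \<chi>) (lax_of X \<psi> X \<chi> (id_func (DCat X)) (\<lambda>as b f. f))
      (lax_of X \<chi> X \<psi> (id_func (DCat X)) (\<lambda>as b f. f)) = id_lax (skew_of X \<chi>)"
    if "left_universal X sh \<chi>" "left_universal X sh \<psi>" for \<chi> \<psi>
    using lax_of_comp[OF that(1,2,1) id id] lax_of_id[OF that(1)] by (simp add: comp_func_id_id)
  show ?thesis
    by (rule iso_in_SkMonI[OF lax[OF assms] lax[OF assms(2,1)] comp[OF assms] comp[OF assms(2,1)]])
qed

lemma iso_same_skew:
  fixes S R :: "('o, 'a) skmon"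
  assumes "skew_monoidal S" "skew_monoidal R" "same_skew S R"
  shows "iso_in SkMon S R (id_lax S)"
proof -
  have comp: "comp_lax S R S (id_lax R) (id_lax S) = id_lax S"
    if s: "skew_monoidal S" "skew_monoidal R" "same_skew S R" for S R :: "('o, 'a) skmon"
  proof -
    interpret S: skew_monoidal S by fact
    have F: "lax_functor S R (id_lax S)" "lax_functor R S (id_lax R)" "lax_functor S S (id_lax S)"
      using s same_skew_sym[OF s(3)] by (auto intro!: lax_functor.intro id_lax_lax_monoidal same_skew_refl)
    note e = s(3)[unfolded same_skew_def]
    have ob: "KOb R = KOb S" "KUnit R = KUnit S" "karrs R = karrs S" using e by simp_all
    have ides: "\<one>\<^bsub>R\<^esub> a = \<one>\<^bsub>S\<^esub> a" if "a \<in> KOb S" for a using e that by simp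
    then have Ids: "Id (KCat R) a = Id (KCat S) a" if "a \<in> KOb S" for a using that by (simp add: ide_def)
    have ten: "a \<odot>\<^bsub>R\<^esub> b = a \<odot>\<^bsub>S\<^esub> b" if "a \<in> KOb S" "b \<in> KOb S" for a b using e that by simp
    have l0: "lax0 S R (id_lax S) = \<one>\<^bsub>S\<^esub> (KUnit S)" "lax0 R S (id_lax R) = \<one>\<^bsub>S\<^esub> (KUnit S)" "lax0 S S (id_lax S) = \<one>\<^bsub>S\<^esub> (KUnit S)"
      by (simp_all add: lax0_def ob ide_def Ids S.KUnit_in)
    have l2: "lax2 S R (id_lax S) a b = \<one>\<^bsub>S\<^esub> (a \<odot>\<^bsub>S\<^esub> b)" "lax2 R S (id_lax R) a b = \<one>\<^bsub>S\<^esub> (a \<odot>\<^bsub>S\<^esub> b)" "lax2 S S (id_lax S) a b = \<one>\<^bsub>S\<^esub> (a \<odot>\<^bsub>S\<^esub> b)"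
      if "a \<in> KOb S" "b \<in> KOb S" for a b
      using that by (simp_all add: lax2_def ob ide_def Ids ten)
    show ?thesis
    proof (rule laxfun_arr_eqI[OF _ F(3)])
      show "lax_functor S S (comp_lax S R S (id_lax R) (id_lax S))"
        using comp_lax_lax_monoidal[OF F(1,2)] s(1) by (simp add: lax_functor_def)
      show "lax0 S S (comp_lax S R S (id_lax R) (id_lax S)) = lax0 S S (id_lax S)"
        using S.KUnit_in by (simp add: comp_lax_simps(2)[OF F(1,2)] l0 ob)
      show "lax2 S S (comp_lax S R S (id_lax R) (id_lax S)) a b = lax2 S S (id_lax S) a b" if "a \<in> KOb S" "b \<in> KOb S" for a b
        using that by (simp add: comp_lax_simps(3)[OF F(1,2)] l2 ob)
    qed (simp_all add: comp_lax_simps(1) ob)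
  qed
  show ?thesis
    by (rule iso_in_SkMonI[OF id_lax_lax_monoidal[OF assms] id_lax_lax_monoidal[OF assms(2,1) same_skew_sym[OF assms(3)]]
      comp[OF assms] comp[OF assms(2,1) same_skew_sym[OF assms(3)]]])
qed

lemma lax_of_cong:
  assumes "\<phi> [] (Unt \<chi>) (Nul \<chi>) = \<phi>' [] (Unt \<chi>) (Nul \<chi>)"
    "\<And>a b. \<lbrakk>a \<in> Ob (DCat X); b \<in> Ob (DCat X)\<rbrakk> \<Longrightarrow> \<phi> [a, b] (Ten \<chi> a b) (Th \<chi> a b) = \<phi>' [a, b] (Ten \<chi> a b) (Th \<chi> a b)"
  shows "lax_of X \<chi> Y \<psi> F \<phi> = lax_of X \<chi> Y \<psi> F \<phi>'"
  using assms by (simp add: lax_of_def fun_eq_iff)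

lemma lax_of_restrict_SMap:
  assumes "left_universal (short_data C) True \<chi>"
  shows "lax_of (short_data C) \<chi> Y \<psi> F (restrict_SMap C \<phi>) = lax_of (short_data C) \<chi> Y \<psi> F \<phi>"
  using left_universal.Ten_in[OF assms] left_universal.Th_in[OF assms] left_universal.Unt_in[OF assms] left_universal.Nul_in[OF assms]
  by (intro lax_of_cong) (simp_all add: short_data_def)

section \<open>Morphisms correspond to lax monoidal functors\<close>

lemma bij_betw_short_lax:
  fixes C D :: "('o, 'a) shmulti"
  assumes C: "short_multicategory C" "left_universal (short_data C) True \<chi>"
    and D: "short_multicategory D" "left_universal (short_data D) True \<psi>"
  shows "bij_betw (\<lambda>F. lax_of (short_data C) \<chi> (short_data D) \<psi> (SFun F) (SMap F))
    {F. short_multi_morphism C D F} {L. lax_monoidal (skew_of (short_data C) \<chi>) (skew_of (short_data D) \<psi>) L}"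
proof -
  interpret C: short_multicategory C by fact
  interpret universal_pair "short_data C" "short_data D" True \<chi> \<psi> by (intro universal_pair.intro C D)
  let ?L = "\<lambda>F. lax_of (short_data C) \<chi> (short_data D) \<psi> (SFun F) (SMap F)"
  note mm = short_morphism_is_multi_morphism[OF C(1) D(1)]
  have "F = G" if F: "short_multi_morphism C D F" and G: "short_multi_morphism C D G" and "?L F = ?L G" for F G
  proof -
    have sf: "SFun F = SFun G" using arg_cong[OF \<open>?L F = ?L G\<close>, of LFun] by (simp add: lax_of_def)
    show ?thesis
    proof (rule shmor_eqI[OF F G sf])
      fix as b f assume "length as \<le> 4" "set as \<subseteq> SOb C" "b \<in> SOb C" "f \<in> SHom C as b"
      then have "MMap as b f \<in> C.M" by (simp add: C.M_iff)
      from morphism_determined[OF mm[OF F] mm[OF G, folded sf] _ this] \<open>?L F = ?L G\<close> sf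
      show "SMap F as b f = SMap G as b f" by (simp add: act_def)
    qed
  qed
  moreover have "lax_monoidal X.S Y.S (?L F)" if "short_multi_morphism C D F" for F
    by (intro universal_morphism.lax_monoidal_L[where sh = True] universal_morphism.intro universal_pair_axioms mm that)
  moreover have "\<exists>F. short_multi_morphism C D F \<and> ?L F = L" if L: "lax_monoidal X.S Y.S L" for L
  proof -
    obtain \<phi> where \<phi>: "multi_morphism (short_data C) (short_data D) True (LFun L) \<phi>"
        "lax_of (short_data C) \<chi> (short_data D) \<psi> (LFun L) \<phi> = L"
      using lax_lifts[OF L] by blast
    show ?thesis
      using multi_morphism_is_short_morphism[OF C(1) D(1) \<phi>(1)] \<phi>(2)
      by (intro exI[of _ "\<lparr>SFun = LFun L, SMap = restrict_SMap C \<phi>\<rparr>"]) (simp add: lax_of_restrict_SMap[OF C(2)])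
  qed
  ultimately show ?thesis
    by (auto simp: bij_betw_def inj_on_def image_iff) metis
qed

lemma bij_betw_multi_lax:
  fixes M N :: "('o, 'a) multi"
  assumes M: "multicategory M" "left_universal (multi_data M) False \<chi>"
    and N: "multicategory N" "left_universal (multi_data N) False \<psi>"
  shows "bij_betw (\<lambda>F. lax_of (multi_data M) \<chi> (multi_data N) \<psi> (unary_functor_of M F) (MFMap F))
    {F. multifunctor M N F} {L. lax_monoidal (skew_of (multi_data M) \<chi>) (skew_of (multi_data N) \<psi>) L}"
proof -
  interpret M: multicategory M by fact
  interpret universal_pair "multi_data M" "multi_data N" False \<chi> \<psi> by (intro universal_pair.intro M N)
  let ?L = "\<lambda>F. lax_of (multi_data M) \<chi> (multi_data N) \<psi> (unary_functor_of M F) (MFMap F)"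
  note mm = multifunctor_is_multi_morphism[OF M(1) N(1)]
  have "F = G" if F: "multifunctor M N F" and G: "multifunctor M N G" and "?L F = ?L G" for F G
  proof -
    have sf: "unary_functor_of M F = unary_functor_of M G" using arg_cong[OF \<open>?L F = ?L G\<close>, of LFun] by (simp add: lax_of_def)
    show ?thesis
    proof (rule multifun_eqI[OF F G])
      show "MFOb F a = MFOb G a" if "a \<in> MOb M" for a
        using arg_cong[OF sf, of "\<lambda>H. FOb H a"] that by simp
      fix as b f assume "set as \<subseteq> MOb M" "b \<in> MOb M" "f \<in> MHom M as b"
      then have "MMap as b f \<in> M.MM" by (simp add: M.MM_iff)
      from morphism_determined[OF mm[OF F] mm[OF G, folded sf] _ this] \<open>?L F = ?L G\<close> sf
      show "MFMap F as b f = MFMap G as b f" by (simp add: act_def)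
    qed
  qed
  moreover have "lax_monoidal X.S Y.S (?L F)" if "multifunctor M N F" for F
    by (intro universal_morphism.lax_monoidal_L[where sh = False] universal_morphism.intro universal_pair_axioms mm that)
  moreover have "\<exists>F. multifunctor M N F \<and> ?L F = L" if L: "lax_monoidal X.S Y.S L" for L
  proof -
    obtain \<phi> where \<phi>: "multi_morphism (multi_data M) (multi_data N) False (LFun L) \<phi>"
        "lax_of (multi_data M) \<chi> (multi_data N) \<psi> (LFun L) \<phi> = L"
      using lax_lifts[OF L] by blast
    have "?L (mk_multifun M (FOb (LFun L)) \<phi>) = lax_of (multi_data M) \<chi> (multi_data N) \<psi> (LFun L) \<phi>"
      unfolding multi_morphism_is_multifunctor(2)[OF M(1) N(1) \<phi>(1)]
      by (rule lax_of_cong) (use X.Ten_in X.Th_in X.Unt_in X.Nul_in in simp_all)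
    then show ?thesis
      using multi_morphism_is_multifunctor(1)[OF M(1) N(1) \<phi>(1)] \<phi>(2) by metis
  qed
  ultimately show ?thesis
    by (auto simp: bij_betw_def inj_on_def image_iff) metis
qed

section \<open>The underlying short multicategory has the same skew monoidal structure\<close>

context multicategory
begin

text \<open>The defining formulas use only substitutions that the truncation retains.\<close>

lemma skew_of_U:
  assumes "left_universal X False \<chi>"
  shows "skew_of (short_data U) \<chi> = skew_of X \<chi>"
proof -
  interpret L: left_universal X False \<chi> by fact
  interpret S: short_multicategory U by (rule short_multicategory_U)
  note in' = L.Ten_in[simplified] L.Th_in[simplified] L.Unt_in[simplified] L.Nul_in[simplified]
  have pl [simp]: "plug [x, y] (Suc 0) [a] = [a, y]" "plug [x] (Suc 0) as = as" "plug [x, y] (Suc 0) [a, b] = [a, b, y]" "plug [x, y] (Suc 0) [] = [y]" for x y a b :: 'o and as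
    by (simp_all add: plug_def)
  have sub: "MSub M [x, y] z (Suc 0) [a] f g \<in> MHom M [a, y] z"
    if "x \<in> MOb M" "a \<in> MOb M" "y \<in> MOb M" "z \<in> MOb M" "f \<in> MHom M [x, y] z" "g \<in> MHom M [a] x" for x y z a f g
    using that MSub_in[of 1 "[x, y]" "[a]" z f g] by simp
  have sub1: "MSub M [x] z (Suc 0) [a, b] f g \<in> MHom M [a, b] z"
    if "x \<in> MOb M" "a \<in> MOb M" "b \<in> MOb M" "z \<in> MOb M" "f \<in> MHom M [x] z" "g \<in> MHom M [a, b] x" for x z a b f g
    using that MSub_in[of 1 "[x]" "[a, b]" z f g] by simp
  note sc = scomp_U[of "[_]" "[_, _]"] scomp_U[of "[_]" "[]"] scomp_U[of "[_, _]" "[_]"] scomp_U[of "[_, _]" "[_, _]"] scomp_U[of "[_, _]" "[]"]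
  have t: "tensor_ar S.X \<chi> a b c d f g = tensor_ar X \<chi> a b c d f g"
    if "a \<in> MOb M" "b \<in> MOb M" "c \<in> MOb M" "d \<in> MOb M" "f \<in> MHom M [a] b" "g \<in> MHom M [c] d" for a b c d f g
    unfolding tensor_ar_def
    by (rule arg_cong[of _ _ The], rule ext, rule conj_cong)
      (use that in \<open>simp_all add: sc sub in'\<close>)
  have a: "associator S.X \<chi> a b c = associator X \<chi> a b c"
    if "a \<in> MOb M" "b \<in> MOb M" "c \<in> MOb M" for a b c
    unfolding associator_def Let_def
    by (rule arg_cong[of _ _ The], rule ext, rule conj_cong)
      (use that in \<open>simp_all add: sc sub1 in'\<close>)
  have l: "left_unitor S.X \<chi> a = left_unitor X \<chi> a" if "a \<in> MOb M" for a
    unfolding left_unitor_def Let_def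
    by (rule arg_cong[of _ _ The], rule ext, rule conj_cong)
      (use that in \<open>simp_all add: sc sub1 in'\<close>)
  have r: "right_unitor S.X \<chi> a = right_unitor X \<chi> a" if "a \<in> MOb M" for a
    using that by (simp add: right_unitor_def sc in')
  have ten: "mk_func (prod_cat (unary_cat M) (unary_cat M)) (\<lambda>(a, c). Ten \<chi> a c) (\<lambda>(a, c) (b, d) (f, g). tensor_ar S.X \<chi> a b c d f g)
      = mk_func (prod_cat (unary_cat M) (unary_cat M)) (\<lambda>(a, c). Ten \<chi> a c) (\<lambda>(a, c) (b, d) (f, g). tensor_ar X \<chi> a b c d f g)"
    by (rule mk_func_cong) (auto simp: prod_cat_def t)
  show ?thesis
    unfolding skew_of_def using ten a l r by (simp add: fun_eq_iff restrict_def)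
qed

end

lemma lax_of_U:
  fixes M N :: "('o, 'a) multi"
  assumes M: "multicategory M" "left_universal (multi_data M) False \<chi>"
    and N: "multicategory N" "left_universal (multi_data N) False \<psi>"
    and G: "is_functor (unary_cat M) (unary_cat N) G"
  shows "lax_of (short_data (U_obj M)) \<chi> (short_data (U_obj N)) \<psi> G (restrict_SMap (U_obj M) \<phi>)
    = lax_of (multi_data M) \<chi> (multi_data N) \<psi> G \<phi>"
proof -
  interpret M: multicategory M by fact
  interpret N: multicategory N by fact
  interpret UM: short_multicategory M.U by (rule M.short_multicategory_U)
  interpret UN: short_multicategory N.U by (rule N.short_multicategory_U)
  interpret LM: left_universal M.X False \<chi> by fact
  interpret LN: left_universal N.X False \<psi> by fact
  interpret G: is_functor "unary_cat M" "unary_cat N" G by fact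
  note sc = N.scomp_U[of "[_]" "[_, _]"] N.scomp_U[of "[_]" "[]"]
  note in' = LM.Ten_in[simplified] LM.Th_in[simplified] LM.Unt_in[simplified] LM.Nul_in[simplified]
    LN.Ten_in[simplified] LN.Th_in[simplified] LN.Unt_in[simplified] LN.Nul_in[simplified] G.FOb_in[simplified]
  have "(THE h. h \<in> Hom (unary_cat N) (Unt \<psi>) (FOb G (Unt \<chi>)) \<and>
       scomp N.U [Unt \<psi>] (FOb G (Unt \<chi>)) 1 [] h (Nul \<psi>) = \<phi> [] (Unt \<chi>) (Nul \<chi>))
    = (THE h. h \<in> Hom (unary_cat N) (Unt \<psi>) (FOb G (Unt \<chi>)) \<and>
       MSub N [Unt \<psi>] (FOb G (Unt \<chi>)) 1 [] h (Nul \<psi>) = \<phi> [] (Unt \<chi>) (Nul \<chi>))"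
    by (rule arg_cong[of _ _ The], rule ext, rule conj_cong)
      (simp_all add: sc in')
  moreover have "(THE h. h \<in> Hom (unary_cat N) (Ten \<psi> (FOb G a) (FOb G b)) (FOb G (Ten \<chi> a b)) \<and>
         scomp N.U [Ten \<psi> (FOb G a) (FOb G b)] (FOb G (Ten \<chi> a b)) 1 [FOb G a, FOb G b]
           h (Th \<psi> (FOb G a) (FOb G b)) = \<phi> [a, b] (Ten \<chi> a b) (Th \<chi> a b))
    = (THE h. h \<in> Hom (unary_cat N) (Ten \<psi> (FOb G a) (FOb G b)) (FOb G (Ten \<chi> a b)) \<and>
         MSub N [Ten \<psi> (FOb G a) (FOb G b)] (FOb G (Ten \<chi> a b)) 1 [FOb G a, FOb G b]
           h (Th \<psi> (FOb G a) (FOb G b)) = \<phi> [a, b] (Ten \<chi> a b) (Th \<chi> a b))"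
    if "a \<in> MOb M" "b \<in> MOb M" for a b
    by (rule arg_cong[of _ _ The], rule ext, rule conj_cong)
      (use that in \<open>simp_all add: sc in'\<close>)
  ultimately show ?thesis
    using in' by (simp add: lax_of_def fun_eq_iff)
qed

lemma multi_morphism_U:
  fixes M N :: "('o, 'a) multi"
  assumes "multicategory M" "multicategory N" "multi_morphism (multi_data M) (multi_data N) False G \<phi>"
  shows "multi_morphism (short_data (U_obj M)) (short_data (U_obj N)) True G \<phi>"
proof -
  interpret M: multicategory M by fact
  interpret N: multicategory N by fact
  interpret UM: short_multicategory M.U by (rule M.short_multicategory_U)
  interpret UN: short_multicategory N.U by (rule N.short_multicategory_U)
  interpret G: multi_morphism M.X N.X False G \<phi> by fact
  have sc: "mcomp UM.X p i q = mcomp M.X p i q"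
    if "p \<in> UM.M" "q \<in> UM.M" "fits True p i q" for p q :: "('o, 'a) mmap" and i
    using that M.scomp_U[of "src p" "src q" "tgt p" "val p" i "val q"]
    by (auto simp: mcomp_def UM.M_iff fits_def)
  have sc': "mcomp UN.X p i q = mcomp N.X p i q"
    if "p \<in> UN.M" "q \<in> UN.M" "fits True p i q" for p q :: "('o, 'a) mmap" and i
    using that N.scomp_U[of "src p" "src q" "tgt p" "val p" i "val q"]
    by (auto simp: mcomp_def UN.M_iff fits_def)
  have in': "p \<in> M.MM" if "p \<in> UM.M" for p using that by (auto simp: M.MM_iff UM.M_iff)
  have maps: "act G \<phi> p \<in> UN.M" if "p \<in> UM.M" for p
    using G.act_maps[OF in'[OF that]] that by (auto simp: N.MM_iff UN.M_iff UM.M_iff)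
  show ?thesis
  proof (intro multi_morphism.intro multi_morphism_axioms.intro UM.partial_multicategory_short UN.partial_multicategory_short)
    show "is_functor (DCat UM.X) (DCat UN.X) G" using G.is_functor_axioms by simp
  next
    fix k :: "('o, 'a) arr" assume "k \<in> arrs (DCat UM.X)"
    then show "act G \<phi> (um k) = um (fmap G k)" using G.act_um[of k] by simp
  next
    fix p q :: "('o, 'a) mmap" and i assume A: "p \<in> UM.M" "q \<in> UM.M" "fits True p i q"
    have f: "fits False p i q" using A(3) by (auto simp: fits_def)
    have f': "fits True (act G \<phi> p) i (act G \<phi> q)" using A(3) by (auto simp: fits_def)
    show "act G \<phi> (mcomp UM.X p i q) = mcomp UN.X (act G \<phi> p) i (act G \<phi> q)"
      unfolding sc[OF A] sc'[OF maps[OF A(1)] maps[OF A(2)] f'] by (rule G.act_mcomp[OF in'[OF A(1)] in'[OF A(2)] f])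
  qed (rule maps)
qed


section \<open>The functors and their equivalences\<close>

lemma restrict_SMap_cong:
  assumes "\<And>as b f. \<lbrakk>length as \<le> 4; set as \<subseteq> SOb C; b \<in> SOb C; f \<in> SHom C as b\<rbrakk> \<Longrightarrow> \<phi> as b f = \<phi>' as b f"
  shows "restrict_SMap C \<phi> = restrict_SMap C \<phi>'"
  using assms by (simp add: restrict_SMap_def fun_eq_iff)

lemma skew_monoidal_of: "left_universal X sh \<chi> \<Longrightarrow> skew_monoidal (skew_of X \<chi>)"
  and left_normal_of: "left_universal X sh \<chi> \<Longrightarrow> left_normal (skew_of X \<chi>)"
  by (rule left_universal.skew_monoidal_S left_universal.left_normal_S, assumption)+

lemma monoidal_left_normal: "monoidal S \<Longrightarrow> left_normal S"
  by (simp add: monoidal_def left_normal_def)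

lemma ShMulti_simps [simp]:
  "C \<in> Ob ShMulti \<longleftrightarrow> short_multicategory C"
  "Hom ShMulti C D = {F. short_multi_morphism C D F}"
  "Id ShMulti C = id_shmor C" "Cmp ShMulti C D E G F = comp_shmor C G F"
  by (simp_all add: ShMulti_def)

lemma SkMon_simps [simp]:
  "S \<in> Ob SkMon \<longleftrightarrow> skew_monoidal S"
  "Hom SkMon S R = {F. lax_monoidal S R F}"
  "Id SkMon S = id_lax S" "Cmp SkMon S R Q G F = comp_lax S R Q G F"
  by (simp_all add: SkMon_def)

lemma Multi_rep_simps [simp]:
  "M \<in> Ob Multi_rep \<longleftrightarrow> multicategory M \<and> multi_representable M"
  "Hom Multi_rep M N = {F. multifunctor M N F}"
  "Id Multi_rep M = mk_multifun M (\<lambda>a. a) (\<lambda>as b f. f)"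
  "Cmp Multi_rep M N P G F = mk_multifun M (\<lambda>a. MFOb G (MFOb F a))
       (\<lambda>as b f. MFMap G (map (MFOb F) as) (MFOb F b) (MFMap F as b f))"
  by (simp_all add: Multi_rep_def Multi_def)

lemma category_full_subcats:
  "category (full_subcat (ShMulti :: (('o, 'a) shmulti, ('o, 'a) shmor) cat) P)"
  "category (full_subcat (SkMon :: (('o, 'a) skmon, ('o, 'a) laxfun) cat) Q)"
  "category (Multi_rep :: (('o, 'a) multi, ('o, 'a) multifun) cat)"
  unfolding Multi_rep_def
  by (intro category_full_subcat category_ShMulti category_SkMon category_Multi)+

subsection \<open>The forgetful functor\<close>

lemma U_rep_functor: "is_functor Multi_rep ShMulti_rep (U_rep :: (('o, 'a) multi, ('o, 'a) multifun, ('o, 'a) shmulti, ('o, 'a) shmor) func)"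
  unfolding U_rep_def ShMulti_rep_def
proof (rule mk_func_is_functor)
  fix M N :: "('o, 'a) multi" and F
  assume A: "M \<in> Ob Multi_rep" "N \<in> Ob Multi_rep" "F \<in> Hom Multi_rep M N"
  then have "multi_morphism (short_data (U_obj M)) (short_data (U_obj N)) True (unary_functor_of M F) (MFMap F)"
    by (intro multi_morphism_U multifunctor_is_multi_morphism) simp_all
  then show "U_mor M F \<in> Hom (full_subcat ShMulti representable) (U_obj M) (U_obj N)"
    using A by (simp add: U_mor_def multicategory.short_multicategory_U multi_morphism_is_short_morphism)
next
  fix M :: "('o, 'a) multi" assume "M \<in> Ob Multi_rep"
  then interpret multicategory M by simp
  let ?I = "mk_multifun M (\<lambda>a. a) (\<lambda>as b f. f)"
  have "unary_functor_of M ?I = id_func (SUnary U)"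
    unfolding unary_functor_of_def id_func_def U_simps(1) by (rule mk_func_cong) simp_all
  moreover have "restrict_SMap U (MFMap ?I) = restrict_SMap U (\<lambda>as b f. f)"
    by (rule restrict_SMap_cong) (simp split: if_splits)
  ultimately show "U_mor M (Id Multi_rep M) = Id (full_subcat ShMulti representable) U"
    by (simp add: U_mor_def id_shmor_def)
next
  fix M N P :: "('o, 'a) multi" and F G
  assume A: "M \<in> Ob Multi_rep" "N \<in> Ob Multi_rep" "P \<in> Ob Multi_rep" "F \<in> Hom Multi_rep M N" "G \<in> Hom Multi_rep N P"
  interpret M: multicategory M using A by simp
  interpret N: multicategory N using A by simp
  interpret F: multifunctor M N F using A by simp
  let ?H = "mk_multifun M (\<lambda>a. MFOb G (MFOb F a)) (\<lambda>as b f. MFMap G (map (MFOb F) as) (MFOb F b) (MFMap F as b f))"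
  have "unary_functor_of M ?H = comp_func (SUnary M.U) (unary_functor_of N G) (unary_functor_of M F)"
    unfolding unary_functor_of_def comp_func_def M.U_simps(1)
    by (rule mk_func_cong) (use F.MFMap_in[of "[_]"] in \<open>simp_all add: F.MFOb_in\<close>)
  moreover have "restrict_SMap M.U (MFMap ?H) = restrict_SMap M.U (\<lambda>as b f. restrict_SMap N.U (MFMap G)
      (map (FOb (unary_functor_of M F)) as) (FOb (unary_functor_of M F) b) (restrict_SMap M.U (MFMap F) as b f))"
  proof (rule restrict_SMap_cong)
    fix as b f assume t: "length as \<le> 4" "set as \<subseteq> SOb M.U" "b \<in> SOb M.U" "f \<in> SHom M.U as b"
    have "set (map (MFOb F) as) \<subseteq> MOb N" using t F.MFOb_in by auto
    then show "MFMap ?H as b f = restrict_SMap N.U (MFMap G) (map (FOb (unary_functor_of M F)) as)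
        (FOb (unary_functor_of M F) b) (restrict_SMap M.U (MFMap F) as b f)"
      using t F.MFMap_in[of as b f] by (simp add: map_FOb_unary_functor_of F.MFOb_in del: map_eq_conv)
  qed
  ultimately show "U_mor M (Cmp Multi_rep M N P G F)
      = Cmp (full_subcat ShMulti representable) M.U N.U (U_obj P) (U_mor N G) (U_mor M F)"
    by (simp add: U_mor_def comp_shmor_def)
next
  fix M :: "('o, 'a) multi" assume "M \<in> Ob Multi_rep"
  then show "U_obj M \<in> Ob (full_subcat ShMulti representable)"
    by (simp add: multicategory.short_multicategory_U multicategory.representable_U)
qed (rule category_full_subcats)

lemma representable_left_representable:
  "\<lbrakk>short_multicategory C; representable C\<rbrakk> \<Longrightarrow> left_representable C"
  unfolding representable_def left_representable_def by (auto intro: short_multicategory.full_classifiers_universal(1))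

context
  fixes ch :: "('o, 'a) shmulti \<Rightarrow> ('o, 'a) classifiers"
  assumes ch: "\<And>C. \<lbrakk>short_multicategory C; left_representable C\<rbrakk> \<Longrightarrow> left_classifiers C (ch C)"
begin

abbreviation K\<^sub>o where "K\<^sub>o C \<equiv> skew_of (short_data C) (ch C)"
abbreviation K\<^sub>m where "K\<^sub>m C D F \<equiv> lax_of (short_data C) (ch C) (short_data D) (ch D) (SFun F) (SMap F)"

lemma left_universal_ch: "\<lbrakk>short_multicategory C; left_representable C\<rbrakk> \<Longrightarrow> left_universal (short_data C) True (ch C)"
  by (intro short_multicategory.left_universal_short ch)

lemma left_universal_ch_multi:
  assumes "multicategory M" "multi_representable M"
  shows "left_universal (multi_data M) False (ch (U_obj M))"
  using assms
  by (intro multicategory.left_universal_multi ch representable_left_representable multicategory.short_multicategory_U multicategory.representable_U)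

abbreviation Sh where "Sh P \<equiv> full_subcat (ShMulti :: (('o, 'a) shmulti, ('o, 'a) shmor) cat) P"
abbreviation Sk where "Sk Q \<equiv> full_subcat (SkMon :: (('o, 'a) skmon, ('o, 'a) laxfun) cat) Q"
abbreviation K_on where "K_on P \<equiv> mk_func (Sh P) K\<^sub>o K\<^sub>m"

text \<open>Both \<open>K\<close> and its restriction are cases of this: a class \<open>P\<close> of left representable short
  multicategories is sent into a class \<open>Q\<close> of skew monoidal categories.\<close>

lemma K_functor_on:
  fixes P Q
  assumes P: "\<And>C. \<lbrakk>short_multicategory C; P C\<rbrakk> \<Longrightarrow> left_representable C"
    and PQ: "\<And>C. \<lbrakk>short_multicategory C; P C\<rbrakk> \<Longrightarrow> Q (K\<^sub>o C)"
  shows "is_functor (Sh P) (Sk Q) (K_on P)"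
    and "fully_faithful (Sh P) (Sk Q) (K_on P)"
proof -
  note lu = left_universal_ch[OF _ P]
  have bij: "bij_betw (K\<^sub>m C D) {F. short_multi_morphism C D F} {L. lax_monoidal (K\<^sub>o C) (K\<^sub>o D) L}"
    if "short_multicategory C" "P C" "short_multicategory D" "P D" for C D
    using that by (intro bij_betw_short_lax lu)
  show "is_functor (Sh P) (Sk Q) (K_on P)"
  proof (rule mk_func_is_functor)
    fix C assume "C \<in> Ob (Sh P)"
    then have C: "short_multicategory C" "P C" by simp_all
    then show "K\<^sub>o C \<in> Ob (Sk Q)"
      using skew_monoidal_of[OF lu[OF C(1) C]] PQ by simp
    have "DCat (short_data C) = SUnary C" by (simp add: short_data_def)
    then show "K\<^sub>m C C (Id (Sh P) C) = Id (Sk Q) (K\<^sub>o C)"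
      using lax_of_id[OF lu[OF C(1) C]] by (simp add: id_shmor_def lax_of_restrict_SMap[OF lu[OF C(1) C]])
  next
    fix C D F assume "C \<in> Ob (Sh P)" "D \<in> Ob (Sh P)" "F \<in> Hom (Sh P) C D"
    then show "K\<^sub>m C D F \<in> Hom (Sk Q) (K\<^sub>o C) (K\<^sub>o D)"
      using bij_betwE[OF bij[of C D]] by auto
  next
    fix C D E F G assume "C \<in> Ob (Sh P)" "D \<in> Ob (Sh P)" "E \<in> Ob (Sh P)"
      "F \<in> Hom (Sh P) C D" "G \<in> Hom (Sh P) D E"
    then have C: "short_multicategory C" "P C" and D: "short_multicategory D" "P D" and E: "short_multicategory E" "P E"
      and F: "short_multi_morphism C D F" and G: "short_multi_morphism D E G" by simp_all
    have "DCat (short_data C) = SUnary C" by (simp add: short_data_def)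
    then show "K\<^sub>m C E (Cmp (Sh P) C D E G F)
        = Cmp (Sk Q) (K\<^sub>o C) (K\<^sub>o D) (K\<^sub>o E) (K\<^sub>m D E G) (K\<^sub>m C D F)"
      using lax_of_comp[OF lu[OF C(1) C] lu[OF D(1) D] lu[OF E(1) E]
        short_morphism_is_multi_morphism[OF C(1) D(1) F] short_morphism_is_multi_morphism[OF D(1) E(1) G]]
      by (simp add: comp_shmor_def lax_of_restrict_SMap[OF lu[OF C(1) C]])
  qed (rule category_full_subcats)
  show "fully_faithful (Sh P) (Sk Q) (K_on P)"
    unfolding fully_faithful_def
  proof (intro ballI)
    fix C D assume CD: "C \<in> Ob (Sh P)" "D \<in> Ob (Sh P)"
    show "bij_betw (FHom (K_on P) C D) (Hom (Sh P) C D)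
        (Hom (Sk Q) (FOb (K_on P) C) (FOb (K_on P) D))"
      by (rule bij_betw_congI[OF bij[of C D]]) (use CD in simp_all)
  qed
qed

text \<open>The chosen classifiers of the underlying short multicategory of \<open>Mu\<close> need not be the
  canonical ones; a change of classifiers is followed by the identity of \<open>S\<close>.\<close>

lemma iso_K_Mu:
  assumes "skew_monoidal S" "left_normal S"
  shows "left_representable (U_obj (left_normal_skew.Mu S))"
    and "\<exists>e. iso_in SkMon (K\<^sub>o (U_obj (left_normal_skew.Mu S))) S e"
proof -
  interpret left_normal_skew S by (intro left_normal_skew.intro left_normal_skew_axioms.intro assms)
  let ?U = "U_obj Mu"
  have sh: "short_multicategory ?U" by (rule Mu.short_multicategory_U)
  have lc: "left_classifiers ?U ch\<^sub>0" by (rule Mu.left_classifiers_U) (rule left_universal_Mu)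
  then show lr: "left_representable ?U" by (auto simp: left_representable_def)
  interpret category "SkMon :: (('o, 'a) skmon, ('o, 'a) laxfun) cat" by (rule category_SkMon)
  let ?R = "skew_of (short_data ?U) ch\<^sub>0"
  have R: "?R = skew_of (multi_data Mu) ch\<^sub>0" by (rule Mu.skew_of_U) (rule left_universal_Mu)
  note lu = left_universal_ch[OF sh lr] short_multicategory.left_universal_short[OF sh lc]
  have sk: "skew_monoidal (K\<^sub>o ?U)" "skew_monoidal ?R" using lu by (auto intro: skew_monoidal_of)
  have "iso_in SkMon ?R S (id_lax ?R)"
    by (rule iso_same_skew[OF sk(2) assms(1)]) (unfold R, rule same_skew_sym[OF same_skew_Mu])
  from iso_in_trans[OF _ _ _ iso_change_of_classifiers[OF lu] this]
  show "\<exists>e. iso_in SkMon (K\<^sub>o ?U) S e"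
    using sk assms(1) by (auto simp: SkMon_def)
qed

lemma K_equivalence_on:
  fixes P Q
  assumes P: "\<And>C. \<lbrakk>short_multicategory C; P C\<rbrakk> \<Longrightarrow> left_representable C"
    and PQ: "\<And>C. \<lbrakk>short_multicategory C; P C\<rbrakk> \<Longrightarrow> Q (K\<^sub>o C)"
    and Q: "\<And>S. \<lbrakk>skew_monoidal S; Q S\<rbrakk> \<Longrightarrow> left_normal S"
    and QP: "\<And>S. \<lbrakk>skew_monoidal S; Q S\<rbrakk> \<Longrightarrow> P (U_obj (left_normal_skew.Mu S))"
  shows "is_equivalence (Sh P) (Sk Q) (K_on P)"
proof (rule equivalence_if_fully_faithful_essentially_surjective)
  let ?K = "K_on P"
  show "is_functor (Sh P) (Sk Q) ?K" "fully_faithful (Sh P) (Sk Q) ?K"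
    by (intro K_functor_on P PQ; assumption)+
  show "essentially_surjective (Sh P) (Sk Q) (K_on P)"
    unfolding essentially_surjective_def
  proof
    fix S assume "S \<in> Ob (Sk Q)"
    then have S: "skew_monoidal S" "Q S" by simp_all
    interpret left_normal_skew S by (intro left_normal_skew.intro left_normal_skew_axioms.intro S Q)
    have "U_obj Mu \<in> Ob (Sh P)"
      using QP[OF S] Mu.short_multicategory_U by simp
    then show "\<exists>C\<in>Ob (Sh P). \<exists>e. iso_in (Sk Q) (FOb (K_on P) C) S e"
      using iso_K_Mu(2)[OF S(1) Q[OF S]] by (intro bexI[of _ "U_obj Mu"]) simp_all
  qed
qed (rule category_full_subcats)+

lemma K_functor_equivalence: "is_equivalence ShMulti_lr SkMon_ln (K_functor ch)"
  unfolding ShMulti_lr_def SkMon_ln_def K_functor_def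
  by (rule K_equivalence_on) (use left_normal_of[OF left_universal_ch] iso_K_Mu(1) in auto)

lemma K_rep_eq: "K_rep ch = mk_func (full_subcat ShMulti representable) K\<^sub>o K\<^sub>m"
  unfolding K_rep_def restrict_func_def ShMulti_rep_def K_functor_def ShMulti_lr_def
  by (rule mk_func_cong) (simp_all add: representable_left_representable)

lemma K_monoidal: "\<lbrakk>short_multicategory C; representable C\<rbrakk> \<Longrightarrow> monoidal (K\<^sub>o C)"
  by (rule representable_monoidal) (simp_all add: ch representable_left_representable)

lemma representable_Mu:
  assumes "skew_monoidal S" "monoidal S"
  shows "multicategory (left_normal_skew.Mu S)" "multi_representable (left_normal_skew.Mu S)"
    "representable (U_obj (left_normal_skew.Mu S))"
proof -
  interpret left_normal_skew S
    by (intro left_normal_skew.intro left_normal_skew_axioms.intro assms monoidal_left_normal)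
  show "multicategory Mu" by (rule multicategory_Mu)
  show r: "multi_representable Mu" using assms(2) by (rule multi_representable_Mu)
  show "representable (U_obj Mu)" by (rule Mu.representable_U) (rule r)
qed

lemma K_rep_equivalence: "is_equivalence ShMulti_rep Mon (K_rep ch)"
  unfolding K_rep_eq ShMulti_rep_def Mon_def
  by (rule K_equivalence_on)
    (auto intro: representable_left_representable K_monoidal monoidal_left_normal representable_Mu)

lemma K_rep_functor:
  "is_functor ShMulti_rep Mon (K_rep ch)" "fully_faithful ShMulti_rep Mon (K_rep ch)"
  unfolding K_rep_eq ShMulti_rep_def Mon_def
  by (rule K_functor_on; simp add: representable_left_representable K_monoidal)+

lemma T_rep_factors: "T_rep ch = comp_func Multi_rep (K_rep ch) U_rep"
  unfolding T_rep_def comp_func_def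
proof (rule mk_func_cong)
  fix M :: "('o, 'a) multi" assume M: "M \<in> Ob Multi_rep"
  then show "skew_of (multi_data M) (ch (U_obj M)) = FOb (K_rep ch) (FOb U_rep M)"
    by (simp add: K_rep_eq U_rep_def multicategory.short_multicategory_U multicategory.representable_U
        multicategory.skew_of_U[OF _ left_universal_ch_multi])
next
  fix M N :: "('o, 'a) multi" and F
  assume A: "M \<in> Ob Multi_rep" "N \<in> Ob Multi_rep" "F \<in> Hom Multi_rep M N"
  interpret U: is_functor Multi_rep ShMulti_rep "U_rep :: (('o, 'a) multi, ('o, 'a) multifun, ('o, 'a) shmulti, ('o, 'a) shmor) func"
    by (rule U_rep_functor)
  have "is_functor (unary_cat M) (unary_cat N) (unary_functor_of M F)"
    using multi_morphism.axioms(3)[OF multifunctor_is_multi_morphism[of M N F]] A by (simp add: multi_data_def)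
  from lax_of_U[OF _ left_universal_ch_multi _ left_universal_ch_multi this, of "MFMap F"] A
  show "lax_of (multi_data M) (ch (U_obj M)) (multi_data N) (ch (U_obj N)) (unary_functor_of M F) (MFMap F)
      = FHom (K_rep ch) (FOb U_rep M) (FOb U_rep N) (FHom U_rep M N F)"
    using U.FHom_in[OF A] by (simp add: K_rep_eq U_rep_def U_mor_def multicategory.short_multicategory_U multicategory.representable_U ShMulti_rep_def)
qed

lemma T_rep_functor: "is_functor Multi_rep Mon (T_rep ch)"
  unfolding T_rep_factors
  by (rule comp_func_is_functor[OF category_full_subcats(3) U_rep_functor K_rep_functor(1)])

lemma T_rep_fully_faithful: "fully_faithful Multi_rep Mon (T_rep ch)"
  unfolding fully_faithful_def
proof (intro ballI)
  fix M N :: "('o, 'a) multi" assume MN: "M \<in> Ob Multi_rep" "N \<in> Ob Multi_rep"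
  then have "multicategory M" "left_universal (multi_data M) False (ch (U_obj M))"
    "multicategory N" "left_universal (multi_data N) False (ch (U_obj N))"
    by (simp_all add: left_universal_ch_multi)
  from bij_betw_multi_lax[OF this]
  show "bij_betw (FHom (T_rep ch) M N) (Hom Multi_rep M N) (Hom Mon (FOb (T_rep ch) M) (FOb (T_rep ch) N))"
    by (rule bij_betw_congI) (use MN in \<open>simp_all add: T_rep_def Mon_def\<close>)
qed

lemma T_rep_essentially_surjective: "essentially_surjective Multi_rep Mon (T_rep ch)"
  unfolding essentially_surjective_def
proof
  fix S :: "('o, 'a) skmon" assume "S \<in> Ob Mon"
  then have S: "skew_monoidal S" "monoidal S" by (simp_all add: Mon_def)
  let ?M = "left_normal_skew.Mu S"
  have "?M \<in> Ob Multi_rep" using representable_Mu[OF S] by simp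
  moreover from this have "FOb (T_rep ch) ?M = K\<^sub>o (U_obj ?M)"
    by (simp add: T_rep_def multicategory.skew_of_U[OF _ left_universal_ch_multi])
  ultimately show "\<exists>M\<in>Ob Multi_rep. \<exists>e. iso_in Mon (FOb (T_rep ch) M) S e"
    using iso_K_Mu(2)[OF S(1) monoidal_left_normal[OF S(2)]] by (intro bexI[of _ ?M]) (simp_all add: Mon_def)
qed

lemma category_reps:
  "category (ShMulti_rep :: (('o, 'a) shmulti, ('o, 'a) shmor) cat)" "category (Mon :: (('o, 'a) skmon, ('o, 'a) laxfun) cat)"
  unfolding ShMulti_rep_def Mon_def by (rule category_full_subcats)+

lemma T_rep_equivalence: "is_equivalence Multi_rep Mon (T_rep ch)"
  by (intro equivalence_if_fully_faithful_essentially_surjective category_full_subcats(3) category_reps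
      T_rep_functor T_rep_fully_faithful T_rep_essentially_surjective)

text \<open>Two out of three for \<open>T_rep = K_rep \<circ> U_rep\<close>: on hom-sets the second factor is bijective because
  the composite and the first are, and \<open>K_rep\<close> reflects the isomorphism
  \<open>K_rep (U_rep M) \<cong> K_rep C\<close> that essential surjectivity of \<open>T_rep\<close> provides.\<close>

lemma U_rep_equivalence:
  "is_equivalence Multi_rep ShMulti_rep (U_rep :: (('o, 'a) multi, ('o, 'a) multifun, ('o, 'a) shmulti, ('o, 'a) shmor) func)"
proof (rule equivalence_if_fully_faithful_essentially_surjective[OF category_full_subcats(3) category_reps(1) U_rep_functor])
  let ?U = "U_rep :: (('o, 'a) multi, ('o, 'a) multifun, ('o, 'a) shmulti, ('o, 'a) shmor) func"
  interpret U: is_functor Multi_rep ShMulti_rep ?U by (rule U_rep_functor)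
  interpret K: is_functor ShMulti_rep Mon "K_rep ch" by (rule K_rep_functor)
  show "fully_faithful Multi_rep ShMulti_rep ?U"
    unfolding fully_faithful_def
  proof (intro ballI)
    fix M N :: "('o, 'a) multi" assume MN: "M \<in> Ob Multi_rep" "N \<in> Ob Multi_rep"
    have K: "bij_betw (FHom (K_rep ch) (FOb ?U M) (FOb ?U N)) (Hom ShMulti_rep (FOb ?U M) (FOb ?U N))
        (Hom Mon (FOb (K_rep ch) (FOb ?U M)) (FOb (K_rep ch) (FOb ?U N)))"
      using K_rep_functor(2) U.FOb_in MN by (simp add: fully_faithful_def)
    have T: "bij_betw (FHom (K_rep ch) (FOb ?U M) (FOb ?U N) \<circ> FHom ?U M N) (Hom Multi_rep M N)
        (Hom Mon (FOb (K_rep ch) (FOb ?U M)) (FOb (K_rep ch) (FOb ?U N)))"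
      by (rule bij_betw_congI[OF T_rep_fully_faithful[unfolded fully_faithful_def, rule_format, OF MN]])
        (use MN in \<open>simp_all add: T_rep_factors\<close>)
    show "bij_betw (FHom ?U M N) (Hom Multi_rep M N) (Hom ShMulti_rep (FOb ?U M) (FOb ?U N))"
      by (rule bij_betw_comp_iff2[OF K, THEN iffD2, OF _ T]) (use U.FHom_in[OF MN] in blast)
  qed
  show "essentially_surjective Multi_rep ShMulti_rep ?U"
    unfolding essentially_surjective_def
  proof
    fix C :: "('o, 'a) shmulti" assume C: "C \<in> Ob ShMulti_rep"
    then obtain M e where M: "M \<in> Ob Multi_rep" "iso_in Mon (FOb (T_rep ch) M) (FOb (K_rep ch) C) e"
      using T_rep_essentially_surjective K.FOb_in unfolding essentially_surjective_def by blast
    then have "iso_in Mon (FOb (K_rep ch) (FOb ?U M)) (FOb (K_rep ch) C) e"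
      by (simp add: T_rep_factors)
    from fully_faithful_reflects_iso[OF category_reps K_rep_functor U.FOb_in[OF M(1)] C this]
    show "\<exists>M\<in>Ob Multi_rep. \<exists>f. iso_in ShMulti_rep (FOb ?U M) C f" using M(1) by blast
  qed
qed

end

theorem theorem4p6:
  fixes ch :: "('o, 'a) shmulti \<Rightarrow> ('o, 'a) classifiers"
  assumes "\<And>C. \<lbrakk>short_multicategory C; left_representable C\<rbrakk> \<Longrightarrow> left_classifiers C (ch C)"
  shows "is_equivalence ShMulti_lr SkMon_ln (K_functor ch)
    \<and> Ob (ShMulti_rep :: (('o, 'a) shmulti, ('o, 'a) shmor) cat) \<subseteq> Ob ShMulti_lr
    \<and> Ob (Mon :: (('o, 'a) skmon, ('o, 'a) laxfun) cat) \<subseteq> Ob SkMon_ln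
    \<and> is_equivalence ShMulti_rep Mon (K_rep ch)
    \<and> is_equivalence Multi_rep ShMulti_rep (U_rep :: (('o, 'a) multi, ('o, 'a) multifun, ('o, 'a) shmulti, ('o, 'a) shmor) func)
    \<and> is_equivalence Multi_rep Mon (T_rep ch)
    \<and> T_rep ch = comp_func Multi_rep (K_rep ch) U_rep"
proof (intro conjI)
  show "is_equivalence ShMulti_lr SkMon_ln (K_functor ch)"
    by (rule K_functor_equivalence) (rule assms)
  show "Ob (ShMulti_rep :: (('o, 'a) shmulti, ('o, 'a) shmor) cat) \<subseteq> Ob ShMulti_lr"
    by (auto simp: ShMulti_rep_def ShMulti_lr_def intro: representable_left_representable)
  show "Ob (Mon :: (('o, 'a) skmon, ('o, 'a) laxfun) cat) \<subseteq> Ob SkMon_ln"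
    by (auto simp: Mon_def SkMon_ln_def intro: monoidal_left_normal)
  show "is_equivalence ShMulti_rep Mon (K_rep ch)"
    by (rule K_rep_equivalence) (rule assms)
  show "is_equivalence Multi_rep ShMulti_rep (U_rep :: (('o, 'a) multi, ('o, 'a) multifun, ('o, 'a) shmulti, ('o, 'a) shmor) func)"
    by (rule U_rep_equivalence) (rule assms)
  show "is_equivalence Multi_rep Mon (T_rep ch)"
    by (rule T_rep_equivalence) (rule assms)
  show "T_rep ch = comp_func Multi_rep (K_rep ch) U_rep"
    by (rule T_rep_factors) (rule assms)
qed

end
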